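(* Let $(u,c,f,\rho_0,\rho_{\mathrm{in}},\mathcal G)$ be admissible data and $\mathcal H(\rho)=\rho_{\mathrm{in}}+\mathcal G(\rho)$. Then there is at most one solution $\rho\in L^\infty((0,T)\times\Omega)^n$ of the initial-boundary-value problem $$\rho_t+(\mathbf U\rho)_x+\mathbf C\rho=f\ \text{in }(0,T)\times\Omega,\qquad \rho(0,\cdot)=\rho_0\ \text{in }\Omega,\qquad (\nu\mathbf U)^-\rho=(\nu\mathbf U)^-\mathcal H(\rho|_{\Gamma_T})\ \text{on }\Gamma_T .$$
   Context: Notation. $T>0$, $n\ge 1$, $\Omega=(0,1)$, $\Gamma=\partial\Omega=\{0,1\}$, $\Gamma_T=[0,T]\times\Gamma$; $\nu(0)=-1$, $\nu(1)=1$ is the outer normal; $\mathrm d\omega$ is the counting measure on $\Gamma$. For real $a$: $a^+=\max(a,0)$, $a^-=\max(-a,0)$. Positive/negative parts, absolute values and inequalities of vectors are componentwise. $\|g\|_{L^\infty(\Omega)^n}=\max_j\|g^j\|_{L^\infty(\Omega)}$. For $u=(u^1,\dots,u^n)$, $c=(c^1,\dots,c^n)$ put $\mathbf U=\operatorname{diag}(u)$, $\mathbf C=\operatorname{diag}(c)$. Componentwise measures on $\Gamma_T$: $\mathrm d\mu_u=(\nu u)\,\mathrm d\omega\,\mathrm dt$, $\mathrm d\mu_u^\pm=(\nu u)^\pm\mathrm d\omega\,\mathrm dt$, $|\mathrm d\mu_u|=\mathrm d\mu_u^++\mathrm d\mu_u^-$. $L^\infty(\Gamma_T,\mathrm d\mu_u^\pm)$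 is the space of $\mathbb R^n$-valued $g$ whose $j$-th component is essentially bounded with respect to $(\nu u^j)^\pm\mathrm d\omega\,\mathrm dt$ (similarly for $|\mathrm d\mu_u|$); "$\mathrm d\mu_u^\pm$-almost everywhere" is also understood componentwise. For a positive definite diagonal matrix $\overline{\mathbf W}\in\mathbb R^{n\times n}$ put $\|g\|_{1,w,\pm}=\int_0^T\int_\Gamma |g|^T\overline{\mathbf W}(\nu u)^\pm\,\mathrm d\omega\,\mathrm dt$. Functions on $\Gamma_T$ defined only with respect to $\mathrm d\mu_u^\pm$ are extended by zero where necessary. Admissible data. $(u,c,f,\rho_0,\rho_{\mathrm{in}},\mathcal G)$ is called admissible if: (i) $u\in L^1((0,T),W^{1,1}(\Omega)^n)$, $c\in L^1((0,T)\times\Omega)^n$, $(u_x+c)^-\in L^1((0,T),L^\infty(\Omega)^n)$, $(u_x)^+\in L^1((0,T),L^\infty(\Omega)^n)$, $f\in L^1((0,T),L^\infty(\Omega)^n)$ with $f\ge0$; (ii) $\rho_0\in L^\infty(\Omega)^n$, $\rho_0\ge 0$ a.e.; $\rho_{\mathrm{in}}\in L^\infty(\Gamma_T,\mathrm d\mu_u^-)$, $\rho_{\mathrm{in}}\ge0$ $\mathrm d\mu_u^-$-a.e.; (iii) $\mathcal G:L^\infty(\Gamma_T,\mathrm d\mu_u^+)\to L^\infty(\Gamma_T,\mathrm d\mu_u^-)$ is linear and (a) weakly-$\star$ continuous: $\rho_k\overset{\star}{\rightharpoonup}\rho$ in $L^\infty(\Gamma_T,\mathrm d\mu_u^+)$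 implies $\mathcal G(\rho_k)\overset{\star}{\rightharpoonup}\mathcal G(\rho)$ in $L^\infty(\Gamma_T,\mathrm d\mu_u^-)$; (b) there is a positive definite diagonal weight matrix $\overline{\mathbf W}\in\mathbb R^{n\times n}$ with $\|\mathcal G(\rho)\|_{1,w,-}\le\|\rho\|_{1,w,+}$ for all $\rho\in L^\infty(\Gamma_T,\mathrm d\mu_u^+)$; (c) causal: $\chi_{[0,t]}\mathcal G(\chi_{[0,t]}\rho)=\chi_{[0,t]}\mathcal G(\rho)$ for all $\rho\in L^\infty(\Gamma_T,\mathrm d\mu_u^+)$ and almost all $t\in[0,T]$; (d) positive: $\rho\ge0$ $\mathrm d\mu_u^+$-a.e. implies $\mathcal G(\rho)\ge0$ $\mathrm d\mu_u^-$-a.e.; (iv) with $\alpha(s)=\|(u_x(s,\cdot)+c(s,\cdot))^-\|_{L^\infty(\Omega)^n}$ and $F_+(t)\in\mathbb R^n$ given by $(F_+)_i(t)=\int_0^t\exp\left(-\int_0^s\alpha(r)\,\mathrm dr\right)\|(f_i(s,\cdot))^+\|_{L^\infty(\Omega)}\,\mathrm ds$, there is a constant vector $\rho_{\max}\in\mathbb R^n$ with $\rho_0\le\rho_{\max}$ a.e. in $\Omega$ and $$\rho_{\mathrm{in}}\exp\left(-\int_0^t\alpha(s)\,\mathrm ds\right)-F_++\mathcal G(F_+)+\mathcal G(\rho_{\max})\le\rho_{\max}\quad\text{for }\mathrm d\mu_u^-\text{-almost all }(t,\omega)\in\Gamma_T.$$ Weak solutions and traces. $\rho\in L^\infty((0,T)\times\Omega)^n$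 is a weak solution of $\rho_t+(\mathbf U\rho)_x+\mathbf C\rho=f$ if $0=\int_0^T\int_\Omega\rho^T(\varphi_t+\mathbf U\varphi_x-\mathbf C\varphi)+f^T\varphi\,\mathrm dx\,\mathrm dt$ for all $\varphi\in C^{0,1}([0,T]\times\overline\Omega,\mathbb R^n)$ with $\varphi(0,\cdot)=\varphi(T,\cdot)=0$ and $\varphi=0$ on $\Gamma_T$. It is known (Boyer) that such $\rho$ lies in $C([0,T],L^p(\Omega)^n)$ for all $p\in[1,\infty)$ and has a unique trace $\gamma\rho\in L^\infty(\Gamma_T,|\mathrm d\mu_u|)$, characterized by $$0=\int_{t_0}^{t_1}\int_\Omega\rho^T(\varphi_t+\mathbf U\varphi_x-\mathbf C\varphi)+f^T\varphi\,\mathrm dx\,\mathrm dt-\int_{t_0}^{t_1}\int_\Gamma\gamma\rho^T(\nu\mathbf U)\varphi\,\mathrm d\omega\,\mathrm dt+\int_\Omega\rho(t_0)^T\varphi(t_0)\,\mathrm dx-\int_\Omega\rho(t_1)^T\varphi(t_1)\,\mathrm dx$$ for all $[t_0,t_1]\subset[0,T]$ and $\varphi\in C^{0,1}([0,T]\times\overline\Omega,\mathbb R^n)$. Solution of the initial-boundary-value problem: $\rho\in L^\infty((0,T)\times\Omega)^n$ that is a weak solution of the transport equation, satisfies $\rho(0)=\rho_0$, and whose trace satisfies $\gamma\rho=\mathcal H(\gamma\rho)$ $\mathrm d\mu_u^-$-almost everywhere on $\Gamma_T$. *)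

theory Defs
  imports "HOL-Analysis.Analysis" "HOL-Probability.Essential_Supremum"
begin

text \<open>
  The index type \<open>'n\<close> stands for the component set \<open>{1, ..., n}\<close>. Functions on
  \<open>(0,T) \<times> (0,1)\<close> and on \<open>[0,T] \<times> {0,1}\<close> are functions of the pair \<open>(t, x)\<close>.
  Elements of Lebesgue spaces are Borel representatives; values outside the domain carry no
  information, since all measures below live on the domain only.
\<close>

section \<open>Componentwise vector operations\<close>

definition vabs :: "real ^ 'n \<Rightarrow> real ^ 'n" where
  "vabs v = (\<chi> j. \<bar>v $ j\<bar>)"

definition vpos :: "real ^ 'n \<Rightarrow> real ^ 'n" where
  "vpos v = (\<chi> j. max (v $ j) 0)"

definition vneg :: "real ^ 'n \<Rightarrow> real ^ 'n" where
  "vneg v = (\<chi> j. max (- (v $ j)) 0)"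

definition dmat :: "real ^ 'n \<Rightarrow> real ^ 'n ^ 'n" where
  "dmat v = (\<chi> i j. if i = j then v $ i else 0)"

definition pos_def_diagonal :: "real ^ 'n ^ 'n \<Rightarrow> bool" where
  "pos_def_diagonal W \<longleftrightarrow>
     (\<forall>i j. i \<noteq> j \<longrightarrow> W $ i $ j = 0) \<and> (\<forall>v. v \<noteq> 0 \<longrightarrow> 0 < v \<bullet> (W *v v))"

section \<open>Measures\<close>

definition time_meas :: "real \<Rightarrow> real measure" where
  "time_meas T = restrict_space lborel {0<..<T}"

definition Omega_meas :: "real measure" where
  "Omega_meas = restrict_space lborel {0<..<1}"

definition cyl_meas :: "real \<Rightarrow> (real \<times> real) measure" where
  "cyl_meas T = restrict_space lborel ({0<..<T} \<times> {0<..<1})"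

definition Gamma_meas :: "real \<Rightarrow> (real \<times> real) measure" where
  "Gamma_meas T = restrict_space lborel {0..T} \<Otimes>\<^sub>M count_space {0, 1}"

definition nu :: "real \<Rightarrow> real" where
  "nu x = (if x = 0 then - 1 else 1)"

definition mu_plus :: "real \<Rightarrow> (real \<times> real \<Rightarrow> real ^ 'n) \<Rightarrow> 'n \<Rightarrow> (real \<times> real) measure" where
  "mu_plus T u j =
     density (Gamma_meas T) (\<lambda>(t, x). ennreal (vpos (nu x *\<^sub>R u (t, x)) $ j))"

definition mu_minus :: "real \<Rightarrow> (real \<times> real \<Rightarrow> real ^ 'n) \<Rightarrow> 'n \<Rightarrow> (real \<times> real) measure" where
  "mu_minus T u j =
     density (Gamma_meas T) (\<lambda>(t, x). ennreal (vneg (nu x *\<^sub>R u (t, x)) $ j))"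

definition mu_abs :: "real \<Rightarrow> (real \<times> real \<Rightarrow> real ^ 'n) \<Rightarrow> 'n \<Rightarrow> (real \<times> real) measure" where
  "mu_abs T u j =
     density (Gamma_meas T)
       (\<lambda>(t, x). ennreal (vpos (nu x *\<^sub>R u (t, x)) $ j) + ennreal (vneg (nu x *\<^sub>R u (t, x)) $ j))"

section \<open>Function spaces\<close>

text \<open>
  Vector-valued spaces are taken with respect to a family of measures, one for each component;
  for \<open>L\<^sup>\<infinity>(\<Omega>)\<^sup>n\<close> the family is constant.
\<close>

definition Linf :: "('n \<Rightarrow> 'a measure) \<Rightarrow> ('a \<Rightarrow> real ^ 'n) \<Rightarrow> bool" where
  "Linf M g \<longleftrightarrow>
     (\<forall>j. (\<lambda>z. g z $ j) \<in> borel_measurable (M j) \<and> (\<exists>B. AE z in M j. \<bar>g z $ j\<bar> \<le> B))"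

definition AE_eq :: "('n \<Rightarrow> 'a measure) \<Rightarrow> ('a \<Rightarrow> real ^ 'n) \<Rightarrow> ('a \<Rightarrow> real ^ 'n) \<Rightarrow> bool" where
  "AE_eq M g h \<longleftrightarrow> (\<forall>j. AE z in M j. g z $ j = h z $ j)"

definition AE_le :: "('n \<Rightarrow> 'a measure) \<Rightarrow> ('a \<Rightarrow> real ^ 'n) \<Rightarrow> ('a \<Rightarrow> real ^ 'n) \<Rightarrow> bool" where
  "AE_le M g h \<longleftrightarrow> (\<forall>j. AE z in M j. g z $ j \<le> h z $ j)"

text \<open>Convergence of a sequence in the weak star topology of \<open>L\<^sup>\<infinity> = (L\<^sup>1)'\<close>.\<close>

definition weak_star_tendsto ::
  "('n \<Rightarrow> 'a measure) \<Rightarrow> (nat \<Rightarrow> 'a \<Rightarrow> real ^ 'n) \<Rightarrow> ('a \<Rightarrow> real ^ 'n) \<Rightarrow> bool" where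
  "weak_star_tendsto M gs g \<longleftrightarrow>
     (\<forall>j. \<forall>h. integrable (M j) h \<longrightarrow>
        (\<lambda>k. \<integral>z. gs k z $ j * h z \<partial>M j) \<longlonglongrightarrow> (\<integral>z. g z $ j * h z \<partial>M j))"

definition Linf_norm1 :: "(real \<Rightarrow> real) \<Rightarrow> ennreal" where
  "Linf_norm1 g = esssup Omega_meas (\<lambda>x. ennreal \<bar>g x\<bar>)"

definition Linf_norm :: "(real \<Rightarrow> real ^ 'n) \<Rightarrow> ennreal" where
  "Linf_norm g = (MAX j. Linf_norm1 (\<lambda>x. g x $ j))"

text \<open>Weak derivative in \<open>L\<^sup>1(0,1)\<close>, tested with \<open>C\<^sup>1\<close> functions of compact support in \<open>(0,1)\<close>.\<close>

definition has_weak_deriv :: "(real \<Rightarrow> real ^ 'n) \<Rightarrow> (real \<Rightarrow> real ^ 'n) \<Rightarrow> bool" where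
  "has_weak_deriv w w' \<longleftrightarrow>
     integrable Omega_meas w \<and> integrable Omega_meas w' \<and>
     (\<forall>\<phi> \<phi>' :: real \<Rightarrow> real.
        (\<forall>x. (\<phi> has_real_derivative \<phi>' x) (at x)) \<and> continuous_on UNIV \<phi>' \<and>
        (\<exists>a b. 0 < a \<and> b < 1 \<and> (\<forall>x. x \<notin> {a..b} \<longrightarrow> \<phi> x = 0)) \<longrightarrow>
        (\<integral>x. \<phi>' x *\<^sub>R w x \<partial>Omega_meas) = - (\<integral>x. \<phi> x *\<^sub>R w' x \<partial>Omega_meas))"

text \<open>
  The weak derivative is unique almost everywhere, so that the infimum runs over a single value,
  or over the empty set (giving \<open>\<infinity>\<close>) if \<open>w\<close> is not in \<open>W\<^sup>1\<^sup>,\<^sup>1\<close>.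
\<close>

definition W11_norm :: "(real \<Rightarrow> real ^ 'n) \<Rightarrow> ennreal" where
  "W11_norm w =
     (INF w' \<in> {w'. has_weak_deriv w w'}.
        (\<integral>\<^sup>+x. ennreal (norm (w x)) \<partial>Omega_meas) + (\<integral>\<^sup>+x. ennreal (norm (w' x)) \<partial>Omega_meas))"

text \<open>
  The Bochner space \<open>L\<^sup>1((0,T), X)\<close>, where \<open>X\<close> is the space of functions on \<open>(0,1)\<close> with finite
  norm \<open>N\<close>: limits almost everywhere in \<open>X\<close> of \<open>X\<close>-valued simple functions, with integrable norm.
  The representative is in addition chosen jointly measurable in \<open>(t, x)\<close>.
\<close>

definition Bochner_L1 ::
  "real \<Rightarrow> ((real \<Rightarrow> real ^ 'n) \<Rightarrow> ennreal) \<Rightarrow> (real \<times> real \<Rightarrow> real ^ 'n) \<Rightarrow> bool" where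
  "Bochner_L1 T N g \<longleftrightarrow>
     g \<in> borel_measurable (cyl_meas T) \<and>
     (\<exists>s :: nat \<Rightarrow> real \<Rightarrow> real \<Rightarrow> real ^ 'n.
        (\<forall>k. simple_function (time_meas T) (s k) \<and> (\<forall>t\<in>{0<..<T}. N (s k t) < \<infinity>)) \<and>
        (AE t in time_meas T. (\<lambda>k. N (\<lambda>x. g (t, x) - s k t x)) \<longlonglongrightarrow> 0)) \<and>
     (\<integral>\<^sup>+t. N (\<lambda>x. g (t, x)) \<partial>time_meas T) < \<infinity>"

section \<open>Admissible data\<close>

definition wnorm_plus ::
  "real \<Rightarrow> (real \<times> real \<Rightarrow> real ^ 'n) \<Rightarrow> real ^ 'n ^ 'n \<Rightarrow> (real \<times> real \<Rightarrow> real ^ 'n) \<Rightarrow> real" where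
  "wnorm_plus T u W g =
     (\<integral>(t, x). vabs (g (t, x)) \<bullet> (W *v vpos (nu x *\<^sub>R u (t, x))) \<partial>Gamma_meas T)"

definition wnorm_minus ::
  "real \<Rightarrow> (real \<times> real \<Rightarrow> real ^ 'n) \<Rightarrow> real ^ 'n ^ 'n \<Rightarrow> (real \<times> real \<Rightarrow> real ^ 'n) \<Rightarrow> real" where
  "wnorm_minus T u W g =
     (\<integral>(t, x). vabs (g (t, x)) \<bullet> (W *v vneg (nu x *\<^sub>R u (t, x))) \<partial>Gamma_meas T)"

definition cutoff :: "real \<Rightarrow> (real \<times> real \<Rightarrow> real ^ 'n) \<Rightarrow> real \<times> real \<Rightarrow> real ^ 'n" where
  "cutoff t g = (\<lambda>(s, x). indicator {0..t} s *\<^sub>R g (s, x))"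

text \<open>
  An operator on equivalence classes is given by a map on representatives that respects equality
  almost everywhere; this and linearity are the first three clauses.
\<close>

definition admissible_bdry_op ::
  "real \<Rightarrow> (real \<times> real \<Rightarrow> real ^ 'n) \<Rightarrow>
   ((real \<times> real \<Rightarrow> real ^ 'n) \<Rightarrow> (real \<times> real \<Rightarrow> real ^ 'n)) \<Rightarrow> bool" where
  "admissible_bdry_op T u G \<longleftrightarrow>
     (\<forall>g. Linf (mu_plus T u) g \<longrightarrow> Linf (mu_minus T u) (G g)) \<and>
     (\<forall>g h. Linf (mu_plus T u) g \<and> Linf (mu_plus T u) h \<and> AE_eq (mu_plus T u) g h \<longrightarrow>
        AE_eq (mu_minus T u) (G g) (G h)) \<and>
     (\<forall>g h a b. Linf (mu_plus T u) g \<and> Linf (mu_plus T u) h \<longrightarrow>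
        AE_eq (mu_minus T u) (G (\<lambda>z. a *\<^sub>R g z + b *\<^sub>R h z)) (\<lambda>z. a *\<^sub>R G g z + b *\<^sub>R G h z)) \<and>
     (\<forall>gs g. (\<forall>k. Linf (mu_plus T u) (gs k)) \<and> Linf (mu_plus T u) g \<and>
        weak_star_tendsto (mu_plus T u) gs g \<longrightarrow>
        weak_star_tendsto (mu_minus T u) (\<lambda>k. G (gs k)) (G g)) \<and>
     (\<exists>W. pos_def_diagonal W \<and>
        (\<forall>g. Linf (mu_plus T u) g \<longrightarrow> wnorm_minus T u W (G g) \<le> wnorm_plus T u W g)) \<and>
     (\<forall>g. Linf (mu_plus T u) g \<longrightarrow>
        (AE t in restrict_space lborel {0..T}.
           AE_eq (mu_minus T u) (cutoff t (G (cutoff t g))) (cutoff t (G g)))) \<and>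
     (\<forall>g. Linf (mu_plus T u) g \<and> AE_le (mu_plus T u) (\<lambda>_. 0) g \<longrightarrow>
        AE_le (mu_minus T u) (\<lambda>_. 0) (G g))"

definition alpha_rate ::
  "(real \<times> real \<Rightarrow> real ^ 'n) \<Rightarrow> (real \<times> real \<Rightarrow> real ^ 'n) \<Rightarrow> real \<Rightarrow> real" where
  "alpha_rate ux c s = enn2real (Linf_norm (\<lambda>x. vneg (ux (s, x) + c (s, x))))"

definition alpha_exp ::
  "(real \<times> real \<Rightarrow> real ^ 'n) \<Rightarrow> (real \<times> real \<Rightarrow> real ^ 'n) \<Rightarrow> real \<Rightarrow> real" where
  "alpha_exp ux c t = exp (- (LINT s:{0<..<t}|lborel. alpha_rate ux c s))"

definition F_plus ::
  "(real \<times> real \<Rightarrow> real ^ 'n) \<Rightarrow> (real \<times> real \<Rightarrow> real ^ 'n) \<Rightarrow> (real \<times> real \<Rightarrow> real ^ 'n) \<Rightarrow>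
   real \<Rightarrow> real ^ 'n" where
  "F_plus ux c f t =
     (\<chi> i. LINT s:{0<..<t}|lborel.
        alpha_exp ux c s * enn2real (Linf_norm1 (\<lambda>x. max (f (s, x) $ i) 0)))"

text \<open>
  The boundary values \<open>u(t,0)\<close> and \<open>u(t,1)\<close> are those of the continuous representative of
  \<open>u(t,\<cdot>) \<in> W\<^sup>1\<^sup>,\<^sup>1(0,1)\<^sup>n\<close>; \<open>u\<close> itself denotes that representative. The function \<open>ux\<close> is the weak
  derivative \<open>u\<^sub>x\<close>; it is unique almost everywhere, and the conditions depend only on its class.
\<close>

definition admissible ::
  "real \<Rightarrow> (real \<times> real \<Rightarrow> real ^ 'n) \<Rightarrow> (real \<times> real \<Rightarrow> real ^ 'n) \<Rightarrow>
   (real \<times> real \<Rightarrow> real ^ 'n) \<Rightarrow> (real \<Rightarrow> real ^ 'n) \<Rightarrow> (real \<times> real \<Rightarrow> real ^ 'n) \<Rightarrow>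
   ((real \<times> real \<Rightarrow> real ^ 'n) \<Rightarrow> (real \<times> real \<Rightarrow> real ^ 'n)) \<Rightarrow> bool" where
  "admissible T u c f \<rho>\<^sub>0 \<rho>\<^sub>i\<^sub>n G \<longleftrightarrow>
     (\<exists>ux.
        Bochner_L1 T W11_norm u \<and>
        u \<in> borel_measurable (restrict_space borel ({0..T} \<times> {0..1})) \<and>
        (AE t in time_meas T. continuous_on {0..1} (\<lambda>x. u (t, x))) \<and>
        ux \<in> borel_measurable (cyl_meas T) \<and>
        (AE t in time_meas T. has_weak_deriv (\<lambda>x. u (t, x)) (\<lambda>x. ux (t, x))) \<and>
        integrable (cyl_meas T) c \<and>
        Bochner_L1 T Linf_norm (\<lambda>z. vneg (ux z + c z)) \<and>
        Bochner_L1 T Linf_norm (\<lambda>z. vpos (ux z)) \<and>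
        Bochner_L1 T Linf_norm f \<and>
        AE_le (\<lambda>_. cyl_meas T) (\<lambda>_. 0) f \<and>
        Linf (\<lambda>_. Omega_meas) \<rho>\<^sub>0 \<and> AE_le (\<lambda>_. Omega_meas) (\<lambda>_. 0) \<rho>\<^sub>0 \<and>
        Linf (mu_minus T u) \<rho>\<^sub>i\<^sub>n \<and> AE_le (mu_minus T u) (\<lambda>_. 0) \<rho>\<^sub>i\<^sub>n \<and>
        admissible_bdry_op T u G \<and>
        (\<exists>\<rho>\<^sub>m\<^sub>a\<^sub>x :: real ^ 'n.
           AE_le (\<lambda>_. Omega_meas) \<rho>\<^sub>0 (\<lambda>_. \<rho>\<^sub>m\<^sub>a\<^sub>x) \<and>
           AE_le (mu_minus T u)
             (\<lambda>(t, x). alpha_exp ux c t *\<^sub>R \<rho>\<^sub>i\<^sub>n (t, x) - F_plus ux c f t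
                + G (\<lambda>(s, y). F_plus ux c f s) (t, x) + G (\<lambda>_. \<rho>\<^sub>m\<^sub>a\<^sub>x) (t, x))
             (\<lambda>_. \<rho>\<^sub>m\<^sub>a\<^sub>x)))"

section \<open>Weak solutions and traces\<close>

text \<open>
  A Lipschitz function on \<open>[0,T] \<times> [0,1]\<close> together with its partial derivatives, which exist
  almost everywhere by Rademacher's theorem.
\<close>

definition test_fun ::
  "real \<Rightarrow> (real \<times> real \<Rightarrow> real ^ 'n) \<Rightarrow> (real \<times> real \<Rightarrow> real ^ 'n) \<Rightarrow>
   (real \<times> real \<Rightarrow> real ^ 'n) \<Rightarrow> bool" where
  "test_fun T \<phi> \<phi>t \<phi>x \<longleftrightarrow>
     (\<exists>L. L-lipschitz_on ({0..T} \<times> {0..1}) \<phi>) \<and>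
     \<phi>t \<in> borel_measurable (cyl_meas T) \<and> \<phi>x \<in> borel_measurable (cyl_meas T) \<and>
     (AE (t, x) in cyl_meas T.
        ((\<lambda>s. \<phi> (s, x)) has_vector_derivative \<phi>t (t, x)) (at t) \<and>
        ((\<lambda>y. \<phi> (t, y)) has_vector_derivative \<phi>x (t, x)) (at x))"

definition weak_integrand ::
  "(real \<times> real \<Rightarrow> real ^ 'n) \<Rightarrow> (real \<times> real \<Rightarrow> real ^ 'n) \<Rightarrow> (real \<times> real \<Rightarrow> real ^ 'n) \<Rightarrow>
   (real \<times> real \<Rightarrow> real ^ 'n) \<Rightarrow> (real \<times> real \<Rightarrow> real ^ 'n) \<Rightarrow> (real \<times> real \<Rightarrow> real ^ 'n) \<Rightarrow>
   (real \<times> real \<Rightarrow> real ^ 'n) \<Rightarrow> real \<times> real \<Rightarrow> real" where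
  "weak_integrand u c f \<rho> \<phi> \<phi>t \<phi>x z =
     \<rho> z \<bullet> (\<phi>t z + dmat (u z) *v \<phi>x z - dmat (c z) *v \<phi> z) + f z \<bullet> \<phi> z"

definition weak_solution ::
  "real \<Rightarrow> (real \<times> real \<Rightarrow> real ^ 'n) \<Rightarrow> (real \<times> real \<Rightarrow> real ^ 'n) \<Rightarrow>
   (real \<times> real \<Rightarrow> real ^ 'n) \<Rightarrow> (real \<times> real \<Rightarrow> real ^ 'n) \<Rightarrow> bool" where
  "weak_solution T u c f \<rho> \<longleftrightarrow>
     Linf (\<lambda>_. cyl_meas T) \<rho> \<and>
     (\<forall>\<phi> \<phi>t \<phi>x. test_fun T \<phi> \<phi>t \<phi>x \<and>
        (\<forall>x\<in>{0..1}. \<phi> (0, x) = 0 \<and> \<phi> (T, x) = 0) \<and>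
        (\<forall>t\<in>{0..T}. \<phi> (t, 0) = 0 \<and> \<phi> (t, 1) = 0) \<longrightarrow>
        0 = (\<integral>z. weak_integrand u c f \<rho> \<phi> \<phi>t \<phi>x z \<partial>cyl_meas T))"

text \<open>
  \<open>r\<close> is the representative of \<open>\<rho>\<close> in \<open>C([0,T], L\<^sup>p(\<Omega>)\<^sup>n)\<close> for all \<open>p \<in> [1,\<infinity>)\<close>; it gives
  meaning to \<open>\<rho>(t)\<close> at every single time \<open>t\<close>.
\<close>

definition time_continuous_version ::
  "real \<Rightarrow> (real \<times> real \<Rightarrow> real ^ 'n) \<Rightarrow> (real \<Rightarrow> real \<Rightarrow> real ^ 'n) \<Rightarrow> bool" where
  "time_continuous_version T \<rho> r \<longleftrightarrow>
     (AE t in time_meas T. AE x in Omega_meas. r t x = \<rho> (t, x)) \<and>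
     (\<forall>t\<in>{0..T}. r t \<in> borel_measurable Omega_meas) \<and>
     (\<forall>p\<ge>1. \<forall>t\<in>{0..T}.
        integrable Omega_meas (\<lambda>x. norm (r t x) powr p) \<and>
        ((\<lambda>s. \<integral>x. norm (r s x - r t x) powr p \<partial>Omega_meas) \<longlongrightarrow> 0) (at t within {0..T}))"

text \<open>\<open>g\<close> is the trace of \<open>\<rho>\<close>, whose version continuous in time is \<open>r\<close>.\<close>

definition is_trace ::
  "real \<Rightarrow> (real \<times> real \<Rightarrow> real ^ 'n) \<Rightarrow> (real \<times> real \<Rightarrow> real ^ 'n) \<Rightarrow>
   (real \<times> real \<Rightarrow> real ^ 'n) \<Rightarrow> (real \<times> real \<Rightarrow> real ^ 'n) \<Rightarrow>
   (real \<Rightarrow> real \<Rightarrow> real ^ 'n) \<Rightarrow> (real \<times> real \<Rightarrow> real ^ 'n) \<Rightarrow> bool" where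
  "is_trace T u c f \<rho> r g \<longleftrightarrow>
     Linf (mu_abs T u) g \<and>
     (\<forall>t0 t1 \<phi> \<phi>t \<phi>x. 0 \<le> t0 \<and> t0 \<le> t1 \<and> t1 \<le> T \<and> test_fun T \<phi> \<phi>t \<phi>x \<longrightarrow>
        0 = (LINT z:{t0<..<t1} \<times> {0<..<1}|cyl_meas T. weak_integrand u c f \<rho> \<phi> \<phi>t \<phi>x z)
          - (LINT z:{t0..t1} \<times> {0, 1}|Gamma_meas T.
               g z \<bullet> ((nu (snd z) *\<^sub>R dmat (u z)) *v \<phi> z))
          + (\<integral>x. r t0 x \<bullet> \<phi> (t0, x) \<partial>Omega_meas)
          - (\<integral>x. r t1 x \<bullet> \<phi> (t1, x) \<partial>Omega_meas))"

text \<open>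
  The version \<open>r\<close> and the trace \<open>g\<close> of a weak solution exist and are unique up to null sets.
\<close>

definition ibvp_solution ::
  "real \<Rightarrow> (real \<times> real \<Rightarrow> real ^ 'n) \<Rightarrow> (real \<times> real \<Rightarrow> real ^ 'n) \<Rightarrow>
   (real \<times> real \<Rightarrow> real ^ 'n) \<Rightarrow> (real \<Rightarrow> real ^ 'n) \<Rightarrow>
   ((real \<times> real \<Rightarrow> real ^ 'n) \<Rightarrow> (real \<times> real \<Rightarrow> real ^ 'n)) \<Rightarrow>
   (real \<times> real \<Rightarrow> real ^ 'n) \<Rightarrow> bool" where
  "ibvp_solution T u c f \<rho>\<^sub>0 H \<rho> \<longleftrightarrow>
     weak_solution T u c f \<rho> \<and>
     (\<exists>r g. time_continuous_version T \<rho> r \<and> is_trace T u c f \<rho> r g \<and>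
        (AE x in Omega_meas. r 0 x = \<rho>\<^sub>0 x) \<and>
        AE_eq (mu_minus T u) g (H g))"

end

theory Submission
  imports Defs
begin

text \<open>
  The \<open>L\<^sup>1\<close> norm of each component of the difference \<open>\<sigma>\<close> of two solutions is estimated by
  renormalisation. A mollifier supported on one side of the origin turns the trace identity into
  an evolution equation for the mollified \<open>\<sigma>\<close>, pointwise in space and absolutely continuous in
  time, to which a smooth convex approximation of the absolute value can be applied. The
  commutator of mollification and transport vanishes in \<open>L\<^sup>1\<close> because translations are continuous
  in \<open>L\<^sup>1\<close>. Because the mollifier is one-sided, the space interval may start or end just outside
  or exactly at the boundary; the resulting bounds, one sharp on the inflow and one on
  the outflow part, are combined by taking their minimum on short time intervals.

  In the sum over the components, weighted by the matrix of the boundary operator \<open>G\<close>, the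
  boundary terms up to time \<open>t\<close> are the difference of the inflow and outflow norms of the trace
  cut off at \<open>t\<close>, which is nonpositive by causality and contractivity of \<open>G\<close>. The remaining rate
  \<open>-c \<le> (u\<^sub>x + c)\<^sup>- + (u\<^sub>x)\<^sup>+\<close> is integrable in time, and Gronwall's inequality applies.
\<close>

text \<open>The obstacle is the modulus of the trace. The trace identity is linear: near an end
  point, \<open>u * avg e \<sigma>\<close> converges to the boundary flux only weakly in time, and
  the modulus does not pass to weak limits. At an outflow time of the left end, u <= 0 gives u |a|
  <= s u a for both signs s; these bounds are linear in a, survive the limit, and their minimum over
  s is minus the modulus of the flux. The surplus 2 M max u 0 makes them valid at every time, so the
  set of inflow times, which is merely measurable, never has to be separated: the increments of the
  energy over all intervals obey several integrable rates at once, hence their minimum.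

  The coefficients are merely integrable in space while \<sigma> is bounded, so the translation
  errors are carried by v \<sigma> and v for a coefficient v. Chain rule, product rule and minimum
  of rates all come from partitions into short intervals on which the continuous factors are nearly
  constant.\<close>

lemma AE_lborel_not_in_negligible:
  assumes "negligible (N :: real set)"
  shows "AE x in lborel. x \<notin> N"
proof -
  have "N \<in> null_sets (completion lborel)"
    using assms by (simp add: negligible_iff_null_sets)
  then have "AE x in completion lborel. x \<notin> N"
    by (rule AE_not_in)
  then show ?thesis by (simp add: AE_completion_iff)
qed

section \<open>Integrability on subsets of the line and continuity of translations in L1\<close>

lemma set_integrable_lborel:
  fixes f :: "real \<Rightarrow> real"
  assumes "integrable lborel f" "A \<in> sets borel"
  shows "set_integrable lborel A f"
  unfolding set_integrable_def by (rule integrable_mult_indicator) (use assms in auto)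

lemma integrable_indicator_Icc: "integrable lborel (indicat_real {a..b::real})"
  by (rule integrable_real_indicator) (auto simp: emeasure_lborel_Icc_eq)

lemma set_integrable_bounded_Icc:
  fixes h :: "real \<Rightarrow> real"
  assumes "\<And>x. \<bar>h x\<bar> \<le> C" "h \<in> borel_measurable borel" "A \<in> sets borel" "A \<subseteq> {a..b}"
  shows "set_integrable lborel A h"
proof -
  have "set_integrable lborel {a..b} (\<lambda>_. C)"
    by (simp add: set_integrable_def integrable_indicator_Icc)
  then have "set_integrable lborel {a..b} h"
    by (rule set_integrable_bound)
      (use assms in \<open>auto simp: set_borel_measurable_def intro!: AE_I2 order_trans[OF assms(1)]\<close>)
  then show ?thesis
    by (rule set_integrable_subset) (use assms in auto)
qed

text \<open>Measurability in the gauge sense supplies continuous functions that converge to f off a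
  negligible set, but without a dominating function. Clipping f and the approximants at height n
  provides the constant 2 n on the bounded interval; clipping f alone costs little in L1 for large
  n.\<close>

lemma continuous_L1_approx:
  fixes f :: "real \<Rightarrow> real" and a b e :: real
  assumes f: "integrable lborel f" and e: "e > 0"
  obtains g where "continuous_on UNIV g" "(LINT x:{a..b}|lborel. \<bar>f x - g x\<bar>) < e"
proof -
  define clip where "clip n y = max (- real n) (min (real n) y)" for n y
  have clip_cont: "continuous_on UNIV (clip n)" for n
    unfolding clip_def by (intro continuous_intros)
  have [measurable]: "f \<in> borel_measurable borel" using f by auto
  have [measurable]: "clip n \<in> borel_measurable borel" for n
    unfolding clip_def by measurable
  have "(\<lambda>n. LINT x:{a..b}|lborel. \<bar>f x - clip n (f x)\<bar>) \<longlonglongrightarrow> (LINT x:{a..b}|lborel. 0)"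
    unfolding set_lebesgue_integral_def
  proof (rule integral_dominated_convergence[where w = "\<lambda>x. \<bar>f x\<bar>"])
    show "AE x in lborel. (\<lambda>n. indicator {a..b} x *\<^sub>R \<bar>f x - clip n (f x)\<bar>) \<longlonglongrightarrow> indicator {a..b} x *\<^sub>R 0"
    proof (intro AE_I2 tendsto_intros)
      fix x
      obtain m :: nat where m: "\<bar>f x\<bar> \<le> m" using real_arch_simple by blast
      have "eventually (\<lambda>n. \<bar>f x - clip n (f x)\<bar> = 0) sequentially"
        using eventually_ge_at_top[of m]
      proof eventually_elim
        case (elim n)
        then have "\<bar>f x\<bar> \<le> real n" using m by (simp add: order_trans)
        then show ?case unfolding clip_def max_def min_def by (smt (verit))
      qed
      then show "(\<lambda>n. \<bar>f x - clip n (f x)\<bar>) \<longlonglongrightarrow> 0"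
        by (simp add: tendsto_eventually)
    qed
    show "AE x in lborel. norm (indicator {a..b} x *\<^sub>R \<bar>f x - clip n (f x)\<bar>) \<le> \<bar>f x\<bar>" for n
      by (intro AE_I2) (auto simp: indicator_def clip_def max_def min_def)
  qed (use f in auto)
  then have "eventually (\<lambda>n. (LINT x:{a..b}|lborel. \<bar>f x - clip n (f x)\<bar>) < e/2) sequentially"
    using e by (intro order_tendstoD) (auto simp: set_lebesgue_integral_def)
  then obtain n where n: "(LINT x:{a..b}|lborel. \<bar>f x - clip n (f x)\<bar>) < e/2"
    by (auto simp: eventually_sequentially)
  have "f measurable_on UNIV"
    by (intro lebesgue_measurable_imp_measurable_on measurable_completion) simp_all
  then obtain N g where N: "negligible N" and g: "\<And>k. continuous_on UNIV (g k)"
    and lim: "\<And>x. x \<notin> N \<Longrightarrow> (\<lambda>k. g k x) \<longlonglongrightarrow> f x"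
    unfolding measurable_on_def by auto
  have cg: "continuous_on UNIV (\<lambda>x. clip n (g k x))" for k
    using continuous_on_compose2[OF clip_cont g] by auto
  have [measurable]: "g k \<in> borel_measurable borel" for k
    using g by (rule borel_measurable_continuous_onI)
  have "(\<lambda>k. LINT x:{a..b}|lborel. \<bar>clip n (f x) - clip n (g k x)\<bar>) \<longlonglongrightarrow> (LINT x:{a..b}|lborel. 0)"
    unfolding set_lebesgue_integral_def
  proof (rule integral_dominated_convergence[where w = "\<lambda>x. indicator {a..b} x * (2 * real n)"])
    show "AE x in lborel. (\<lambda>k. indicator {a..b} x *\<^sub>R \<bar>clip n (f x) - clip n (g k x)\<bar>) \<longlonglongrightarrow> indicator {a..b} x *\<^sub>R 0"
      using AE_lborel_not_in_negligible[OF N]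
    proof eventually_elim
      case (elim x)
      have "(\<lambda>k. \<bar>clip n (f x) - clip n (g k x)\<bar>) \<longlonglongrightarrow> \<bar>clip n (f x) - clip n (f x)\<bar>"
        unfolding clip_def by (intro tendsto_intros lim elim)
      then show ?case by (intro tendsto_intros) simp
    qed
    show "AE x in lborel. norm (indicator {a..b} x *\<^sub>R \<bar>clip n (f x) - clip n (g k x)\<bar>) \<le> indicator {a..b} x * (2 * real n)" for k
      by (intro AE_I2) (auto simp: indicator_def clip_def max_def min_def)
  qed (auto simp: integrable_indicator_Icc)
  then have "eventually (\<lambda>k. (LINT x:{a..b}|lborel. \<bar>clip n (f x) - clip n (g k x)\<bar>) < e/2) sequentially"
    using e by (intro order_tendstoD) (auto simp: set_lebesgue_integral_def)
  then obtain k where k: "(LINT x:{a..b}|lborel. \<bar>clip n (f x) - clip n (g k x)\<bar>) < e/2"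
    by (auto simp: eventually_sequentially)
  have cb: "\<bar>clip n y\<bar> \<le> n" for y by (auto simp: clip_def)
  have i1: "set_integrable lborel {a..b} (\<lambda>x. clip n (f x))"
    and i2: "set_integrable lborel {a..b} (\<lambda>x. clip n (g k x))"
    by (rule set_integrable_bounded_Icc[where a = a and b = b, OF cb]; simp)+
  have i0: "set_integrable lborel {a..b} f"
    by (rule set_integrable_lborel[OF f]) simp
  have "(LINT x:{a..b}|lborel. \<bar>f x - clip n (g k x)\<bar>) \<le>
      (LINT x:{a..b}|lborel. \<bar>f x - clip n (f x)\<bar> + \<bar>clip n (f x) - clip n (g k x)\<bar>)"
    by (intro set_integral_mono set_integrable_abs set_integral_diff set_integral_add i0 i1 i2) auto
  also have "\<dots> = (LINT x:{a..b}|lborel. \<bar>f x - clip n (f x)\<bar>) + (LINT x:{a..b}|lborel. \<bar>clip n (f x) - clip n (g k x)\<bar>)"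
    by (intro set_integral_add set_integrable_abs set_integral_diff i0 i1 i2)
  finally have "(LINT x:{a..b}|lborel. \<bar>f x - clip n (g k x)\<bar>) < e"
    using n k by simp
  with cg show ?thesis using that by blast
qed

lemma L1_translation_continuous:
  fixes f :: "real \<Rightarrow> real" and e :: real
  assumes f: "integrable lborel f" and supp: "\<And>x. x \<notin> {0..1} \<Longrightarrow> f x = 0" and e: "e > 0"
  obtains d where "d > 0" "\<And>h. \<bar>h\<bar> \<le> d \<Longrightarrow> (\<integral>\<^sup>+x. ennreal \<bar>f (x + h) - f x\<bar> \<partial>lborel) \<le> ennreal e"
proof -
  \<comment> \<open>The window [-2, 3] contains x and x + h whenever x lies in [-1, 2] and |h| <= 1;
    for other x both values of f vanish. The approximation error e/4 is paid twice and the
    oscillation e/8 of g over length 3, in total 7/8 e.\<close>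
  obtain g where g: "continuous_on UNIV g" and fg: "(LINT x:{-2..3}|lborel. \<bar>f x - g x\<bar>) < e/4"
    using continuous_L1_approx[OF f, of "e/4"] e by auto
  have [measurable]: "f \<in> borel_measurable borel" using f by auto
  have [measurable]: "g \<in> borel_measurable borel" using g by (rule borel_measurable_continuous_onI)
  have "uniformly_continuous_on {-2..3} g"
    by (rule compact_uniformly_continuous) (use g continuous_on_subset in auto)
  then obtain d where d: "d > 0" "\<And>x y. x \<in> {-2..3} \<Longrightarrow> y \<in> {-2..3} \<Longrightarrow> dist y x < d \<Longrightarrow> dist (g y) (g x) < e/8"
    unfolding uniformly_continuous_on_def by (elim allE[of _ "e/8"]) (use e in auto)
  have int_gf: "set_integrable lborel {-2..3} (\<lambda>x. \<bar>f x - g x\<bar>)"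
  proof (intro set_integrable_abs set_integral_diff)
    show "set_integrable lborel {-2..3} f" by (rule set_integrable_lborel[OF f]) auto
    show "set_integrable lborel {-2..3} g"
      by (rule borel_integrable_compact[unfolded set_integrable_def[symmetric]]) (use g continuous_on_subset in auto)
  qed
  define G where "G x = indicator {-2..3} x * \<bar>f x - g x\<bar>" for x
  have G0: "G x \<ge> 0" for x by (simp add: G_def)
  have [measurable]: "G \<in> borel_measurable borel" unfolding G_def by measurable
  have nG: "(\<integral>\<^sup>+x. ennreal (G x) \<partial>lborel) \<le> ennreal (e/4)"
  proof -
    have "integrable lborel G" using int_gf by (simp add: set_integrable_def G_def[abs_def])
    moreover have "integral\<^sup>L lborel G \<le> e/4" using fg by (simp add: set_lebesgue_integral_def G_def[abs_def])
    ultimately show ?thesis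
      by (subst nn_integral_eq_integral) (auto simp: G0 intro: ennreal_leI)
  qed
  show ?thesis
  proof (rule that)
    show "min (d/2) 1 > 0" using d by auto
    fix h :: real assume h: "\<bar>h\<bar> \<le> min (d/2) 1"
    have tri: "\<bar>p - q\<bar> \<le> \<bar>p - p'\<bar> + \<bar>q - q'\<bar> + e/8" if "\<bar>p' - q'\<bar> < e/8" for p q p' q' :: real
      using that by linarith
    have pw: "\<bar>f (x + h) - f x\<bar> \<le> G (x + h) + G x + indicator {-1..2} x * (e/8)" for x
    proof (cases "x \<in> {-1..2}")
      case True
      then have "x \<in> {-2..3}" "x + h \<in> {-2..3}" using h by auto
      moreover have "dist (x + h) x < d" using h d by (auto simp: dist_real_def)
      ultimately have "\<bar>g (x + h) - g x\<bar> < e/8" using d(2)[of x "x + h"] by (simp add: dist_real_def)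
      from tri[OF this, of "f (x + h)" "f x"] True \<open>x + h \<in> _\<close> \<open>x \<in> {-2..3}\<close>
      show ?thesis by (simp add: G_def)
    next
      case False
      then have "f x = 0" "f (x + h) = 0" using h by (auto intro!: supp)
      then show ?thesis using False G0[of x] G0[of "x + h"] by simp
    qed
    have shift: "(\<integral>\<^sup>+x. ennreal (G (x + h)) \<partial>lborel) = (\<integral>\<^sup>+x. ennreal (G x) \<partial>lborel)"
      using nn_integral_real_affine[of "\<lambda>x. ennreal (G x)" 1 h] by (simp add: add.commute)
    have "(\<integral>\<^sup>+x. ennreal \<bar>f (x + h) - f x\<bar> \<partial>lborel) \<le>
        (\<integral>\<^sup>+x. (ennreal (G (x + h)) + ennreal (G x)) + ennreal (e/8) * indicator {-1..2} x \<partial>lborel)"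
    proof (rule nn_integral_mono)
      fix x
      have "ennreal \<bar>f (x + h) - f x\<bar> \<le> ennreal (G (x + h) + G x + indicator {-1..2} x * (e/8))"
        by (rule ennreal_leI[OF pw])
      also have "\<dots> = (ennreal (G (x + h)) + ennreal (G x)) + ennreal (e/8) * indicator {-1..2} x"
        using e G0 by (cases "x \<in> {-1..2}") (auto simp: ennreal_plus add_nonneg_nonneg)
      finally show "ennreal \<bar>f (x + h) - f x\<bar> \<le> \<dots>" .
    qed
    also have "\<dots> = (\<integral>\<^sup>+x. ennreal (G (x + h)) \<partial>lborel) + (\<integral>\<^sup>+x. ennreal (G x) \<partial>lborel) + ennreal (e/8) * emeasure lborel {-1..2::real}"
      by (simp add: nn_integral_add nn_integral_cmult_indicator del: emeasure_lborel_Icc_eq)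
    also have "\<dots> \<le> ennreal (e/4) + ennreal (e/4) + ennreal (e/8) * 3"
      unfolding shift by (intro add_mono nG mult_left_mono) auto
    also have "\<dots> = ennreal (e/4 + e/4 + e/8*3)"
    proof -
      have "ennreal (e/8) * 3 = ennreal (e/8 * 3)"
        using e by (subst ennreal_mult) auto
      then show ?thesis using e by (simp only: ennreal_plus[symmetric] divide_nonneg_nonneg add_nonneg_nonneg mult_nonneg_nonneg)
    qed
    also have "\<dots> \<le> ennreal e" using e by (intro ennreal_leI) simp
    finally show "(\<integral>\<^sup>+x. ennreal \<bar>f (x + h) - f x\<bar> \<partial>lborel) \<le> ennreal e" .
  qed
qed

text \<open>The crude counterpart of \<open>L1_translation_continuous\<close>, valid for every
  shift. It is what yields majorants that do not depend on the width of the mollifier.\<close>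

lemma nn_integral_translation_le:
  fixes f :: "real \<Rightarrow> real"
  assumes f: "integrable lborel f"
  shows "(\<integral>\<^sup>+x. ennreal \<bar>f (x + h) - f x\<bar> \<partial>lborel) \<le> ennreal (2 * (\<integral>x. \<bar>f x\<bar> \<partial>lborel))"
proof -
  have [measurable]: "f \<in> borel_measurable borel" using f by auto
  have shift: "(\<integral>\<^sup>+x. ennreal \<bar>f (x + h)\<bar> \<partial>lborel) = (\<integral>\<^sup>+x. ennreal \<bar>f x\<bar> \<partial>lborel)"
    using nn_integral_real_affine[of "\<lambda>x. ennreal \<bar>f x\<bar>" 1 h] by (simp add: add.commute)
  have "(\<integral>\<^sup>+x. ennreal \<bar>f (x + h) - f x\<bar> \<partial>lborel) \<le> (\<integral>\<^sup>+x. ennreal \<bar>f (x + h)\<bar> + ennreal \<bar>f x\<bar> \<partial>lborel)"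
    by (intro nn_integral_mono) (auto simp flip: ennreal_plus intro!: ennreal_leI)
  also have "\<dots> = (\<integral>\<^sup>+x. ennreal \<bar>f x\<bar> \<partial>lborel) + (\<integral>\<^sup>+x. ennreal \<bar>f x\<bar> \<partial>lborel)"
    by (subst nn_integral_add) (auto simp: shift)
  also have "(\<integral>\<^sup>+x. ennreal \<bar>f x\<bar> \<partial>lborel) = ennreal (\<integral>x. \<bar>f x\<bar> \<partial>lborel)"
    using f by (intro nn_integral_eq_integral) auto
  finally show ?thesis by (simp flip: ennreal_plus)
qed

text \<open>Minkowski's integral inequality by way of Tonelli. Every error term of the mollification
  is put into this form: an average over the mollification variable z of a quantity whose L1 norm in
  y is a translation error.\<close>

lemma nn_integral_average_le:
  fixes F :: "real \<Rightarrow> real \<Rightarrow> real" and w :: "real \<Rightarrow> real"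
  assumes F[measurable]: "case_prod F \<in> borel_measurable (borel \<Otimes>\<^sub>M borel)" and w[measurable]: "w \<in> borel_measurable borel"
    and wb: "\<And>z. \<bar>w z\<bar> \<le> C * indicator {0..1} z" and C: "C \<ge> 0"
    and W: "\<And>z. z \<in> {0..1} \<Longrightarrow> (\<integral>\<^sup>+y. ennreal \<bar>F y z\<bar> \<partial>lborel) \<le> ennreal W"
  shows "(\<integral>\<^sup>+y. ennreal \<bar>\<integral>z. F y z * w z \<partial>lborel\<bar> \<partial>lborel) \<le> ennreal (C * W)"
proof -
  have "(\<integral>\<^sup>+y. ennreal \<bar>\<integral>z. F y z * w z \<partial>lborel\<bar> \<partial>lborel) \<le> (\<integral>\<^sup>+y. (\<integral>\<^sup>+z. ennreal \<bar>F y z * w z\<bar> \<partial>lborel) \<partial>lborel)"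
  proof (rule nn_integral_mono)
    fix y :: real
    show "ennreal \<bar>\<integral>z. F y z * w z \<partial>lborel\<bar> \<le> (\<integral>\<^sup>+z. ennreal \<bar>F y z * w z\<bar> \<partial>lborel)"
    proof (cases "integrable lborel (\<lambda>z. F y z * w z)")
      case True
      then show ?thesis
        using integral_norm_bound_ennreal[OF True] by simp
    next
      \<comment> \<open>A divergent Bochner integral has the value 0, so the bound is
        trivial.\<close>
      case False
      then show ?thesis by (simp add: not_integrable_integral_eq)
    qed
  qed
  also have "\<dots> = (\<integral>\<^sup>+z. (\<integral>\<^sup>+y. ennreal \<bar>F y z * w z\<bar> \<partial>lborel) \<partial>lborel)"
    by (rule lborel_pair.Fubini'[symmetric]) measurable
  also have "\<dots> \<le> (\<integral>\<^sup>+z. ennreal (C * W) * indicator {0..1::real} z \<partial>lborel)"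
  proof (rule nn_integral_mono)
    fix z :: real
    have "(\<integral>\<^sup>+y. ennreal \<bar>F y z * w z\<bar> \<partial>lborel) = (\<integral>\<^sup>+y. ennreal \<bar>w z\<bar> * ennreal \<bar>F y z\<bar> \<partial>lborel)"
      by (simp add: abs_mult mult.commute flip: ennreal_mult)
    also have "\<dots> = ennreal \<bar>w z\<bar> * (\<integral>\<^sup>+y. ennreal \<bar>F y z\<bar> \<partial>lborel)"
      by (rule nn_integral_cmult) measurable
    also have "\<dots> \<le> ennreal (C * W) * indicator {0..1} z"
    proof (cases "z \<in> {0..1}")
      case True
      have "ennreal \<bar>w z\<bar> * (\<integral>\<^sup>+y. ennreal \<bar>F y z\<bar> \<partial>lborel) \<le> ennreal C * ennreal W"
        using wb[of z] True by (intro mult_mono W ennreal_leI) auto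
      then show ?thesis using True C by (simp add: ennreal_mult')
    next
      case False
      then show ?thesis using wb[of z] by simp
    qed
    finally show "(\<integral>\<^sup>+y. ennreal \<bar>F y z * w z\<bar> \<partial>lborel) \<le> ennreal (C * W) * indicator {0..1} z" .
  qed
  also have "\<dots> = ennreal (C * W)" by (subst nn_integral_cmult_indicator) auto
  finally show ?thesis .
qed

subsection \<open>Interval integrals\<close>

lemma LINT_Ioc_split:
  fixes f :: "real \<Rightarrow> real"
  assumes "set_integrable lborel {a<..c} f" "a \<le> b" "b \<le> c"
  shows "(LINT x:{a<..c}|lborel. f x) = (LINT x:{a<..b}|lborel. f x) + (LINT x:{b<..c}|lborel. f x)"
proof -
  have *: "{a<..c} = {a<..b} \<union> {b<..c}" using assms by auto
  show ?thesis unfolding *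
    by (rule set_integral_Un) (use assms(2,3) in \<open>auto intro: set_integrable_subset[OF assms(1)]\<close>)
qed

text \<open>Both sides are additive over a partition with mesh below d. The chain rule, the product
  rule and the minimum of two rates are reduced to short intervals by this lemma.\<close>

lemma le_integral_of_local:
  fixes F h :: "real \<Rightarrow> real"
  assumes h: "set_integrable lborel {s<..t} h" and "s \<le> t" and d: "d > 0"
    and loc: "\<And>a b. s \<le> a \<Longrightarrow> a \<le> b \<Longrightarrow> b \<le> t \<Longrightarrow> b - a < d \<Longrightarrow> F b - F a \<le> (LINT x:{a<..b}|lborel. h x)"
  shows "F t - F s \<le> (LINT x:{s<..t}|lborel. h x)"
proof -
  obtain n :: nat where n: "n > 0" "(t - s) / real n < d"
  proof -
    obtain n :: nat where "n > (t - s) / d" using reals_Archimedean2 by blast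
    then have "(t - s) / real (Suc n) < d" using d \<open>s \<le> t\<close>
      by (simp add: field_simps)
    then show ?thesis using that[of "Suc n"] by simp
  qed
  define p where "p i = s + (t - s) * (real i / real n)" for i
  have mono: "p i \<le> p (Suc i)" for i
    unfolding p_def using n \<open>s \<le> t\<close> by (auto intro!: mult_left_mono divide_right_mono)
  have ps: "s \<le> p i" for i unfolding p_def using n \<open>s \<le> t\<close> by auto
  have pt: "p i \<le> t" if "i \<le> n" for i
  proof -
    have "(t - s) * (real i / real n) \<le> (t - s) * 1"
      using that n \<open>s \<le> t\<close> by (intro mult_left_mono) auto
    then show ?thesis by (simp add: p_def)
  qed
  have "F (p i) - F s \<le> (LINT x:{s<..p i}|lborel. h x)" if "i \<le> n" for i
    using that
  proof (induction i)
    case 0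
    then show ?case by (simp add: p_def set_lebesgue_integral_def)
  next
    case (Suc i)
    have *: "set_integrable lborel {s<..p (Suc i)} h"
      by (rule set_integrable_subset[OF h]) (use pt[OF Suc.prems] in auto)
    have "F (p (Suc i)) - F (p i) \<le> (LINT x:{p i<..p (Suc i)}|lborel. h x)"
    proof (rule loc[OF ps mono pt[OF Suc.prems]])
      have "p (Suc i) - p i = (t - s) / n"
        using n by (simp add: p_def add_divide_distrib distrib_left)
      then show "p (Suc i) - p i < d" using n by simp
    qed
    moreover have "(LINT x:{s<..p (Suc i)}|lborel. h x) = (LINT x:{s<..p i}|lborel. h x) + (LINT x:{p i<..p (Suc i)}|lborel. h x)"
      by (rule LINT_Ioc_split[OF * ps mono])
    ultimately show ?case using Suc by simp
  qed
  from this[of n] show ?thesis using n by (simp add: p_def)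
qed

lemma LINT_Ioc_mono:
  fixes f g :: "real \<Rightarrow> real"
  assumes "set_integrable lborel {a<..b} f" "set_integrable lborel {a<..b} g"
    "\<And>x. a < x \<Longrightarrow> x \<le> b \<Longrightarrow> f x \<le> g x"
  shows "(LINT x:{a<..b}|lborel. f x) \<le> (LINT x:{a<..b}|lborel. g x)"
  by (rule set_integral_mono[OF assms(1,2)]) (use assms(3) in auto)

lemma LINT_Ioc_const: "a \<le> b \<Longrightarrow> (LINT x:{a<..b}|lborel. (c::real)) = c * (b - a)"
  by (simp add: set_lebesgue_integral_def)

lemma LINT_Ioc_abs_le:
  fixes f :: "real \<Rightarrow> real"
  assumes "set_integrable lborel {a<..b} f"
  shows "\<bar>LINT x:{a<..b}|lborel. f x\<bar> \<le> (LINT x:{a<..b}|lborel. \<bar>f x\<bar>)"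
  using set_integral_norm_bound[OF assms] by simp

text \<open>On a short interval, one of two continuous functions is the minimum up to a small error.\<close>

lemma increment_le_integral_min:
  fixes P h1 h2 :: "real \<Rightarrow> real"
  assumes h1: "integrable lborel h1" and h2: "integrable lborel h2"
    and P1: "\<And>a b. s \<le> a \<Longrightarrow> a \<le> b \<Longrightarrow> b \<le> t \<Longrightarrow> P b - P a \<le> (LINT x:{a<..b}|lborel. h1 x)"
    and P2: "\<And>a b. s \<le> a \<Longrightarrow> a \<le> b \<Longrightarrow> b \<le> t \<Longrightarrow> P b - P a \<le> (LINT x:{a<..b}|lborel. h2 x)"
    and st: "s \<le> t"
  shows "P t - P s \<le> (LINT x:{s<..t}|lborel. min (h1 x) (h2 x))"
proof (rule field_le_epsilon)
  fix e :: real assume e: "e > 0"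
  \<comment> \<open>The loss is 2 e' (t - s) from the constant in \<open>h\<close> below and twice
    the integral of \<open>k\<close>, which stays below 2 e'; together this is e' (2 (t - s) +
    4).\<close>
  define e' where "e' = e / (2 * (t - s) + 4)"
  have e': "e' > 0" "e' * (2 * (t - s) + 4) = e" using e st by (auto simp: e'_def)
  have arith: "p \<le> m + (2 * k1 + c) \<Longrightarrow> k1 \<le> k2 \<Longrightarrow> k2 = a + b \<Longrightarrow> a < e' \<Longrightarrow> b < e' \<Longrightarrow> p \<le> m + (2 * (e' + e') + c)"
    for p m k1 k2 a b c :: real by (smt (verit))
  obtain g1 where g1: "continuous_on UNIV g1" "(LINT x:{s..t}|lborel. \<bar>h1 x - g1 x\<bar>) < e'"
    using continuous_L1_approx[OF h1 e'(1)] by blast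
  obtain g2 where g2: "continuous_on UNIV g2" "(LINT x:{s..t}|lborel. \<bar>h2 x - g2 x\<bar>) < e'"
    using continuous_L1_approx[OF h2 e'(1)] by blast
  have uc: "\<exists>d>0. \<forall>x\<in>{s..t}. \<forall>y\<in>{s..t}. \<bar>y - x\<bar> < d \<longrightarrow> \<bar>g y - g x\<bar> < e'" if "continuous_on UNIV g" for g :: "real \<Rightarrow> real"
  proof -
    have "uniformly_continuous_on {s..t} g"
      by (rule compact_uniformly_continuous) (use that continuous_on_subset in auto)
    then show ?thesis unfolding uniformly_continuous_on_def dist_real_def by (elim allE[of _ e']) (use e'(1) in auto)
  qed
  obtain d1 where d1: "d1 > 0" "\<And>x y. x \<in> {s..t} \<Longrightarrow> y \<in> {s..t} \<Longrightarrow> \<bar>y - x\<bar> < d1 \<Longrightarrow> \<bar>g1 y - g1 x\<bar> < e'"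
    using uc[OF g1(1)] by blast
  obtain d2 where d2: "d2 > 0" "\<And>x y. x \<in> {s..t} \<Longrightarrow> y \<in> {s..t} \<Longrightarrow> \<bar>y - x\<bar> < d2 \<Longrightarrow> \<bar>g2 y - g2 x\<bar> < e'"
    using uc[OF g2(1)] by blast
  have ig: "set_integrable lborel {a<..b} g" if "continuous_on UNIV g" for g :: "real \<Rightarrow> real" and a b
  proof (rule set_integrable_subset)
    show "set_integrable lborel {a..b} g"
      by (rule borel_integrable_compact[unfolded set_integrable_def[symmetric]]) (use that continuous_on_subset in auto)
  qed auto
  have ig': "set_integrable lborel {a..b} g" if "continuous_on UNIV g" for g :: "real \<Rightarrow> real" and a b
    by (rule borel_integrable_compact[unfolded set_integrable_def[symmetric]]) (use that continuous_on_subset in auto)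
  note ih1 = set_integrable_lborel[OF h1] note ih2 = set_integrable_lborel[OF h2]
  have imin: "set_integrable lborel {a<..b} (\<lambda>x. min (h1 x) (h2 x))" for a b
    using h1 h2 by (intro set_integrable_lborel) auto
  define k where "k x = \<bar>h1 x - g1 x\<bar> + \<bar>h2 x - g2 x\<bar>" for x
  have ik: "set_integrable lborel {a<..b} k" for a b
    unfolding k_def
    by (intro set_integral_add set_integrable_abs set_integral_diff ih1 ih2 ig g1 g2) auto
  have ik': "set_integrable lborel {a..b} k" for a b
    unfolding k_def
    by (intro set_integral_add set_integrable_abs set_integral_diff ih1 ih2 ig' g1 g2) auto
  define h where "h x = min (h1 x) (h2 x) + (2 * k x + 2 * e')" for x
  have c: "set_integrable lborel {a<..b} (\<lambda>_. c::real)" for a b c :: real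
    by (rule ig) auto
  have ih: "set_integrable lborel {a<..b} h" for a b
    unfolding h_def by (intro set_integral_add(1) imin set_integrable_mult_right ik c)
  have "P t - P s \<le> (LINT x:{s<..t}|lborel. h x)"
  proof (rule le_integral_of_local[OF ih st])
    show "min d1 d2 > 0" using d1 d2 by simp
    fix a b assume ab: "s \<le> a" "a \<le> b" "b \<le> t" "b - a < min d1 d2"
    \<comment> \<open>The choice is made once for the whole short interval, at its right end, by
      comparing the continuous approximants. Elsewhere in the interval it is the minimum up to their
      oscillation and the approximation error.\<close>
    define h' where "h' = (if g1 b \<le> g2 b then h1 else h2)"
    have "P b - P a \<le> (LINT x:{a<..b}|lborel. h' x)"
      unfolding h'_def using P1 P2 ab by auto
    also have "\<dots> \<le> (LINT x:{a<..b}|lborel. h x)"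
    proof (rule LINT_Ioc_mono[OF _ ih])
      show "set_integrable lborel {a<..b} h'" unfolding h'_def using ih1 ih2 by auto
      fix x assume x: "a < x" "x \<le> b"
      then have "\<bar>g1 b - g1 x\<bar> < e'" "\<bar>g2 b - g2 x\<bar> < e'" using ab by (auto intro!: d1 d2)
      then show "h' x \<le> h x" unfolding h'_def h_def k_def min_def by (smt (verit))
    qed
    finally show "P b - P a \<le> (LINT x:{a<..b}|lborel. h x)" .
  qed
  also have "\<dots> = (LINT x:{s<..t}|lborel. min (h1 x) (h2 x)) + (2 * (LINT x:{s<..t}|lborel. k x) + 2 * e' * (t - s))"
    unfolding h_def
    using st by (simp add: set_integral_add(2)[OF imin set_integral_add(1)[OF set_integrable_mult_right[OF ik] c]]
        set_integral_add(2)[OF set_integrable_mult_right[OF ik] c] LINT_Ioc_const)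
  finally have "P t - P s \<le> (LINT x:{s<..t}|lborel. min (h1 x) (h2 x)) + (2 * (LINT x:{s<..t}|lborel. k x) + 2 * e' * (t - s))" .
  moreover have "(LINT x:{s<..t}|lborel. k x) \<le> (LINT x:{s..t}|lborel. k x)"
    using ik[of s t] ik'[of s t] unfolding set_lebesgue_integral_def set_integrable_def
    by (intro integral_mono) (auto simp: k_def indicator_def)
  moreover have "(LINT x:{s..t}|lborel. k x) = (LINT x:{s..t}|lborel. \<bar>h1 x - g1 x\<bar>) + (LINT x:{s..t}|lborel. \<bar>h2 x - g2 x\<bar>)"
    unfolding k_def
    by (intro set_integral_add set_integrable_abs set_integral_diff ih1 ih2 ig' g1 g2) auto
  ultimately have "P t - P s \<le> (LINT x:{s<..t}|lborel. min (h1 x) (h2 x)) + (2 * (e' + e') + 2 * e' * (t - s))"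
    using g1(2) g2(2) arith by blast
  then show "P t - P s \<le> (LINT x:{s<..t}|lborel. min (h1 x) (h2 x)) + e"
    using e'(2) by (simp add: algebra_simps)
qed

lemma continuous_on_indefinite_integral:
  fixes f :: "real \<Rightarrow> real"
  assumes f: "integrable lborel f"
  shows "continuous_on {s..t} (\<lambda>x. LINT y:{s<..x}|lborel. f y)"
proof -
  have "(LINT y:{s<..x}|lborel. f y) = integral {s..x} f" for x
  proof -
    have "(LINT y:{s<..x}|lborel. f y) = (LINT y:{s..x}|lborel. f y)"
      using f by (intro set_integral_cong_set) (auto simp: set_borel_measurable_def
          intro!: AE_I'[of "{s}"])
    also have "\<dots> = integral {s..x} f"
      by (rule set_borel_integral_eq_integral) (rule set_integrable_lborel[OF f], simp)
    finally show ?thesis .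
  qed
  moreover have "continuous_on {s..t} (\<lambda>x. integral {s..x} f)"
    by (rule indefinite_integral_continuous_1, rule set_borel_integral_eq_integral(1))
       (rule set_integrable_lborel[OF f], simp)
  ultimately show ?thesis by simp
qed

text \<open>A one-sided chain rule for an absolutely continuous s that never uses its pointwise
  derivative. Convexity gives the tangent inequality at the right end of a short interval, and
  uniform continuity of \<beta>' along s allows the factor to be moved under the integral.\<close>

lemma convex_chain_inequality:
  fixes \<beta> \<beta>' s D :: "real \<Rightarrow> real"
  assumes D: "integrable lborel D" and b': "continuous_on UNIV \<beta>'"
    and conv: "\<And>x y. \<beta> y - \<beta> x \<le> \<beta>' y * (y - x)"
    and s: "\<And>a b. t0 \<le> a \<Longrightarrow> a \<le> b \<Longrightarrow> b \<le> t1 \<Longrightarrow> s b - s a = (LINT x:{a<..b}|lborel. D x)"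
    and t: "t0 \<le> t1" and int: "set_integrable lborel {t0<..t1} (\<lambda>x. \<beta>' (s x) * D x)"
  shows "\<beta> (s t1) - \<beta> (s t0) \<le> (LINT x:{t0<..t1}|lborel. \<beta>' (s x) * D x)"
proof (rule field_le_epsilon)
  fix e :: real assume e: "e > 0"
  define K where "K = (LINT x:{t0<..t1}|lborel. \<bar>D x\<bar>)"
  have K: "K \<ge> 0" unfolding K_def set_lebesgue_integral_def by (intro integral_nonneg_AE) auto
  define e' where "e' = e / (K + 1)"
  have e': "e' > 0" "e' * K \<le> e" using e K by (auto simp: e'_def field_simps)
  note iD = set_integrable_lborel[OF D]
  have "continuous_on {t0..t1} (\<lambda>x. s t0 + (LINT y:{t0<..x}|lborel. D y))"
    by (intro continuous_intros continuous_on_indefinite_integral D)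
  then have cs: "continuous_on {t0..t1} s"
    by (rule continuous_on_eq) (use s[of t0] in fastforce)
  have "continuous_on {t0..t1} (\<lambda>x. \<beta>' (s x))"
    by (rule continuous_on_compose2[OF b' cs]) auto
  then have "uniformly_continuous_on {t0..t1} (\<lambda>x. \<beta>' (s x))"
    by (rule compact_uniformly_continuous) auto
  then obtain d where d: "d > 0" "\<And>x y. x \<in> {t0..t1} \<Longrightarrow> y \<in> {t0..t1} \<Longrightarrow> \<bar>y - x\<bar> < d \<Longrightarrow> \<bar>\<beta>' (s y) - \<beta>' (s x)\<bar> < e'"
    unfolding uniformly_continuous_on_def dist_real_def by (elim allE[of _ e']) (use e'(1) in auto)
  define h where "h x = \<beta>' (s x) * D x + e' * \<bar>D x\<bar>" for x
  have ih: "set_integrable lborel {a<..b} h" if "t0 \<le> a" "b \<le> t1" for a b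
    unfolding h_def using that
    by (intro set_integral_add(1) set_integrable_mult_right set_integrable_abs iD set_integrable_subset[OF int]) auto
  have "\<beta> (s t1) - \<beta> (s t0) \<le> (LINT x:{t0<..t1}|lborel. h x)"
  proof (rule le_integral_of_local[OF ih t d(1)])
    fix a b assume ab: "t0 \<le> a" "a \<le> b" "b \<le> t1" "b - a < d"
    have "\<beta> (s b) - \<beta> (s a) \<le> \<beta>' (s b) * (s b - s a)" by (rule conv)
    also have "\<dots> = (LINT x:{a<..b}|lborel. \<beta>' (s b) * D x)" using s ab by simp
    also have "\<dots> \<le> (LINT x:{a<..b}|lborel. h x)"
    proof (rule LINT_Ioc_mono)
      show "set_integrable lborel {a<..b} h" using ih ab by simp
      show "set_integrable lborel {a<..b} (\<lambda>x. \<beta>' (s b) * D x)"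
        by (intro set_integrable_mult_right iD) auto
      fix x assume x: "a < x" "x \<le> b"
      have "(\<beta>' (s b) - \<beta>' (s x)) * D x \<le> \<bar>\<beta>' (s b) - \<beta>' (s x)\<bar> * \<bar>D x\<bar>"
        by (metis abs_ge_self abs_mult)
      also have "\<dots> \<le> e' * \<bar>D x\<bar>"
        using d(2)[of x b] x ab by (intro mult_right_mono) auto
      finally show "\<beta>' (s b) * D x \<le> h x" by (simp add: h_def algebra_simps)
    qed
    finally show "\<beta> (s b) - \<beta> (s a) \<le> (LINT x:{a<..b}|lborel. h x)" .
  qed auto
  also have "\<dots> = (LINT x:{t0<..t1}|lborel. \<beta>' (s x) * D x) + e' * K"
    unfolding h_def K_def
    by (subst set_integral_add(2)) (auto intro!: int set_integrable_mult_right set_integrable_abs iD)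
  finally show "\<beta> (s t1) - \<beta> (s t0) \<le> (LINT x:{t0<..t1}|lborel. \<beta>' (s x) * D x) + e"
    using e'(2) by simp
qed

subsection \<open>A one-sided mollifier\<close>

definition pos2 :: "real \<Rightarrow> real" where "pos2 z = (max z 0)\<^sup>2"

text \<open>On [0,1] this is 30 z^2 (1 - z)^2, with 1/30 the integral of z^2 (1 - z)^2. The double
  zeros at both ends make it continuously differentiable, as test functions must be. Its support
  lies to the right of 0, so that averages look only to the right.\<close>

definition moll :: "real \<Rightarrow> real" where "moll z = 30 * pos2 z * pos2 (1 - z)"

definition moll' :: "real \<Rightarrow> real" where
  "moll' z = 60 * max z 0 * pos2 (1 - z) - 60 * pos2 z * max (1 - z) 0"

text \<open>The primitive of \<open>moll\<close>; on \<open>[0,1]\<close> it is \<open>10 z^3 - 15 z^4 + 6 z^5\<close>.\<close>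

definition moll_step :: "real \<Rightarrow> real" where
  "moll_step z = pos2 z * (10 * z - 15 * z^2 + 6 * z^3) - pos2 (z - 1) * ((z - 1) * (6 * z^2 + 3 * z + 1))"

lemma DERIV_pos2: "(pos2 has_real_derivative 2 * max x 0) (at x)"
proof -
  consider "x > 0" | "x < 0" | "x = 0" by linarith
  then show ?thesis
  proof cases
    case 1
    have "((\<lambda>z. z\<^sup>2) has_real_derivative 2 * x) (at x)"
      by (auto intro!: derivative_eq_intros)
    then have "(pos2 has_real_derivative 2 * x) (at x)"
      by (rule has_field_derivative_transform_within_open[of _ _ _ "{0<..}"]) (use 1 in \<open>auto simp: pos2_def\<close>)
    then show ?thesis using 1 by simp
  next
    case 2
    have "((\<lambda>z. 0) has_real_derivative 0) (at x)" by simp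
    then have "(pos2 has_real_derivative 0) (at x)"
      by (rule has_field_derivative_transform_within_open[of _ _ _ "{..<0}"]) (use 2 in \<open>auto simp: pos2_def\<close>)
    then show ?thesis using 2 by simp
  next
    case 3
    have "((\<lambda>h. pos2 h / h) \<longlongrightarrow> 0) (at 0)"
    proof (rule Lim_null_comparison)
      show "\<forall>\<^sub>F h in at 0. norm (pos2 h / h) \<le> \<bar>h\<bar>"
        by (rule always_eventually) (auto simp: pos2_def max_def power2_eq_square)
      show "((\<lambda>h::real. \<bar>h\<bar>) \<longlongrightarrow> 0) (at 0)" by (intro tendsto_eq_intros) auto
    qed
    then show ?thesis unfolding 3 DERIV_def by (simp add: pos2_def[of 0])
  qed
qed

lemma DERIV_pos2' [derivative_intros]:
  assumes "(f has_real_derivative f') (at x)"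
  shows "((\<lambda>z. pos2 (f z)) has_real_derivative 2 * max (f x) 0 * f') (at x)"
  using DERIV_chain2[OF DERIV_pos2 assms] .

lemma DERIV_moll: "(moll has_real_derivative moll' x) (at x)"
proof -
  have "((\<lambda>z. 30 * pos2 z * pos2 (1 - z)) has_real_derivative moll' x) (at x)"
    unfolding moll'_def by (rule derivative_eq_intros refl | simp)+
  then show ?thesis by (simp add: moll_def[abs_def])
qed

text \<open>With p z = 10 z^3 - 15 z^4 + 6 z^5 one has p z - 1 = (z - 1)^3 (6 z^2 + 3 z + 1). The
  second term of \<open>moll_step\<close> removes this excess beyond 1, so the derivative is a
  polynomial identity on each of three regions.\<close>

lemma DERIV_moll_step: "(moll_step has_real_derivative moll x) (at x)"
proof -
  have "(moll_step has_real_derivative (2 * max x 0 * (10 * x - 15 * x^2 + 6 * x^3) + (10 - 30 * x + 18 * x^2) * pos2 x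
      - (2 * max (x - 1) 0 * ((x - 1) * (6 * x^2 + 3 * x + 1)) + (6 * x^2 + 3 * x + 1 + (12 * x + 3) * (x - 1)) * pos2 (x - 1)))) (at x)"
    unfolding moll_step_def[abs_def] by (rule derivative_eq_intros refl | simp add: numeral_eq_Suc)+
  also have "(2 * max x 0 * (10 * x - 15 * x^2 + 6 * x^3) + (10 - 30 * x + 18 * x^2) * pos2 x
      - (2 * max (x - 1) 0 * ((x - 1) * (6 * x^2 + 3 * x + 1)) + (6 * x^2 + 3 * x + 1 + (12 * x + 3) * (x - 1)) * pos2 (x - 1))) = moll x"
  proof -
    consider "x \<le> 0" | "0 \<le> x" "x \<le> 1" | "1 \<le> x" by linarith
    then show ?thesis
      by cases (auto simp: moll_def pos2_def max_absorb1 max_absorb2 power2_eq_square power3_eq_cube algebra_simps)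
  qed
  finally show ?thesis .
qed

lemma moll_eq_0: "z \<le> 0 \<or> 1 \<le> z \<Longrightarrow> moll z = 0" "z \<le> 0 \<or> 1 \<le> z \<Longrightarrow> moll' z = 0"
  by (auto simp: moll_def moll'_def pos2_def max_def)

lemma moll_nonneg: "moll z \<ge> 0"
  by (simp add: moll_def pos2_def)

lemma continuous_on_moll: "continuous_on A moll" "continuous_on A moll'"
  by (auto intro!: continuous_intros simp: moll_def[abs_def] moll'_def[abs_def] pos2_def)

lemma measurable_moll [measurable]: "moll \<in> borel_measurable borel" "moll' \<in> borel_measurable borel"
  by (auto intro!: borel_measurable_continuous_onI continuous_on_moll)

lemma pos2_le_1: "z \<le> 1 \<Longrightarrow> pos2 z \<le> 1" "0 \<le> pos2 z"
  by (auto simp: pos2_def max_def power_le_one)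

lemma moll_bounds: "\<bar>moll z\<bar> \<le> 30 * indicator {0..1} z" "\<bar>moll' z\<bar> \<le> 60 * indicator {0..1} z"
proof -
  have "pos2 z * pos2 (1 - z) \<le> 1" if "z \<in> {0..1}"
    using that by (intro mult_le_one pos2_le_1) auto
  then show "\<bar>moll z\<bar> \<le> 30 * indicator {0..1} z"
    using moll_eq_0(1)[of z] moll_nonneg[of z] by (cases "z \<in> {0..1}") (auto simp: moll_def)
  have "max z 0 * pos2 (1 - z) \<le> 1" "pos2 z * max (1 - z) 0 \<le> 1" if "z \<in> {0..1}"
    using that by (auto intro!: mult_le_one pos2_le_1)
  moreover have "max z 0 * pos2 (1 - z) \<ge> 0" "pos2 z * max (1 - z) 0 \<ge> 0"
    by (auto simp: pos2_le_1)
  ultimately show "\<bar>moll' z\<bar> \<le> 60 * indicator {0..1} z"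
    using moll_eq_0(2)[of z] by (cases "z \<in> {0..1}") (auto simp: moll'_def abs_le_iff)
qed

lemma moll_step_0: "z \<le> 0 \<Longrightarrow> moll_step z = 0" and moll_step_1: "z \<ge> 1 \<Longrightarrow> moll_step z = 1"
  by (auto simp: moll_step_def pos2_def max_absorb1 max_absorb2 power2_eq_square power3_eq_cube algebra_simps)

lemma moll_step_mono: "x \<le> y \<Longrightarrow> moll_step x \<le> moll_step y"
  by (rule DERIV_nonneg_imp_nondecreasing) (use DERIV_moll_step moll_nonneg in blast)+

lemma moll_step_bounds: "0 \<le> moll_step z" "moll_step z \<le> 1"
  using moll_step_mono[of "min z 0" z] moll_step_mono[of z "max z 1"] by (auto simp: moll_step_0 moll_step_1)

text \<open>The second integrand is the derivative of z moll z. That its integral vanishes is the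
  cancellation in the commutator: the first-order part of the transport term offsets ux times the
  average.\<close>

lemma integral_moll: "(\<integral>z. moll z \<partial>lborel) = 1"
  and integral_moll_moment: "(\<integral>z. (z * moll' z + moll z) \<partial>lborel) = 0"
proof -
  have c: "isCont moll z" "isCont moll' z" for z
    using continuous_on_moll[of UNIV] by (auto simp: continuous_on_eq_continuous_at)
  have "(\<integral>z. moll z * indicator {0..1} z \<partial>lborel) = moll_step 1 - moll_step 0"
    by (rule integral_FTC_Icc_real) (auto intro!: DERIV_moll_step c)
  moreover have "moll z * indicator {0..1} z = moll z" for z
    using moll_eq_0(1)[of z] by (cases "z \<in> {0..1}") auto
  ultimately show "(\<integral>z. moll z \<partial>lborel) = 1" by (simp add: moll_step_0 moll_step_1)
  have "(\<integral>z. (z * moll' z + moll z) * indicator {0..1} z \<partial>lborel) = 1 * moll 1 - 0 * moll 0"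
  proof (rule integral_FTC_Icc_real)
    show "((\<lambda>z. z * moll z) has_real_derivative x * moll' x + moll x) (at x)" for x
      by (rule derivative_eq_intros DERIV_moll refl | simp)+
  qed (auto intro!: continuous_intros c)
  moreover have "(z * moll' z + moll z) * indicator {0..1} z = z * moll' z + moll z" for z
    using moll_eq_0[of z] by (cases "z \<in> {0..1}") auto
  ultimately show "(\<integral>z. (z * moll' z + moll z) \<partial>lborel) = 0" by (simp add: moll_eq_0)
qed

lemma moll_Lipschitz: "\<bar>moll x - moll y\<bar> \<le> 60 * \<bar>x - y\<bar>"
proof -
  have "norm (moll x - moll y) \<le> 60 * norm (x - y)"
  proof (rule field_differentiable_bound[OF convex_UNIV])
    show "(moll has_real_derivative moll' z) (at z within UNIV)" for z by (simp add: DERIV_moll)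
    show "norm (moll' z) \<le> 60" for z
      using moll_bounds(2)[of z] by (cases "z \<in> {0..1}") auto
  qed auto
  then show ?thesis by simp
qed

subsection \<open>A smooth convex approximation of the absolute value\<close>

text \<open>Subtracting d makes the value at 0 vanish, so that end points at which the mollified
  function is zero contribute nothing.\<close>

definition sabs :: "real \<Rightarrow> real \<Rightarrow> real" where "sabs d s = sqrt (s\<^sup>2 + d\<^sup>2) - d"

definition sabs' :: "real \<Rightarrow> real \<Rightarrow> real" where "sabs' d s = s / sqrt (s\<^sup>2 + d\<^sup>2)"

context
  fixes d :: real
  assumes d: "d > 0"
begin

lemma sqrt_sabs_pos: "sqrt (s\<^sup>2 + d\<^sup>2) > 0"
  using d by (simp add: add_nonneg_pos)

lemma sqrt_sabs_bounds: "\<bar>s\<bar> \<le> sqrt (s\<^sup>2 + d\<^sup>2)" "sqrt (s\<^sup>2 + d\<^sup>2) \<le> \<bar>s\<bar> + d"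
proof -
  show "\<bar>s\<bar> \<le> sqrt (s\<^sup>2 + d\<^sup>2)" by (rule real_le_rsqrt) simp
  show "sqrt (s\<^sup>2 + d\<^sup>2) \<le> \<bar>s\<bar> + d"
    by (rule real_le_lsqrt) (use d in \<open>auto simp: power2_sum\<close>)
qed

lemma DERIV_sabs: "(sabs d has_real_derivative sabs' d s) (at s)"
  unfolding sabs_def[abs_def] sabs'_def using sqrt_sabs_pos[of s]
  by (auto intro!: derivative_eq_intros simp: field_simps)

lemma continuous_on_sabs: "continuous_on A (sabs d)" "continuous_on A (sabs' d)"
  unfolding sabs_def[abs_def] sabs'_def[abs_def] using sqrt_sabs_pos
  by (auto intro!: continuous_intros simp: less_imp_neq[symmetric])

lemma abs_sabs'_le: "\<bar>sabs' d s\<bar> \<le> 1"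
  using sqrt_sabs_bounds[of s] sqrt_sabs_pos[of s] by (simp add: sabs'_def abs_divide)

lemma sabs_le: "sabs d s \<le> \<bar>s\<bar>" "\<bar>s\<bar> - d \<le> sabs d s" "0 \<le> sabs d s"
  using sqrt_sabs_bounds[of s] real_le_rsqrt[of d "s\<^sup>2 + d\<^sup>2"] by (auto simp: sabs_def)

lemma sabs_0: "sabs d 0 = 0"
  using d by (simp add: sabs_def)

text \<open>The tangent inequality for the Euclidean norm: Cauchy-Schwarz for the vectors (x, d) and
  (y, d).\<close>

lemma sabs_convex: "sabs d y - sabs d x \<le> sabs' d y * (y - x)"
proof -
  let ?p = "sqrt (x\<^sup>2 + d\<^sup>2)" and ?q = "sqrt (y\<^sup>2 + d\<^sup>2)"
  have "x * y + d * d \<le> ?p * ?q"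
  proof -
    have "(x * y + d * d)\<^sup>2 \<le> (x\<^sup>2 + d\<^sup>2) * (y\<^sup>2 + d\<^sup>2)"
      using zero_le_power2[of "d * x - d * y"] by (simp add: power2_eq_square algebra_simps)
    then have "\<bar>x * y + d * d\<bar> \<le> sqrt ((x\<^sup>2 + d\<^sup>2) * (y\<^sup>2 + d\<^sup>2))" by (simp add: real_le_rsqrt)
    then show ?thesis by (simp add: real_sqrt_mult)
  qed
  moreover have "?q * ?q = y * y + d * d"
    using d by (simp add: power2_eq_square)
  ultimately have "(?q - ?p) * ?q \<le> y * (y - x)" by (simp add: algebra_simps)
  then have "?q - ?p \<le> y * (y - x) / ?q"
    using sqrt_sabs_pos[of y] by (simp add: pos_le_divide_eq)
  then show ?thesis by (simp add: sabs_def sabs'_def)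
qed

text \<open>The absolute value is homogeneous of degree one, so \<beta>' s * s equals \<beta> s for
  it. Here the exact value is q - d^2 / q with q = sqrt (s^2 + d^2), and d^2 / q lies between 0 and
  d. This keeps the term with ux in the renormalised equation of size d.\<close>

lemma sabs'_mult_bounds: "sabs' d s * s \<le> \<bar>s\<bar>" "\<bar>s\<bar> - d \<le> sabs' d s * s" "\<bar>sabs d s - sabs' d s * s\<bar> \<le> d"
proof -
  let ?q = "sqrt (s\<^sup>2 + d\<^sup>2)"
  have qq: "?q * ?q = s * s + d * d" using d by (simp add: power2_eq_square)
  have e: "sabs' d s * s = ?q - d * d / ?q"
  proof -
    have "sabs' d s * s = (?q * ?q - d * d) / ?q" by (simp add: sabs'_def qq del: real_sqrt_mult_self)
    also have "\<dots> = ?q - d * d / ?q"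
      using sqrt_sabs_pos[of s] by (simp add: diff_divide_distrib del: real_sqrt_mult_self)
    finally show ?thesis .
  qed
  have "d \<le> ?q" by (rule real_le_rsqrt) simp
  then have *: "d * d / ?q \<le> d" "d * d / ?q \<ge> 0" using d sqrt_sabs_pos[of s] by (auto simp: pos_divide_le_eq)
  then show 2: "\<bar>s\<bar> - d \<le> sabs' d s * s" using e sqrt_sabs_bounds[of s] by linarith
  show 3: "\<bar>sabs d s - sabs' d s * s\<bar> \<le> d" using * e by (simp add: sabs_def)
  have "sabs' d s * s \<le> \<bar>sabs' d s\<bar> * \<bar>s\<bar>" by (metis abs_ge_self abs_mult)
  also have "\<dots> \<le> 1 * \<bar>s\<bar>" by (intro mult_right_mono abs_sabs'_le) simp
  finally show "sabs' d s * s \<le> \<bar>s\<bar>" by simp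
qed

lemma measurable_sabs [measurable]: "sabs d \<in> borel_measurable borel" "sabs' d \<in> borel_measurable borel"
  by (auto intro!: borel_measurable_continuous_onI continuous_on_sabs)

end

subsection \<open>Integration by parts\<close>

lemma integrable_mult_Icc:
  fixes h w :: "real \<Rightarrow> real"
  assumes [measurable]: "h \<in> borel_measurable borel" "w \<in> borel_measurable borel"
    and h: "\<And>z. \<bar>h z\<bar> \<le> B" and w: "\<And>z. \<bar>w z\<bar> \<le> C * indicator {0..1} z"
  shows "integrable lborel (\<lambda>z. h z * w z)"
proof (rule Bochner_Integration.integrable_bound[where f = "\<lambda>z. (B * C) * indicator {0..1::real} z"])
  show "integrable lborel (\<lambda>z. (B * C) * indicator {0..1::real} z)"
    by (intro integrable_mult_right integrable_indicator_Icc)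
  have "B \<ge> 0" using h[of 0] by linarith
  then have "\<bar>h z * w z\<bar> \<le> B * (C * indicator {0..1} z)" for z
    unfolding abs_mult by (intro mult_mono h w) auto
  then show "AE z in lborel. norm (h z * w z) \<le> norm ((B * C) * indicator {0..1} z)"
    by (intro AE_I2) (auto simp: mult.assoc intro: order_trans[OF _ abs_ge_self])
qed auto

lemma integrable_mult_bounded:
  fixes h w :: "real \<Rightarrow> real"
  assumes h: "integrable lborel h" and [measurable]: "w \<in> borel_measurable borel" and w: "\<And>z. \<bar>w z\<bar> \<le> C"
  shows "integrable lborel (\<lambda>z. h z * w z)"
proof (rule Bochner_Integration.integrable_bound[where f = "\<lambda>z. h z * C"])
  show "AE z in lborel. norm (h z * w z) \<le> norm (h z * C)"
    using w by (intro AE_I2) (auto simp: abs_mult intro!: mult_left_mono order_trans[OF w abs_ge_self])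
qed (use h in auto)

lemma nn_integral_le_imp_integrable:
  fixes h :: "real \<Rightarrow> real"
  assumes [measurable]: "h \<in> borel_measurable borel" and le: "(\<integral>\<^sup>+x. ennreal \<bar>h x\<bar> \<partial>lborel) \<le> ennreal X" and X: "X \<ge> 0"
  shows "integrable lborel h" "(\<integral>x. \<bar>h x\<bar> \<partial>lborel) \<le> X"
proof -
  show i: "integrable lborel h"
    using le by (intro integrableI_bounded) (auto simp: le_less_trans[OF le])
  have "ennreal (\<integral>x. \<bar>h x\<bar> \<partial>lborel) \<le> ennreal X"
    using le i by (subst nn_integral_eq_integral[symmetric]) auto
  then show "(\<integral>x. \<bar>h x\<bar> \<partial>lborel) \<le> X" using X by simp
qed

lemma LINT_subset_le:
  fixes h :: "real \<Rightarrow> real"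
  assumes "integrable lborel h" "A \<in> sets borel"
  shows "(LINT x:A|lborel. \<bar>h x\<bar>) \<le> (\<integral>x. \<bar>h x\<bar> \<partial>lborel)"
  unfolding set_lebesgue_integral_def
  by (intro integral_mono integrable_mult_indicator integrable_abs)
    (use assms in \<open>auto simp: indicator_def\<close>)

text \<open>The product rule for an absolutely continuous u and a continuously differentiable B. On
  a short interval the increment is split with B frozen at the right end and u at the left end;
  uniform continuity pays for unfreezing them.\<close>

lemma le_integral_product:
  fixes u ux B B' :: "real \<Rightarrow> real"
  assumes ux: "integrable lborel ux" and u: "\<And>x y. x \<le> y \<Longrightarrow> u y - u x = (LINT z:{x<..y}|lborel. ux z)"
    and B: "\<And>x. (B has_real_derivative B' x) (at x)" and B': "continuous_on UNIV B'" and ab: "a \<le> b"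
    and cu: "continuous_on {a..b} u"
    and int: "set_integrable lborel {a<..b} (\<lambda>x. ux x * B x + u x * B' x)"
  shows "u b * B b - u a * B a \<le> (LINT x:{a<..b}|lborel. ux x * B x + u x * B' x)"
proof (rule field_le_epsilon)
  fix e :: real assume e: "e > 0"
  note iux = set_integrable_lborel[OF ux]
  have iB': "set_integrable lborel {x<..y} B'" for x y
    by (rule set_integrable_subset[OF borel_integrable_compact[of "{x..y}", unfolded set_integrable_def[symmetric]]])
      (use B' continuous_on_subset in auto)
  define K where "K = (LINT x:{a<..b}|lborel. \<bar>ux x\<bar> + \<bar>B' x\<bar>)"
  have K: "K \<ge> 0" unfolding K_def set_lebesgue_integral_def by (intro integral_nonneg_AE) auto
  define e' where "e' = e / (K + 1)"
  have e': "e' > 0" "e' * K \<le> e" using e K by (auto simp: e'_def field_simps)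
  have cB: "continuous_on {a..b} B"
    using B by (meson DERIV_isCont continuous_at_imp_continuous_on)
  have uc: "\<exists>d>0. \<forall>x\<in>{a..b}. \<forall>y\<in>{a..b}. \<bar>y - x\<bar> < d \<longrightarrow> \<bar>g y - g x\<bar> < e'" if "continuous_on {a..b} g" for g :: "real \<Rightarrow> real"
  proof -
    have "uniformly_continuous_on {a..b} g"
      by (rule compact_uniformly_continuous[OF that]) auto
    then show ?thesis unfolding uniformly_continuous_on_def dist_real_def by (elim allE[of _ e']) (use e'(1) in auto)
  qed
  obtain d1 where d1: "d1 > 0" "\<And>x y. x \<in> {a..b} \<Longrightarrow> y \<in> {a..b} \<Longrightarrow> \<bar>y - x\<bar> < d1 \<Longrightarrow> \<bar>u y - u x\<bar> < e'"
    using uc[OF cu] by blast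
  obtain d2 where d2: "d2 > 0" "\<And>x y. x \<in> {a..b} \<Longrightarrow> y \<in> {a..b} \<Longrightarrow> \<bar>y - x\<bar> < d2 \<Longrightarrow> \<bar>B y - B x\<bar> < e'"
    using uc[OF cB] by blast
  define h where "h x = (ux x * B x + u x * B' x) + e' * (\<bar>ux x\<bar> + \<bar>B' x\<bar>)" for x
  have ih: "set_integrable lborel {x<..y} h" if "a \<le> x" "y \<le> b" for x y
    unfolding h_def using that
    by (intro set_integral_add(1) set_integrable_mult_right set_integrable_abs iux iB' set_integrable_subset[OF int]) auto
  have "u b * B b - u a * B a \<le> (LINT x:{a<..b}|lborel. h x)"
  proof (rule le_integral_of_local[OF ih ab])
    show "min d1 d2 > 0" using d1 d2 by simp
    fix x y assume xy: "a \<le> x" "x \<le> y" "y \<le> b" "y - x < min d1 d2"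
    have FTC: "B y - B x = (LINT z:{x<..y}|lborel. B' z)"
    proof -
      have "B y - B x = (\<integral>z. indicator {x..y} z *\<^sub>R B' z \<partial>lborel)"
      proof (rule integral_FTC_Icc[OF xy(2), symmetric])
        show "(B has_vector_derivative B' z) (at z within {x..y})" for z
          using B[of z] by (simp add: has_real_derivative_iff_has_vector_derivative has_vector_derivative_at_within)
        show "continuous_on {x..y} B'" using B' by (rule continuous_on_subset) simp
      qed
      also have "\<dots> = (LINT z:{x<..y}|lborel. B' z)"
        unfolding set_lebesgue_integral_def
        using borel_measurable_continuous_onI[OF B']
        by (intro integral_cong_AE) (auto simp: indicator_def intro!: AE_I'[of "{x}"])
      finally show ?thesis .
    qed
    have "u y * B y - u x * B x = B y * (u y - u x) + u x * (B y - B x)" by (simp add: algebra_simps)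
    also have "\<dots> = (LINT z:{x<..y}|lborel. B y * ux z) + (LINT z:{x<..y}|lborel. u x * B' z)"
      using u[OF xy(2)] FTC by simp
    also have "\<dots> = (LINT z:{x<..y}|lborel. B y * ux z + u x * B' z)"
      by (intro set_integral_add(2)[symmetric] set_integrable_mult_right iux iB') auto
    also have "\<dots> \<le> (LINT z:{x<..y}|lborel. h z)"
    proof (rule LINT_Ioc_mono)
      show "set_integrable lborel {x<..y} h" using ih xy by simp
      show "set_integrable lborel {x<..y} (\<lambda>z. B y * ux z + u x * B' z)"
        by (intro set_integral_add(1) set_integrable_mult_right iux iB') auto
      fix z assume z: "x < z" "z \<le> y"
      have "(B y - B z) * ux z \<le> \<bar>B y - B z\<bar> * \<bar>ux z\<bar>" by (metis abs_ge_self abs_mult)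
      also have "\<dots> \<le> e' * \<bar>ux z\<bar>" using d2(2)[of z y] z xy by (intro mult_right_mono) auto
      finally have 1: "(B y - B z) * ux z \<le> e' * \<bar>ux z\<bar>" .
      have "(u x - u z) * B' z \<le> \<bar>u x - u z\<bar> * \<bar>B' z\<bar>" by (metis abs_ge_self abs_mult)
      also have "\<dots> \<le> e' * \<bar>B' z\<bar>" using d1(2)[of z x] z xy by (intro mult_right_mono) auto
      finally have 2: "(u x - u z) * B' z \<le> e' * \<bar>B' z\<bar>" .
      show "B y * ux z + u x * B' z \<le> h z" using 1 2 by (simp add: h_def algebra_simps)
    qed
    finally show "u y * B y - u x * B x \<le> (LINT x:{x<..y}|lborel. h x)" .
  qed auto
  also have "\<dots> = (LINT x:{a<..b}|lborel. ux x * B x + u x * B' x) + e' * K"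
    unfolding h_def K_def
    by (subst set_integral_add(2)) (auto intro!: int set_integrable_mult_right set_integral_add(1) set_integrable_abs iux iB')
  finally show "u b * B b - u a * B a \<le> (LINT x:{a<..b}|lborel. ux x * B x + u x * B' x) + e"
    using e'(2) by simp
qed

text \<open>The reverse inequality is the previous lemma for -u.\<close>

lemma integral_product:
  fixes u ux B B' :: "real \<Rightarrow> real"
  assumes ux: "integrable lborel ux" and u: "\<And>x y. x \<le> y \<Longrightarrow> u y - u x = (LINT z:{x<..y}|lborel. ux z)"
    and B: "\<And>x. (B has_real_derivative B' x) (at x)" and B': "continuous_on UNIV B'" and ab: "a \<le> b"
    and cu: "continuous_on {a..b} u"
    and int: "set_integrable lborel {a<..b} (\<lambda>x. ux x * B x + u x * B' x)"
  shows "u b * B b - u a * B a = (LINT x:{a<..b}|lborel. ux x * B x + u x * B' x)"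
proof (rule antisym)
  show "u b * B b - u a * B a \<le> (LINT x:{a<..b}|lborel. ux x * B x + u x * B' x)"
    by (rule le_integral_product[OF assms])
  have m: "(LINT z:A|lborel. - f z) = - (LINT z:A|lborel. f z)" for f :: "real \<Rightarrow> real" and A
    by (simp add: set_lebesgue_integral_def)
  have "(- u b) * B b - (- u a) * B a \<le> (LINT x:{a<..b}|lborel. (- ux x) * B x + (- u x) * B' x)"
  proof (rule le_integral_product[OF _ _ B B' ab])
    show "integrable lborel (\<lambda>x. - ux x)" using ux by simp
    show "- u y - - u x = (LINT z:{x<..y}|lborel. - ux z)" if "x \<le> y" for x y
      using u[OF that] by (simp add: m)
    show "continuous_on {a..b} (\<lambda>x. - u x)" using cu by (intro continuous_intros)
    show "set_integrable lborel {a<..b} (\<lambda>x. (- ux x) * B x + (- u x) * B' x)"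
      using set_integrable_mult_right[of "-1", OF int] by (simp add: algebra_simps)
  qed
  also have "(\<lambda>x. (- ux x) * B x + (- u x) * B' x) = (\<lambda>x. - (ux x * B x + u x * B' x))"
    by (simp add: fun_eq_iff)
  finally have "- u b * B b - - u a * B a \<le> - (LINT x:{a<..b}|lborel. ux x * B x + u x * B' x)"
    by (simp only: m)
  then show "(LINT x:{a<..b}|lborel. ux x * B x + u x * B' x) \<le> u b * B b - u a * B a"
    by simp
qed

subsection \<open>Mollification in space\<close>

definition avg :: "real \<Rightarrow> (real \<Rightarrow> real) \<Rightarrow> real \<Rightarrow> real" where
  "avg e f y = (\<integral>z. f (y + e * z) * moll z \<partial>lborel)"

text \<open>This is minus the derivative of \<open>avg\<close>, because y enters the mollifier as (x
  - y) / e.\<close>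

definition avg' :: "real \<Rightarrow> (real \<Rightarrow> real) \<Rightarrow> real \<Rightarrow> real" where
  "avg' e f y = (\<integral>z. f (y + e * z) * moll' z \<partial>lborel) / e"

lemma avg_eq: "e > 0 \<Longrightarrow> avg e f y = (\<integral>x. f x * moll ((x - y) / e) \<partial>lborel) / e"
  and avg'_eq: "e > 0 \<Longrightarrow> avg' e f y = (\<integral>x. f x * moll' ((x - y) / e) \<partial>lborel) / e\<^sup>2"
  unfolding avg_def avg'_def
  using lborel_integral_real_affine[of e "\<lambda>x. f x * moll ((x - y) / e)" y]
    lborel_integral_real_affine[of e "\<lambda>x. f x * moll' ((x - y) / e)" y]
  by (auto simp: power2_eq_square)

lemma DERIV_avg:
  assumes f: "integrable lborel f" and e: "e > 0"
  shows "(avg e f has_real_derivative - avg' e f y) (at y)"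
proof -
  have [measurable]: "f \<in> borel_measurable borel" using f by auto
  have "((\<lambda>w. (avg e f w - avg e f y) / (w - y)) \<longlongrightarrow> - avg' e f y) (at y)"
    unfolding tendsto_at_iff_sequentially comp_def
  proof (intro allI impI)
    fix X :: "nat \<Rightarrow> real" assume X: "\<forall>i. X i \<in> UNIV - {y}" "X \<longlonglongrightarrow> y"
    let ?q = "\<lambda>i x. (moll ((x - X i) / e) - moll ((x - y) / e)) / (X i - y)"
    have qb: "\<bar>?q i x\<bar> \<le> 60 / e" for i x
    proof -
      have "\<bar>moll ((x - X i) / e) - moll ((x - y) / e)\<bar> \<le> 60 * \<bar>(x - X i) / e - (x - y) / e\<bar>"
        by (rule moll_Lipschitz)
      also have "(x - X i) / e - (x - y) / e = - (X i - y) / e" using e by (simp add: field_simps)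
      finally show ?thesis using X e by (simp add: abs_divide divide_simps mult.commute abs_minus_commute)
    qed
    have m1: "\<bar>moll z\<bar> \<le> 30" for z using moll_bounds(1)[of z] by (cases "z \<in> {0..1}") auto
    have int: "integrable lborel (\<lambda>x. f x * moll ((x - w) / e))" for w
      by (rule integrable_mult_bounded[OF f _ m1]) simp
    have "(\<lambda>i. \<integral>x. f x * ?q i x \<partial>lborel) \<longlonglongrightarrow> (\<integral>x. f x * (- moll' ((x - y) / e) / e) \<partial>lborel)"
    proof (rule integral_dominated_convergence[where w = "\<lambda>x. \<bar>f x\<bar> * (60 / e)"])
      show "AE x in lborel. norm (f x * ?q i x) \<le> \<bar>f x\<bar> * (60 / e)" for i
        using qb by (intro AE_I2) (simp add: abs_mult mult_left_mono del: times_divide_eq_right)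
      show "AE x in lborel. (\<lambda>i. f x * ?q i x) \<longlonglongrightarrow> f x * (- moll' ((x - y) / e) / e)"
      proof (intro AE_I2 tendsto_mult tendsto_const)
        fix x
        have "((\<lambda>w. moll ((x - w) / e)) has_real_derivative - moll' ((x - y) / e) / e) (at y)"
        proof -
          have "((\<lambda>w. (x - w) / e) has_real_derivative - 1 / e) (at y)"
            using e by (auto intro!: derivative_eq_intros)
          from DERIV_chain2[OF DERIV_moll this] show ?thesis by simp
        qed
        then have "((\<lambda>w. (moll ((x - w) / e) - moll ((x - y) / e)) / (w - y)) \<longlongrightarrow> - moll' ((x - y) / e) / e) (at y)"
          by (simp add: has_field_derivative_iff)
        then show "(\<lambda>i. ?q i x) \<longlonglongrightarrow> - moll' ((x - y) / e) / e"
          using X unfolding tendsto_at_iff_sequentially comp_def by blast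
      qed
    qed (use f in auto)
    moreover have "(\<integral>x. f x * ?q i x \<partial>lborel) / e = (avg e f (X i) - avg e f y) / (X i - y)" for i
    proof -
      have "(\<integral>x. f x * ?q i x \<partial>lborel) = (\<integral>x. (f x * moll ((x - X i) / e) - f x * moll ((x - y) / e)) / (X i - y) \<partial>lborel)"
        by (simp add: right_diff_distrib)
      also have "\<dots> = ((\<integral>x. f x * moll ((x - X i) / e) \<partial>lborel) - (\<integral>x. f x * moll ((x - y) / e) \<partial>lborel)) / (X i - y)"
        by (simp add: Bochner_Integration.integral_diff[OF int int])
      finally show ?thesis using e by (simp add: avg_eq diff_divide_distrib mult.commute)
    qed
    moreover have "(\<integral>x. f x * (- moll' ((x - y) / e) / e) \<partial>lborel) / e = - avg' e f y"
      using e by (simp add: avg'_eq power2_eq_square)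
    ultimately show "(\<lambda>i. (avg e f (X i) - avg e f y) / (X i - y)) \<longlonglongrightarrow> - avg' e f y"
      using e tendsto_divide[OF _ tendsto_const[of e]] by fastforce
  qed
  then show ?thesis by (simp add: has_field_derivative_iff)
qed

lemma continuous_on_avg':
  assumes f: "integrable lborel f" and e: "e > 0"
  shows "continuous_on UNIV (avg' e f)"
proof -
  have [measurable]: "f \<in> borel_measurable borel" using f by auto
  have m1: "\<bar>moll' z\<bar> \<le> 60" for z using moll_bounds(2)[of z] by (cases "z \<in> {0..1}") auto
  have "continuous_on UNIV (\<lambda>y. (\<integral>x. f x * moll' ((x - y) / e) \<partial>lborel))"
    unfolding continuous_on_sequentially comp_def
  proof (intro allI ballI impI)
    fix X y assume X: "(\<forall>n. X n \<in> UNIV) \<and> X \<longlonglongrightarrow> (y::real)"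
    show "(\<lambda>n. \<integral>x. f x * moll' ((x - X n) / e) \<partial>lborel) \<longlonglongrightarrow> (\<integral>x. f x * moll' ((x - y) / e) \<partial>lborel)"
    proof (rule integral_dominated_convergence[where w = "\<lambda>x. \<bar>f x\<bar> * 60"])
      show "AE x in lborel. norm (f x * moll' ((x - X i) / e)) \<le> \<bar>f x\<bar> * 60" for i
        using m1 by (intro AE_I2) (simp add: abs_mult mult_left_mono)
      show "AE x in lborel. (\<lambda>i. f x * moll' ((x - X i) / e)) \<longlonglongrightarrow> f x * moll' ((x - y) / e)"
      proof (intro AE_I2 tendsto_mult tendsto_const)
        fix x
        have "isCont moll' ((x - y) / e)"
          using continuous_on_moll(2)[of UNIV] by (simp add: continuous_on_eq_continuous_at)
        moreover have "(\<lambda>i. (x - X i) / e) \<longlonglongrightarrow> (x - y) / e"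
          using X e by (intro tendsto_intros) auto
        ultimately show "(\<lambda>i. moll' ((x - X i) / e)) \<longlonglongrightarrow> moll' ((x - y) / e)"
          by (rule isCont_tendsto_compose)
      qed
    qed (use f in auto)
  qed
  moreover have "avg' e f = (\<lambda>y. (\<integral>x. f x * moll' ((x - y) / e) \<partial>lborel) / e\<^sup>2)"
    using e by (intro ext avg'_eq)
  ultimately show ?thesis using e by (auto intro!: continuous_intros)
qed

lemma measurable_avg [measurable]:
  assumes [measurable]: "f \<in> borel_measurable borel"
  shows "avg e f \<in> borel_measurable borel" "avg' e f \<in> borel_measurable borel"
  unfolding avg_def[abs_def] avg'_def[abs_def] by measurable

lemma avg_bound:
  assumes [measurable]: "f \<in> borel_measurable borel" and b: "\<And>x. \<bar>f x\<bar> \<le> M"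
  shows "\<bar>avg e f y\<bar> \<le> M"
proof -
  have m: "integrable lborel moll"
    using integral_moll by (metis not_integrable_integral_eq zero_neq_one)
  have "\<bar>avg e f y\<bar> \<le> (\<integral>z. \<bar>f (y + e * z) * moll z\<bar> \<partial>lborel)"
    unfolding avg_def using integral_norm_bound[of lborel "\<lambda>z. f (y + e * z) * moll z"] by simp
  also have "\<dots> \<le> (\<integral>z. M * moll z \<partial>lborel)"
  proof (rule integral_mono)
    show "integrable lborel (\<lambda>z. \<bar>f (y + e * z) * moll z\<bar>)"
      by (intro integrable_abs integrable_mult_Icc[OF _ _ b moll_bounds(1)]) auto
  qed (use m b moll_nonneg in \<open>auto simp: abs_mult intro!: mult_right_mono\<close>)
  also have "\<dots> = M" by (simp add: integral_moll)
  finally show ?thesis .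
qed

lemma avg_bound_deriv:
  assumes [measurable]: "f \<in> borel_measurable borel" and b: "\<And>x. \<bar>f x\<bar> \<le> M" and e: "e > 0"
  shows "\<bar>avg' e f y\<bar> \<le> 60 * M / e"
proof -
  have "\<bar>\<integral>z. f (y + e * z) * moll' z \<partial>lborel\<bar> \<le> (\<integral>z. \<bar>f (y + e * z) * moll' z\<bar> \<partial>lborel)"
    using integral_norm_bound[of lborel "\<lambda>z. f (y + e * z) * moll' z"] by simp
  also have "\<dots> \<le> (\<integral>z. M * (60 * indicator {0..1::real} z) \<partial>lborel)"
  proof (rule integral_mono)
    show "integrable lborel (\<lambda>z. \<bar>f (y + e * z) * moll' z\<bar>)"
      by (intro integrable_abs integrable_mult_Icc[OF _ _ b moll_bounds(2)]) auto
    show "integrable lborel (\<lambda>z. M * (60 * indicator {0..1::real} z))"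
      by (intro integrable_mult_right integrable_indicator_Icc)
    have "M \<ge> 0" using b[of 0] by linarith
    then show "\<bar>f (y + e * z) * moll' z\<bar> \<le> M * (60 * indicator {0..1} z)" for z
      unfolding abs_mult using b moll_bounds(2) by (intro mult_mono) auto
  qed
  also have "\<dots> = 60 * M" by simp
  finally show ?thesis using e by (simp add: avg'_def abs_divide divide_right_mono)
qed

text \<open>As \<open>moll\<close> has mass one, the error is the average over z of f (y + e z) - f
  y; the factor 30 bounds \<open>moll\<close>.\<close>

lemma avg_L1_error:
  fixes f :: "real \<Rightarrow> real"
  assumes f: "integrable lborel f" and e: "e > 0" and W: "W \<ge> 0"
    and mod: "\<And>r. 0 \<le> r \<Longrightarrow> r \<le> e \<Longrightarrow> (\<integral>\<^sup>+y. ennreal \<bar>f (y + r) - f y\<bar> \<partial>lborel) \<le> ennreal W"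
  shows "integrable lborel (\<lambda>y. avg e f y - f y)" "(\<integral>y. \<bar>avg e f y - f y\<bar> \<partial>lborel) \<le> 30 * W"
proof -
  have fm[measurable]: "f \<in> borel_measurable borel" using f by auto
  have m: "integrable lborel moll"
    using integral_moll by (metis not_integrable_integral_eq zero_neq_one)
  have m1: "\<bar>moll z\<bar> \<le> 30" for z using moll_bounds(1)[of z] by (cases "z \<in> {0..1}") auto
  have int: "integrable lborel (\<lambda>z. f (y + e * z) * moll z)" for y
    by (rule integrable_mult_bounded[OF lborel_integrable_real_affine[OF f]]) (use e m1 in auto)
  have eq: "avg e f y - f y = (\<integral>z. (f (y + e * z) - f y) * moll z \<partial>lborel)" for y
  proof -
    have "(\<integral>z. (f (y + e * z) - f y) * moll z \<partial>lborel) = (\<integral>z. f (y + e * z) * moll z - f y * moll z \<partial>lborel)"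
      by (simp add: left_diff_distrib)
    also have "\<dots> = avg e f y - f y"
      using m int by (subst Bochner_Integration.integral_diff) (auto simp: avg_def integral_moll)
    finally show ?thesis by simp
  qed
  have "(\<integral>\<^sup>+y. ennreal \<bar>avg e f y - f y\<bar> \<partial>lborel) \<le> ennreal (30 * W)"
    unfolding eq
  proof (rule nn_integral_average_le[OF _ _ moll_bounds(1)])
    fix z :: real assume "z \<in> {0..1}"
    then show "(\<integral>\<^sup>+y. ennreal \<bar>f (y + e * z) - f y\<bar> \<partial>lborel) \<le> ennreal W"
      using e by (intro mod) (auto intro: mult_left_le)
  qed auto
  then show "integrable lborel (\<lambda>y. avg e f y - f y)" "(\<integral>y. \<bar>avg e f y - f y\<bar> \<partial>lborel) \<le> 30 * W"
    using W by (auto intro!: nn_integral_le_imp_integrable)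
qed

subsection \<open>The commutator estimate at a fixed time\<close>

text \<open>All functions live on the whole line, so translates and averages need no case
  distinction at the boundary. Since ux vanishes outside (0,1), the relation between u and ux forces
  u to be constant on either side of it.\<close>

locale transport_slice =
  fixes M :: real and \<sigma> u ux c :: "real \<Rightarrow> real"
  assumes sigma_measurable [measurable]: "\<sigma> \<in> borel_measurable borel"
    and u_measurable [measurable]: "u \<in> borel_measurable borel"
    and sigma_le: "\<And>x. \<bar>\<sigma> x\<bar> \<le> M" and sigma_0: "\<And>x. x \<notin> {0<..<1} \<Longrightarrow> \<sigma> x = 0"
    and ux_int: "integrable lborel ux" and ux_0: "\<And>x. x \<notin> {0<..<1} \<Longrightarrow> ux x = 0"
    and c_int: "integrable lborel c" and c_0: "\<And>x. x \<notin> {0<..<1} \<Longrightarrow> c x = 0"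
    and u_diff: "\<And>a b. a \<le> b \<Longrightarrow> u b - u a = (LINT z:{a<..b}|lborel. ux z)"
begin

lemma M_nonneg: "M \<ge> 0"
  using sigma_le[of 0] by linarith

lemma ux_measurable [measurable]: "ux \<in> borel_measurable borel"
  and c_measurable [measurable]: "c \<in> borel_measurable borel"
  using ux_int c_int by auto

lemma sigma_int: "integrable lborel \<sigma>"
proof (rule integrableI_bounded_set[where A = "{0..1}" and B = M])
  show "AE x in lborel. x \<notin> {0..1} \<longrightarrow> \<sigma> x = 0" using sigma_0 by auto
qed (use sigma_le in auto)

lemma integrable_mult_sigma: "integrable lborel v \<Longrightarrow> integrable lborel (\<lambda>x. v x * \<sigma> x)"
  by (rule integrable_mult_bounded[OF _ _ sigma_le]) auto

lemma u_bound: "\<bar>u y\<bar> \<le> \<bar>u 0\<bar> + (\<integral>x. \<bar>ux x\<bar> \<partial>lborel)"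
proof -
  have *: "\<bar>u b - u a\<bar> \<le> (\<integral>x. \<bar>ux x\<bar> \<partial>lborel)" if "a \<le> b" for a b
    unfolding u_diff[OF that]
    using LINT_Ioc_abs_le[OF set_integrable_lborel[OF ux_int], of a b] LINT_subset_le[OF ux_int, of "{a<..b}"] by simp
  show ?thesis
    using *[of 0 y] *[of y 0] by (cases "0 \<le> y") auto
qed

lemma u_continuous: "continuous_on {a..b} u"
proof -
  have "continuous_on {a..b} (\<lambda>x. u a + (LINT z:{a<..x}|lborel. ux z))"
    by (intro continuous_intros continuous_on_indefinite_integral ux_int)
  then show ?thesis
    by (rule continuous_on_eq) (use u_diff[of a] in fastforce)
qed

text \<open>The spatial part of the weak formulation tested with x -> moll ((x - y) / e) / e, after
  the substitution x = y + e z.\<close>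

definition flux :: "real \<Rightarrow> real \<Rightarrow> real" where
  "flux e y = (\<integral>z. \<sigma> (y + e * z) * (u (y + e * z) * moll' z / e - c (y + e * z) * moll z) \<partial>lborel)"

text \<open>A bound for the L1 modulus of continuity. Shifts to the right suffice because the
  mollifier is one-sided.\<close>

definition mod_le :: "real \<Rightarrow> real \<Rightarrow> (real \<Rightarrow> real) \<Rightarrow> bool" where
  "mod_le W e f \<longleftrightarrow> (\<forall>r. 0 \<le> r \<and> r \<le> e \<longrightarrow> (\<integral>\<^sup>+y. ennreal \<bar>f (y + r) - f y\<bar> \<partial>lborel) \<le> ennreal W)"

lemma mod_leD: "mod_le W e f \<Longrightarrow> z \<in> {0..1} \<Longrightarrow> e > 0 \<Longrightarrow> (\<integral>\<^sup>+y. ennreal \<bar>f (y + e * z) - f y\<bar> \<partial>lborel) \<le> ennreal W"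
  unfolding mod_le_def by (auto intro: mult_left_le)

text \<open>
  Multiplying by \<open>v\<close> turns the translation error of the bounded function \<open>\<sigma>\<close> into
  translation errors of the integrable functions \<open>v \<sigma>\<close> and \<open>v\<close>.
\<close>

lemma weighted_translation:
  assumes v[measurable]: "v \<in> borel_measurable borel" and W: "W \<ge> 0" and e: "e > 0" and z: "z \<in> {0..1}"
    and m1: "mod_le W e (\<lambda>x. v x * \<sigma> x)" and m2: "mod_le W e v"
  shows "(\<integral>\<^sup>+y. ennreal \<bar>v y * (\<sigma> (y + e * z) - \<sigma> y)\<bar> \<partial>lborel) \<le> ennreal ((1 + M) * W)"
proof -
  let ?h = "e * z"
  have "(\<integral>\<^sup>+y. ennreal \<bar>v y * (\<sigma> (y + ?h) - \<sigma> y)\<bar> \<partial>lborel) \<le>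
     (\<integral>\<^sup>+y. ennreal \<bar>v (y + ?h) * \<sigma> (y + ?h) - v y * \<sigma> y\<bar> + ennreal M * ennreal \<bar>v (y + ?h) - v y\<bar> \<partial>lborel)"
  proof (rule nn_integral_mono)
    fix y
    have "v y * (\<sigma> (y + ?h) - \<sigma> y) = (v (y + ?h) * \<sigma> (y + ?h) - v y * \<sigma> y) - \<sigma> (y + ?h) * (v (y + ?h) - v y)"
      by (simp add: algebra_simps)
    then have "\<bar>v y * (\<sigma> (y + ?h) - \<sigma> y)\<bar> \<le> \<bar>v (y + ?h) * \<sigma> (y + ?h) - v y * \<sigma> y\<bar> + \<bar>\<sigma> (y + ?h) * (v (y + ?h) - v y)\<bar>"
      by (metis abs_triangle_ineq4)
    also have "\<bar>\<sigma> (y + ?h) * (v (y + ?h) - v y)\<bar> \<le> M * \<bar>v (y + ?h) - v y\<bar>"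
      unfolding abs_mult by (intro mult_right_mono sigma_le) auto
    finally have "ennreal \<bar>v y * (\<sigma> (y + ?h) - \<sigma> y)\<bar> \<le> ennreal (\<bar>v (y + ?h) * \<sigma> (y + ?h) - v y * \<sigma> y\<bar> + M * \<bar>v (y + ?h) - v y\<bar>)"
      by (intro ennreal_leI) auto
    also have "\<dots> = ennreal \<bar>v (y + ?h) * \<sigma> (y + ?h) - v y * \<sigma> y\<bar> + ennreal M * ennreal \<bar>v (y + ?h) - v y\<bar>"
      using M_nonneg by (simp add: ennreal_mult)
    finally show "ennreal \<bar>v y * (\<sigma> (y + ?h) - \<sigma> y)\<bar> \<le> \<dots>" .
  qed
  also have "\<dots> = (\<integral>\<^sup>+y. ennreal \<bar>v (y + ?h) * \<sigma> (y + ?h) - v y * \<sigma> y\<bar> \<partial>lborel) + ennreal M * (\<integral>\<^sup>+y. ennreal \<bar>v (y + ?h) - v y\<bar> \<partial>lborel)"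
    by (simp add: nn_integral_add nn_integral_cmult)
  also have "\<dots> \<le> ennreal W + ennreal M * ennreal W"
    using mod_leD[OF m1 z e] mod_leD[OF m2 z e] by (intro add_mono mult_left_mono) auto
  also have "\<dots> = ennreal ((1 + M) * W)"
    using W M_nonneg by (simp add: ennreal_mult[symmetric] ennreal_plus[symmetric] algebra_simps del: ennreal_plus)
  finally show ?thesis .
qed

text \<open>The remainder is z times the mean over r in [0,1] of ux (y + e z r) - ux y, hence a
  translation error of ux.\<close>

lemma u_Taylor:
  assumes W: "W \<ge> 0" and e: "e > 0" and z: "z \<in> {0..1}" and m: "mod_le W e ux"
  shows "(\<integral>\<^sup>+y. ennreal \<bar>(u (y + e * z) - u y) / e - z * ux y\<bar> \<partial>lborel) \<le> ennreal W"
proof (cases "z = 0")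
  case True
  then show ?thesis by simp
next
  case False
  then have z: "z > 0" "z \<le> 1" using z by auto
  let ?h = "e * z"
  have h: "?h > 0" "?h \<le> e" using z e by (auto intro: mult_left_le)
  have eq: "(u (y + ?h) - u y) / e - z * ux y = z * (\<integral>r. (ux (y + ?h * r) - ux y) * indicator {0<..1} r \<partial>lborel)" for y
  proof -
    have "u (y + ?h) - u y = (\<integral>x. indicator {y<..y + ?h} x *\<^sub>R ux x \<partial>lborel)"
      using u_diff[of y "y + ?h"] h by (simp add: set_lebesgue_integral_def)
    also have "\<dots> = ?h * (\<integral>r. indicator {y<..y + ?h} (y + ?h * r) *\<^sub>R ux (y + ?h * r) \<partial>lborel)"
      using lborel_integral_real_affine[of ?h "\<lambda>x. indicator {y<..y + ?h} x *\<^sub>R ux x" y] h z(1) by simp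
    also have "(\<lambda>r. indicator {y<..y + ?h} (y + ?h * r) *\<^sub>R ux (y + ?h * r)) = (\<lambda>r. ux (y + ?h * r) * indicator {0<..1} r)"
    proof
      fix r
      have "y < y + ?h * r \<longleftrightarrow> 0 < r" using zero_less_mult_pos[of ?h r] mult_pos_pos[OF h(1), of r] h(1) by fastforce
      moreover have "y + ?h * r \<le> y + ?h \<longleftrightarrow> r \<le> 1"
        using h mult_le_cancel_left_pos[of ?h r 1] by simp
      ultimately show "indicator {y<..y + ?h} (y + ?h * r) *\<^sub>R ux (y + ?h * r) = ux (y + ?h * r) * indicator {0<..1} r"
        by (simp add: indicator_def)
    qed
    finally have 1: "u (y + ?h) - u y = ?h * (\<integral>r. ux (y + ?h * r) * indicator {0<..1} r \<partial>lborel)" .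
    have i1: "integrable lborel (\<lambda>r. ux (y + ?h * r) * indicator {0<..1} r)"
      by (rule integrable_mult_bounded[OF lborel_integrable_real_affine[OF ux_int], where C = 1]) (use h in \<open>auto simp: indicator_def\<close>)
    have i2: "integrable lborel (indicat_real {0<..1::real})"
      by (rule integrable_real_indicator) auto
    have "(\<integral>r. (ux (y + ?h * r) - ux y) * indicator {0<..1} r \<partial>lborel) =
        (\<integral>r. ux (y + ?h * r) * indicator {0<..1} r - ux y * indicator {0<..1} r \<partial>lborel)"
      by (simp add: left_diff_distrib)
    also have "\<dots> = (\<integral>r. ux (y + ?h * r) * indicator {0<..1} r \<partial>lborel) - ux y"
      using i1 i2 by (subst Bochner_Integration.integral_diff) auto
    finally show ?thesis using 1 e by (simp add: right_diff_distrib)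
  qed
  have "(\<integral>\<^sup>+y. ennreal \<bar>(u (y + ?h) - u y) / e - z * ux y\<bar> \<partial>lborel) \<le>
      (\<integral>\<^sup>+y. ennreal \<bar>\<integral>r. (ux (y + ?h * r) - ux y) * indicator {0<..1} r \<partial>lborel\<bar> \<partial>lborel)"
    unfolding eq using z by (intro nn_integral_mono ennreal_leI) (auto simp: abs_mult intro: mult_left_le_one_le)
  also have "\<dots> \<le> ennreal (1 * W)"
  proof (rule nn_integral_average_le)
    fix r :: real assume r: "r \<in> {0..1}"
    then have "z * r \<in> {0..1}" using z by (auto intro: mult_le_one)
    from mod_leD[OF m this e] show "(\<integral>\<^sup>+y. ennreal \<bar>ux (y + ?h * r) - ux y\<bar> \<partial>lborel) \<le> ennreal W"
      by (simp add: mult.assoc)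
  qed (auto simp: indicator_def)
  finally show ?thesis by simp
qed

text \<open>A one-dimensional commutator lemma in the manner of DiPerna and Lions. Adding the
  average of c \<sigma> to \<open>flux\<close> leaves u \<sigma> integrated against moll' / e, and
  subtracting u y times \<open>avg'\<close> turns u into its increment. Its first-order part z ux y
  is split off, which gives \<open>F1\<close>. What remains is ux y times the integral of \<sigma>
  (y + e z) against \<open>w2\<close>; as \<open>w2\<close> has mean zero, \<sigma> may be replaced
  by its increment, which gives \<open>F2\<close>. The constants 60 and 90 = 60 + 30 bound moll' and
  \<open>w2\<close>.\<close>

lemma commutator_estimate:
  fixes e W :: real
  assumes e: "e > 0" and W: "W \<ge> 0" and mux: "mod_le W e ux" and muxs: "mod_le W e (\<lambda>x. ux x * \<sigma> x)"
  defines "R \<equiv> \<lambda>y. flux e y + avg e (\<lambda>x. c x * \<sigma> x) y - u y * avg' e \<sigma> y + ux y * avg e \<sigma> y"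
  shows "integrable lborel R" "(\<integral>y. \<bar>R y\<bar> \<partial>lborel) \<le> 150 * (1 + M) * W"
proof -
  define F1 where "F1 y z = \<sigma> (y + e * z) * ((u (y + e * z) - u y) / e - z * ux y)" for y z
  define F2 where "F2 y z = ux y * (\<sigma> (y + e * z) - \<sigma> y)" for y z
  define w2 where "w2 z = z * moll' z + moll z" for z
  have w2[measurable]: "w2 \<in> borel_measurable borel" unfolding w2_def by measurable
  have w2b: "\<bar>w2 z\<bar> \<le> 90 * indicator {0..1} z" for z
  proof (cases "z \<in> {0..1}")
    case True
    have "\<bar>z * moll' z\<bar> \<le> 1 * (60 * indicator {0..1} z)"
      unfolding abs_mult using True moll_bounds(2)[of z] by (intro mult_mono) auto
    then show ?thesis using moll_bounds(1)[of z] True by (simp add: w2_def)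
  next
    case False
    then show ?thesis using moll_eq_0[of z] by (auto simp: w2_def)
  qed
  have m1: "\<bar>moll z\<bar> \<le> 30" "\<bar>moll' z\<bar> \<le> 60" for z
    using moll_bounds[of z] by (cases "z \<in> {0..1}"; simp)+
  have K: "R y = (\<integral>z. F1 y z * moll' z \<partial>lborel) + (\<integral>z. F2 y z * w2 z \<partial>lborel)" for y
  proof -
    have bs: "\<bar>\<sigma> (y + e * z)\<bar> \<le> M" for z by (rule sigma_le)
    have bsu: "\<bar>\<sigma> (y + e * z) * u (y + e * z)\<bar> \<le> M * (\<bar>u 0\<bar> + (\<integral>x. \<bar>ux x\<bar> \<partial>lborel))" for z
      unfolding abs_mult by (intro mult_mono sigma_le u_bound M_nonneg) auto
    have i1: "integrable lborel (\<lambda>z. \<sigma> (y + e * z) * u (y + e * z) * moll' z)"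
      by (rule integrable_mult_Icc[OF _ _ bsu moll_bounds(2)]) auto
    have i2: "integrable lborel (\<lambda>z. \<sigma> (y + e * z) * moll' z)"
      by (rule integrable_mult_Icc[OF _ _ bs moll_bounds(2)]) auto
    have i3: "integrable lborel (\<lambda>z. \<sigma> (y + e * z) * moll z)"
      by (rule integrable_mult_Icc[OF _ _ bs moll_bounds(1)]) auto
    have i4: "integrable lborel (\<lambda>z. c (y + e * z) * \<sigma> (y + e * z) * moll z)"
      by (rule integrable_mult_bounded[OF lborel_integrable_real_affine[OF integrable_mult_sigma[OF c_int]]]) (use e m1 in auto)
    have i5: "integrable lborel w2"
      using integrable_mult_Icc[of "\<lambda>_. 1" w2 1 90] w2b by simp
    have i6: "integrable lborel (\<lambda>z. \<sigma> (y + e * z) * w2 z)"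
      by (rule integrable_mult_Icc[OF _ _ bs w2b]) auto
    have i7: "integrable lborel (\<lambda>z. \<sigma> (y + e * z) * (z * moll' z))"
    proof -
      have "(\<lambda>z. \<sigma> (y + e * z) * (z * moll' z)) = (\<lambda>z. \<sigma> (y + e * z) * w2 z - \<sigma> (y + e * z) * moll z)"
        by (simp add: w2_def algebra_simps)
      then show ?thesis using i6 i3 by simp
    qed
    have "flux e y = (\<integral>z. (\<sigma> (y + e * z) * u (y + e * z) * moll' z) / e - c (y + e * z) * \<sigma> (y + e * z) * moll z \<partial>lborel)"
      unfolding flux_def by (intro Bochner_Integration.integral_cong) (auto simp: algebra_simps)
    also have "\<dots> = (\<integral>z. \<sigma> (y + e * z) * u (y + e * z) * moll' z \<partial>lborel) / e - avg e (\<lambda>x. c x * \<sigma> x) y"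
      using i1 i4 by (simp add: avg_def)
    finally have fl: "flux e y = \<dots>" .
    have F1: "(\<integral>z. F1 y z * moll' z \<partial>lborel) = (\<integral>z. \<sigma> (y + e * z) * u (y + e * z) * moll' z \<partial>lborel) / e
        - u y * avg' e \<sigma> y - ux y * (\<integral>z. \<sigma> (y + e * z) * (z * moll' z) \<partial>lborel)"
    proof -
      have "(\<integral>z. F1 y z * moll' z \<partial>lborel) = (\<integral>z. (\<sigma> (y + e * z) * u (y + e * z) * moll' z) / e
          - u y / e * (\<sigma> (y + e * z) * moll' z) - ux y * (\<sigma> (y + e * z) * (z * moll' z)) \<partial>lborel)"
        unfolding F1_def by (intro Bochner_Integration.integral_cong) (auto simp: algebra_simps diff_divide_distrib)
      also have "\<dots> = (\<integral>z. \<sigma> (y + e * z) * u (y + e * z) * moll' z \<partial>lborel) / e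
          - u y / e * (\<integral>z. \<sigma> (y + e * z) * moll' z \<partial>lborel) - ux y * (\<integral>z. \<sigma> (y + e * z) * (z * moll' z) \<partial>lborel)"
        using i1 i2 i7 by simp
      finally show ?thesis by (simp add: avg'_def)
    qed
    have F2: "(\<integral>z. F2 y z * w2 z \<partial>lborel) = ux y * (\<integral>z. \<sigma> (y + e * z) * (z * moll' z) \<partial>lborel) + ux y * avg e \<sigma> y"
    proof -
      have "(\<integral>z. F2 y z * w2 z \<partial>lborel) = (\<integral>z. ux y * (\<sigma> (y + e * z) * (z * moll' z)) + ux y * (\<sigma> (y + e * z) * moll z) - ux y * \<sigma> y * w2 z \<partial>lborel)"
        unfolding F2_def w2_def by (intro Bochner_Integration.integral_cong) (auto simp: algebra_simps)
      also have "\<dots> = ux y * (\<integral>z. \<sigma> (y + e * z) * (z * moll' z) \<partial>lborel) + ux y * (\<integral>z. \<sigma> (y + e * z) * moll z \<partial>lborel) - ux y * \<sigma> y * (\<integral>z. w2 z \<partial>lborel)"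
        using i3 i7 i5 by simp
      finally show ?thesis using integral_moll_moment by (simp add: avg_def w2_def)
    qed
    show ?thesis unfolding R_def fl F1 F2 by simp
  qed
  have n1: "(\<integral>\<^sup>+y. ennreal \<bar>\<integral>z. F1 y z * moll' z \<partial>lborel\<bar> \<partial>lborel) \<le> ennreal (60 * (M * W))"
  proof (rule nn_integral_average_le[OF _ _ moll_bounds(2)])
    show "case_prod F1 \<in> borel_measurable (borel \<Otimes>\<^sub>M borel)" unfolding F1_def by measurable
    fix z :: real assume z: "z \<in> {0..1}"
    have "(\<integral>\<^sup>+y. ennreal \<bar>F1 y z\<bar> \<partial>lborel) \<le> (\<integral>\<^sup>+y. ennreal M * ennreal \<bar>(u (y + e * z) - u y) / e - z * ux y\<bar> \<partial>lborel)"
      using M_nonneg by (intro nn_integral_mono)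
        (auto simp: F1_def abs_mult ennreal_mult[symmetric] intro!: ennreal_leI mult_right_mono sigma_le)
    also have "\<dots> = ennreal M * (\<integral>\<^sup>+y. ennreal \<bar>(u (y + e * z) - u y) / e - z * ux y\<bar> \<partial>lborel)"
      by (rule nn_integral_cmult) measurable
    also have "\<dots> \<le> ennreal M * ennreal W"
      by (intro mult_left_mono u_Taylor[OF W e z mux]) auto
    finally show "(\<integral>\<^sup>+y. ennreal \<bar>F1 y z\<bar> \<partial>lborel) \<le> ennreal (M * W)"
      using M_nonneg W by (simp add: ennreal_mult)
  qed auto
  have n2: "(\<integral>\<^sup>+y. ennreal \<bar>\<integral>z. F2 y z * w2 z \<partial>lborel\<bar> \<partial>lborel) \<le> ennreal (90 * ((1 + M) * W))"
  proof (rule nn_integral_average_le[OF _ _ w2b])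
    show "case_prod F2 \<in> borel_measurable (borel \<Otimes>\<^sub>M borel)" unfolding F2_def by measurable
    fix z :: real assume z: "z \<in> {0..1}"
    show "(\<integral>\<^sup>+y. ennreal \<bar>F2 y z\<bar> \<partial>lborel) \<le> ennreal ((1 + M) * W)"
      unfolding F2_def by (rule weighted_translation[OF _ W e z muxs mux]) measurable
  qed auto
  have [measurable]: "case_prod F1 \<in> borel_measurable (borel \<Otimes>\<^sub>M borel)" "case_prod F2 \<in> borel_measurable (borel \<Otimes>\<^sub>M borel)"
    unfolding F1_def F2_def by measurable
  have Rm: "R \<in> borel_measurable borel"
    unfolding K[abs_def] by measurable
  have "(\<integral>\<^sup>+y. ennreal \<bar>R y\<bar> \<partial>lborel) \<le>
      (\<integral>\<^sup>+y. ennreal \<bar>\<integral>z. F1 y z * moll' z \<partial>lborel\<bar> + ennreal \<bar>\<integral>z. F2 y z * w2 z \<partial>lborel\<bar> \<partial>lborel)"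
    unfolding K by (intro nn_integral_mono) (auto simp flip: ennreal_plus intro!: ennreal_leI)
  also have "\<dots> = (\<integral>\<^sup>+y. ennreal \<bar>\<integral>z. F1 y z * moll' z \<partial>lborel\<bar> \<partial>lborel) + (\<integral>\<^sup>+y. ennreal \<bar>\<integral>z. F2 y z * w2 z \<partial>lborel\<bar> \<partial>lborel)"
    by (rule nn_integral_add) measurable
  also have "\<dots> \<le> ennreal (60 * (M * W)) + ennreal (90 * ((1 + M) * W))"
    by (intro add_mono n1 n2)
  also have "\<dots> = ennreal (60 * (M * W) + 90 * ((1 + M) * W))"
    using M_nonneg W by (intro ennreal_plus[symmetric]) auto
  also have "\<dots> \<le> ennreal (150 * (1 + M) * W)"
    using M_nonneg W by (intro ennreal_leI) (simp add: algebra_simps)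
  finally have "(\<integral>\<^sup>+y. ennreal \<bar>R y\<bar> \<partial>lborel) \<le> ennreal (150 * (1 + M) * W)" .
  then show "integrable lborel R" "(\<integral>y. \<bar>R y\<bar> \<partial>lborel) \<le> 150 * (1 + M) * W"
    using nn_integral_le_imp_integrable[OF Rm] M_nonneg W by auto
qed

text \<open>Write \<beta> for sabs d and s for the average of \<sigma>. By the product rule for u
  \<beta> s, the end point terms become an integral in which the terms u avg' cancel. The integrand
  left over is \<beta>' R + ux (\<beta> - \<beta>' s) - \<beta>' E2 + c (|\<sigma>| - \<beta>'
  \<sigma>). The first and third terms are translation errors, the second is at most d |ux| by the
  near homogeneity of \<beta>, and the last is of both kinds. The total 150 + 30 + 60 is rounded up
  to 300.\<close>

lemma slice_estimate:
  fixes e W d a b :: real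
  assumes e: "e > 0" and W: "W \<ge> 0" and d: "d > 0" and a: "a \<le> 0" and b: "1 - e \<le> b" "0 \<le> b"
    and mux: "mod_le W e ux" and muxs: "mod_le W e (\<lambda>x. ux x * \<sigma> x)"
    and mc: "mod_le W e c" and mcs: "mod_le W e (\<lambda>x. c x * \<sigma> x)"
  defines "J \<equiv> (LINT y:{a<..b}|lborel. sabs' d (avg e \<sigma> y) * flux e y) + (\<integral>x. c x * \<bar>\<sigma> x\<bar> \<partial>lborel)
      + u b * sabs d (avg e \<sigma> b) - u a * sabs d (avg e \<sigma> a)"
  shows "\<bar>J\<bar> \<le> 300 * (1 + M) * W + d * ((\<integral>x. \<bar>ux x\<bar> \<partial>lborel) + (\<integral>x. \<bar>c x\<bar> \<partial>lborel))
      + M * (LINT x:{1 - e<..}|lborel. \<bar>c x\<bar>)"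
proof -
  define s where "s = avg e \<sigma>"
  define B where "B y = sabs d (s y)" for y
  define b' where "b' y = sabs' d (s y)" for y
  define R where "R y = flux e y + avg e (\<lambda>x. c x * \<sigma> x) y - u y * avg' e \<sigma> y + ux y * s y" for y
  define E2 where "E2 y = avg e (\<lambda>x. c x * \<sigma> x) y - c y * \<sigma> y" for y
  define E3 where "E3 y = c y * (s y - \<sigma> y)" for y
  note ab = order_trans[OF a b(2)]
  have [measurable]: "s \<in> borel_measurable borel" unfolding s_def by measurable
  have [measurable]: "b' \<in> borel_measurable borel" "B \<in> borel_measurable borel"
    unfolding b'_def B_def using measurable_sabs[OF d] by measurable
  have R: "integrable lborel R" "(\<integral>y. \<bar>R y\<bar> \<partial>lborel) \<le> 150 * (1 + M) * W"
    using commutator_estimate[OF e W mux muxs] unfolding R_def s_def by auto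
  have E2: "integrable lborel E2" "(\<integral>y. \<bar>E2 y\<bar> \<partial>lborel) \<le> 30 * W"
    unfolding E2_def using mcs
    by (auto intro!: avg_L1_error[OF integrable_mult_sigma[OF c_int] e W] simp: mod_le_def)
  have sb: "\<bar>s y\<bar> \<le> M" for y unfolding s_def by (rule avg_bound[OF _ sigma_le]) simp
  have b'b: "\<bar>b' y\<bar> \<le> 1" for y unfolding b'_def by (rule abs_sabs'_le[OF d])
  have E3: "integrable lborel E3" "(\<integral>y. \<bar>E3 y\<bar> \<partial>lborel) \<le> 30 * ((1 + M) * W)"
  proof -
    have i3: "integrable lborel (\<lambda>z. \<sigma> (y + e * z) * moll z)" for y
      by (rule integrable_mult_Icc[OF _ _ sigma_le moll_bounds(1)]) auto
    have m: "integrable lborel moll"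
      using integral_moll by (metis not_integrable_integral_eq zero_neq_one)
    have eq: "E3 y = (\<integral>z. c y * (\<sigma> (y + e * z) - \<sigma> y) * moll z \<partial>lborel)" for y
    proof -
      have "(\<integral>z. c y * (\<sigma> (y + e * z) - \<sigma> y) * moll z \<partial>lborel)
          = (\<integral>z. c y * (\<sigma> (y + e * z) * moll z) - c y * \<sigma> y * moll z \<partial>lborel)"
        by (intro Bochner_Integration.integral_cong) (auto simp: algebra_simps)
      also have "\<dots> = E3 y"
        using i3 m by (subst Bochner_Integration.integral_diff) (auto simp: E3_def s_def avg_def integral_moll right_diff_distrib)
      finally show ?thesis by simp
    qed
    have Em: "E3 \<in> borel_measurable borel" unfolding E3_def by measurable
    have "(\<integral>\<^sup>+y. ennreal \<bar>E3 y\<bar> \<partial>lborel) \<le> ennreal (30 * ((1 + M) * W))"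
      unfolding eq
      by (rule nn_integral_average_le[OF _ _ moll_bounds(1)])
        (auto intro!: weighted_translation[OF _ W e _ mcs mc])
    then show "integrable lborel E3" "(\<integral>y. \<bar>E3 y\<bar> \<partial>lborel) \<le> 30 * ((1 + M) * W)"
      using nn_integral_le_imp_integrable[OF Em] M_nonneg W by auto
  qed
  have DB: "(B has_real_derivative - (b' y * avg' e \<sigma> y)) (at y)" for y
    unfolding B_def b'_def s_def
    using DERIV_chain2[OF DERIV_sabs[OF d] DERIV_avg[OF sigma_int e]] by simp
  have cs: "continuous_on UNIV s"
    unfolding s_def using DERIV_avg[OF sigma_int e] by (meson DERIV_isCont continuous_at_imp_continuous_on)
  have cB': "continuous_on UNIV (\<lambda>y. - (b' y * avg' e \<sigma> y))"
    unfolding b'_def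
    by (intro continuous_intros continuous_on_avg'[OF sigma_int e] continuous_on_compose2[OF continuous_on_sabs(2)[OF d] cs]) auto
  have iuxs: "integrable lborel (\<lambda>y. ux y * g y)" if "g \<in> borel_measurable borel" "\<And>y. \<bar>g y\<bar> \<le> C" for g C
    by (rule integrable_mult_bounded[OF ux_int that])
  have Bb: "\<bar>B y\<bar> \<le> M" for y
    using sabs_le[OF d, of "s y"] sb[of y] unfolding B_def by linarith
  have iuB: "set_integrable lborel {a<..b} (\<lambda>y. u y * (b' y * avg' e \<sigma> y))"
  proof (rule set_integrable_bounded_Icc[of _ "(\<bar>u 0\<bar> + (\<integral>x. \<bar>ux x\<bar> \<partial>lborel)) * (1 * (60 * M / e))" _ a b])
    show "\<bar>u y * (b' y * avg' e \<sigma> y)\<bar> \<le> (\<bar>u 0\<bar> + (\<integral>x. \<bar>ux x\<bar> \<partial>lborel)) * (1 * (60 * M / e))" for y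
      unfolding abs_mult by (intro mult_mono u_bound b'b avg_bound_deriv[OF _ sigma_le e]) auto
  qed auto
  have iuB': "set_integrable lborel {a<..b} (\<lambda>y. ux y * B y + u y * - (b' y * avg' e \<sigma> y))"
    using set_integrable_lborel[OF iuxs[OF _ Bb]] set_integrable_mult_right[of "-1", OF iuB]
    by (intro set_integral_add(1)) auto
  have parts: "u b * B b - u a * B a = (LINT y:{a<..b}|lborel. ux y * B y + u y * - (b' y * avg' e \<sigma> y))"
    by (rule integral_product[OF ux_int u_diff DB cB' ab u_continuous iuB']) auto
  have ics: "integrable lborel (\<lambda>y. c y * \<bar>\<sigma> y\<bar>)"
    by (rule integrable_mult_bounded[OF c_int, where C = M]) (auto simp: sigma_le)
  have ibf: "set_integrable lborel {a<..b} (\<lambda>y. b' y * flux e y)"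
  proof -
    have "(\<lambda>y. b' y * flux e y) = (\<lambda>y. (R y * b' y - (E2 y + c y * \<sigma> y) * b' y - ux y * (b' y * s y)) + u y * (b' y * avg' e \<sigma> y))"
      by (simp add: R_def E2_def algebra_simps fun_eq_iff)
    moreover have "integrable lborel (\<lambda>y. R y * b' y - (E2 y + c y * \<sigma> y) * b' y - ux y * (b' y * s y))"
    proof (intro Bochner_Integration.integrable_diff integrable_mult_bounded[OF _ _ b'b] R(1)
          Bochner_Integration.integrable_add E2(1) integrable_mult_sigma c_int)
      show "integrable lborel (\<lambda>y. ux y * (b' y * s y))"
      proof (rule iuxs)
        show "\<bar>b' y * s y\<bar> \<le> 1 * M" for y unfolding abs_mult by (intro mult_mono b'b sb) auto
      qed auto
    qed auto
    ultimately show ?thesis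
      using set_integral_add(1)[OF set_integrable_lborel iuB] by simp
  qed
  define X where "X y = b' y * flux e y + (ux y * B y + u y * - (b' y * avg' e \<sigma> y)) + c y * \<bar>\<sigma> y\<bar>" for y
  have iX: "set_integrable lborel {a<..b} X"
    unfolding X_def by (intro set_integral_add(1) ibf iuB' set_integrable_lborel[OF ics]) auto
  \<comment> \<open>Since a <= 0, the interval misses only the part of (0,1) to the right of b,
    which lies within e of the end point.\<close>
  have J1: "J = (LINT y:{a<..b}|lborel. X y) + (LINT y:{b<..}|lborel. c y * \<bar>\<sigma> y\<bar>)"
  proof -
    have "(\<integral>x. c x * \<bar>\<sigma> x\<bar> \<partial>lborel) = (LINT y:{a<..b} \<union> {b<..}|lborel. c y * \<bar>\<sigma> y\<bar>)"
      unfolding set_lebesgue_integral_def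
    proof (intro Bochner_Integration.integral_cong refl)
      fix x
      show "c x * \<bar>\<sigma> x\<bar> = indicat_real ({a<..b} \<union> {b<..}) x *\<^sub>R (c x * \<bar>\<sigma> x\<bar>)"
        using a c_0[of x] by (cases "x \<in> {a<..b} \<union> {b<..}") auto
    qed
    also have "\<dots> = (LINT y:{a<..b}|lborel. c y * \<bar>\<sigma> y\<bar>) + (LINT y:{b<..}|lborel. c y * \<bar>\<sigma> y\<bar>)"
      by (rule set_integral_Un) (auto intro!: set_integrable_lborel ics)
    finally have 1: "(\<integral>x. c x * \<bar>\<sigma> x\<bar> \<partial>lborel) = \<dots>" .
    have "(LINT y:{a<..b}|lborel. X y) = (LINT y:{a<..b}|lborel. b' y * flux e y)
        + (LINT y:{a<..b}|lborel. ux y * B y + u y * - (b' y * avg' e \<sigma> y)) + (LINT y:{a<..b}|lborel. c y * \<bar>\<sigma> y\<bar>)"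
      unfolding X_def
      by (subst set_integral_add(2), intro set_integral_add(1) ibf iuB', rule set_integrable_lborel[OF ics], simp,
          subst set_integral_add(2)[OF ibf iuB'], simp)
    then show ?thesis using 1 parts unfolding J_def B_def b'_def s_def by simp
  qed
  have pw: "\<bar>X y\<bar> \<le> \<bar>R y\<bar> + d * \<bar>ux y\<bar> + \<bar>E2 y\<bar> + d * \<bar>c y\<bar> + 2 * \<bar>E3 y\<bar>" for y
  proof -
    have eq: "X y = b' y * R y + ux y * (B y - b' y * s y) - b' y * E2 y + c y * (\<bar>\<sigma> y\<bar> - b' y * \<sigma> y)"
      unfolding X_def R_def E2_def by (simp add: algebra_simps)
    have 1: "\<bar>b' y * R y\<bar> \<le> 1 * \<bar>R y\<bar>" "\<bar>b' y * E2 y\<bar> \<le> 1 * \<bar>E2 y\<bar>"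
      unfolding abs_mult by (intro mult_right_mono b'b; simp)+
    have 2: "\<bar>ux y * (B y - b' y * s y)\<bar> \<le> \<bar>ux y\<bar> * d"
      unfolding abs_mult B_def b'_def by (intro mult_left_mono sabs'_mult_bounds[OF d]) auto
    \<comment> \<open>|s| and \<beta>' s differ by at most d; exchanging \<sigma> for s costs |s -
      \<sigma>| once in the modulus and once in the product with \<beta>'.\<close>
    have 3: "\<bar>\<bar>\<sigma> y\<bar> - b' y * \<sigma> y\<bar> \<le> d + 2 * \<bar>s y - \<sigma> y\<bar>"
    proof -
      have "\<bar>b' y * (s y - \<sigma> y)\<bar> \<le> 1 * \<bar>s y - \<sigma> y\<bar>"
        unfolding abs_mult by (intro mult_right_mono b'b; simp)
      then have "\<bar>b' y * s y - b' y * \<sigma> y\<bar> \<le> \<bar>s y - \<sigma> y\<bar>" by (simp add: algebra_simps)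
      moreover have "b' y * s y \<le> \<bar>s y\<bar>" "\<bar>s y\<bar> - d \<le> b' y * s y"
        unfolding b'_def using sabs'_mult_bounds[OF d, of "s y"] by auto
      ultimately show ?thesis using d by (smt (verit))
    qed
    have "\<bar>c y * (\<bar>\<sigma> y\<bar> - b' y * \<sigma> y)\<bar> \<le> \<bar>c y\<bar> * (d + 2 * \<bar>s y - \<sigma> y\<bar>)"
      unfolding abs_mult by (intro mult_left_mono 3) auto
    also have "\<dots> = d * \<bar>c y\<bar> + 2 * \<bar>E3 y\<bar>" unfolding E3_def abs_mult by (simp add: distrib_left mult_ac)
    finally show ?thesis unfolding eq using 1 2 by (simp add: mult.commute) (smt (verit))
  qed
  define Y where "Y y = \<bar>R y\<bar> + d * \<bar>ux y\<bar> + \<bar>E2 y\<bar> + d * \<bar>c y\<bar> + 2 * \<bar>E3 y\<bar>" for y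
  have iY: "integrable lborel Y"
    unfolding Y_def using R E2 E3 ux_int c_int by auto
  have Y0: "Y y \<ge> 0" for y unfolding Y_def using d by simp
  have "\<bar>LINT y:{a<..b}|lborel. X y\<bar> \<le> (LINT y:{a<..b}|lborel. \<bar>X y\<bar>)"
    by (rule LINT_Ioc_abs_le[OF iX])
  also have "\<dots> \<le> (LINT y:{a<..b}|lborel. \<bar>Y y\<bar>)"
    using pw Y0 by (intro LINT_Ioc_mono set_integrable_abs iX set_integrable_lborel iY) (auto simp: Y_def)
  also have "\<dots> \<le> (\<integral>y. \<bar>Y y\<bar> \<partial>lborel)" by (rule LINT_subset_le[OF iY]) simp
  also have "\<dots> = (\<integral>y. Y y \<partial>lborel)" using Y0 by simp
  also have "\<dots> = (\<integral>y. \<bar>R y\<bar> \<partial>lborel) + d * (\<integral>y. \<bar>ux y\<bar> \<partial>lborel) + (\<integral>y. \<bar>E2 y\<bar> \<partial>lborel)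
      + d * (\<integral>y. \<bar>c y\<bar> \<partial>lborel) + 2 * (\<integral>y. \<bar>E3 y\<bar> \<partial>lborel)"
    unfolding Y_def using R E2 E3 ux_int c_int by simp
  also have "\<dots> \<le> 150 * (1 + M) * W + d * (\<integral>y. \<bar>ux y\<bar> \<partial>lborel) + 30 * W
      + d * (\<integral>y. \<bar>c y\<bar> \<partial>lborel) + 2 * (30 * ((1 + M) * W))"
    by (intro add_mono R E2 E3 mult_left_mono order_refl) auto
  also have "\<dots> \<le> 300 * (1 + M) * W + d * ((\<integral>x. \<bar>ux x\<bar> \<partial>lborel) + (\<integral>x. \<bar>c x\<bar> \<partial>lborel))"
    using M_nonneg W mult_nonneg_nonneg[OF M_nonneg W] by (simp add: algebra_simps)
  finally have A: "\<bar>LINT y:{a<..b}|lborel. X y\<bar> \<le> 300 * (1 + M) * W + d * ((\<integral>x. \<bar>ux x\<bar> \<partial>lborel) + (\<integral>x. \<bar>c x\<bar> \<partial>lborel))" .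
  have "\<bar>LINT y:{b<..}|lborel. c y * \<bar>\<sigma> y\<bar>\<bar> \<le> (LINT y:{b<..}|lborel. \<bar>c y * \<bar>\<sigma> y\<bar>\<bar>)"
    using set_integral_norm_bound[OF set_integrable_lborel[OF ics], of "{b<..}"] by simp
  also have "\<dots> \<le> (LINT y:{1 - e<..}|lborel. M * \<bar>c y\<bar>)"
    unfolding set_lebesgue_integral_def
  proof (rule integral_mono)
    show "integrable lborel (\<lambda>y. indicat_real {b<..} y *\<^sub>R \<bar>c y * \<bar>\<sigma> y\<bar>\<bar>)"
      by (intro integrable_mult_indicator integrable_abs ics) simp
    show "integrable lborel (\<lambda>y. indicat_real {1 - e<..} y *\<^sub>R (M * \<bar>c y\<bar>))"
      by (intro integrable_mult_indicator integrable_abs integrable_mult_right c_int) simp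
    fix y
    have "\<bar>c y * \<bar>\<sigma> y\<bar>\<bar> \<le> M * \<bar>c y\<bar>"
      using mult_right_mono[OF sigma_le[of y], of "\<bar>c y\<bar>"] by (simp add: abs_mult mult.commute)
    then show "indicat_real {b<..} y *\<^sub>R \<bar>c y * \<bar>\<sigma> y\<bar>\<bar> \<le> indicat_real {1 - e<..} y *\<^sub>R (M * \<bar>c y\<bar>)"
      using b(1) M_nonneg by (auto simp: indicator_def)
  qed
  also have "\<dots> = M * (LINT y:{1 - e<..}|lborel. \<bar>c y\<bar>)" by simp
  finally show ?thesis using A unfolding J1 by linarith
qed

text \<open>The bound blows up as e tends to 0. It serves integrability and Fubini at a fixed width;
  estimates uniform in e come from \<open>slice_estimate\<close>.\<close>

lemma flux_bound:
  assumes e: "e > 0"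
  shows "\<bar>flux e y\<bar> \<le> 60 * M / e * (\<bar>u 0\<bar> + (\<integral>x. \<bar>ux x\<bar> \<partial>lborel) + (\<integral>x. \<bar>c x\<bar> \<partial>lborel))"
proof -
  define U where "U = \<bar>u 0\<bar> + (\<integral>x. \<bar>ux x\<bar> \<partial>lborel)"
  have U0: "U \<ge> 0" unfolding U_def by (intro add_nonneg_nonneg integral_nonneg_AE) auto
  let ?g = "\<lambda>z. M * (U * (60 * indicator {0..1} z) / e + \<bar>c (y + e * z)\<bar> * 30)"
  have ig: "integrable lborel ?g"
    using e by (intro integrable_mult_right Bochner_Integration.integrable_add integrable_divide_zero
        integrable_mult_left integrable_abs lborel_integrable_real_affine c_int integrable_indicator_Icc) auto
  have pw: "\<bar>\<sigma> (y + e * z) * (u (y + e * z) * moll' z / e - c (y + e * z) * moll z)\<bar> \<le> ?g z" for z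
  proof -
    have 1: "\<bar>u (y + e * z) * moll' z / e\<bar> \<le> U * (60 * indicator {0..1} z) / e"
      unfolding abs_divide abs_mult using e U0
      by (intro frac_le mult_mono moll_bounds) (use u_bound in \<open>auto simp: U_def\<close>)
    have 2: "\<bar>c (y + e * z) * moll z\<bar> \<le> \<bar>c (y + e * z)\<bar> * 30"
      unfolding abs_mult using moll_bounds(1)[of z] by (intro mult_left_mono) (cases "z \<in> {0..1}"; auto)+
    show ?thesis
      unfolding abs_mult[of "\<sigma> _"]
      by (intro mult_mono sigma_le M_nonneg order_trans[OF abs_triangle_ineq4 add_mono[OF 1 2]]) auto
  qed
  have "\<bar>flux e y\<bar> \<le> (\<integral>z. ?g z \<partial>lborel)"
    unfolding flux_def
  proof (rule order_trans[OF integral_abs_bound], rule integral_mono[OF _ ig])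
    show "integrable lborel (\<lambda>z. \<bar>\<sigma> (y + e * z) * (u (y + e * z) * moll' z / e - c (y + e * z) * moll z)\<bar>)"
      using pw by (intro integrable_abs Bochner_Integration.integrable_bound[OF ig]) (auto intro!: AE_I2 order_trans[OF _ abs_ge_self])
  qed (use pw in auto)
  also have "\<dots> = M * (U * 60 / e + (\<integral>z. \<bar>c (y + e * z)\<bar> \<partial>lborel) * 30)"
  proof -
    have i1: "integrable lborel (\<lambda>z::real. U * (60 * indicator {0..1} z) / e)"
      by (intro integrable_divide_zero integrable_mult_right integrable_indicator_Icc)
    have i2: "integrable lborel (\<lambda>z. \<bar>c (y + e * z)\<bar> * 30)"
      using e by (intro integrable_mult_left integrable_abs lborel_integrable_real_affine c_int) auto
    have "(\<integral>z. U * (60 * indicator {0..1::real} z) / e \<partial>lborel) = U * 60 / e" by simp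
    then show ?thesis
      using Bochner_Integration.integral_add[OF i1 i2] by simp
  qed
  also have "(\<integral>z. \<bar>c (y + e * z)\<bar> \<partial>lborel) = (\<integral>x. \<bar>c x\<bar> \<partial>lborel) / e"
    using lborel_integral_real_affine[of e "\<lambda>x. \<bar>c x\<bar>" y] e by simp
  also have "M * (U * 60 / e + (\<integral>x. \<bar>c x\<bar> \<partial>lborel) / e * 30) \<le> M * (U * 60 / e + (\<integral>x. \<bar>c x\<bar> \<partial>lborel) / e * 60)"
    using e by (intro mult_left_mono add_left_mono M_nonneg mult_left_mono divide_nonneg_nonneg) auto
  also have "\<dots> = 60 * M / e * (U + (\<integral>x. \<bar>c x\<bar> \<partial>lborel))" by (simp add: algebra_simps add_divide_distrib)
  finally show ?thesis unfolding U_def .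
qed

end

lemma integral_moll_affine: "e > 0 \<Longrightarrow> (\<integral>y. moll ((p - y) / e) / e \<partial>lborel) = 1"
  "e > 0 \<Longrightarrow> integrable lborel (\<lambda>y. moll ((p - y) / e) / e)"
proof -
  assume e: "e > 0"
  have eq: "(p - y) / e = p / e + (- 1 / e) * y" for y using e by (simp add: field_simps)
  have m: "integrable lborel moll"
    using integral_moll by (metis not_integrable_integral_eq zero_neq_one)
  show "integrable lborel (\<lambda>y. moll ((p - y) / e) / e)"
    unfolding eq using e by (intro integrable_divide_zero lborel_integrable_real_affine m) auto
  have "(\<integral>y. moll ((p - y) / e) \<partial>lborel) = e"
    using lborel_integral_real_affine[of "- 1 / e" moll "p / e"] e integral_moll unfolding eq by (simp add: field_simps)
  then show "(\<integral>y. moll ((p - y) / e) / e \<partial>lborel) = 1" using e by simp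
qed

lemma integrable_pair_bound:
  fixes H :: "real \<Rightarrow> real \<Rightarrow> real"
  assumes H[measurable]: "case_prod H \<in> borel_measurable (borel \<Otimes>\<^sub>M borel)" and b: "\<And>t y. \<bar>H t y\<bar> \<le> f t * g y"
    and f: "integrable lborel f" and g: "integrable lborel g"
  shows "integrable (lborel \<Otimes>\<^sub>M lborel) (case_prod H)"
proof (rule lborel_pair.Fubini_integrable)
  have [measurable]: "f \<in> borel_measurable borel" using f by auto
  have i: "integrable lborel (\<lambda>y. f t * g y)" for t by (intro integrable_mult_right g)
  have Hi: "integrable lborel (\<lambda>y. H t y)" for t
    by (rule Bochner_Integration.integrable_bound[OF i[of t]]) (auto intro!: AE_I2 order_trans[OF b abs_ge_self])
  then show "AE t in lborel. integrable lborel (\<lambda>y. case (t, y) of (t, y) \<Rightarrow> H t y)" by simp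
  show "integrable lborel (\<lambda>t. \<integral>y. norm (case (t, y) of (t, y) \<Rightarrow> H t y) \<partial>lborel)"
  proof (rule Bochner_Integration.integrable_bound[OF integrable_mult_left[OF f, of "\<integral>y. g y \<partial>lborel"]])
    show "AE t in lborel. norm (\<integral>y. norm (case (t, y) of (t, y) \<Rightarrow> H t y) \<partial>lborel) \<le> norm (f t * (\<integral>y. g y \<partial>lborel))"
    proof (intro AE_I2)
      fix t
      have "(\<integral>y. \<bar>H t y\<bar> \<partial>lborel) \<le> (\<integral>y. f t * g y \<partial>lborel)"
        using Hi by (intro integral_mono i integrable_abs b)
      then show "norm (\<integral>y. norm (case (t, y) of (t, y) \<Rightarrow> H t y) \<partial>lborel) \<le> norm (f t * (\<integral>y. g y \<partial>lborel))"
        by (simp add: integral_nonneg_AE)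
    qed
  qed measurable
qed measurable

subsection \<open>Evolution of the mollified solution\<close>

text \<open>
  \<open>\<sigma>\<close>, \<open>u\<close>, \<open>c\<close> are extended to the whole line (\<open>\<sigma>\<close> and \<open>c\<close> by zero, \<open>u\<close> constantly in space);
  \<open>G0\<close> and \<open>G1\<close> stand for \<open>u \<gamma>\<sigma>\<close> at the two end points, and \<open>r\<close> is the version of \<open>\<sigma>\<close> continuous in time.
\<close>

locale transport =
  fixes T M :: real and \<sigma> u ux c r :: "real \<Rightarrow> real \<Rightarrow> real" and G0 G1 :: "real \<Rightarrow> real"
  assumes slice: "\<And>t. transport_slice M (\<sigma> t) (u t) (ux t) (c t)"
    and meas_sigma [measurable]: "case_prod \<sigma> \<in> borel_measurable (borel \<Otimes>\<^sub>M borel)"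
    and meas_u [measurable]: "case_prod u \<in> borel_measurable (borel \<Otimes>\<^sub>M borel)"
    and meas_ux [measurable]: "case_prod ux \<in> borel_measurable (borel \<Otimes>\<^sub>M borel)"
    and meas_c [measurable]: "case_prod c \<in> borel_measurable (borel \<Otimes>\<^sub>M borel)"
    and ux_L1: "integrable lborel (\<lambda>t. \<integral>x. \<bar>ux t x\<bar> \<partial>lborel)"
    and c_L1: "integrable lborel (\<lambda>t. \<integral>x. \<bar>c t x\<bar> \<partial>lborel)"
    and u0_L1: "integrable lborel (\<lambda>t. u t 0)"
    and G0_L1: "integrable lborel G0" and G1_L1: "integrable lborel G1"
    and r_int: "\<And>t. 0 \<le> t \<Longrightarrow> t \<le> T \<Longrightarrow> integrable lborel (r t)"
    and r_0: "\<And>t x. 0 \<le> t \<Longrightarrow> t \<le> T \<Longrightarrow> x \<notin> {0<..<1} \<Longrightarrow> r t x = 0"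
    and r_eq: "AE t in lborel. 0 < t \<and> t \<le> T \<longrightarrow> (AE x in lborel. r t x = \<sigma> t x)"
    and weak: "\<And>\<phi> \<phi>' t0 t1. 0 \<le> t0 \<Longrightarrow> t0 \<le> t1 \<Longrightarrow> t1 \<le> T \<Longrightarrow>
        (\<And>x. (\<phi> has_real_derivative \<phi>' x) (at x)) \<Longrightarrow> continuous_on UNIV \<phi>' \<Longrightarrow>
        (\<integral>x. r t1 x * \<phi> x \<partial>lborel) - (\<integral>x. r t0 x * \<phi> x \<partial>lborel) =
        (LINT t:{t0<..t1}|lborel. (\<integral>x. \<sigma> t x * (u t x * \<phi>' x - c t x * \<phi> x) \<partial>lborel) + G0 t * \<phi> 0 - G1 t * \<phi> 1)"
begin

text \<open>One integrable majorant in time for all coefficients and boundary fluxes; every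
  domination argument in time refers to it.\<close>

definition bd :: "real \<Rightarrow> real" where
  "bd t = \<bar>u t 0\<bar> + (\<integral>x. \<bar>ux t x\<bar> \<partial>lborel) + (\<integral>x. \<bar>c t x\<bar> \<partial>lborel) + \<bar>G0 t\<bar> + \<bar>G1 t\<bar>"

lemma meas_G [measurable]: "G0 \<in> borel_measurable borel" "G1 \<in> borel_measurable borel"
  using G0_L1 G1_L1 by auto

lemma bd_int: "integrable lborel bd"
  unfolding bd_def using u0_L1 ux_L1 c_L1 G0_L1 G1_L1 by auto

lemma bd_nonneg: "bd t \<ge> 0"
  unfolding bd_def by (intro add_nonneg_nonneg integral_nonneg_AE) auto

lemma bd_ge: "\<bar>u t 0\<bar> + (\<integral>x. \<bar>ux t x\<bar> \<partial>lborel) \<le> bd t" "(\<integral>x. \<bar>ux t x\<bar> \<partial>lborel) \<le> bd t" "(\<integral>x. \<bar>c t x\<bar> \<partial>lborel) \<le> bd t"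
    "\<bar>u t 0\<bar> + (\<integral>x. \<bar>ux t x\<bar> \<partial>lborel) + (\<integral>x. \<bar>c t x\<bar> \<partial>lborel) \<le> bd t" "\<bar>G0 t\<bar> \<le> bd t" "\<bar>G1 t\<bar> \<le> bd t"
proof -
  have "(\<integral>x. \<bar>ux t x\<bar> \<partial>lborel) \<ge> 0" "(\<integral>x. \<bar>c t x\<bar> \<partial>lborel) \<ge> 0" by (auto intro!: integral_nonneg_AE)
  then show "\<bar>u t 0\<bar> + (\<integral>x. \<bar>ux t x\<bar> \<partial>lborel) \<le> bd t" "(\<integral>x. \<bar>ux t x\<bar> \<partial>lborel) \<le> bd t" "(\<integral>x. \<bar>c t x\<bar> \<partial>lborel) \<le> bd t"
    "\<bar>u t 0\<bar> + (\<integral>x. \<bar>ux t x\<bar> \<partial>lborel) + (\<integral>x. \<bar>c t x\<bar> \<partial>lborel) \<le> bd t" "\<bar>G0 t\<bar> \<le> bd t" "\<bar>G1 t\<bar> \<le> bd t"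
    unfolding bd_def by auto
qed

lemma M_nonneg: "M \<ge> 0"
  by (rule transport_slice.M_nonneg[OF slice])

lemma sigma_le: "\<bar>\<sigma> t x\<bar> \<le> M"
  by (rule transport_slice.sigma_le[OF slice])

abbreviation fl :: "real \<Rightarrow> real \<Rightarrow> real \<Rightarrow> real" where
  "fl e t y \<equiv> transport_slice.flux (\<sigma> t) (u t) (c t) e y"

lemma fl_def: "fl e t y = (\<integral>z. \<sigma> t (y + e * z) * (u t (y + e * z) * moll' z / e - c t (y + e * z) * moll z) \<partial>lborel)"
  by (rule transport_slice.flux_def[OF slice])

lemma fl_measurable [measurable]: "(\<lambda>(t, y). fl e t y) \<in> borel_measurable (borel \<Otimes>\<^sub>M borel)"
  unfolding fl_def by measurable

lemma avg_measurable [measurable]: "(\<lambda>(t, y). avg e (\<sigma> t) y) \<in> borel_measurable (borel \<Otimes>\<^sub>M borel)"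
  unfolding avg_def by measurable

text \<open>The boundary fluxes appear as mollified point sources at 0 and 1. As functions of y they
  are supported in [-e, 0] and [1 - e, 1], so the choice of the space interval decides whether they
  are seen.\<close>

definition rate :: "real \<Rightarrow> real \<Rightarrow> real \<Rightarrow> real" where
  "rate e t y = fl e t y + G0 t * (moll ((0 - y) / e) / e) - G1 t * (moll ((1 - y) / e) / e)"

lemma rate_measurable [measurable]: "(\<lambda>(t, y). rate e t y) \<in> borel_measurable (borel \<Otimes>\<^sub>M borel)"
  unfolding rate_def by measurable

lemma rate_bound:
  assumes e: "e > 0"
  shows "\<bar>rate e t y\<bar> \<le> (60 * M / e + 60 / e) * bd t"
proof -
  have m: "\<bar>moll z / e\<bar> \<le> 30 / e" for z
    using moll_bounds(1)[of z] e by (cases "z \<in> {0..1}") (auto simp: abs_divide divide_right_mono)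
  have "\<bar>fl e t y\<bar> \<le> 60 * M / e * bd t"
    by (rule order_trans[OF transport_slice.flux_bound[OF slice e]])
      (use M_nonneg e in \<open>auto intro!: mult_left_mono divide_right_mono bd_ge\<close>)
  moreover have "\<bar>G0 t * (moll ((0 - y) / e) / e)\<bar> \<le> bd t * (30 / e)" "\<bar>G1 t * (moll ((1 - y) / e) / e)\<bar> \<le> bd t * (30 / e)"
    unfolding abs_mult using bd_nonneg by (intro mult_mono bd_ge m; simp)+
  ultimately have "\<bar>rate e t y\<bar> \<le> 60 * M / e * bd t + bd t * (30 / e) + bd t * (30 / e)"
    unfolding rate_def by linarith
  then show ?thesis by (simp add: algebra_simps)
qed

lemma rate_int: "e > 0 \<Longrightarrow> integrable lborel (\<lambda>t. rate e t y)"
  by (rule Bochner_Integration.integrable_bound[OF integrable_mult_right[OF bd_int]])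
    (auto intro!: AE_I2 order_trans[OF rate_bound abs_ge_self])

lemma avg_evolution:
  assumes e: "e > 0" and t: "0 \<le> t0" "t0 \<le> t1" "t1 \<le> T"
  shows "avg e (r t1) y - avg e (r t0) y = (LINT t:{t0<..t1}|lborel. rate e t y)"
proof -
  define \<phi> where "\<phi> x = moll ((x - y) / e) / e" for x
  define \<phi>' where "\<phi>' x = moll' ((x - y) / e) / e\<^sup>2" for x
  have D: "(\<phi> has_real_derivative \<phi>' x) (at x)" for x
  proof -
    have "((\<lambda>x. (x - y) / e) has_real_derivative 1 / e) (at x)"
      using e by (auto intro!: derivative_eq_intros)
    from DERIV_cdivide[OF DERIV_chain2[OF DERIV_moll this], of e] show ?thesis
      unfolding \<phi>_def[abs_def] \<phi>'_def by (simp add: power2_eq_square)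
  qed
  have C: "continuous_on UNIV \<phi>'"
    unfolding \<phi>'_def using e by (intro continuous_intros continuous_on_compose2[OF continuous_on_moll(2)]) auto
  have "avg e (r t1) y - avg e (r t0) y = (\<integral>x. r t1 x * \<phi> x \<partial>lborel) - (\<integral>x. r t0 x * \<phi> x \<partial>lborel)"
    using e by (simp add: avg_eq \<phi>_def)
  also have "\<dots> = (LINT t:{t0<..t1}|lborel. (\<integral>x. \<sigma> t x * (u t x * \<phi>' x - c t x * \<phi> x) \<partial>lborel) + G0 t * \<phi> 0 - G1 t * \<phi> 1)"
    by (rule weak[OF t D C])
  also have "\<dots> = (LINT t:{t0<..t1}|lborel. rate e t y)"
  proof -
    have "(\<integral>x. \<sigma> t x * (u t x * \<phi>' x - c t x * \<phi> x) \<partial>lborel) = fl e t y" for t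
    proof -
      have "(\<integral>x. \<sigma> t x * (u t x * \<phi>' x - c t x * \<phi> x) \<partial>lborel) =
          (\<integral>z. e * (\<sigma> t (y + e * z) * (u t (y + e * z) * \<phi>' (y + e * z) - c t (y + e * z) * \<phi> (y + e * z))) \<partial>lborel)"
        using e lborel_integral_real_affine[of e "\<lambda>x. \<sigma> t x * (u t x * \<phi>' x - c t x * \<phi> x)" y] by simp
      also have "\<dots> = fl e t y"
        unfolding fl_def using e
        by (intro Bochner_Integration.integral_cong) (auto simp: \<phi>_def \<phi>'_def field_simps power2_eq_square)
      finally show ?thesis .
    qed
    then show ?thesis unfolding rate_def \<phi>_def by simp
  qed
  finally show ?thesis .
qed

text \<open>The exceptional set of times is the same for all e and y, because \<sigma> and its
  version agree as functions of x at almost every time.\<close>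

lemma avg_r_eq: "AE t in lborel. 0 < t \<and> t \<le> T \<longrightarrow> (\<forall>e>0. \<forall>y. avg e (r t) y = avg e (\<sigma> t) y)"
  using r_eq
proof eventually_elim
  case (elim t)
  show ?case
  proof (intro impI allI)
    fix e y :: real assume t: "0 < t \<and> t \<le> T" and e: "e > 0"
    have [measurable]: "r t \<in> borel_measurable borel" using r_int[of t] t by auto
    have "(\<integral>x. r t x * moll ((x - y) / e) \<partial>lborel) = (\<integral>x. \<sigma> t x * moll ((x - y) / e) \<partial>lborel)"
      using elim t by (intro integral_cong_AE) auto
    then show "avg e (r t) y = avg e (\<sigma> t) y" using e by (simp add: avg_eq)
  qed
qed

lemma sabs_evolution:
  assumes e: "e > 0" and d: "d > 0" and t: "0 \<le> t0" "t0 \<le> t1" "t1 \<le> T"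
  shows "sabs d (avg e (r t1) y) - sabs d (avg e (r t0) y) \<le> (LINT t:{t0<..t1}|lborel. sabs' d (avg e (\<sigma> t) y) * rate e t y)"
proof -
  \<comment> \<open>The locale gives no joint measurability of \<open>r\<close>. Defining s through
    the integral of \<open>rate\<close> makes it measurable in time, and on [t0, t1] it agrees with
    the average of \<open>r\<close>.\<close>
  define s where "s t = avg e (r t0) y + (LINT \<tau>:{t0<..t}|lborel. rate e \<tau> y)" for t
  have s_r: "s t = avg e (r t) y" if "t0 \<le> t" "t \<le> t1" for t
    unfolding s_def using avg_evolution[OF e t(1) that(1), of y] that t by simp
  note iD = rate_int[OF e, of y]
  have [measurable]: "(\<lambda>\<tau>. rate e \<tau> y) \<in> borel_measurable borel" using iD by auto
  have s_eq: "s = (\<lambda>t. avg e (r t0) y + (\<integral>\<tau>. (if t0 < \<tau> \<and> \<tau> \<le> t then rate e \<tau> y else 0) \<partial>lborel))"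
    unfolding s_def set_lebesgue_integral_def
    by (intro ext arg_cong2[where f = "(+)"] Bochner_Integration.integral_cong) (auto simp: indicator_def)
  have [measurable]: "s \<in> borel_measurable borel"
    unfolding s_eq by measurable
  note [measurable] = measurable_sabs[OF d]
  have i: "integrable lborel (\<lambda>t. rate e t y * sabs' d (s t))"
    by (rule integrable_mult_bounded[OF iD _ abs_sabs'_le[OF d]]) measurable
  have "sabs d (s t1) - sabs d (s t0) \<le> (LINT t:{t0<..t1}|lborel. sabs' d (s t) * rate e t y)"
  proof (rule convex_chain_inequality[OF iD continuous_on_sabs(2)[OF d] sabs_convex[OF d] _ t(2)])
    show "s b - s a = (LINT t:{a<..b}|lborel. rate e t y)" if "t0 \<le> a" "a \<le> b" "b \<le> t1" for a b
      unfolding s_def using LINT_Ioc_split[OF set_integrable_lborel[OF iD] that(1,2)] by simp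
    show "set_integrable lborel {t0<..t1} (\<lambda>t. sabs' d (s t) * rate e t y)"
      by (rule set_integrable_lborel) (use i in \<open>auto simp: mult.commute\<close>)
  qed
  also have "\<dots> = (LINT t:{t0<..t1}|lborel. sabs' d (avg e (\<sigma> t) y) * rate e t y)"
    unfolding set_lebesgue_integral_def
  proof (rule integral_cong_AE)
    show "AE \<tau> in lborel. indicat_real {t0<..t1} \<tau> *\<^sub>R (sabs' d (s \<tau>) * rate e \<tau> y) =
        indicat_real {t0<..t1} \<tau> *\<^sub>R (sabs' d (avg e (\<sigma> \<tau>) y) * rate e \<tau> y)"
      using avg_r_eq
    proof eventually_elim
      case (elim \<tau>)
      then show ?case using s_r[of \<tau>] e t by (auto simp: indicator_def)
    qed
  qed measurable
  finally show ?thesis using s_r[of t0] s_r[of t1] t by simp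
qed

lemma sabs_evolution_integrated:
  assumes e: "e > 0" and d: "d > 0" and t: "0 \<le> t0" "t0 \<le> t1" "t1 \<le> T"
  shows "(LINT y:{a<..b}|lborel. sabs d (avg e (r t1) y)) - (LINT y:{a<..b}|lborel. sabs d (avg e (r t0) y))
    \<le> (LINT t:{t0<..t1}|lborel. (LINT y:{a<..b}|lborel. sabs' d (avg e (\<sigma> t) y) * rate e t y))"
proof -
  note [measurable] = measurable_sabs[OF d]
  define F where "F t y = indicat_real {t0<..t1} t * (indicat_real {a<..b} y * (sabs' d (avg e (\<sigma> t) y) * rate e t y))" for t y
  define K where "K = 60 * M / e + 60 / e"
  have [measurable]: "case_prod F \<in> borel_measurable (borel \<Otimes>\<^sub>M borel)"
    unfolding F_def by measurable
  have Fb: "\<bar>F t y\<bar> \<le> bd t * (K * indicat_real {a..b} y)" for t y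
  proof -
    have "\<bar>sabs' d (avg e (\<sigma> t) y) * rate e t y\<bar> \<le> 1 * (K * bd t)"
      unfolding abs_mult K_def by (intro mult_mono abs_sabs'_le[OF d] rate_bound[OF e]) auto
    moreover have "0 \<le> K * bd t" using M_nonneg e bd_nonneg by (simp add: K_def)
    ultimately show ?thesis by (auto simp: F_def indicator_def mult.commute)
  qed
  have iF: "integrable (lborel \<Otimes>\<^sub>M lborel) (case_prod F)"
    by (rule integrable_pair_bound[OF _ Fb bd_int]) (auto intro!: integrable_mult_right integrable_indicator_Icc)
  have cavg: "continuous_on UNIV (avg e (r t))" if "0 \<le> t" "t \<le> T" for t
    using DERIV_avg[OF r_int[OF that] e] by (meson DERIV_isCont continuous_at_imp_continuous_on)
  have i: "set_integrable lborel {a<..b} (\<lambda>y. sabs d (avg e (r t) y))" if "0 \<le> t" "t \<le> T" for t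
  proof (rule set_integrable_subset)
    have "continuous_on UNIV (\<lambda>y. sabs d (avg e (r t) y))"
      by (rule continuous_on_compose2[OF continuous_on_sabs(1)[OF d] cavg[OF that]]) auto
    then show "set_integrable lborel {a..b} (\<lambda>y. sabs d (avg e (r t) y))"
      by (intro borel_integrable_compact[unfolded set_integrable_def[symmetric]]) (auto intro: continuous_on_subset)
  qed auto
  have i0: "set_integrable lborel {a<..b} (\<lambda>y. sabs d (avg e (r t0) y))"
    and i1: "set_integrable lborel {a<..b} (\<lambda>y. sabs d (avg e (r t1) y))"
    using i t by auto
  have "(LINT y:{a<..b}|lborel. sabs d (avg e (r t1) y)) - (LINT y:{a<..b}|lborel. sabs d (avg e (r t0) y))
      = (LINT y:{a<..b}|lborel. sabs d (avg e (r t1) y) - sabs d (avg e (r t0) y))"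
    by (rule set_integral_diff(2)[OF i1 i0, symmetric])
  also have "\<dots> \<le> (\<integral>y. (\<integral>t. F t y \<partial>lborel) \<partial>lborel)"
    unfolding set_lebesgue_integral_def
  proof (rule integral_mono)
    show "integrable lborel (\<lambda>y. indicat_real {a<..b} y *\<^sub>R (sabs d (avg e (r t1) y) - sabs d (avg e (r t0) y)))"
      using set_integral_diff(1)[OF i1 i0] by (simp add: set_integrable_def)
    show "integrable lborel (\<lambda>y. \<integral>t. F t y \<partial>lborel)"
      by (rule lborel_pair.integrable_snd[OF iF])
    fix y
    have "(\<integral>t. F t y \<partial>lborel) = indicat_real {a<..b} y * (LINT t:{t0<..t1}|lborel. sabs' d (avg e (\<sigma> t) y) * rate e t y)"
      unfolding F_def set_lebesgue_integral_def by (subst integral_mult_right_zero[symmetric]) (simp add: mult_ac)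
    then show "indicat_real {a<..b} y *\<^sub>R (sabs d (avg e (r t1) y) - sabs d (avg e (r t0) y)) \<le> (\<integral>t. F t y \<partial>lborel)"
      using sabs_evolution[OF e d t, of y] by (auto simp: indicator_def)
  qed
  also have "\<dots> = (\<integral>t. (\<integral>y. F t y \<partial>lborel) \<partial>lborel)"
    by (rule lborel_pair.Fubini_integral[OF iF])
  also have "\<dots> = (LINT t:{t0<..t1}|lborel. (LINT y:{a<..b}|lborel. sabs' d (avg e (\<sigma> t) y) * rate e t y))"
    unfolding F_def set_lebesgue_integral_def by simp
  finally show ?thesis .
qed

end

subsection \<open>Vanishing regularisation\<close>

text \<open>This serves both as width of the mollifier and as parameter of \<open>sabs\<close>. The
  summand 2 keeps it at most 1/2, so that [-reg n, 0] and [1 - reg n, 1], where the ends of the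
  space interval move, stay apart.\<close>

definition reg :: "nat \<Rightarrow> real" where "reg n = 1 / (real n + 2)"

lemma reg_pos: "reg n > 0" and reg_le: "reg n \<le> 1/2"
  by (auto simp: reg_def field_simps)

lemma reg_lim: "reg \<longlonglongrightarrow> 0"
  unfolding reg_def by real_asymp

lemma reg_eventually_le: "d > 0 \<Longrightarrow> eventually (\<lambda>n. reg n \<le> d) sequentially"
  using order_tendstoD(2)[OF reg_lim, of d] by (auto elim: eventually_mono)

lemma tail_integral_tendsto_0:
  fixes f :: "real \<Rightarrow> real" and h :: "nat \<Rightarrow> real \<Rightarrow> real"
  assumes f: "integrable lborel f" and supp: "\<And>x. x \<notin> {0<..<1} \<Longrightarrow> f x = 0"
    and [measurable]: "\<And>n. h n \<in> borel_measurable borel" and h: "\<And>n x. \<bar>h n x\<bar> \<le> 1"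
    and lim: "\<And>x. x \<in> {0<..<1} \<Longrightarrow> (\<lambda>n. h n x) \<longlonglongrightarrow> 0"
  shows "(\<lambda>n. \<integral>x. f x * h n x \<partial>lborel) \<longlonglongrightarrow> 0"
proof -
  have [measurable]: "f \<in> borel_measurable borel" using f by auto
  have "(\<lambda>n. \<integral>x. f x * h n x \<partial>lborel) \<longlonglongrightarrow> (\<integral>x. 0 \<partial>(lborel :: real measure))"
  proof (rule integral_dominated_convergence[where w = "\<lambda>x. \<bar>f x\<bar>"])
    show "AE x in lborel. (\<lambda>n. f x * h n x) \<longlonglongrightarrow> 0"
    proof (intro AE_I2)
      fix x
      show "(\<lambda>n. f x * h n x) \<longlonglongrightarrow> 0"
        by (cases "x \<in> {0<..<1}") (auto simp: supp intro!: tendsto_mult_right_zero lim)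
    qed
    show "AE x in lborel. norm (f x * h n x) \<le> \<bar>f x\<bar>" for n
      using h by (intro AE_I2) (auto simp: abs_mult intro: mult_left_le)
  qed (use f in auto)
  then show ?thesis by simp
qed

lemma LINT_Ioc_dominated_convergence:
  fixes J :: "nat \<Rightarrow> real \<Rightarrow> real"
  assumes [measurable]: "\<And>n. J n \<in> borel_measurable borel" "j \<in> borel_measurable borel"
    and b: "\<And>n t. \<bar>J n t\<bar> \<le> w t" and w: "integrable lborel w" and lim: "\<And>t. (\<lambda>n. J n t) \<longlonglongrightarrow> j t"
  shows "(\<lambda>n. LINT t:{t0<..t1}|lborel. J n t) \<longlonglongrightarrow> (LINT t:{t0<..t1}|lborel. j t)"
  unfolding set_lebesgue_integral_def
proof (rule integral_dominated_convergence[OF _ _ w])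
  show "AE t in lborel. (\<lambda>n. indicat_real {t0<..t1} t *\<^sub>R J n t) \<longlonglongrightarrow> indicat_real {t0<..t1} t *\<^sub>R j t"
    by (intro AE_I2 tendsto_intros lim)
  show "AE t in lborel. norm (indicat_real {t0<..t1} t *\<^sub>R J n t) \<le> w t" for n
    using b[of n] order_trans[OF abs_ge_zero b[of n]] by (intro AE_I2) (auto simp: indicator_def)
qed measurable

lemma tail_sets: "x \<in> {0<..<1} \<Longrightarrow> (\<lambda>n. indicat_real {1 - reg n<..} x) \<longlonglongrightarrow> 0"
  "x \<in> {0<..<1} \<Longrightarrow> (\<lambda>n. indicat_real {0<..reg n} x) \<longlonglongrightarrow> 0"
proof -
  assume x: "x \<in> {0<..<1::real}"
  have "eventually (\<lambda>n. reg n \<le> (1 - x) / 2 \<and> reg n \<le> x / 2) sequentially"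
    using x by (intro eventually_conj reg_eventually_le) auto
  then have "eventually (\<lambda>n. indicat_real {1 - reg n<..} x = 0 \<and> indicat_real {0<..reg n} x = 0) sequentially"
    by eventually_elim (use x in \<open>auto simp: indicator_def\<close>)
  then show "(\<lambda>n. indicat_real {1 - reg n<..} x) \<longlonglongrightarrow> 0" "(\<lambda>n. indicat_real {0<..reg n} x) \<longlonglongrightarrow> 0"
    by (auto intro!: tendsto_eventually elim: eventually_mono)
qed

lemma tail_abs:
  fixes f :: "real \<Rightarrow> real"
  assumes f: "integrable lborel f" and supp: "\<And>x. x \<notin> {0<..<1} \<Longrightarrow> f x = 0"
  shows "(\<lambda>n. \<integral>x. \<bar>f x\<bar> * indicat_real {1 - reg n<..} x \<partial>lborel) \<longlonglongrightarrow> 0"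
    "(\<lambda>n. \<integral>x. \<bar>f x\<bar> * indicat_real {0<..reg n} x \<partial>lborel) \<longlonglongrightarrow> 0"
proof -
  have i1: "\<bar>indicat_real A x\<bar> \<le> 1" for A :: "real set" and x by (simp add: indicator_def)
  show "(\<lambda>n. \<integral>x. \<bar>f x\<bar> * indicat_real {1 - reg n<..} x \<partial>lborel) \<longlonglongrightarrow> 0"
    by (rule tail_integral_tendsto_0[OF integrable_abs[OF f] _ _ i1 tail_sets(1)]) (use supp in auto)
  show "(\<lambda>n. \<integral>x. \<bar>f x\<bar> * indicat_real {0<..reg n} x \<partial>lborel) \<longlonglongrightarrow> 0"
    by (rule tail_integral_tendsto_0[OF integrable_abs[OF f] _ _ i1 tail_sets(2)]) (use supp in auto)
qed

lemma avg_L1_tendsto: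
  fixes f :: "real \<Rightarrow> real"
  assumes f: "integrable lborel f" and supp: "\<And>x. x \<notin> {0<..<1} \<Longrightarrow> f x = 0"
  shows "(\<lambda>n. \<integral>y. \<bar>avg (reg n) f y - f y\<bar> \<partial>lborel) \<longlonglongrightarrow> 0"
proof (rule LIMSEQ_I)
  fix e :: real assume e: "e > 0"
  have supp': "f x = 0" if "x \<notin> {0..1}" for x using supp[of x] that by auto
  have e60: "e / 60 > 0" using e by simp
  obtain d where d: "d > 0" "\<And>h. \<bar>h\<bar> \<le> d \<Longrightarrow> (\<integral>\<^sup>+x. ennreal \<bar>f (x + h) - f x\<bar> \<partial>lborel) \<le> ennreal (e / 60)"
    using L1_translation_continuous[OF f supp' e60] by blast
  obtain N where N: "\<And>n. n \<ge> N \<Longrightarrow> reg n \<le> d"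
    using reg_eventually_le[OF d(1)] by (auto simp: eventually_sequentially)
  have "norm ((\<integral>y. \<bar>avg (reg n) f y - f y\<bar> \<partial>lborel) - 0) < e" if "n \<ge> N" for n
  proof -
    have "(\<integral>y. \<bar>avg (reg n) f y - f y\<bar> \<partial>lborel) \<le> 30 * (e / 60)"
      using N[OF that] e by (intro avg_L1_error[OF f reg_pos]) (auto intro!: d)
    moreover have "(\<integral>y. \<bar>avg (reg n) f y - f y\<bar> \<partial>lborel) \<ge> 0" by (intro integral_nonneg_AE) auto
    ultimately show ?thesis using e by simp
  qed
  then show "\<exists>N. \<forall>n\<ge>N. norm ((\<integral>y. \<bar>avg (reg n) f y - f y\<bar> \<partial>lborel) - 0) < e" by blast
qed

lemma sabs_avg_tendsto:
  fixes f :: "real \<Rightarrow> real"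
  assumes f: "integrable lborel f" and supp: "\<And>x. x \<notin> {0<..<1} \<Longrightarrow> f x = 0"
    and a: "\<And>n. - reg n \<le> a n" "\<And>n. a n \<le> 0" and b: "\<And>n. 1 - reg n \<le> b n" "\<And>n. b n \<le> 1"
  shows "(\<lambda>n. LINT y:{a n<..b n}|lborel. sabs (reg n) (avg (reg n) f y)) \<longlonglongrightarrow> (\<integral>x. \<bar>f x\<bar> \<partial>lborel)"
proof -
  have [measurable]: "f \<in> borel_measurable borel" using f by auto
  note iabs = set_integrable_lborel[OF integrable_abs[OF f]]
  \<comment> \<open>Three errors: that of the mollification; that of \<open>sabs\<close>, at most
    reg n on an interval of length at most 2; and the mass of f beyond b n. On the left nothing is
    lost, since a n <= 0.\<close>
  have bound: "\<bar>(LINT y:{a n<..b n}|lborel. sabs (reg n) (avg (reg n) f y)) - (\<integral>x. \<bar>f x\<bar> \<partial>lborel)\<bar>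
      \<le> (\<integral>y. \<bar>avg (reg n) f y - f y\<bar> \<partial>lborel) + 2 * reg n + (\<integral>x. \<bar>f x\<bar> * indicat_real {1 - reg n<..} x \<partial>lborel)" for n
  proof -
    let ?e = "reg n"
    have e: "?e > 0" "?e \<le> 1/2" by (rule reg_pos reg_le)+
    note [measurable] = measurable_sabs[OF e(1)]
    have ab: "a n \<le> b n" using a[of n] b[of n] e by simp
    have ia: "integrable lborel (\<lambda>y. avg ?e f y - f y)"
      by (rule avg_L1_error(1)[OF f e(1), of "2 * (\<integral>x. \<bar>f x\<bar> \<partial>lborel)"])
        (auto intro!: nn_integral_translation_le f mult_nonneg_nonneg integral_nonneg_AE)
    have iavg: "integrable lborel (avg ?e f)"
      using Bochner_Integration.integrable_add[OF ia f] by simp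
    have isa: "set_integrable lborel {a n<..b n} (\<lambda>y. sabs ?e (avg ?e f y))"
    proof (rule set_integrable_lborel)
      show "integrable lborel (\<lambda>y. sabs ?e (avg ?e f y))"
        by (rule Bochner_Integration.integrable_bound[OF iavg])
          (use sabs_le[OF e(1)] in \<open>auto intro!: AE_I2\<close>)
    qed simp
    have 1: "(\<integral>x. \<bar>f x\<bar> \<partial>lborel) = (LINT y:{a n<..b n}|lborel. \<bar>f y\<bar>) + (LINT y:{b n<..}|lborel. \<bar>f y\<bar>)"
    proof -
      have "(\<integral>x. \<bar>f x\<bar> \<partial>lborel) = (LINT y:{a n<..b n} \<union> {b n<..}|lborel. \<bar>f y\<bar>)"
        unfolding set_lebesgue_integral_def
      proof (intro Bochner_Integration.integral_cong refl)
        fix x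
        show "\<bar>f x\<bar> = indicat_real ({a n<..b n} \<union> {b n<..}) x *\<^sub>R \<bar>f x\<bar>"
          using a(2)[of n] supp[of x] by (cases "x \<in> {a n<..b n} \<union> {b n<..}") auto
      qed
      also have "\<dots> = (LINT y:{a n<..b n}|lborel. \<bar>f y\<bar>) + (LINT y:{b n<..}|lborel. \<bar>f y\<bar>)"
        by (rule set_integral_Un) (auto intro!: iabs)
      finally show ?thesis .
    qed
    have 2: "0 \<le> (LINT y:{b n<..}|lborel. \<bar>f y\<bar>)" "(LINT y:{b n<..}|lborel. \<bar>f y\<bar>) \<le> (\<integral>x. \<bar>f x\<bar> * indicat_real {1 - ?e<..} x \<partial>lborel)"
    proof -
      show "0 \<le> (LINT y:{b n<..}|lborel. \<bar>f y\<bar>)" unfolding set_lebesgue_integral_def by (intro integral_nonneg_AE) auto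
      show "(LINT y:{b n<..}|lborel. \<bar>f y\<bar>) \<le> (\<integral>x. \<bar>f x\<bar> * indicat_real {1 - ?e<..} x \<partial>lborel)"
        unfolding set_lebesgue_integral_def
      proof (rule integral_mono)
        show "integrable lborel (\<lambda>x. \<bar>f x\<bar> * indicat_real {1 - ?e<..} x)"
          using iabs[of "{1 - ?e<..}"] by (simp add: set_integrable_def mult.commute)
        show "integrable lborel (\<lambda>x. indicat_real {b n<..} x *\<^sub>R \<bar>f x\<bar>)"
          using iabs[of "{b n<..}"] by (simp add: set_integrable_def)
        fix x show "indicat_real {b n<..} x *\<^sub>R \<bar>f x\<bar> \<le> \<bar>f x\<bar> * indicat_real {1 - ?e<..} x"
          using b(1)[of n] by (auto simp: indicator_def)
      qed
    qed
    have 3: "\<bar>(LINT y:{a n<..b n}|lborel. sabs ?e (avg ?e f y)) - (LINT y:{a n<..b n}|lborel. \<bar>f y\<bar>)\<bar>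
        \<le> (\<integral>y. \<bar>avg ?e f y - f y\<bar> \<partial>lborel) + 2 * ?e"
    proof -
      have c: "set_integrable lborel {a n<..b n} (\<lambda>_. ?e)"
        by (rule set_integrable_bounded_Icc[where C = ?e and a = "a n" and b = "b n"]) (use e in auto)
      have "\<bar>(LINT y:{a n<..b n}|lborel. sabs ?e (avg ?e f y)) - (LINT y:{a n<..b n}|lborel. \<bar>f y\<bar>)\<bar>
          = \<bar>LINT y:{a n<..b n}|lborel. sabs ?e (avg ?e f y) - \<bar>f y\<bar>\<bar>"
        by (subst set_integral_diff(2)[OF isa iabs]) auto
      also have "\<dots> \<le> (LINT y:{a n<..b n}|lborel. \<bar>sabs ?e (avg ?e f y) - \<bar>f y\<bar>\<bar>)"
        by (rule LINT_Ioc_abs_le) (auto intro!: set_integral_diff(1) isa iabs)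
      also have "\<dots> \<le> (LINT y:{a n<..b n}|lborel. \<bar>avg ?e f y - f y\<bar> + ?e)"
      proof (rule LINT_Ioc_mono)
        show "set_integrable lborel {a n<..b n} (\<lambda>y. \<bar>sabs ?e (avg ?e f y) - \<bar>f y\<bar>\<bar>)"
          by (intro set_integrable_abs set_integral_diff(1) isa iabs) simp
        show "set_integrable lborel {a n<..b n} (\<lambda>y. \<bar>avg ?e f y - f y\<bar> + ?e)"
          by (intro set_integral_add(1) set_integrable_abs set_integrable_lborel[OF ia] c) simp
        fix y
        show "\<bar>sabs ?e (avg ?e f y) - \<bar>f y\<bar>\<bar> \<le> \<bar>avg ?e f y - f y\<bar> + ?e"
          using sabs_le(1,2)[OF e(1), of "avg ?e f y"] by (smt (verit))
      qed
      also have "\<dots> = (LINT y:{a n<..b n}|lborel. \<bar>avg ?e f y - f y\<bar>) + ?e * (b n - a n)"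
        by (subst set_integral_add(2)[OF set_integrable_abs[OF set_integrable_lborel[OF ia]] c])
          (auto simp: LINT_Ioc_const[OF ab])
      also have "\<dots> \<le> (\<integral>y. \<bar>avg ?e f y - f y\<bar> \<partial>lborel) + ?e * 2"
        using a[of n] b[of n] e by (intro add_mono LINT_subset_le[OF ia] mult_left_mono) auto
      finally show ?thesis by simp
    qed
    show ?thesis using 1 2 3 by linarith
  qed
  define g where "g n = (\<integral>y. \<bar>avg (reg n) f y - f y\<bar> \<partial>lborel) + 2 * reg n + (\<integral>x. \<bar>f x\<bar> * indicat_real {1 - reg n<..} x \<partial>lborel)" for n
  have g: "g \<longlonglongrightarrow> 0"
  proof -
    have "(\<lambda>n. 2 * reg n) \<longlonglongrightarrow> 0" using tendsto_mult_right_zero[OF reg_lim] .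
    then have "g \<longlonglongrightarrow> 0 + 0 + 0"
      unfolding g_def by (intro tendsto_add avg_L1_tendsto[OF f supp] tail_abs(1)[OF f supp])
    then show ?thesis by simp
  qed
  have "(\<lambda>n. (LINT y:{a n<..b n}|lborel. sabs (reg n) (avg (reg n) f y)) - (\<integral>x. \<bar>f x\<bar> \<partial>lborel)) \<longlonglongrightarrow> 0"
  proof (rule Lim_null_comparison[OF _ g])
    show "\<forall>\<^sub>F n in sequentially. norm ((LINT y:{a n<..b n}|lborel. sabs (reg n) (avg (reg n) f y)) - (\<integral>x. \<bar>f x\<bar> \<partial>lborel)) \<le> g n"
      using bound by (intro always_eventually) (simp add: g_def)
  qed
  then show ?thesis by (simp add: LIM_zero_iff)
qed

context transport
begin

lemma integrable_bd:
  assumes [measurable]: "f \<in> borel_measurable borel" and b: "\<And>t. \<bar>f t\<bar> \<le> K * bd t"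
  shows "integrable lborel f"
  by (rule Bochner_Integration.integrable_bound[OF integrable_mult_right[OF bd_int, of K]])
    (auto intro!: AE_I2 order_trans[OF b abs_ge_self])

lemmas sigma_0 = transport_slice.sigma_0[OF slice]
lemmas ux_int = transport_slice.ux_int[OF slice]
lemmas ux_0 = transport_slice.ux_0[OF slice]
lemmas c_int = transport_slice.c_int[OF slice]
lemmas c_0 = transport_slice.c_0[OF slice]
lemmas u_diff = transport_slice.u_diff[OF slice]
lemmas sigma_int = transport_slice.sigma_int[OF slice]

lemma u_le: "\<bar>u t y\<bar> \<le> bd t"
  using transport_slice.u_bound[OF slice, of t y] bd_ge(1)[of t] by linarith

lemma integral_c_sigma_le:
  assumes [measurable]: "g \<in> borel_measurable borel" and g: "\<And>x. \<bar>g x\<bar> \<le> K"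
  shows "\<bar>\<integral>x. c t x * g x \<partial>lborel\<bar> \<le> K * bd t"
proof -
  have K: "K \<ge> 0" using g[of 0] by linarith
  have i: "integrable lborel (\<lambda>x. c t x * g x)" by (rule integrable_mult_bounded[OF c_int _ g]) simp
  have "\<bar>\<integral>x. c t x * g x \<partial>lborel\<bar> \<le> (\<integral>x. \<bar>c t x * g x\<bar> \<partial>lborel)" by (rule integral_abs_bound)
  also have "\<dots> \<le> (\<integral>x. K * \<bar>c t x\<bar> \<partial>lborel)"
    using c_int[of t] i
    by (intro integral_mono integrable_abs integrable_mult_right)
      (auto simp: abs_mult mult.commute[of K] intro!: mult_left_mono g)
  also have "\<dots> \<le> K * bd t" using bd_ge(3)[of t] K by (simp add: mult_left_mono)
  finally show ?thesis .
qed

text \<open>The failure at time t of the exact balance for |\<sigma>|, that is, the quantity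
  \<open>J\<close> of \<open>slice_estimate\<close> with \<open>sabs\<close> and the mollifier
  sharing the parameter e.\<close>

definition defect :: "real \<Rightarrow> real \<Rightarrow> real \<Rightarrow> real \<Rightarrow> real" where
  "defect e a b t = (LINT y:{a<..b}|lborel. sabs' e (avg e (\<sigma> t) y) * fl e t y) + (\<integral>x. c t x * \<bar>\<sigma> t x\<bar> \<partial>lborel)
      + u t b * sabs e (avg e (\<sigma> t) b) - u t a * sabs e (avg e (\<sigma> t) a)"

lemma defect_measurable [measurable]: "e > 0 \<Longrightarrow> defect e a b \<in> borel_measurable borel"
proof -
  assume e: "e > 0"
  note [measurable] = measurable_sabs[OF e]
  show ?thesis unfolding defect_def set_lebesgue_integral_def by measurable
qed

lemma defect_estimate:
  assumes W: "W \<ge> 0" and e: "e > 0" and a: "a \<le> 0" and b: "1 - e \<le> b" "0 \<le> b"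
    and m: "\<And>v h. v = ux t \<or> v = c t \<or> v = (\<lambda>x. ux t x * \<sigma> t x) \<or> v = (\<lambda>x. c t x * \<sigma> t x) \<Longrightarrow> 0 \<le> h \<Longrightarrow> h \<le> e \<Longrightarrow>
       (\<integral>\<^sup>+y. ennreal \<bar>v (y + h) - v y\<bar> \<partial>lborel) \<le> ennreal W"
  shows "\<bar>defect e a b t\<bar> \<le> 300 * (1 + M) * W + e * ((\<integral>x. \<bar>ux t x\<bar> \<partial>lborel) + (\<integral>x. \<bar>c t x\<bar> \<partial>lborel))
      + M * (\<integral>x. \<bar>c t x\<bar> * indicat_real {1 - e<..} x \<partial>lborel)"
proof -
  have "transport_slice.mod_le W e v" if "v = ux t \<or> v = c t \<or> v = (\<lambda>x. ux t x * \<sigma> t x) \<or> v = (\<lambda>x. c t x * \<sigma> t x)" for v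
    unfolding transport_slice.mod_le_def[OF slice[of t]] using m[OF that] by blast
  then have "\<bar>defect e a b t\<bar> \<le> 300 * (1 + M) * W + e * ((\<integral>x. \<bar>ux t x\<bar> \<partial>lborel) + (\<integral>x. \<bar>c t x\<bar> \<partial>lborel))
      + M * (LINT x:{1 - e<..}|lborel. \<bar>c t x\<bar>)"
    unfolding defect_def by (intro transport_slice.slice_estimate[OF slice[of t] e W e a b]) auto
  then show ?thesis by (simp add: set_lebesgue_integral_def mult.commute[of _ "indicat_real _ _"])
qed

lemma slice_products:
  assumes "v = ux t \<or> v = c t \<or> v = (\<lambda>x. ux t x * \<sigma> t x) \<or> v = (\<lambda>x. c t x * \<sigma> t x)"
  shows "integrable lborel v" "x \<notin> {0<..<1} \<Longrightarrow> v x = 0" "(\<integral>x. \<bar>v x\<bar> \<partial>lborel) \<le> (1 + M) * bd t"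
proof -
  have *: "integrable lborel (\<lambda>x. w x * \<sigma> t x)" "(\<integral>x. \<bar>w x * \<sigma> t x\<bar> \<partial>lborel) \<le> M * (\<integral>x. \<bar>w x\<bar> \<partial>lborel)"
    if w: "integrable lborel w" for w
  proof -
    show i: "integrable lborel (\<lambda>x. w x * \<sigma> t x)"
      by (rule transport_slice.integrable_mult_sigma[OF slice w])
    have "(\<integral>x. \<bar>w x * \<sigma> t x\<bar> \<partial>lborel) \<le> (\<integral>x. M * \<bar>w x\<bar> \<partial>lborel)"
      using i w by (intro integral_mono integrable_abs integrable_mult_right)
        (auto simp: abs_mult mult.commute[of M] intro!: mult_left_mono sigma_le)
    then show "(\<integral>x. \<bar>w x * \<sigma> t x\<bar> \<partial>lborel) \<le> M * (\<integral>x. \<bar>w x\<bar> \<partial>lborel)" by simp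
  qed
  show "integrable lborel v" using assms *(1)[OF ux_int] *(1)[OF c_int] ux_int c_int by auto
  show "x \<notin> {0<..<1} \<Longrightarrow> v x = 0" using assms ux_0 c_0 by auto
  have "M * bd t \<ge> 0" using M_nonneg bd_nonneg by simp
  then show "(\<integral>x. \<bar>v x\<bar> \<partial>lborel) \<le> (1 + M) * bd t"
    using assms order_trans[OF *(2)[OF ux_int] mult_left_mono[OF bd_ge(2) M_nonneg]]
      order_trans[OF *(2)[OF c_int] mult_left_mono[OF bd_ge(3) M_nonneg]] bd_ge(2,3)[of t] bd_nonneg[of t]
    by (auto simp: algebra_simps intro: add_increasing add_increasing2)
qed

text \<open>Uniform in e: any translation changes an integrable function by at most twice its norm,
  so W = 2 (1 + M) bd t is admissible in \<open>defect_estimate\<close>.\<close>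

lemma defect_bound:
  assumes e: "e > 0" "e \<le> 1" and a: "a \<le> 0" and b: "1 - e \<le> b" "0 \<le> b"
  shows "\<bar>defect e a b t\<bar> \<le> (600 * (1 + M) * (1 + M) + 2 + M) * bd t"
proof -
  have "\<bar>defect e a b t\<bar> \<le> 300 * (1 + M) * (2 * ((1 + M) * bd t)) + e * ((\<integral>x. \<bar>ux t x\<bar> \<partial>lborel) + (\<integral>x. \<bar>c t x\<bar> \<partial>lborel))
      + M * (\<integral>x. \<bar>c t x\<bar> * indicat_real {1 - e<..} x \<partial>lborel)"
  proof (rule defect_estimate[OF _ e(1) a b])
    show "2 * ((1 + M) * bd t) \<ge> 0" using M_nonneg bd_nonneg by simp
    fix v h assume v: "v = ux t \<or> v = c t \<or> v = (\<lambda>x. ux t x * \<sigma> t x) \<or> v = (\<lambda>x. c t x * \<sigma> t x)"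
    show "(\<integral>\<^sup>+y. ennreal \<bar>v (y + h) - v y\<bar> \<partial>lborel) \<le> ennreal (2 * ((1 + M) * bd t))"
      by (rule order_trans[OF nn_integral_translation_le[OF slice_products(1)[OF v]]])
        (use slice_products(3)[OF v] in \<open>auto intro!: ennreal_leI\<close>)
  qed
  also have "e * ((\<integral>x. \<bar>ux t x\<bar> \<partial>lborel) + (\<integral>x. \<bar>c t x\<bar> \<partial>lborel)) \<le> 1 * (bd t + bd t)"
    using e bd_ge(2,3)[of t] by (intro mult_mono add_mono) (auto intro!: add_nonneg_nonneg integral_nonneg_AE)
  also have "M * (\<integral>x. \<bar>c t x\<bar> * indicat_real {1 - e<..} x \<partial>lborel) \<le> M * bd t"
  proof (rule mult_left_mono[OF _ M_nonneg])
    have "(\<integral>x. \<bar>c t x\<bar> * indicat_real {1 - e<..} x \<partial>lborel) \<le> (\<integral>x. \<bar>c t x\<bar> \<partial>lborel)"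
      using integrable_abs[OF c_int[of t]]
      by (intro integral_mono integrable_mult_bounded[where C = 1]) (auto simp: indicator_def)
    then show "(\<integral>x. \<bar>c t x\<bar> * indicat_real {1 - e<..} x \<partial>lborel) \<le> bd t" using bd_ge(3)[of t] by simp
  qed
  finally show ?thesis by (simp add: algebra_simps)
qed

text \<open>Pointwise in t only, as the shift below which translations are small depends on t. The
  majorant of \<open>defect_bound\<close> carries the limit under the time integral.\<close>

lemma defect_tendsto:
  assumes a: "\<And>n. a n \<le> 0" and b: "\<And>n. 1 - reg n \<le> b n"
  shows "(\<lambda>n. defect (reg n) (a n) (b n) t) \<longlonglongrightarrow> 0"
proof (rule LIMSEQ_I)
  fix \<eta> :: real assume \<eta>: "\<eta> > 0"
  define \<eta>' where "\<eta>' = \<eta> / (300 * (1 + M) + 2)"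
  have \<eta>': "\<eta>' > 0" "300 * (1 + M) * \<eta>' + \<eta>' < \<eta>"
  proof -
    have p: "300 * (1 + M) + 2 > 0" using M_nonneg by simp
    show 1: "\<eta>' > 0" using \<eta> p by (simp add: \<eta>'_def)
    have "(300 * (1 + M) + 2) * \<eta>' = \<eta>" using p by (simp add: \<eta>'_def)
    then show "300 * (1 + M) * \<eta>' + \<eta>' < \<eta>" using 1 by (simp add: algebra_simps)
  qed
  have tr: "\<exists>d>0. \<forall>h. \<bar>h\<bar> \<le> d \<longrightarrow> (\<integral>\<^sup>+y. ennreal \<bar>v (y + h) - v y\<bar> \<partial>lborel) \<le> ennreal \<eta>'"
    if v: "v = ux t \<or> v = c t \<or> v = (\<lambda>x. ux t x * \<sigma> t x) \<or> v = (\<lambda>x. c t x * \<sigma> t x)" for v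
  proof -
    have "v x = 0" if "x \<notin> {0..1}" for x using slice_products(2)[OF v, of x] that by auto
    from L1_translation_continuous[OF slice_products(1)[OF v] this \<eta>'(1)] show ?thesis by metis
  qed
  obtain d1 where d1: "d1 > 0" "\<forall>h. \<bar>h\<bar> \<le> d1 \<longrightarrow> (\<integral>\<^sup>+y. ennreal \<bar>ux t (y + h) - ux t y\<bar> \<partial>lborel) \<le> ennreal \<eta>'"
    using tr[of "ux t"] by auto
  obtain d2 where d2: "d2 > 0" "\<forall>h. \<bar>h\<bar> \<le> d2 \<longrightarrow> (\<integral>\<^sup>+y. ennreal \<bar>c t (y + h) - c t y\<bar> \<partial>lborel) \<le> ennreal \<eta>'"
    using tr[of "c t"] by auto
  obtain d3 where d3: "d3 > 0" "\<forall>h. \<bar>h\<bar> \<le> d3 \<longrightarrow> (\<integral>\<^sup>+y. ennreal \<bar>ux t (y + h) * \<sigma> t (y + h) - ux t y * \<sigma> t y\<bar> \<partial>lborel) \<le> ennreal \<eta>'"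
    using tr[of "\<lambda>x. ux t x * \<sigma> t x"] by auto
  obtain d4 where d4: "d4 > 0" "\<forall>h. \<bar>h\<bar> \<le> d4 \<longrightarrow> (\<integral>\<^sup>+y. ennreal \<bar>c t (y + h) * \<sigma> t (y + h) - c t y * \<sigma> t y\<bar> \<partial>lborel) \<le> ennreal \<eta>'"
    using tr[of "\<lambda>x. c t x * \<sigma> t x"] by auto
  let ?rest = "\<lambda>n. reg n * ((\<integral>x. \<bar>ux t x\<bar> \<partial>lborel) + (\<integral>x. \<bar>c t x\<bar> \<partial>lborel))
      + M * (\<integral>x. \<bar>c t x\<bar> * indicat_real {1 - reg n<..} x \<partial>lborel)"
  have "?rest \<longlonglongrightarrow> 0 * ((\<integral>x. \<bar>ux t x\<bar> \<partial>lborel) + (\<integral>x. \<bar>c t x\<bar> \<partial>lborel)) + M * 0"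
    by (rule tendsto_add[OF tendsto_mult[OF reg_lim tendsto_const] tendsto_mult[OF tendsto_const tail_abs(1)[OF c_int c_0]]])
  then have "eventually (\<lambda>n. ?rest n < \<eta>') sequentially"
    using \<eta>'(1) by (intro order_tendstoD) auto
  moreover have "eventually (\<lambda>n. reg n \<le> min (min d1 d2) (min d3 d4)) sequentially"
    using d1 d2 d3 d4 by (intro reg_eventually_le) auto
  ultimately have "eventually (\<lambda>n. norm (defect (reg n) (a n) (b n) t - 0) < \<eta>) sequentially"
  proof eventually_elim
    case (elim n)
    have "\<bar>defect (reg n) (a n) (b n) t\<bar> \<le> 300 * (1 + M) * \<eta>' + reg n * ((\<integral>x. \<bar>ux t x\<bar> \<partial>lborel) + (\<integral>x. \<bar>c t x\<bar> \<partial>lborel))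
      + M * (\<integral>x. \<bar>c t x\<bar> * indicat_real {1 - reg n<..} x \<partial>lborel)"
    proof (rule defect_estimate[OF _ reg_pos a b])
      show "0 \<le> b n" using b[of n] reg_le[of n] by simp
      fix v h assume "v = ux t \<or> v = c t \<or> v = (\<lambda>x. ux t x * \<sigma> t x) \<or> v = (\<lambda>x. c t x * \<sigma> t x)" "0 \<le> h" "h \<le> reg n"
      then show "(\<integral>\<^sup>+y. ennreal \<bar>v (y + h) - v y\<bar> \<partial>lborel) \<le> ennreal \<eta>'"
        using elim(2) d1(2) d2(2) d3(2) d4(2) by auto
    qed (use \<eta>' in auto)
    then show ?case using elim(1) \<eta>'(2) by simp
  qed
  then show "\<exists>N. \<forall>n\<ge>N. norm (defect (reg n) (a n) (b n) t - 0) < \<eta>"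
    by (simp add: eventually_sequentially)
qed

lemma integrable_slice_rate:
  assumes e: "e > 0"
  shows "integrable lborel (\<lambda>t. LINT y:{a<..b}|lborel. sabs' e (avg e (\<sigma> t) y) * rate e t y)"
proof -
  note [measurable] = measurable_sabs[OF e]
  define K where "K = 60 * M / e + 60 / e"
  have "integrable (lborel \<Otimes>\<^sub>M lborel) (\<lambda>(t, y). indicat_real {a<..b} y * (sabs' e (avg e (\<sigma> t) y) * rate e t y))"
  proof (rule integrable_pair_bound[OF _ _ bd_int])
    fix t y
    have "\<bar>sabs' e (avg e (\<sigma> t) y) * rate e t y\<bar> \<le> 1 * (K * bd t)"
      unfolding abs_mult K_def by (intro mult_mono abs_sabs'_le[OF e] rate_bound[OF e]) auto
    then show "\<bar>indicat_real {a<..b} y * (sabs' e (avg e (\<sigma> t) y) * rate e t y)\<bar> \<le> bd t * (K * indicat_real {a..b} y)"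
      using M_nonneg e bd_nonneg[of t] by (auto simp: K_def indicator_def mult.commute)
  qed (auto intro!: integrable_mult_right integrable_indicator_Icc)
  from lborel_pair.integrable_fst[OF this] show ?thesis
    by (simp add: set_lebesgue_integral_def)
qed

text \<open>The share, weighted with the approximate sign of \<sigma>, that a unit mollified source
  at p has in the interval (a, b]. It lies in [-1, 1].\<close>

definition src :: "real \<Rightarrow> real \<Rightarrow> real \<Rightarrow> real \<Rightarrow> real \<Rightarrow> real" where
  "src p e a b t = (LINT y:{a<..b}|lborel. sabs' e (avg e (\<sigma> t) y) * (moll ((p - y) / e) / e))"

lemma src_integrand_int:
  assumes e: "e > 0"
  shows "integrable lborel (\<lambda>y. sabs' e (avg e (\<sigma> t) y) * (moll ((p - y) / e) / e))"
proof -
  note [measurable] = measurable_sabs[OF e]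
  have [measurable]: "avg e (\<sigma> t) \<in> borel_measurable borel"
    by (rule measurable_avg) (rule transport_slice.sigma_measurable[OF slice])
  have "integrable lborel (\<lambda>y. moll ((p - y) / e) / e * sabs' e (avg e (\<sigma> t) y))"
    by (rule integrable_mult_bounded[OF integral_moll_affine(2)[OF e] _ abs_sabs'_le[OF e]]) measurable
  moreover have "(\<lambda>y. sabs' e (avg e (\<sigma> t) y) * (moll ((p - y) / e) / e)) = (\<lambda>y. moll ((p - y) / e) / e * sabs' e (avg e (\<sigma> t) y))"
    by (rule ext) (rule mult.commute)
  ultimately show ?thesis by simp
qed

lemma abs_src_le: "e > 0 \<Longrightarrow> \<bar>src p e a b t\<bar> \<le> 1"
proof -
  assume e: "e > 0"
  have "\<bar>src p e a b t\<bar> \<le> (LINT y:{a<..b}|lborel. \<bar>sabs' e (avg e (\<sigma> t) y) * (moll ((p - y) / e) / e)\<bar>)"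
    unfolding src_def by (intro LINT_Ioc_abs_le set_integrable_lborel src_integrand_int[OF e]) simp
  also have "\<dots> \<le> (\<integral>y. \<bar>sabs' e (avg e (\<sigma> t) y) * (moll ((p - y) / e) / e)\<bar> \<partial>lborel)"
    by (rule LINT_subset_le[OF src_integrand_int[OF e]]) simp
  also have "\<dots> \<le> (\<integral>y. moll ((p - y) / e) / e \<partial>lborel)"
  proof (rule integral_mono)
    show "\<bar>sabs' e (avg e (\<sigma> t) y) * (moll ((p - y) / e) / e)\<bar> \<le> moll ((p - y) / e) / e" for y
    proof -
      have "\<bar>sabs' e (avg e (\<sigma> t) y) * (moll ((p - y) / e) / e)\<bar> \<le> 1 * (moll ((p - y) / e) / e)"
        unfolding abs_mult using e moll_nonneg by (intro mult_mono abs_sabs'_le) auto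
      then show ?thesis by simp
    qed
  qed (rule integrable_abs[OF src_integrand_int[OF e]] integral_moll_affine(2)[OF e])+
  finally show ?thesis using integral_moll_affine[OF e] by simp
qed

lemma src_measurable [measurable]: "e > 0 \<Longrightarrow> src p e a b \<in> borel_measurable borel"
proof -
  assume e: "e > 0"
  note [measurable] = measurable_sabs[OF e]
  show ?thesis unfolding src_def set_lebesgue_integral_def by measurable
qed

text \<open>The terms are grouped by end point. Each bracket holds the transport flux at that end
  and the point source next to it; the choices of a and b made later leave only one of the
  two.\<close>

lemma slice_rate_eq:
  assumes e: "e > 0"
  shows "(LINT y:{a<..b}|lborel. sabs' e (avg e (\<sigma> t) y) * rate e t y) = defect e a b t - (\<integral>x. c t x * \<bar>\<sigma> t x\<bar> \<partial>lborel)
     + (u t a * sabs e (avg e (\<sigma> t) a) + G0 t * src 0 e a b t) + (- u t b * sabs e (avg e (\<sigma> t) b) - G1 t * src 1 e a b t)"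
proof -
  note [measurable] = measurable_sabs[OF e]
  have [measurable]: "avg e (\<sigma> t) \<in> borel_measurable borel"
    by (rule measurable_avg) (rule transport_slice.sigma_measurable[OF slice])
  have [measurable]: "(\<lambda>y. fl e t y) \<in> borel_measurable borel" by measurable
  have ifl: "set_integrable lborel {a<..b} (\<lambda>y. sabs' e (avg e (\<sigma> t) y) * fl e t y)"
  proof (rule set_integrable_bounded_Icc[where a = a and b = b])
    show "\<bar>sabs' e (avg e (\<sigma> t) y) * fl e t y\<bar> \<le> 1 * (60 * M / e * (\<bar>u t 0\<bar> + (\<integral>x. \<bar>ux t x\<bar> \<partial>lborel) + (\<integral>x. \<bar>c t x\<bar> \<partial>lborel)))" for y
      unfolding abs_mult by (intro mult_mono abs_sabs'_le[OF e] transport_slice.flux_bound[OF slice e]) auto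
  qed auto
  have isr: "set_integrable lborel {a<..b} (\<lambda>y. sabs' e (avg e (\<sigma> t) y) * (moll ((p - y) / e) / e))" for p
    by (rule set_integrable_lborel[OF src_integrand_int[OF e]]) simp
  have "(LINT y:{a<..b}|lborel. sabs' e (avg e (\<sigma> t) y) * rate e t y) =
      (LINT y:{a<..b}|lborel. (sabs' e (avg e (\<sigma> t) y) * fl e t y + G0 t * (sabs' e (avg e (\<sigma> t) y) * (moll ((0 - y) / e) / e)))
         - G1 t * (sabs' e (avg e (\<sigma> t) y) * (moll ((1 - y) / e) / e)))"
    by (simp add: rate_def algebra_simps)
  also have "\<dots> = (LINT y:{a<..b}|lborel. sabs' e (avg e (\<sigma> t) y) * fl e t y) + G0 t * src 0 e a b t - G1 t * src 1 e a b t"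
    unfolding src_def
    by (subst set_integral_diff(2)[OF set_integral_add(1)[OF ifl set_integrable_mult_right[OF isr]] set_integrable_mult_right[OF isr]],
        subst set_integral_add(2)[OF ifl set_integrable_mult_right[OF isr]]) simp
  finally show ?thesis by (simp add: defect_def)
qed

definition absorption :: "real \<Rightarrow> real" where
  "absorption t = (\<integral>x. c t x * \<bar>\<sigma> t x\<bar> \<partial>lborel)"

lemma absorption_int: "integrable lborel absorption"
proof (rule integrable_bd)
  show "\<bar>absorption t\<bar> \<le> M * bd t" for t
    unfolding absorption_def
    by (rule integral_c_sigma_le) (use sigma_le transport_slice.sigma_measurable[OF slice] in auto)
  show "absorption \<in> borel_measurable borel" unfolding absorption_def by measurable
qed

text \<open>Of the majorants X and Y of the two end contributions only the time integrals have to
  converge. Pointwise limits would be too much to ask, because the trace is reached only weakly in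
  time.\<close>

lemma energy_limit:
  fixes a b :: "nat \<Rightarrow> real"
  assumes t: "0 \<le> t0" "t0 \<le> t1" "t1 \<le> T"
    and a: "\<And>n. - reg n \<le> a n" "\<And>n. a n \<le> 0" and b: "\<And>n. 1 - reg n \<le> b n" "\<And>n. b n \<le> 1"
    and X: "\<And>n t. u t (a n) * sabs (reg n) (avg (reg n) (\<sigma> t) (a n)) + G0 t * src 0 (reg n) (a n) (b n) t \<le> X n t"
    and iX: "\<And>n. integrable lborel (X n)" and limX: "(\<lambda>n. LINT t:{t0<..t1}|lborel. X n t) \<longlonglongrightarrow> x"
    and Y: "\<And>n t. - u t (b n) * sabs (reg n) (avg (reg n) (\<sigma> t) (b n)) - G1 t * src 1 (reg n) (a n) (b n) t \<le> Y n t"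
    and iY: "\<And>n. integrable lborel (Y n)" and limY: "(\<lambda>n. LINT t:{t0<..t1}|lborel. Y n t) \<longlonglongrightarrow> y"
  shows "(\<integral>x. \<bar>r t1 x\<bar> \<partial>lborel) - (\<integral>x. \<bar>r t0 x\<bar> \<partial>lborel) \<le> - (LINT t:{t0<..t1}|lborel. absorption t) + x + y"
proof (rule LIMSEQ_le)
  have t': "0 \<le> t1" "t0 \<le> T" using t by auto
  show "(\<lambda>n. (LINT y:{a n<..b n}|lborel. sabs (reg n) (avg (reg n) (r t1) y)) - (LINT y:{a n<..b n}|lborel. sabs (reg n) (avg (reg n) (r t0) y)))
      \<longlonglongrightarrow> (\<integral>x. \<bar>r t1 x\<bar> \<partial>lborel) - (\<integral>x. \<bar>r t0 x\<bar> \<partial>lborel)"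
    using t t' by (intro tendsto_diff sabs_avg_tendsto r_int r_0 a b) auto
  let ?J = "\<lambda>n t. defect (reg n) (a n) (b n) t"
  have b0: "0 \<le> b n" for n using b(1)[of n] reg_le[of n] by simp
  have Jb: "\<bar>?J n t\<bar> \<le> (600 * (1 + M) * (1 + M) + 2 + M) * bd t" for n t
    by (rule defect_bound[OF reg_pos _ a(2) b(1) b0]) (use reg_le[of n] in simp)
  have iJ: "integrable lborel (?J n)" for n
    by (rule integrable_bd[OF _ Jb]) (rule defect_measurable[OF reg_pos])
  have limJ: "(\<lambda>n. LINT t:{t0<..t1}|lborel. ?J n t) \<longlonglongrightarrow> (LINT t:{t0<..t1}|lborel. 0)"
    by (rule LINT_Ioc_dominated_convergence[OF _ _ Jb])
      (auto intro!: defect_measurable reg_pos integrable_mult_right bd_int defect_tendsto a b)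
  show "(\<lambda>n. (LINT t:{t0<..t1}|lborel. ?J n t) + - (LINT t:{t0<..t1}|lborel. absorption t) + (LINT t:{t0<..t1}|lborel. X n t)
      + (LINT t:{t0<..t1}|lborel. Y n t)) \<longlonglongrightarrow> - (LINT t:{t0<..t1}|lborel. absorption t) + x + y"
    using tendsto_add[OF tendsto_add[OF tendsto_add[OF limJ tendsto_const[of "- (LINT t:{t0<..t1}|lborel. absorption t)"]] limX] limY]
    by simp
  show "\<exists>N. \<forall>n\<ge>N. (LINT y:{a n<..b n}|lborel. sabs (reg n) (avg (reg n) (r t1) y)) - (LINT y:{a n<..b n}|lborel. sabs (reg n) (avg (reg n) (r t0) y))
     \<le> (LINT t:{t0<..t1}|lborel. ?J n t) + - (LINT t:{t0<..t1}|lborel. absorption t) + (LINT t:{t0<..t1}|lborel. X n t)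
      + (LINT t:{t0<..t1}|lborel. Y n t)"
  proof (intro exI allI impI)
    fix n
    note iS = set_integrable_lborel[where A = "{t0<..t1}"]
    have "(LINT y:{a n<..b n}|lborel. sabs (reg n) (avg (reg n) (r t1) y)) - (LINT y:{a n<..b n}|lborel. sabs (reg n) (avg (reg n) (r t0) y))
       \<le> (LINT t:{t0<..t1}|lborel. (LINT y:{a n<..b n}|lborel. sabs' (reg n) (avg (reg n) (\<sigma> t) y) * rate (reg n) t y))"
      by (rule sabs_evolution_integrated[OF reg_pos reg_pos t])
    also have "\<dots> \<le> (LINT t:{t0<..t1}|lborel. ((?J n t - absorption t) + X n t) + Y n t)"
    proof (rule LINT_Ioc_mono)
      show "set_integrable lborel {t0<..t1} (\<lambda>t. LINT y:{a n<..b n}|lborel. sabs' (reg n) (avg (reg n) (\<sigma> t) y) * rate (reg n) t y)"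
        by (rule iS[OF integrable_slice_rate[OF reg_pos]]) simp
      show "set_integrable lborel {t0<..t1} (\<lambda>t. ((?J n t - absorption t) + X n t) + Y n t)"
        by (intro iS Bochner_Integration.integrable_add Bochner_Integration.integrable_diff iJ absorption_int iX iY) simp
      fix t
      show "(LINT y:{a n<..b n}|lborel. sabs' (reg n) (avg (reg n) (\<sigma> t) y) * rate (reg n) t y) \<le> ((?J n t - absorption t) + X n t) + Y n t"
        unfolding slice_rate_eq[OF reg_pos] using X[of t n] Y[of t n] by (simp add: absorption_def)
    qed
    also have "\<dots> = (LINT t:{t0<..t1}|lborel. ?J n t) - (LINT t:{t0<..t1}|lborel. absorption t) + (LINT t:{t0<..t1}|lborel. X n t)
      + (LINT t:{t0<..t1}|lborel. Y n t)"
      unfolding set_lebesgue_integral_def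
      using iS[OF iJ, of n] iS[OF absorption_int] iS[OF iX, of n] iS[OF iY, of n]
      by (simp add: set_integrable_def algebra_simps)
    finally show "(LINT y:{a n<..b n}|lborel. sabs (reg n) (avg (reg n) (r t1) y)) - (LINT y:{a n<..b n}|lborel. sabs (reg n) (avg (reg n) (r t0) y))
       \<le> (LINT t:{t0<..t1}|lborel. ?J n t) + - (LINT t:{t0<..t1}|lborel. absorption t) + (LINT t:{t0<..t1}|lborel. X n t)
        + (LINT t:{t0<..t1}|lborel. Y n t)" by simp
  qed
qed

subsection \<open>The boundary flux\<close>

text \<open>A cut-off concentrating at an end point isolates the boundary term. Its derivative is a
  mollifier, so the transport term is an average of \<sigma> u over a window next to p; every other
  interior term vanishes in the limit because the cut-off tends to 0 in (0,1). Replacing u in the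
  window by its value at p costs the mass of ux on \<open>A n\<close>, which vanishes as
  well.\<close>

lemma boundary_flux_tendsto:
  fixes \<phi> :: "nat \<Rightarrow> real \<Rightarrow> real" and y :: "nat \<Rightarrow> real"
  assumes t: "0 \<le> t0" "t0 \<le> t1" "t1 \<le> T" and \<kappa>: "\<bar>\<kappa>\<bar> = 1"
    and D: "\<And>n x. (\<phi> n has_real_derivative \<kappa> * (moll ((x - y n) / reg n) / reg n)) (at x)"
    and b: "\<And>n x. \<bar>\<phi> n x\<bar> \<le> 1" and lim: "\<And>x. x \<in> {0<..<1} \<Longrightarrow> (\<lambda>n. \<phi> n x) \<longlonglongrightarrow> 0"
    and p: "\<And>n. \<phi> n 0 = p0" "\<And>n. \<phi> n 1 = p1"
    and A: "\<And>n. A n \<in> sets borel" "\<And>x. x \<in> {0<..<1} \<Longrightarrow> (\<lambda>n. indicat_real (A n) x) \<longlonglongrightarrow> 0"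
    and osc: "\<And>n t z. z \<in> {0..1} \<Longrightarrow> \<bar>u t p - u t (y n + reg n * z)\<bar> \<le> (\<integral>x. \<bar>ux t x\<bar> * indicat_real (A n) x \<partial>lborel)"
  shows "(\<lambda>n. LINT t:{t0<..t1}|lborel. \<kappa> * (u t p * avg (reg n) (\<sigma> t) (y n)) + G0 t * p0 - G1 t * p1) \<longlonglongrightarrow> 0"
proof -
  note [measurable] = A(1)
  have c\<phi>: "continuous_on UNIV (\<phi> n)" for n
    using D by (meson DERIV_isCont continuous_at_imp_continuous_on)
  have [measurable]: "\<phi> n \<in> borel_measurable borel" for n by (rule borel_measurable_continuous_onI[OF c\<phi>])
  have D': "continuous_on UNIV (\<lambda>x. \<kappa> * (moll ((x - y n) / reg n) / reg n))" for n
    using reg_pos[of n] by (intro continuous_intros continuous_on_compose2[OF continuous_on_moll(1)]) auto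
  define P where "P n t = (\<integral>x. c t x * (\<sigma> t x * \<phi> n x) \<partial>lborel)" for n t
  define Q where "Q n t = avg (reg n) (\<lambda>x. \<sigma> t x * u t x) (y n)" for n t
  define S where "S n t = u t p * avg (reg n) (\<sigma> t) (y n)" for n t
  have [measurable]: "P n \<in> borel_measurable borel" "Q n \<in> borel_measurable borel" "S n \<in> borel_measurable borel" for n
    unfolding P_def Q_def S_def avg_def by measurable
  have slm: "\<sigma> t \<in> borel_measurable borel" "u t \<in> borel_measurable borel" for t
    by (rule transport_slice.sigma_measurable[OF slice] transport_slice.u_measurable[OF slice])+
  note [measurable] = slm
  have su: "\<bar>\<sigma> t x * u t x\<bar> \<le> M * bd t" for t x
    unfolding abs_mult by (intro mult_mono sigma_le u_le M_nonneg) auto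
  have sphi: "\<bar>\<sigma> t x * \<phi> n x\<bar> \<le> M" for n t x
  proof -
    have "\<bar>\<sigma> t x * \<phi> n x\<bar> \<le> M * 1" unfolding abs_mult by (intro mult_mono sigma_le b M_nonneg) auto
    then show ?thesis by simp
  qed
  have Pb: "\<bar>P n t\<bar> \<le> M * bd t" for n t
    unfolding P_def by (rule integral_c_sigma_le[OF _ sphi]) measurable
  have Qb: "\<bar>Q n t\<bar> \<le> M * bd t" for n t
    unfolding Q_def by (rule avg_bound[OF _ su]) measurable
  have avb: "\<bar>avg (reg n) (\<sigma> t) (y n)\<bar> \<le> M" for n t
    by (rule avg_bound[OF _ sigma_le]) measurable
  have Sb: "\<bar>S n t\<bar> \<le> M * bd t" for n t
    unfolding S_def abs_mult mult.commute[of M] by (intro mult_mono u_le avb bd_nonneg) auto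
  have iP: "integrable lborel (P n)" and iQ: "integrable lborel (Q n)" and iS: "integrable lborel (S n)" for n
    by (rule integrable_bd[OF _ Pb] integrable_bd[OF _ Qb] integrable_bd[OF _ Sb]; measurable)+
  have eq: "(\<integral>x. \<sigma> t x * (u t x * (\<kappa> * (moll ((x - y n) / reg n) / reg n)) - c t x * \<phi> n x) \<partial>lborel) = \<kappa> * Q n t - P n t" for n t
  proof -
    have m1: "\<bar>moll z\<bar> \<le> 30" for z using moll_bounds(1)[of z] by (cases "z \<in> {0..1}") auto
    have isu: "integrable lborel (\<lambda>x. \<sigma> t x * u t x)"
      by (rule integrable_mult_bounded[OF sigma_int _ u_le]) measurable
    have i1: "integrable lborel (\<lambda>x. \<sigma> t x * u t x * moll ((x - y n) / reg n))"
      by (rule integrable_mult_bounded[OF isu _ m1]) measurable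
    have i2: "integrable lborel (\<lambda>x. c t x * (\<sigma> t x * \<phi> n x))"
      by (rule integrable_mult_bounded[OF c_int _ sphi]) measurable
    have "(\<integral>x. \<sigma> t x * (u t x * (\<kappa> * (moll ((x - y n) / reg n) / reg n)) - c t x * \<phi> n x) \<partial>lborel)
        = (\<integral>x. \<kappa> * ((\<sigma> t x * u t x * moll ((x - y n) / reg n)) / reg n) - c t x * (\<sigma> t x * \<phi> n x) \<partial>lborel)"
      by (intro Bochner_Integration.integral_cong) (auto simp: algebra_simps)
    also have "\<dots> = \<kappa> * ((\<integral>x. \<sigma> t x * u t x * moll ((x - y n) / reg n) \<partial>lborel) / reg n) - P n t"
      unfolding P_def using i1 i2 by simp
    finally show ?thesis unfolding Q_def by (simp add: avg_eq[OF reg_pos])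
  qed
  \<comment> \<open>By the weak formulation the sum of these terms is the integral whose limit is
    sought; each of them tends to 0.\<close>
  have "(\<lambda>n. ((\<integral>x. r t1 x * \<phi> n x \<partial>lborel) - (\<integral>x. r t0 x * \<phi> n x \<partial>lborel)) + (LINT t:{t0<..t1}|lborel. P n t)
      + (LINT t:{t0<..t1}|lborel. \<kappa> * (S n t - Q n t))) \<longlonglongrightarrow> (0 - 0) + (LINT t:{t0<..t1}|lborel. 0) + (LINT t:{t0<..t1}|lborel. 0)"
  proof (intro tendsto_add tendsto_diff)
    show "(\<lambda>n. \<integral>x. r t1 x * \<phi> n x \<partial>lborel) \<longlonglongrightarrow> 0"
      using t by (intro tail_integral_tendsto_0 r_int r_0 b lim) auto
    show "(\<lambda>n. \<integral>x. r t0 x * \<phi> n x \<partial>lborel) \<longlonglongrightarrow> 0"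
      using t by (intro tail_integral_tendsto_0 r_int r_0 b lim) auto
    show "(\<lambda>n. LINT t:{t0<..t1}|lborel. P n t) \<longlonglongrightarrow> (LINT t:{t0<..t1}|lborel. 0)"
    proof (rule LINT_Ioc_dominated_convergence[OF _ _ Pb integrable_mult_right[OF bd_int]])
      fix t
      have "(\<lambda>n. \<integral>x. (c t x * \<sigma> t x) * \<phi> n x \<partial>lborel) \<longlonglongrightarrow> 0"
        by (rule tail_integral_tendsto_0[OF _ _ _ b lim]) (auto intro!: transport_slice.integrable_mult_sigma[OF slice] c_int simp: c_0)
      then show "(\<lambda>n. P n t) \<longlonglongrightarrow> 0" by (simp add: P_def mult.assoc)
    qed auto
    show "(\<lambda>n. LINT t:{t0<..t1}|lborel. \<kappa> * (S n t - Q n t)) \<longlonglongrightarrow> (LINT t:{t0<..t1}|lborel. 0)"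
    proof (rule LINT_Ioc_dominated_convergence[where w = "\<lambda>t. 2 * M * bd t"])
      show "\<bar>\<kappa> * (S n t - Q n t)\<bar> \<le> 2 * M * bd t" for n t
        using Sb[of n t] Qb[of n t] \<kappa> by (simp add: abs_mult)
      fix t
      show "(\<lambda>n. \<kappa> * (S n t - Q n t)) \<longlonglongrightarrow> 0"
      proof (rule Lim_null_comparison)
        have "(\<lambda>n. \<integral>x. \<bar>ux t x\<bar> * indicat_real (A n) x \<partial>lborel) \<longlonglongrightarrow> 0"
          by (rule tail_integral_tendsto_0[OF integrable_abs[OF ux_int] _ _ _ A(2)]) (auto simp: ux_0 indicator_def)
        from tendsto_mult_right_zero[OF this, of M]
        show "(\<lambda>n. M * (\<integral>x. \<bar>ux t x\<bar> * indicat_real (A n) x \<partial>lborel)) \<longlonglongrightarrow> 0" .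
        show "\<forall>\<^sub>F n in sequentially. norm (\<kappa> * (S n t - Q n t)) \<le> M * (\<integral>x. \<bar>ux t x\<bar> * indicat_real (A n) x \<partial>lborel)"
        proof (intro always_eventually allI)
          fix n
          define K where "K = M * (\<integral>x. \<bar>ux t x\<bar> * indicat_real (A n) x \<partial>lborel)"
          have K0: "K \<ge> 0" unfolding K_def using M_nonneg by (intro mult_nonneg_nonneg integral_nonneg_AE) auto
          have i1: "integrable lborel (\<lambda>z. \<sigma> t (y n + reg n * z) * moll z)"
            by (rule integrable_mult_Icc[OF _ _ sigma_le moll_bounds(1)]) auto
          have i2: "integrable lborel (\<lambda>z. \<sigma> t (y n + reg n * z) * u t (y n + reg n * z) * moll z)"
            by (rule integrable_mult_Icc[OF _ _ su moll_bounds(1)]) auto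
          have m: "integrable lborel moll"
            using integral_moll by (metis not_integrable_integral_eq zero_neq_one)
          have SQ: "S n t - Q n t = (\<integral>z. u t p * (\<sigma> t (y n + reg n * z) * moll z) - \<sigma> t (y n + reg n * z) * u t (y n + reg n * z) * moll z \<partial>lborel)"
            unfolding S_def Q_def avg_def using i1 i2 by simp
          have "\<bar>S n t - Q n t\<bar> \<le> (\<integral>z. \<bar>u t p * (\<sigma> t (y n + reg n * z) * moll z) - \<sigma> t (y n + reg n * z) * u t (y n + reg n * z) * moll z\<bar> \<partial>lborel)"
            unfolding SQ by (rule integral_abs_bound)
          also have "\<dots> \<le> (\<integral>z. K * moll z \<partial>lborel)"
          proof (rule integral_mono)
            fix z
            show "\<bar>u t p * (\<sigma> t (y n + reg n * z) * moll z) - \<sigma> t (y n + reg n * z) * u t (y n + reg n * z) * moll z\<bar> \<le> K * moll z"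
            proof (cases "z \<in> {0..1}")
              case True
              have fac: "u t p * (\<sigma> t (y n + reg n * z) * moll z) - \<sigma> t (y n + reg n * z) * u t (y n + reg n * z) * moll z
                  = \<sigma> t (y n + reg n * z) * (u t p - u t (y n + reg n * z)) * moll z"
                by (simp add: algebra_simps)
              have "\<bar>u t p * (\<sigma> t (y n + reg n * z) * moll z) - \<sigma> t (y n + reg n * z) * u t (y n + reg n * z) * moll z\<bar>
                  = \<bar>\<sigma> t (y n + reg n * z)\<bar> * \<bar>u t p - u t (y n + reg n * z)\<bar> * moll z"
                unfolding fac abs_mult using moll_nonneg[of z] by simp
              also have "\<dots> \<le> K * moll z"
                unfolding K_def using M_nonneg moll_nonneg by (intro mult_mono mult_right_mono sigma_le osc[OF True]) auto
              finally show ?thesis .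
            next
              case False
              then have "moll z = 0" by (intro moll_eq_0) auto
              then show ?thesis by simp
            qed
          qed (use i1 i2 m in auto)
          also have "\<dots> = K" by (simp add: integral_moll)
          finally show "norm (\<kappa> * (S n t - Q n t)) \<le> K" using \<kappa> by (simp add: abs_mult)
        qed
      qed
    qed (auto intro!: integrable_mult_right bd_int)
  qed
  moreover have "((\<integral>x. r t1 x * \<phi> n x \<partial>lborel) - (\<integral>x. r t0 x * \<phi> n x \<partial>lborel)) + (LINT t:{t0<..t1}|lborel. P n t)
      + (LINT t:{t0<..t1}|lborel. \<kappa> * (S n t - Q n t)) = (LINT t:{t0<..t1}|lborel. \<kappa> * S n t + G0 t * p0 - G1 t * p1)" for n
  proof -
    note sil = set_integrable_lborel[where A = "{t0<..t1}"]
    show ?thesis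
      unfolding weak[OF t D D'] eq p set_lebesgue_integral_def
      using sil[OF iP, of n] sil[OF iQ, of n] sil[OF iS, of n] sil[OF G0_L1] sil[OF G1_L1]
      by (simp add: set_integrable_def algebra_simps)
  qed
  ultimately show ?thesis unfolding S_def by (simp add: set_lebesgue_integral_def)
qed

lemma u_osc:
  assumes "a \<le> b" "{a<..b} \<subseteq> A" "A \<in> sets borel"
  shows "\<bar>u t b - u t a\<bar> \<le> (\<integral>x. \<bar>ux t x\<bar> * indicat_real A x \<partial>lborel)"
proof -
  have "\<bar>u t b - u t a\<bar> \<le> (LINT x:{a<..b}|lborel. \<bar>ux t x\<bar>)"
    unfolding u_diff[OF assms(1)] by (rule LINT_Ioc_abs_le[OF set_integrable_lborel[OF ux_int]]) simp
  also have "\<dots> \<le> (LINT x:A|lborel. \<bar>ux t x\<bar>)"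
    unfolding set_lebesgue_integral_def using assms
    by (intro integral_mono set_integrable_lborel[OF integrable_abs[OF ux_int], unfolded set_integrable_def])
      (auto simp: indicator_def)
  finally show ?thesis by (simp add: set_lebesgue_integral_def mult.commute)
qed

lemma left_flux_tendsto:
  assumes t: "0 \<le> t0" "t0 \<le> t1" "t1 \<le> T"
  shows "(\<lambda>n. LINT t:{t0<..t1}|lborel. u t 0 * avg (reg n) (\<sigma> t) 0) \<longlonglongrightarrow> (LINT t:{t0<..t1}|lborel. G0 t)"
proof -
  have "(\<lambda>n. LINT t:{t0<..t1}|lborel. (-1) * (u t 0 * avg (reg n) (\<sigma> t) 0) + G0 t * 1 - G1 t * 0) \<longlonglongrightarrow> 0"
  \<comment> \<open>The cut-off decreases from 1 at 0 to 0 at reg n, so it keeps G0 and drops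
    G1.\<close>
  proof (rule boundary_flux_tendsto[OF t, where \<phi> = "\<lambda>n x. 1 - moll_step (x / reg n)" and A = "\<lambda>n. {0<..reg n}" and y = "\<lambda>_. 0"])
    show "((\<lambda>x. 1 - moll_step (x / reg n)) has_real_derivative -1 * (moll ((x - 0) / reg n) / reg n)) (at x)" for n x
    proof -
      have "((\<lambda>x. x / reg n) has_real_derivative 1 / reg n) (at x)"
        using reg_pos[of n] by (auto intro!: derivative_eq_intros)
      from DERIV_diff[OF DERIV_const DERIV_chain2[OF DERIV_moll_step this], of 1] show ?thesis by simp
    qed
    show "\<bar>1 - moll_step (x / reg n)\<bar> \<le> 1" for n x using moll_step_bounds[of "x / reg n"] by simp
    show "(\<lambda>n. 1 - moll_step (x / reg n)) \<longlonglongrightarrow> 0" if "x \<in> {0<..<1}" for x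
    proof (rule tendsto_eventually)
      show "\<forall>\<^sub>F n in sequentially. 1 - moll_step (x / reg n) = 0"
        using reg_eventually_le[of x] that
        by (auto elim!: eventually_mono intro!: moll_step_1 simp: pos_le_divide_eq[OF reg_pos])
    qed
    show "1 - moll_step (1 / reg n) = 0" for n
      using reg_le[of n] by (simp add: moll_step_1 pos_le_divide_eq[OF reg_pos])
    show "\<bar>u t 0 - u t (0 + reg n * z)\<bar> \<le> (\<integral>x. \<bar>ux t x\<bar> * indicat_real {0<..reg n} x \<partial>lborel)" if z: "z \<in> {0..1}" for n t z
    proof -
      have "reg n * z \<le> reg n" "0 \<le> reg n * z" using z reg_pos[of n] by (auto intro: mult_left_le)
      moreover from this have "{0<..reg n * z} \<subseteq> {0<..reg n}" by auto
      ultimately show ?thesis using u_osc[of 0 "reg n * z" "{0<..reg n}" t] by (simp add: abs_minus_commute)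
    qed
  qed (auto simp: moll_step_0 intro: tail_sets)
  moreover have iS: "integrable lborel (\<lambda>t. u t 0 * avg (reg n) (\<sigma> t) 0)" for n
  proof (rule integrable_bd)
    show "\<bar>u t 0 * avg (reg n) (\<sigma> t) 0\<bar> \<le> M * bd t" for t
      unfolding abs_mult mult.commute[of M]
      by (intro mult_mono u_le avg_bound[OF transport_slice.sigma_measurable[OF slice] sigma_le] bd_nonneg) auto
  qed measurable
  have "(LINT t:{t0<..t1}|lborel. (-1) * (u t 0 * avg (reg n) (\<sigma> t) 0) + G0 t * 1 - G1 t * 0)
      = (LINT t:{t0<..t1}|lborel. G0 t) - (LINT t:{t0<..t1}|lborel. u t 0 * avg (reg n) (\<sigma> t) 0)" for n
    by (subst set_integral_diff(2)[symmetric]) (auto intro!: set_integrable_lborel G0_L1 iS)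
  ultimately have "(\<lambda>n. (LINT t:{t0<..t1}|lborel. G0 t) - (LINT t:{t0<..t1}|lborel. u t 0 * avg (reg n) (\<sigma> t) 0)) \<longlonglongrightarrow> 0"
    by simp
  from tendsto_diff[OF tendsto_const this, of "LINT t:{t0<..t1}|lborel. G0 t"] show ?thesis by simp
qed

lemma right_flux_tendsto:
  assumes t: "0 \<le> t0" "t0 \<le> t1" "t1 \<le> T"
  shows "(\<lambda>n. LINT t:{t0<..t1}|lborel. u t 1 * avg (reg n) (\<sigma> t) (1 - reg n)) \<longlonglongrightarrow> (LINT t:{t0<..t1}|lborel. G1 t)"
proof -
  have "(\<lambda>n. LINT t:{t0<..t1}|lborel. 1 * (u t 1 * avg (reg n) (\<sigma> t) (1 - reg n)) + G0 t * 0 - G1 t * 1) \<longlonglongrightarrow> 0"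
  \<comment> \<open>The window has to start at 1 - reg n, as the average looks to the right and
    \<sigma> vanishes beyond 1.\<close>
  proof (rule boundary_flux_tendsto[OF t, where \<phi> = "\<lambda>n x. moll_step ((x - (1 - reg n)) / reg n)" and A = "\<lambda>n. {1 - reg n<..}" and y = "\<lambda>n. 1 - reg n"])
    show "((\<lambda>x. moll_step ((x - (1 - reg n)) / reg n)) has_real_derivative 1 * (moll ((x - (1 - reg n)) / reg n) / reg n)) (at x)" for n x
    proof -
      have "((\<lambda>x. (x - (1 - reg n)) / reg n) has_real_derivative 1 / reg n) (at x)"
        using reg_pos[of n] by (auto intro!: derivative_eq_intros)
      from DERIV_chain2[OF DERIV_moll_step this] show ?thesis by simp
    qed
    show "\<bar>moll_step ((x - (1 - reg n)) / reg n)\<bar> \<le> 1" for n x using moll_step_bounds[of "(x - (1 - reg n)) / reg n"] by simp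
    show "(\<lambda>n. moll_step ((x - (1 - reg n)) / reg n)) \<longlonglongrightarrow> 0" if "x \<in> {0<..<1}" for x
    proof (rule tendsto_eventually)
      have "\<forall>\<^sub>F n in sequentially. reg n \<le> 1 - x" using that by (intro reg_eventually_le) auto
      then show "\<forall>\<^sub>F n in sequentially. moll_step ((x - (1 - reg n)) / reg n) = 0"
        by (rule eventually_mono) (intro moll_step_0 divide_nonpos_pos reg_pos, simp)
    qed
    show "moll_step ((0 - (1 - reg n)) / reg n) = 0" for n
      using reg_le[of n] by (intro moll_step_0 divide_nonpos_pos reg_pos) simp
    show "moll_step ((1 - (1 - reg n)) / reg n) = 1" for n
      using reg_pos[of n] by (simp add: moll_step_1)
    show "\<bar>u t 1 - u t (1 - reg n + reg n * z)\<bar> \<le> (\<integral>x. \<bar>ux t x\<bar> * indicat_real {1 - reg n<..} x \<partial>lborel)" if z: "z \<in> {0..1}" for n t z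
    proof -
      have "reg n * z \<le> reg n" "0 \<le> reg n * z" using z reg_pos[of n] by (auto intro: mult_left_le)
      moreover from this have "{1 - reg n + reg n * z<..1} \<subseteq> {1 - reg n<..}" by auto
      ultimately show ?thesis using u_osc[of "1 - reg n + reg n * z" 1 "{1 - reg n<..}" t] by simp
    qed
  qed (auto intro: tail_sets)
  moreover have iS: "integrable lborel (\<lambda>t. u t 1 * avg (reg n) (\<sigma> t) (1 - reg n))" for n
  proof (rule integrable_bd)
    show "\<bar>u t 1 * avg (reg n) (\<sigma> t) (1 - reg n)\<bar> \<le> M * bd t" for t
      unfolding abs_mult mult.commute[of M]
      by (intro mult_mono u_le avg_bound[OF transport_slice.sigma_measurable[OF slice] sigma_le] bd_nonneg) auto
  qed measurable
  have "(LINT t:{t0<..t1}|lborel. 1 * (u t 1 * avg (reg n) (\<sigma> t) (1 - reg n)) + G0 t * 0 - G1 t * 1)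
      = (LINT t:{t0<..t1}|lborel. u t 1 * avg (reg n) (\<sigma> t) (1 - reg n)) - (LINT t:{t0<..t1}|lborel. G1 t)" for n
    by (subst set_integral_diff(2)[symmetric]) (auto intro!: set_integrable_lborel G1_L1 iS)
  ultimately have "(\<lambda>n. (LINT t:{t0<..t1}|lborel. u t 1 * avg (reg n) (\<sigma> t) (1 - reg n)) - (LINT t:{t0<..t1}|lborel. G1 t)) \<longlonglongrightarrow> 0"
    by simp
  then show ?thesis by (simp add: LIM_zero_iff)
qed

text \<open>
  The energy is estimated on intervals \<open>[a, b]\<close> with \<open>a\<close> in \<open>[-reg n, 0]\<close> and \<open>b\<close> in
  \<open>[1 - reg n, 1]\<close>; \<open>h\<close> bounds the limit of what each end point contributes. Starting at
  \<open>-reg n\<close> sees all of the inflow, starting at \<open>0\<close> all of the outflow; the minimum of the two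
  bounds is \<open>u \<bar>\<gamma>\<sigma>\<bar>\<close>. At the right end point, \<open>1\<close> and \<open>1 - reg n\<close> play these roles.
\<close>

definition left_bound :: "(real \<Rightarrow> real) \<Rightarrow> bool" where
  "left_bound h \<longleftrightarrow> integrable lborel h \<and> (\<exists>a X. (\<forall>n. - reg n \<le> a n \<and> a n \<le> 0 \<and> integrable lborel (X n)) \<and>
     (\<forall>n b t. u t (a n) * sabs (reg n) (avg (reg n) (\<sigma> t) (a n)) + G0 t * src 0 (reg n) (a n) b t \<le> X n t) \<and>
     (\<forall>t0 t1. 0 \<le> t0 \<and> t0 \<le> t1 \<and> t1 \<le> T \<longrightarrow>
        (\<lambda>n. LINT t:{t0<..t1}|lborel. X n t) \<longlonglongrightarrow> (LINT t:{t0<..t1}|lborel. h t)))"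

definition right_bound :: "(real \<Rightarrow> real) \<Rightarrow> bool" where
  "right_bound h \<longleftrightarrow> integrable lborel h \<and> (\<exists>b X. (\<forall>n. 1 - reg n \<le> b n \<and> b n \<le> 1 \<and> integrable lborel (X n)) \<and>
     (\<forall>n a t. - u t (b n) * sabs (reg n) (avg (reg n) (\<sigma> t) (b n)) - G1 t * src 1 (reg n) a (b n) t \<le> X n t) \<and>
     (\<forall>t0 t1. 0 \<le> t0 \<and> t0 \<le> t1 \<and> t1 \<le> T \<longrightarrow>
        (\<lambda>n. LINT t:{t0<..t1}|lborel. X n t) \<longlonglongrightarrow> (LINT t:{t0<..t1}|lborel. h t)))"

lemma left_bound_full: "left_bound (\<lambda>t. \<bar>G0 t\<bar>)"
  unfolding left_bound_def
proof (intro conjI exI[of _ "\<lambda>n. - reg n"] exI[of _ "\<lambda>_ t. \<bar>G0 t\<bar>"] allI impI)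
  fix n b t
  \<comment> \<open>The window of this average ends at 0 and misses the support of \<sigma>. The
    transport flux at the end point is therefore zero and only the source remains.\<close>
  have "avg (reg n) (\<sigma> t) (- reg n) = 0"
  proof -
    have "\<sigma> t (- reg n + reg n * z) * moll z = 0" for z
    proof (cases "z \<le> 1")
      case True
      then have "reg n * z \<le> reg n * 1" using reg_pos[of n] by (intro mult_left_mono) auto
      then show ?thesis by (simp add: sigma_0)
    next
      case False
      then show ?thesis by (simp add: moll_eq_0)
    qed
    then show ?thesis by (simp only: avg_def) simp
  qed
  moreover have "G0 t * src 0 (reg n) (- reg n) b t \<le> \<bar>G0 t\<bar>"
    using mult_left_mono[OF abs_src_le[OF reg_pos[of n], of 0 "- reg n" b t] abs_ge_zero[of "G0 t"]]
    by (metis abs_ge_self abs_mult mult_1_right order_trans)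
  ultimately show "u t (- reg n) * sabs (reg n) (avg (reg n) (\<sigma> t) (- reg n)) + G0 t * src 0 (reg n) (- reg n) b t \<le> \<bar>G0 t\<bar>"
    by (simp add: sabs_0[OF reg_pos])
qed (use reg_pos less_imp_le G0_L1 in auto)

lemma right_bound_full: "right_bound (\<lambda>t. \<bar>G1 t\<bar>)"
  unfolding right_bound_def
proof (intro conjI exI[of _ "\<lambda>n. 1"] exI[of _ "\<lambda>_ t. \<bar>G1 t\<bar>"] allI impI)
  fix n a t
  \<comment> \<open>The window starts at 1, again outside the support of \<sigma>.\<close>
  have "avg (reg n) (\<sigma> t) 1 = 0"
  proof -
    have "\<sigma> t (1 + reg n * z) * moll z = 0" for z
    proof (cases "z \<ge> 0")
      case True
      then have "0 \<le> reg n * z" using reg_pos[of n] by simp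
      then show ?thesis by (simp add: sigma_0)
    next
      case False
      then show ?thesis by (simp add: moll_eq_0)
    qed
    then show ?thesis by (simp only: avg_def) simp
  qed
  moreover have "- (G1 t * src 1 (reg n) a 1 t) \<le> \<bar>G1 t\<bar>"
    using mult_left_mono[OF abs_src_le[OF reg_pos[of n], of 1 a 1 t] abs_ge_zero[of "G1 t"]]
    by (metis abs_ge_minus_self abs_mult mult_1_right order_trans)
  ultimately show "- u t 1 * sabs (reg n) (avg (reg n) (\<sigma> t) 1) - G1 t * src 1 (reg n) a 1 t \<le> \<bar>G1 t\<bar>"
    by (simp add: sabs_0[OF reg_pos])
qed (use reg_pos less_imp_le G1_L1 in auto)

text \<open>
  On the outflow part \<open>v \<le> 0\<close> the right-hand side is \<open>s v a\<close> up to a vanishing term; as it is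
  linear in \<open>a\<close>, it passes to the weak limit for either sign \<open>s\<close>.
\<close>

lemma outflow_bound:
  fixes v a s :: real
  assumes e: "e > 0" and a: "\<bar>a\<bar> \<le> M" and s: "s = 1 \<or> s = -1"
  shows "v * sabs e a \<le> 2 * M * max v 0 + e * \<bar>v\<bar> + s * (v * a)"
proof (cases "v \<ge> 0")
  case True
  \<comment> \<open>For v > 0 the bound may be generous: v M for the left-hand side and another v M
    in case s v a is negative.\<close>
  have "v * sabs e a \<le> v * M" using True sabs_le(1)[OF e, of a] a by (intro mult_left_mono) auto
  moreover have "v * (- M) \<le> v * (s * a)" using True a s by (intro mult_left_mono) auto
  ultimately show ?thesis using True mult_nonneg_nonneg[OF less_imp_le[OF e] True] by (simp add: algebra_simps)
next
  case False
  have "v * sabs e a \<le> v * (\<bar>a\<bar> - e)" using False sabs_le(2)[OF e, of a] by (intro mult_left_mono_neg) auto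
  also have "\<dots> = e * \<bar>v\<bar> + v * \<bar>a\<bar>" using False by (simp add: algebra_simps)
  also have "v * \<bar>a\<bar> \<le> v * (s * a)" using False s by (intro mult_left_mono_neg) auto
  finally show ?thesis using False by (simp add: algebra_simps)
qed

text \<open>Starting at 0 excludes the point source, which is supported in [-reg n, 0]. What is left
  is the transport flux, and after \<open>outflow_bound\<close> it enters linearly, so
  \<open>left_flux_tendsto\<close> identifies the limit.\<close>

lemma left_bound_outflow:
  assumes s: "s = 1 \<or> s = -1"
  shows "left_bound (\<lambda>t. 2 * M * max (u t 0) 0 + s * G0 t)"
  unfolding left_bound_def
proof (intro conjI exI[of _ "\<lambda>n. 0"] exI[of _ "\<lambda>n t. (2 * M * max (u t 0) 0 + reg n * \<bar>u t 0\<bar>) + s * (u t 0 * avg (reg n) (\<sigma> t) 0)"] allI impI)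
  have avb: "\<bar>avg (reg n) (\<sigma> t) y\<bar> \<le> M" for n t y
    by (rule avg_bound[OF transport_slice.sigma_measurable[OF slice] sigma_le])
  have i1: "integrable lborel (\<lambda>t. 2 * M * max (u t 0) 0)"
    by (intro integrable_mult_right integrable_max u0_L1) auto
  have i2: "integrable lborel (\<lambda>t. \<bar>u t 0\<bar>)" using u0_L1 by simp
  have iS: "integrable lborel (\<lambda>t. u t 0 * avg (reg n) (\<sigma> t) 0)" for n
  proof (rule integrable_bd)
    show "\<bar>u t 0 * avg (reg n) (\<sigma> t) 0\<bar> \<le> M * bd t" for t
      unfolding abs_mult mult.commute[of M] by (intro mult_mono u_le avb bd_nonneg) auto
  qed measurable
  show "integrable lborel (\<lambda>t. 2 * M * max (u t 0) 0 + s * G0 t)"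
    by (intro Bochner_Integration.integrable_add i1 integrable_mult_right G0_L1)
  show "integrable lborel (\<lambda>t. (2 * M * max (u t 0) 0 + reg n * \<bar>u t 0\<bar>) + s * (u t 0 * avg (reg n) (\<sigma> t) 0))" for n
    by (intro Bochner_Integration.integrable_add i1 i2 integrable_mult_right iS)
  fix n b t
  have "src 0 (reg n) 0 b t = 0"
  proof -
    have "(\<lambda>y. indicat_real {0<..b} y *\<^sub>R (sabs' (reg n) (avg (reg n) (\<sigma> t) y) * (moll ((0 - y) / reg n) / reg n))) = (\<lambda>_. 0)"
    proof
      fix y
      show "indicat_real {0<..b} y *\<^sub>R (sabs' (reg n) (avg (reg n) (\<sigma> t) y) * (moll ((0 - y) / reg n) / reg n)) = 0"
      proof (cases "y \<in> {0<..b}")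
        case True
        then have "(0 - y) / reg n \<le> 0" using reg_pos[of n] by (simp add: divide_nonneg_pos)
        then show ?thesis by (simp add: moll_eq_0)
      qed simp
    qed
    then show ?thesis by (simp only: src_def set_lebesgue_integral_def) simp
  qed
  then show "u t 0 * sabs (reg n) (avg (reg n) (\<sigma> t) 0) + G0 t * src 0 (reg n) 0 b t
      \<le> (2 * M * max (u t 0) 0 + reg n * \<bar>u t 0\<bar>) + s * (u t 0 * avg (reg n) (\<sigma> t) 0)"
    using outflow_bound[OF reg_pos avb s] by simp
next
  fix t0 t1 assume t: "0 \<le> t0 \<and> t0 \<le> t1 \<and> t1 \<le> T"
  have avb: "\<bar>avg (reg n) (\<sigma> t) y\<bar> \<le> M" for n t y
    by (rule avg_bound[OF transport_slice.sigma_measurable[OF slice] sigma_le])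
  have i1: "set_integrable lborel {t0<..t1} (\<lambda>t. 2 * M * max (u t 0) 0)"
    by (intro set_integrable_lborel integrable_mult_right integrable_max u0_L1) auto
  have i2: "set_integrable lborel {t0<..t1} (\<lambda>t. \<bar>u t 0\<bar>)" using u0_L1 by (intro set_integrable_lborel) auto
  have i3: "set_integrable lborel {t0<..t1} G0" using G0_L1 by (intro set_integrable_lborel) auto
  have iS: "set_integrable lborel {t0<..t1} (\<lambda>t. u t 0 * avg (reg n) (\<sigma> t) 0)" for n
  proof (rule set_integrable_lborel[OF integrable_bd])
    show "\<bar>u t 0 * avg (reg n) (\<sigma> t) 0\<bar> \<le> M * bd t" for t
      unfolding abs_mult mult.commute[of M] by (intro mult_mono u_le avb bd_nonneg) auto
  qed measurable
  have eqn: "(LINT t:{t0<..t1}|lborel. (2 * M * max (u t 0) 0 + reg n * \<bar>u t 0\<bar>) + s * (u t 0 * avg (reg n) (\<sigma> t) 0))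
     = ((LINT t:{t0<..t1}|lborel. 2 * M * max (u t 0) 0) + reg n * (LINT t:{t0<..t1}|lborel. \<bar>u t 0\<bar>)) + s * (LINT t:{t0<..t1}|lborel. u t 0 * avg (reg n) (\<sigma> t) 0)" for n
    by (simp only: set_integral_add(2)[OF set_integral_add(1)[OF i1 set_integrable_mult_right[OF i2]] set_integrable_mult_right[OF iS]]
        set_integral_add(2)[OF i1 set_integrable_mult_right[OF i2]] set_integral_mult_right)
  have eq: "(LINT t:{t0<..t1}|lborel. 2 * M * max (u t 0) 0 + s * G0 t)
     = ((LINT t:{t0<..t1}|lborel. 2 * M * max (u t 0) 0) + 0 * (LINT t:{t0<..t1}|lborel. \<bar>u t 0\<bar>)) + s * (LINT t:{t0<..t1}|lborel. G0 t)"
    by (simp only: set_integral_add(2)[OF i1 set_integrable_mult_right[OF i3]] set_integral_mult_right)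
  show "(\<lambda>n. LINT t:{t0<..t1}|lborel. (2 * M * max (u t 0) 0 + reg n * \<bar>u t 0\<bar>) + s * (u t 0 * avg (reg n) (\<sigma> t) 0))
      \<longlonglongrightarrow> (LINT t:{t0<..t1}|lborel. 2 * M * max (u t 0) 0 + s * G0 t)"
    unfolding eqn eq
    using t by (intro tendsto_add tendsto_const tendsto_mult reg_lim left_flux_tendsto) auto
qed (use reg_pos less_imp_le in auto)

text \<open>The mirror image of \<open>left_bound_outflow\<close> with one difference: the flux is
  taken at 1 - reg n, while the limit is known with u at the end point itself. \<open>V\<close> is
  the variation of u in between and vanishes in the limit.\<close>

lemma right_bound_outflow:
  assumes s: "s = 1 \<or> s = -1"
  shows "right_bound (\<lambda>t. 2 * M * max (- u t 1) 0 + s * G1 t)"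
proof -
  define V where "V n t = (\<integral>x. \<bar>ux t x\<bar> * indicat_real {1 - reg n<..} x \<partial>lborel)" for n t
  define X where "X n t = (2 * M * max (- u t 1) 0 + reg n * \<bar>u t 1\<bar>) + (M * V n t + s * (u t 1 * avg (reg n) (\<sigma> t) (1 - reg n)))" for n t
  have avb: "\<bar>avg (reg n) (\<sigma> t) y\<bar> \<le> M" for n t y
    by (rule avg_bound[OF transport_slice.sigma_measurable[OF slice] sigma_le])
  have u1: "integrable lborel (\<lambda>t. u t 1)"
    by (rule integrable_bd[where K = 1]) (auto simp: u_le)
  have V0: "V n t \<ge> 0" for n t unfolding V_def by (intro integral_nonneg_AE) auto
  have [measurable]: "V n \<in> borel_measurable borel" for n unfolding V_def by measurable
  have Vb: "\<bar>V n t\<bar> \<le> 1 * bd t" for n t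
  proof -
    have "V n t \<le> (\<integral>x. \<bar>ux t x\<bar> \<partial>lborel)" unfolding V_def
      using integrable_abs[OF ux_int[of t]]
      by (intro integral_mono integrable_mult_bounded[where C = 1]) (auto simp: indicator_def)
    then show ?thesis using V0[of n t] bd_ge(2)[of t] by simp
  qed
  have iV: "integrable lborel (V n)" for n by (rule integrable_bd[OF _ Vb]) measurable
  have limV: "(\<lambda>n. LINT t:{t0<..t1}|lborel. V n t) \<longlonglongrightarrow> (LINT t:{t0<..t1}|lborel. 0)" for t0 t1
  proof (rule LINT_Ioc_dominated_convergence[OF _ _ Vb])
    show "(\<lambda>n. V n t) \<longlonglongrightarrow> 0" for t
      unfolding V_def by (rule tail_abs(1)[OF ux_int ux_0])
  qed (auto intro: bd_int)
  have j1: "integrable lborel (\<lambda>t. 2 * M * max (- u t 1) 0)"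
    by (intro integrable_mult_right integrable_max Bochner_Integration.integrable_minus u1) auto
  have j2: "integrable lborel (\<lambda>t. \<bar>u t 1\<bar>)" using u1 by simp
  have jS: "integrable lborel (\<lambda>t. u t 1 * avg (reg n) (\<sigma> t) (1 - reg n))" for n
  proof (rule integrable_bd)
    show "\<bar>u t 1 * avg (reg n) (\<sigma> t) (1 - reg n)\<bar> \<le> M * bd t" for t
      unfolding abs_mult mult.commute[of M] by (intro mult_mono u_le avb bd_nonneg) auto
  qed measurable
  have iX: "integrable lborel (X n)" for n
    unfolding X_def by (intro Bochner_Integration.integrable_add j1 j2 iV integrable_mult_right jS)
  have bound: "- u t (1 - reg n) * sabs (reg n) (avg (reg n) (\<sigma> t) (1 - reg n)) - G1 t * src 1 (reg n) a (1 - reg n) t \<le> X n t" for n a t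
  proof -
    let ?a = "avg (reg n) (\<sigma> t) (1 - reg n)"
    have src: "src 1 (reg n) a (1 - reg n) t = 0"
    proof -
      have "(\<lambda>y. indicat_real {a<..1 - reg n} y *\<^sub>R (sabs' (reg n) (avg (reg n) (\<sigma> t) y) * (moll ((1 - y) / reg n) / reg n))) = (\<lambda>_. 0)"
      proof
        fix y
        show "indicat_real {a<..1 - reg n} y *\<^sub>R (sabs' (reg n) (avg (reg n) (\<sigma> t) y) * (moll ((1 - y) / reg n) / reg n)) = 0"
        proof (cases "y \<in> {a<..1 - reg n}")
          case True
          then have "1 \<le> (1 - y) / reg n" using reg_pos[of n] by (simp add: pos_le_divide_eq)
          then show ?thesis by (simp add: moll_eq_0)
        qed simp
      qed
      then show ?thesis by (simp only: src_def set_lebesgue_integral_def) simp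
    qed
    have sb: "0 \<le> sabs (reg n) ?a" "sabs (reg n) ?a \<le> M"
      using sabs_le(1,3)[OF reg_pos[of n], of ?a] avb[of n t "1 - reg n"] by auto
    have "\<bar>u t 1 - u t (1 - reg n)\<bar> \<le> V n t"
      unfolding V_def using reg_pos[of n] by (intro u_osc) auto
    then have "(u t 1 - u t (1 - reg n)) * sabs (reg n) ?a \<le> V n t * M"
      using sb V0[of n t] by (intro mult_mono) auto
    \<comment> \<open>Here v = -u t 1, positive for inflow at the right end. The sign is passed as
      -s so that the linear term becomes s u a.\<close>
    moreover have "- u t 1 * sabs (reg n) ?a \<le> 2 * M * max (- u t 1) 0 + reg n * \<bar>- u t 1\<bar> + (- s) * (- u t 1 * ?a)"
      by (rule outflow_bound[OF reg_pos avb]) (use s in auto)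
    ultimately show ?thesis unfolding src X_def by (simp add: algebra_simps)
  qed
  have lim: "(\<lambda>n. LINT t:{t0<..t1}|lborel. X n t) \<longlonglongrightarrow> (LINT t:{t0<..t1}|lborel. 2 * M * max (- u t 1) 0 + s * G1 t)"
    if t: "0 \<le> t0 \<and> t0 \<le> t1 \<and> t1 \<le> T" for t0 t1
  proof -
    note sil = set_integrable_lborel[where A = "{t0<..t1}"]
    have i1: "set_integrable lborel {t0<..t1} (\<lambda>t. 2 * M * max (- u t 1) 0)" by (rule sil[OF j1]) simp
    have i2: "set_integrable lborel {t0<..t1} (\<lambda>t. \<bar>u t 1\<bar>)" by (rule sil[OF j2]) simp
    have i3: "set_integrable lborel {t0<..t1} G1" by (rule sil[OF G1_L1]) simp
    have iS: "set_integrable lborel {t0<..t1} (\<lambda>t. u t 1 * avg (reg n) (\<sigma> t) (1 - reg n))" for n by (rule sil[OF jS]) simp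
    have iV': "set_integrable lborel {t0<..t1} (V n)" for n by (rule sil[OF iV]) simp
    have eqn: "(LINT t:{t0<..t1}|lborel. X n t)
       = ((LINT t:{t0<..t1}|lborel. 2 * M * max (- u t 1) 0) + reg n * (LINT t:{t0<..t1}|lborel. \<bar>u t 1\<bar>))
        + (M * (LINT t:{t0<..t1}|lborel. V n t) + s * (LINT t:{t0<..t1}|lborel. u t 1 * avg (reg n) (\<sigma> t) (1 - reg n)))" for n
      unfolding X_def
      by (simp only: set_integral_add(2)[OF set_integral_add(1)[OF i1 set_integrable_mult_right[OF i2]]
          set_integral_add(1)[OF set_integrable_mult_right[OF iV'] set_integrable_mult_right[OF iS]]]
          set_integral_add(2)[OF i1 set_integrable_mult_right[OF i2]]
          set_integral_add(2)[OF set_integrable_mult_right[OF iV'] set_integrable_mult_right[OF iS]] set_integral_mult_right)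
    have eq: "(LINT t:{t0<..t1}|lborel. 2 * M * max (- u t 1) 0 + s * G1 t)
       = ((LINT t:{t0<..t1}|lborel. 2 * M * max (- u t 1) 0) + 0 * (LINT t:{t0<..t1}|lborel. \<bar>u t 1\<bar>))
         + (M * (LINT t:{t0<..t1}|lborel. 0) + s * (LINT t:{t0<..t1}|lborel. G1 t))"
      by (simp only: set_integral_add(2)[OF i1 set_integrable_mult_right[OF i3]] set_integral_mult_right) simp
    show ?thesis
      unfolding eqn eq
      using t by (intro tendsto_add tendsto_const tendsto_mult reg_lim right_flux_tendsto limV) auto
  qed
  show ?thesis
    unfolding right_bound_def
    by (intro conjI exI[of _ "\<lambda>n. 1 - reg n"] exI[of _ X] allI impI)
      (use bound lim iX less_imp_le[OF reg_pos] in \<open>auto intro!: Bochner_Integration.integrable_add j1 integrable_mult_right G1_L1\<close>)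
qed

section \<open>The energy inequality with the modulus of the boundary flux\<close>

definition energy :: "real \<Rightarrow> real" where "energy t = (\<integral>x. \<bar>r t x\<bar> \<partial>lborel)"

text \<open>The bound is required over all subintervals and not only from time 0, because only then
  is the property stable under minimum.\<close>

definition rate_bound_fun :: "(real \<Rightarrow> real) \<Rightarrow> bool" where
  "rate_bound_fun f \<longleftrightarrow> integrable lborel f \<and> (\<forall>t0 t1. 0 \<le> t0 \<longrightarrow> t0 \<le> t1 \<longrightarrow> t1 \<le> T \<longrightarrow>
     energy t1 - energy t0 \<le> (LINT t:{t0<..t1}|lborel. f t))"

text \<open>The majorant at the left end holds for every b and the one at the right end for every a,
  so the bounds for the two ends can be combined freely.\<close>

lemma rate_bound_fun_add:
  assumes "left_bound h" "right_bound k"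
  shows "rate_bound_fun (\<lambda>t. h t + k t - absorption t)"
proof -
  obtain a X where a: "\<And>n. - reg n \<le> a n" "\<And>n. a n \<le> 0" and iX: "\<And>n. integrable lborel (X n)"
    and X: "\<And>n b t. u t (a n) * sabs (reg n) (avg (reg n) (\<sigma> t) (a n)) + G0 t * src 0 (reg n) (a n) b t \<le> X n t"
    and limX: "\<And>t0 t1. 0 \<le> t0 \<and> t0 \<le> t1 \<and> t1 \<le> T \<Longrightarrow> (\<lambda>n. LINT t:{t0<..t1}|lborel. X n t) \<longlonglongrightarrow> (LINT t:{t0<..t1}|lborel. h t)"
    using assms(1) unfolding left_bound_def by blast
  obtain b Y where b: "\<And>n. 1 - reg n \<le> b n" "\<And>n. b n \<le> 1" and iY: "\<And>n. integrable lborel (Y n)"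
    and Y: "\<And>n a t. - u t (b n) * sabs (reg n) (avg (reg n) (\<sigma> t) (b n)) - G1 t * src 1 (reg n) a (b n) t \<le> Y n t"
    and limY: "\<And>t0 t1. 0 \<le> t0 \<and> t0 \<le> t1 \<and> t1 \<le> T \<Longrightarrow> (\<lambda>n. LINT t:{t0<..t1}|lborel. Y n t) \<longlonglongrightarrow> (LINT t:{t0<..t1}|lborel. k t)"
    using assms(2) unfolding right_bound_def by blast
  have ih: "integrable lborel h" and ik: "integrable lborel k"
    using assms by (auto simp: left_bound_def right_bound_def)
  show ?thesis
    unfolding rate_bound_fun_def
  proof (intro conjI allI impI)
    show "integrable lborel (\<lambda>t. h t + k t - absorption t)" using ih ik absorption_int by auto
    fix t0 t1 assume t: "0 \<le> t0" "t0 \<le> t1" "t1 \<le> T"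
    note sil = set_integrable_lborel[where A = "{t0<..t1}"]
    have "energy t1 - energy t0 \<le> - (LINT t:{t0<..t1}|lborel. absorption t) + (LINT t:{t0<..t1}|lborel. h t) + (LINT t:{t0<..t1}|lborel. k t)"
      unfolding energy_def using t by (intro energy_limit[OF t a b X iX limX Y iY limY]) auto
    also have "\<dots> = (LINT t:{t0<..t1}|lborel. h t + k t - absorption t)"
      unfolding set_lebesgue_integral_def
      using sil[OF ih] sil[OF ik] sil[OF absorption_int] by (simp add: set_integrable_def algebra_simps)
    finally show "energy t1 - energy t0 \<le> (LINT t:{t0<..t1}|lborel. h t + k t - absorption t)" .
  qed
qed

lemma rate_bound_fun_min:
  assumes "rate_bound_fun f" "rate_bound_fun g"
  shows "rate_bound_fun (\<lambda>t. min (f t) (g t))"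
  using assms unfolding rate_bound_fun_def
  by (auto intro!: increment_le_integral_min)

text \<open>Three bounds at each end give nine rates, and their minimum is again a rate. If u t 0 >
  0, the bound |G0| is taken. Otherwise 2 M max (u t 0) 0 is zero and the sign opposite to that of
  G0 leaves -|G0|; for u t 0 = 0 this lies below the asserted 0. The right end is treated likewise.
  As G0 stands for u times the trace, sgn (u t 0) |G0 t| is u times the modulus of the
  trace.\<close>

theorem energy_inequality:
  assumes t: "0 \<le> t0" "t0 \<le> t1" "t1 \<le> T"
  shows "energy t1 - energy t0 \<le> (LINT t:{t0<..t1}|lborel. sgn (u t 0) * \<bar>G0 t\<bar> - sgn (u t 1) * \<bar>G1 t\<bar> - absorption t)"
proof -
  define hL :: "nat \<Rightarrow> real \<Rightarrow> real" where
    "hL i t = (if i = 0 then \<bar>G0 t\<bar> else 2 * M * max (u t 0) 0 + (if i = 1 then 1 else -1) * G0 t)" for i t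
  define hR :: "nat \<Rightarrow> real \<Rightarrow> real" where
    "hR i t = (if i = 0 then \<bar>G1 t\<bar> else 2 * M * max (- u t 1) 0 + (if i = 1 then 1 else -1) * G1 t)" for i t
  have L: "left_bound (hL i)" for i
    unfolding hL_def using left_bound_full left_bound_outflow[of 1] left_bound_outflow[of "-1"] by (cases "i = 0"; cases "i = 1") auto
  have R: "right_bound (hR i)" for i
    unfolding hR_def using right_bound_full right_bound_outflow[of 1] right_bound_outflow[of "-1"] by (cases "i = 0"; cases "i = 1") auto
  define f where "f i j t = hL i t + hR j t - absorption t" for i j t
  have f: "rate_bound_fun (f i j)" for i j
    unfolding f_def by (rule rate_bound_fun_add[OF L R])
  define g where "g j t = min (f 0 j t) (min (f 1 j t) (f 2 j t))" for j t
  have g: "rate_bound_fun (g j)" for j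
    unfolding g_def by (intro rate_bound_fun_min f)
  define F where "F t = min (g 0 t) (min (g 1 t) (g 2 t))" for t
  have F: "rate_bound_fun F"
    unfolding F_def by (intro rate_bound_fun_min g)
  have "energy t1 - energy t0 \<le> (LINT t:{t0<..t1}|lborel. F t)"
    using F t by (auto simp: rate_bound_fun_def)
  also have "\<dots> \<le> (LINT t:{t0<..t1}|lborel. sgn (u t 0) * \<bar>G0 t\<bar> - sgn (u t 1) * \<bar>G1 t\<bar> - absorption t)"
  proof (rule LINT_Ioc_mono)
    show "set_integrable lborel {t0<..t1} F"
      using F by (intro set_integrable_lborel) (auto simp: rate_bound_fun_def)
    have [measurable]: "(\<lambda>t. u t p) \<in> borel_measurable borel" for p by measurable
    have sg: "integrable lborel (\<lambda>t. sgn (u t p) * \<bar>G t\<bar>)" if "integrable lborel G" for p G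
      using integrable_mult_bounded[OF integrable_abs[OF that], of "\<lambda>t. sgn (u t p)" 1]
      by (simp add: mult.commute abs_sgn_eq)
    show "set_integrable lborel {t0<..t1} (\<lambda>t. sgn (u t 0) * \<bar>G0 t\<bar> - sgn (u t 1) * \<bar>G1 t\<bar> - absorption t)"
      by (intro set_integrable_lborel Bochner_Integration.integrable_diff sg G0_L1 G1_L1 absorption_int) simp
    fix t
    obtain i where i: "i = 0 \<or> i = 1 \<or> i = 2" "hL i t \<le> sgn (u t 0) * \<bar>G0 t\<bar>"
    proof (cases "u t 0 > 0")
      case True
      then show ?thesis using that[of 0] by (simp add: hL_def)
    next
      case False
      have "sgn (u t 0) * \<bar>G0 t\<bar> \<ge> - \<bar>G0 t\<bar>" using False by (auto simp: sgn_if)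
      then show ?thesis using that[of 1] that[of 2] False by (cases "G0 t \<ge> 0") (auto simp: hL_def)
    qed
    obtain j where j: "j = 0 \<or> j = 1 \<or> j = 2" "hR j t \<le> - sgn (u t 1) * \<bar>G1 t\<bar>"
    proof (cases "u t 1 < 0")
      case True
      then show ?thesis using that[of 0] by (simp add: hR_def)
    next
      case False
      have "- sgn (u t 1) * \<bar>G1 t\<bar> \<ge> - \<bar>G1 t\<bar>" using False by (auto simp: sgn_if)
      then show ?thesis using that[of 1] that[of 2] False by (cases "G1 t \<ge> 0") (auto simp: hR_def)
    qed
    have "F t \<le> f i j t"
      using i(1) j(1) by (auto simp: F_def g_def min_le_iff_disj)
    also have "\<dots> \<le> sgn (u t 0) * \<bar>G0 t\<bar> - sgn (u t 1) * \<bar>G1 t\<bar> - absorption t"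
      using i(2) j(2) by (simp add: f_def)
    finally show "F t \<le> sgn (u t 0) * \<bar>G0 t\<bar> - sgn (u t 1) * \<bar>G1 t\<bar> - absorption t" .
  qed
  finally show ?thesis .
qed

end

subsection \<open>Weak derivatives in one dimension\<close>

lemma moll_step_avg_tendsto:
  fixes W :: "real \<Rightarrow> real"
  assumes [measurable]: "W \<in> borel_measurable borel" and b: "\<And>x. \<bar>W x\<bar> \<le> B" and c: "isCont W a"
  shows "(\<lambda>n. avg (reg n) W a) \<longlonglongrightarrow> W a"
proof -
  have m: "integrable lborel moll"
    using integral_moll by (metis not_integrable_integral_eq zero_neq_one)
  have "(\<lambda>n. avg (reg n) W a) \<longlonglongrightarrow> (\<integral>z. W a * moll z \<partial>lborel)"
    unfolding avg_def
  proof (rule integral_dominated_convergence[where w = "\<lambda>z. B * moll z"])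
    show "AE z in lborel. (\<lambda>n. W (a + reg n * z) * moll z) \<longlonglongrightarrow> W a * moll z"
    proof (intro AE_I2 tendsto_mult tendsto_const)
      fix z
      have "(\<lambda>n. a + reg n * z) \<longlonglongrightarrow> a + 0 * z" by (intro tendsto_intros reg_lim)
      then show "(\<lambda>n. W (a + reg n * z)) \<longlonglongrightarrow> W a" using c by (intro isCont_tendsto_compose[where g = W]) auto
    qed
    show "AE z in lborel. norm (W (a + reg n * z) * moll z) \<le> B * moll z" for n
      using moll_nonneg b by (intro AE_I2) (auto simp: abs_mult intro: mult_right_mono)
  qed (use m in auto)
  then show ?thesis by (simp add: integral_moll)
qed

context
  fixes w w' :: "real \<Rightarrow> real"
  assumes cont: "continuous_on {0..1} w"
    and int: "integrable lborel (\<lambda>x. indicat_real {0<..<1} x * w' x)"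
    and test: "\<And>\<phi> \<phi>'. (\<And>x. (\<phi> has_real_derivative \<phi>' x) (at x)) \<Longrightarrow> continuous_on UNIV \<phi>' \<Longrightarrow>
        (\<exists>a b. 0 < a \<and> b < 1 \<and> (\<forall>x. x \<notin> {a..b} \<longrightarrow> \<phi> x = 0)) \<Longrightarrow>
        (\<integral>x. indicat_real {0<..<1} x * (\<phi>' x * w x) \<partial>lborel) = - (\<integral>x. indicat_real {0<..<1} x * (\<phi> x * w' x) \<partial>lborel)"
begin

text \<open>The difference of two smooth steps at a and b approximates the indicator of (a, b]. Its
  derivative is a difference of mollifiers, which recovers the values of the continuous function w
  at a and b.\<close>

lemma weak_deriv_increment_interior:
  assumes ab: "0 < a" "a \<le> b" "b < 1"
  shows "w b - w a = (LINT x:{a<..b}|lborel. indicat_real {0<..<1} x * w' x)"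
proof -
  define W where "W x = indicat_real {0<..<1} x * w x" for x
  define W' where "W' x = indicat_real {0<..<1} x * w' x" for x
  have iW': "integrable lborel W'" using int by (simp add: W'_def[abs_def])
  have Wm[measurable]: "W \<in> borel_measurable borel"
  proof -
    have "continuous_on {0<..<1} w" using cont by (rule continuous_on_subset) auto
    from borel_measurable_continuous_on_indicator[OF _ this] show ?thesis by (simp add: W_def[abs_def])
  qed
  obtain B where B: "\<And>x. \<bar>W x\<bar> \<le> B"
  proof -
    have "bounded (w ` {0..1})" by (rule compact_imp_bounded[OF compact_continuous_image[OF cont]]) simp
    then obtain B where B: "\<And>x. x \<in> {0..1} \<Longrightarrow> \<bar>w x\<bar> \<le> B" unfolding bounded_iff by fastforce
    have "\<bar>W x\<bar> \<le> \<bar>B\<bar>" for x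
      using B[of x] by (auto simp: W_def indicator_def)
    then show ?thesis using that by blast
  qed
  have cW: "isCont W p" if "0 < p" "p < 1" for p
  proof -
    have "isCont w p" using cont that by (intro continuous_on_interior[OF cont]) auto
    moreover have "eventually (\<lambda>x. W x = w x) (nhds p)"
      using eventually_nhds_in_open[of "{0<..<1}" p] that by (auto elim: eventually_mono simp: W_def)
    ultimately show ?thesis by (subst isCont_cong) auto
  qed
  define \<phi> where "\<phi> n x = moll_step ((x - a) / reg n) - moll_step ((x - b) / reg n)" for n x
  define \<phi>' where "\<phi>' n x = moll ((x - a) / reg n) / reg n - moll ((x - b) / reg n) / reg n" for n x
  have D: "(\<phi> n has_real_derivative \<phi>' n x) (at x)" for n x
  proof -
    have "((\<lambda>x. moll_step ((x - p) / reg n)) has_real_derivative moll ((x - p) / reg n) / reg n) (at x)" for p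
    proof -
      have "((\<lambda>x. (x - p) / reg n) has_real_derivative 1 / reg n) (at x)"
        using reg_pos[of n] by (auto intro!: derivative_eq_intros)
      from DERIV_chain2[OF DERIV_moll_step this] show ?thesis by simp
    qed
    then show ?thesis unfolding \<phi>_def[abs_def] \<phi>'_def by (intro DERIV_diff)
  qed
  have C: "continuous_on UNIV (\<phi>' n)" for n
    unfolding \<phi>'_def[abs_def] using reg_pos[of n]
    by (intro continuous_intros continuous_on_compose2[OF continuous_on_moll(1)]) auto
  have [measurable]: "\<phi> n \<in> borel_measurable borel" for n
    using D by (intro borel_measurable_continuous_onI) (meson DERIV_isCont continuous_at_imp_continuous_on)
  have z: "moll_step ((x - p) / reg n) = 0" if "x \<le> p" for x p n
    using that reg_pos[of n] by (intro moll_step_0 divide_nonpos_pos) auto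
  have lim1: "(\<lambda>n. avg (reg n) W a - avg (reg n) W b) \<longlonglongrightarrow> w a - w b"
    using tendsto_diff[OF moll_step_avg_tendsto[OF Wm B cW] moll_step_avg_tendsto[OF Wm B cW], of a b] ab
    by (simp add: W_def)
  have lim2: "(\<lambda>n. - (\<integral>x. \<phi> n x * W' x \<partial>lborel)) \<longlonglongrightarrow> - (\<integral>x. indicat_real {a<..b} x * W' x \<partial>lborel)"
  proof (intro tendsto_minus integral_dominated_convergence[where w = "\<lambda>x. \<bar>W' x\<bar>"])
    have "(\<lambda>n. \<phi> n x) \<longlonglongrightarrow> indicat_real {a<..b} x" for x
    proof (rule tendsto_eventually)
      have ev: "eventually (\<lambda>n. p < x \<longrightarrow> moll_step ((x - p) / reg n) = 1) sequentially" for p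
      proof (cases "p < x")
        case True
        then have "eventually (\<lambda>n. reg n \<le> x - p) sequentially" by (intro reg_eventually_le) simp
        then show ?thesis
          by (rule eventually_mono) (auto intro!: moll_step_1 simp: pos_le_divide_eq[OF reg_pos])
      qed simp
      show "\<forall>\<^sub>F n in sequentially. \<phi> n x = indicat_real {a<..b} x"
        using ev[of a] ev[of b]
      proof eventually_elim
        case (elim n)
        then show ?case using ab z[of x a n] z[of x b n] by (auto simp: \<phi>_def indicator_def not_less)
      qed
    qed
    then show "AE x in lborel. (\<lambda>n. \<phi> n x * W' x) \<longlonglongrightarrow> indicat_real {a<..b} x * W' x"
      by (intro AE_I2 tendsto_mult tendsto_const)
    have "\<bar>\<phi> n x\<bar> \<le> 1" for n x
      using moll_step_bounds[of "(x - a) / reg n"] moll_step_bounds[of "(x - b) / reg n"] unfolding \<phi>_def by linarith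
    then show "AE x in lborel. norm (\<phi> n x * W' x) \<le> \<bar>W' x\<bar>" for n
      by (intro AE_I2) (auto simp: abs_mult intro: mult_left_le_one_le)
  qed (use iW' in auto)
  \<comment> \<open>The test function lives on [a, b + reg n]; this set has to stay away from 1 for
    the support condition.\<close>
  have "eventually (\<lambda>n. reg n \<le> (1 - b) / 2) sequentially" using ab by (intro reg_eventually_le) auto
  then have ev: "eventually (\<lambda>n. avg (reg n) W a - avg (reg n) W b = - (\<integral>x. \<phi> n x * W' x \<partial>lborel)) sequentially"
  proof eventually_elim
    case (elim n)
    have supp: "\<phi> n x = 0" if "x \<notin> {a..b + reg n}" for x
    proof (cases "x < a")
      case True
      then show ?thesis using ab z[of x a n] z[of x b n] by (simp add: \<phi>_def)
    next
      case False
      then have "b + reg n < x" using that by auto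
      then show ?thesis using ab reg_pos[of n] by (auto simp: \<phi>_def moll_step_1 pos_le_divide_eq)
    qed
    have iW: "integrable lborel W"
      by (rule integrableI_bounded_set[where A = "{0..1}" and B = B]) (use B in \<open>auto simp: W_def\<close>)
    have m1: "\<bar>moll z\<bar> \<le> 30" for z using moll_bounds(1)[of z] by (cases "z \<in> {0..1}") auto
    have i: "integrable lborel (\<lambda>x. W x * moll ((x - p) / reg n))" for p
      by (rule integrable_mult_bounded[OF iW _ m1]) measurable
    have "(\<integral>x. indicat_real {0<..<1} x * (\<phi>' n x * w x) \<partial>lborel) = (\<integral>x. (W x * moll ((x - a) / reg n)) / reg n - (W x * moll ((x - b) / reg n)) / reg n \<partial>lborel)"
      by (intro Bochner_Integration.integral_cong) (auto simp: \<phi>'_def W_def algebra_simps)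
    also have "\<dots> = avg (reg n) W a - avg (reg n) W b"
      using i by (simp add: avg_eq[OF reg_pos])
    finally have 1: "avg (reg n) W a - avg (reg n) W b = (\<integral>x. indicat_real {0<..<1} x * (\<phi>' n x * w x) \<partial>lborel)" by simp
    have "\<exists>p q. 0 < p \<and> q < 1 \<and> (\<forall>x. x \<notin> {p..q} \<longrightarrow> \<phi> n x = 0)"
      using supp ab elim by (intro exI[of _ a] exI[of _ "b + reg n"]) auto
    note test[OF D C this]
    then show ?case unfolding 1 by (simp add: W'_def mult_ac)
  qed
  have "w a - w b = - (\<integral>x. indicat_real {a<..b} x * W' x \<partial>lborel)"
    by (rule LIMSEQ_unique[OF lim1]) (rule Lim_transform_eventually[OF lim2], use ev in \<open>auto elim: eventually_mono\<close>)
  then show ?thesis by (simp add: set_lebesgue_integral_def W'_def)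
qed

text \<open>The difference of w and the indefinite integral is constant inside (0,1), hence by
  continuity on [0,1]. The clamped argument is the constant extension that
  \<open>transport_slice\<close> asks for.\<close>

lemma weak_deriv_increment:
  assumes ab: "a \<le> b"
  shows "w (max 0 (min 1 b)) - w (max 0 (min 1 a)) = (LINT x:{a<..b}|lborel. indicat_real {0<..<1} x * w' x)"
proof -
  define W' where "W' x = indicat_real {0<..<1} x * w' x" for x
  have iW': "integrable lborel W'" using int by (simp add: W'_def[abs_def])
  define D where "D x = w x - (LINT z:{0<..x}|lborel. W' z)" for x
  have cD: "continuous_on {0..1} D"
    unfolding D_def by (intro continuous_intros cont continuous_on_indefinite_integral iW')
  have split: "(LINT z:{0<..q}|lborel. W' z) = (LINT z:{0<..p}|lborel. W' z) + (LINT z:{p<..q}|lborel. W' z)" if "0 \<le> p" "p \<le> q" for p q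
    by (rule LINT_Ioc_split[OF set_integrable_lborel[OF iW']]) (use that in auto)
  have Deq: "D x = D (1/2)" if "x \<in> {0<..<1}" for x
  proof (cases "x \<le> 1/2")
    case True
    then show ?thesis using weak_deriv_increment_interior[of x "1/2"] split[of x "1/2"] that by (simp add: D_def W'_def)
  next
    case False
    then show ?thesis using weak_deriv_increment_interior[of "1/2" x] split[of "1/2" x] that by (simp add: D_def W'_def)
  qed
  have D1: "D x = D (1/2)" if "x \<in> {0..1}" for x
  proof (rule continuous_constant_on_closure[where S = "{0<..<1}" and f = D])
    show "continuous_on (closure {0<..<1}) D" using cD by simp
    show "x \<in> closure {0<..<1}" using that by simp
  qed (rule Deq)
  let ?a = "max 0 (min 1 a)" and ?b = "max 0 (min 1 b)"
  have "w ?b - w ?a = (LINT z:{?a<..?b}|lborel. W' z)"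
    using D1[of ?a] D1[of ?b] split[of ?a ?b] ab by (simp add: D_def)
  also have "\<dots> = (LINT z:{a<..b}|lborel. W' z)"
    unfolding set_lebesgue_integral_def
    by (intro Bochner_Integration.integral_cong) (use ab in \<open>auto simp: W'_def indicator_def\<close>)
  finally show ?thesis by (simp add: W'_def)
qed

end

text \<open>If f has mean zero on (y, y + d], then -f y is the mean of the increments f (y + d z) -
  f y. Their L1 norm is small by continuity of translations, so the norm of f is below every
  e.\<close>

lemma AE_eq_0_of_interval_integrals:
  fixes f :: "real \<Rightarrow> real"
  assumes f: "integrable lborel f" and supp: "\<And>x. x \<notin> {0<..<1} \<Longrightarrow> f x = 0"
    and zero: "\<And>a b. a \<le> b \<Longrightarrow> (LINT x:{a<..b}|lborel. f x) = 0"
  shows "AE x in lborel. f x = 0"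
proof -
  have [measurable]: "f \<in> borel_measurable borel" using f by auto
  \<comment> \<open>The summand 0 gives the bound the shape expected by
    \<open>ennreal_le_epsilon\<close>.\<close>
  have key: "(\<integral>\<^sup>+y. ennreal \<bar>f y\<bar> \<partial>lborel) \<le> 0 + ennreal e" if e: "e > 0" for e
  proof -
    have supp': "f x = 0" if "x \<notin> {0..1}" for x using supp[of x] that by auto
    obtain d where d: "d > 0" "\<And>h. \<bar>h\<bar> \<le> d \<Longrightarrow> (\<integral>\<^sup>+x. ennreal \<bar>f (x + h) - f x\<bar> \<partial>lborel) \<le> ennreal e"
      using L1_translation_continuous[OF f supp' e] by blast
    have eq: "\<bar>f y\<bar> = \<bar>\<integral>z. (f (y + d * z) - f y) * indicat_real {0<..1} z \<partial>lborel\<bar>" for y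
    proof -
      have "0 = (\<integral>x. indicat_real {y<..y + d} x * f x \<partial>lborel)"
        using zero[of y "y + d"] d by (simp add: set_lebesgue_integral_def)
      also have "\<dots> = d * (\<integral>z. indicat_real {y<..y + d} (y + d * z) * f (y + d * z) \<partial>lborel)"
        using lborel_integral_real_affine[of d "\<lambda>x. indicat_real {y<..y + d} x * f x" y] d by simp
      also have "(\<lambda>z. indicat_real {y<..y + d} (y + d * z) * f (y + d * z)) = (\<lambda>z. f (y + d * z) * indicat_real {0<..1} z)"
      proof
        fix z
        have "0 < d * z \<longleftrightarrow> 0 < z" "d * z \<le> d \<longleftrightarrow> z \<le> 1"
          using d(1) mult_le_cancel_left_pos[OF d(1), of z 1] by (auto simp: zero_less_mult_iff)
        then show "indicat_real {y<..y + d} (y + d * z) * f (y + d * z) = f (y + d * z) * indicat_real {0<..1} z"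
          by (simp add: indicator_def)
      qed
      finally have 1: "(\<integral>z. f (y + d * z) * indicat_real {0<..1} z \<partial>lborel) = 0" using d by simp
      have i1: "integrable lborel (\<lambda>z. f (y + d * z) * indicat_real {0<..1} z)"
        by (rule integrable_mult_bounded[OF lborel_integrable_real_affine[OF f], where C = 1]) (use d in \<open>auto simp: indicator_def\<close>)
      have i2: "integrable lborel (indicat_real {0<..1::real})"
        by (rule integrable_real_indicator) auto
      have "(\<integral>z. (f (y + d * z) - f y) * indicat_real {0<..1} z \<partial>lborel) = (\<integral>z. f (y + d * z) * indicat_real {0<..1} z - f y * indicat_real {0<..1} z \<partial>lborel)"
        by (simp add: left_diff_distrib)
      also have "\<dots> = - f y"
        using i1 i2 1 by (subst Bochner_Integration.integral_diff) auto
      finally show ?thesis by simp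
    qed
    have "(\<integral>\<^sup>+y. ennreal \<bar>f y\<bar> \<partial>lborel) \<le> ennreal (1 * e)"
      unfolding eq
    proof (rule nn_integral_average_le)
      fix z :: real assume "z \<in> {0..1}"
      then show "(\<integral>\<^sup>+y. ennreal \<bar>f (y + d * z) - f y\<bar> \<partial>lborel) \<le> ennreal e"
        using d(1) by (intro d(2)) (auto intro: mult_left_le)
    qed (auto simp: indicator_def)
    then show ?thesis by simp
  qed
  have "(\<integral>\<^sup>+y. ennreal \<bar>f y\<bar> \<partial>lborel) \<le> 0"
    by (rule ennreal_le_epsilon) (rule key)
  then show ?thesis by (simp add: nn_integral_0_iff_AE)
qed

subsection \<open>A Gronwall inequality\<close>

text \<open>E obeys its bound only at almost every time, so the argument runs with the nondecreasing
  integral F. On an interval where \<alpha> has mass below 1/2 and before which F vanishes, F t <= F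
  t / 2; finitely many such intervals reach every t.\<close>

lemma Gronwall_zero:
  fixes E \<alpha> :: "real \<Rightarrow> real"
  assumes \<alpha>: "integrable lborel \<alpha>" "\<And>t. \<alpha> t \<ge> 0" and E: "\<And>t. E t \<ge> 0"
    and f: "integrable lborel (\<lambda>t. \<alpha> t * E t)" and T: "T > 0"
    and le: "AE t in lborel. 0 < t \<and> t < T \<longrightarrow> E t \<le> (LINT s:{0<..t}|lborel. \<alpha> s * E s)"
  shows "AE t in lborel. 0 < t \<and> t < T \<longrightarrow> E t = 0"
proof -
  define F where "F t = (LINT s:{0<..t}|lborel. \<alpha> s * E s)" for t
  have split: "(LINT z:{0<..q}|lborel. h z) = (LINT z:{0<..p}|lborel. h z) + (LINT z:{p<..q}|lborel. h z)"
    if "0 \<le> p" "p \<le> q" "integrable lborel h" for p q and h :: "real \<Rightarrow> real"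
    by (rule LINT_Ioc_split[OF set_integrable_lborel[OF that(3)]]) (use that in auto)
  have nonneg: "(LINT z:{p<..q}|lborel. h z) \<ge> 0" if "\<And>z. h z \<ge> 0" for p q and h :: "real \<Rightarrow> real"
    unfolding set_lebesgue_integral_def using that by (intro integral_nonneg_AE) auto
  have F_mono: "F p \<le> F q" if "0 \<le> p" "p \<le> q" for p q
    unfolding F_def using split[OF that f] nonneg[of "\<lambda>s. \<alpha> s * E s" p q] \<alpha>(2) E by simp
  have F_nonneg: "F t \<ge> 0" for t
    unfolding F_def by (intro nonneg mult_nonneg_nonneg \<alpha> E)
  have "continuous_on {0..T} (\<lambda>x. LINT y:{0<..x}|lborel. \<alpha> y)"
    by (rule continuous_on_indefinite_integral[OF \<alpha>(1)])
  then have "uniformly_continuous_on {0..T} (\<lambda>x. LINT y:{0<..x}|lborel. \<alpha> y)"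
    by (rule compact_uniformly_continuous) simp
  then have "\<exists>d>0. \<forall>x\<in>{0..T}. \<forall>y\<in>{0..T}. \<bar>y - x\<bar> < d \<longrightarrow> \<bar>(LINT y:{0<..y}|lborel. \<alpha> y) - (LINT y:{0<..x}|lborel. \<alpha> y)\<bar> < 1/2"
    unfolding uniformly_continuous_on_def dist_real_def by (elim allE[of _ "1/2"]) auto
  then obtain d where d: "d > 0" "\<And>x y. x \<in> {0..T} \<Longrightarrow> y \<in> {0..T} \<Longrightarrow> \<bar>y - x\<bar> < d \<Longrightarrow> \<bar>(LINT y:{0<..y}|lborel. \<alpha> y) - (LINT y:{0<..x}|lborel. \<alpha> y)\<bar> < 1/2"
    by blast
  \<comment> \<open>Steps of length d/2 stay strictly within the distance d of uniform
    continuity.\<close>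
  have F0: "F t = 0" if "0 \<le> t" "t < T" "t \<le> real k * (d/2)" for k t
    using that
  proof (induction k arbitrary: t)
    case 0
    then show ?case by (simp add: F_def set_lebesgue_integral_def)
  next
    case (Suc k)
    let ?p = "real k * (d/2)"
    show ?case
    proof (cases "t \<le> ?p")
      case True
      then show ?thesis using Suc by auto
    next
      case False
      have p: "0 \<le> ?p" "?p \<le> t" "?p < T" "\<bar>t - ?p\<bar> < d" using False Suc.prems d(1) by (auto simp: algebra_simps)
      have "F t = (LINT s:{?p<..t}|lborel. \<alpha> s * E s)"
        using split[OF p(1,2) f] Suc.IH[of ?p] p by (simp add: F_def)
      also have "\<dots> \<le> (LINT s:{?p<..t}|lborel. \<alpha> s * F t)"
      proof (rule set_integral_mono_AE)
        show "set_integrable lborel {?p<..t} (\<lambda>s. \<alpha> s * E s)" by (rule set_integrable_lborel[OF f]) simp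
        show "set_integrable lborel {?p<..t} (\<lambda>s. \<alpha> s * F t)"
          by (intro set_integrable_lborel integrable_mult_left \<alpha>) simp
        show "AE s\<in>{?p<..t} in lborel. \<alpha> s * E s \<le> \<alpha> s * F t"
          using le
        proof eventually_elim
          case (elim s)
          show ?case
          proof
            assume s: "s \<in> {?p<..t}"
            then have "E s \<le> F s" using elim p Suc.prems by (auto simp: F_def)
            also have "F s \<le> F t" using s order_trans[OF p(1), of s] by (intro F_mono) auto
            finally show "\<alpha> s * E s \<le> \<alpha> s * F t" by (intro mult_left_mono \<alpha>)
          qed
        qed
      qed
      also have "\<dots> = (LINT s:{?p<..t}|lborel. \<alpha> s) * F t" by simp
      also have "(LINT s:{?p<..t}|lborel. \<alpha> s) = (LINT s:{0<..t}|lborel. \<alpha> s) - (LINT s:{0<..?p}|lborel. \<alpha> s)"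
        using split[OF p(1,2) \<alpha>(1)] by simp
      also have "\<dots> * F t \<le> 1/2 * F t"
      proof (rule mult_right_mono[OF _ F_nonneg])
        have "\<bar>(LINT s:{0<..t}|lborel. \<alpha> s) - (LINT s:{0<..?p}|lborel. \<alpha> s)\<bar> < 1/2"
          by (rule d(2)) (use p Suc.prems in auto)
        then show "(LINT s:{0<..t}|lborel. \<alpha> s) - (LINT s:{0<..?p}|lborel. \<alpha> s) \<le> 1/2" by (rule abs_le_D1[OF less_imp_le])
      qed
      finally show ?thesis using F_nonneg[of t] by simp
    qed
  qed
  show ?thesis
    using le
  proof eventually_elim
    case (elim t)
    show ?case
    proof
      assume t: "0 < t \<and> t < T"
      obtain k :: nat where "t / (d/2) \<le> real k" using real_arch_simple by blast
      then have "t \<le> real k * (d/2)" using d(1) by (simp add: field_simps)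
      then have "F t = 0" using F0 t by auto
      then show "E t = 0" using elim t E[of t] by (auto simp: F_def)
    qed
  qed
qed

subsection \<open>Essential suprema of slices\<close>

text \<open>The essential supremum is at most a exactly when the set where h t exceeds a has measure
  zero in (0,1), and by Tonelli the measure of this set is a measurable function of t.\<close>

lemma measurable_esssup_slice:
  fixes h :: "real \<Rightarrow> real \<Rightarrow> ennreal"
  assumes [measurable]: "case_prod h \<in> borel_measurable (borel \<Otimes>\<^sub>M borel)"
  shows "(\<lambda>t. esssup Omega_meas (h t)) \<in> borel_measurable borel"
proof (rule borel_measurableI_le)
  fix a :: ennreal
  have m: "h t \<in> borel_measurable Omega_meas" for t
    unfolding Omega_meas_def by (intro measurable_restrict_space1) measurable
  have "esssup Omega_meas (h t) \<le> a \<longleftrightarrow> (\<integral>\<^sup>+x. indicator {0<..<1} x * indicator {a<..} (h t x) \<partial>lborel) = 0" for t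
  proof -
    have "esssup Omega_meas (h t) \<le> a \<longleftrightarrow> (AE x in Omega_meas. h t x \<le> a)"
    proof
      assume "esssup Omega_meas (h t) \<le> a"
      then show "AE x in Omega_meas. h t x \<le> a"
        using esssup_AE[of "h t" Omega_meas] by (auto elim: order_trans eventually_mono)
    qed (rule esssup_I[OF m])
    also have "\<dots> \<longleftrightarrow> (AE x in lborel. x \<in> {0<..<1} \<longrightarrow> h t x \<le> a)"
      unfolding Omega_meas_def by (subst AE_restrict_space_iff) auto
    also have "\<dots> \<longleftrightarrow> (AE x in lborel. indicator {0<..<1} x * indicator {a<..} (h t x) = (0 :: ennreal))"
      by (intro AE_cong) (auto simp: indicator_def not_less)
    also have "\<dots> \<longleftrightarrow> (\<integral>\<^sup>+x. indicator {0<..<1} x * indicator {a<..} (h t x) \<partial>lborel) = 0"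
      by (rule nn_integral_0_iff_AE[symmetric]) measurable
    finally show ?thesis .
  qed
  then have "{t \<in> space borel. esssup Omega_meas (h t) \<le> a} =
      {t \<in> space borel. (\<integral>\<^sup>+x. indicator {0<..<1} x * indicator {a<..} (h t x) \<partial>lborel) = 0}" by simp
  also have "\<dots> \<in> sets borel" by measurable
  finally show "{t \<in> space borel. esssup Omega_meas (h t) \<le> a} \<in> sets borel" .
qed

subsection \<open>The space-time cylinder and its lateral boundary\<close>

lemma cyl_ext_measurable:
  fixes g :: "real \<times> real \<Rightarrow> 'b :: {second_countable_topology, real_normed_vector}"
  assumes "g \<in> borel_measurable (cyl_meas T)"
  shows "(\<lambda>z. indicat_real ({0<..<T} \<times> {0<..<1}) z *\<^sub>R g z) \<in> borel_measurable (borel \<Otimes>\<^sub>M borel)"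
proof -
  have "{0<..<T} \<times> {0<..<1::real} \<in> sets lborel" by (simp add: open_Times)
  then have "(\<lambda>z. indicat_real ({0<..<T} \<times> {0<..<1}) z *\<^sub>R g z) \<in> borel_measurable lborel"
    using assms unfolding cyl_meas_def by (subst (asm) borel_measurable_restrict_space_iff) auto
  then show ?thesis by (simp add: borel_prod)
qed

lemma cyl_integrable_iff:
  fixes g :: "real \<times> real \<Rightarrow> 'b :: {second_countable_topology, banach}"
  shows "integrable (cyl_meas T) g \<longleftrightarrow> integrable (lborel \<Otimes>\<^sub>M lborel) (\<lambda>z. indicat_real ({0<..<T} \<times> {0<..<1}) z *\<^sub>R g z)"
  unfolding cyl_meas_def by (subst integrable_restrict_space) (auto simp: open_Times lborel_prod)

lemma cyl_integral:
  fixes g :: "real \<times> real \<Rightarrow> 'b :: {second_countable_topology, banach}"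
  shows "(\<integral>z. g z \<partial>cyl_meas T) = (\<integral>z. indicat_real ({0<..<T} \<times> {0<..<1}) z *\<^sub>R g z \<partial>(lborel \<Otimes>\<^sub>M lborel))"
  unfolding cyl_meas_def by (subst integral_restrict_space) (auto simp: open_Times lborel_prod)

lemma cyl_AE:
  assumes "AE z in cyl_meas T. P z"
  shows "AE t in lborel. AE x in lborel. t \<in> {0<..<T} \<longrightarrow> x \<in> {0<..<1} \<longrightarrow> P (t, x)"
proof -
  have "AE z in lborel. z \<in> {0<..<T} \<times> {0<..<1::real} \<longrightarrow> P z"
    using assms unfolding cyl_meas_def by (subst (asm) AE_restrict_space_iff) (auto simp: open_Times)
  then have "AE z in (lborel \<Otimes>\<^sub>M lborel). z \<in> {0<..<T} \<times> {0<..<1::real} \<longrightarrow> P z"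
    by (simp only: lborel_prod)
  from lborel_pair.AE_pair[OF this] show ?thesis by (auto elim!: eventually_mono)
qed

lemma sigma_finite_Gamma: "pair_sigma_finite (restrict_space lborel {0..T::real}) (count_space {0, 1::real})"
proof -
  interpret A: sigma_finite_measure "restrict_space lborel {0..T}"
    by (rule sigma_finite_measure_restrict_space) (auto intro: sigma_finite_lborel)
  interpret B: sigma_finite_measure "count_space {0, 1::real}"
    by (rule sigma_finite_measure_count_space_finite) simp
  show ?thesis ..
qed

lemma Gamma_slice_measurable:
  fixes f :: "real \<times> real \<Rightarrow> real"
  assumes "f \<in> borel_measurable (Gamma_meas T)" and p: "p \<in> {0, 1}"
  shows "(\<lambda>t. indicat_real {0..T} t * f (t, p)) \<in> borel_measurable borel"
proof -
  have "(\<lambda>t. (t, p)) \<in> measurable (restrict_space lborel {0..T}) (Gamma_meas T)"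
    unfolding Gamma_meas_def using p by (intro measurable_Pair) auto
  from measurable_compose[OF this assms(1)] show ?thesis
    by (subst (asm) borel_measurable_restrict_space_iff) auto
qed

lemma Gamma_integrable:
  fixes f :: "real \<times> real \<Rightarrow> real"
  assumes m: "f \<in> borel_measurable (Gamma_meas T)"
    and i: "\<And>p. p \<in> {0, 1} \<Longrightarrow> integrable lborel (\<lambda>t. indicat_real {0..T} t * f (t, p))"
  shows "integrable (Gamma_meas T) f"
    "(\<integral>z. f z \<partial>Gamma_meas T) = (\<integral>t. indicat_real {0..T} t * f (t, 0) \<partial>lborel) + (\<integral>t. indicat_real {0..T} t * f (t, 1) \<partial>lborel)"
proof -
  interpret pair_sigma_finite "restrict_space lborel {0..T}" "count_space {0, 1::real}" by (rule sigma_finite_Gamma)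
  have "integrable (restrict_space lborel {0..T}) (\<lambda>t. \<integral>x. norm (f (t, x)) \<partial>count_space {0, 1})"
    using integrable_abs[OF i[of 0]] integrable_abs[OF i[of 1]]
    by (subst integrable_restrict_space) (auto simp: lebesgue_integral_count_space_finite distrib_left abs_mult)
  then show *: "integrable (Gamma_meas T) f"
    unfolding Gamma_meas_def
    by (intro Fubini_integrable) (use m in \<open>auto simp: Gamma_meas_def integrable_count_space\<close>)
  have "(\<integral>z. f z \<partial>Gamma_meas T) = (\<integral>t. (\<integral>x. f (t, x) \<partial>count_space {0, 1}) \<partial>restrict_space lborel {0..T})"
    using integral_fst'[OF *[unfolded Gamma_meas_def]] by (simp add: Gamma_meas_def)
  also have "\<dots> = (\<integral>t. indicat_real {0..T} t * f (t, 0) + indicat_real {0..T} t * f (t, 1) \<partial>lborel)"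
    by (subst integral_restrict_space) (auto simp: lebesgue_integral_count_space_finite distrib_left)
  also have "\<dots> = (\<integral>t. indicat_real {0..T} t * f (t, 0) \<partial>lborel) + (\<integral>t. indicat_real {0..T} t * f (t, 1) \<partial>lborel)"
    by (rule Bochner_Integration.integral_add) (rule i; simp)+
  finally show "(\<integral>z. f z \<partial>Gamma_meas T) = \<dots>" .
qed

lemma Gamma_AE:
  assumes "AE z in Gamma_meas T. P z" and p: "p \<in> {0, 1::real}"
  shows "AE t in lborel. t \<in> {0..T} \<longrightarrow> P (t, p)"
proof -
  interpret pair_sigma_finite "restrict_space lborel {0..T}" "count_space {0, 1::real}" by (rule sigma_finite_Gamma)
  have "AE t in restrict_space lborel {0..T}. AE x in count_space {0, 1}. P (t, x)"
    using AE_pair[OF assms(1)[unfolded Gamma_meas_def]] by simp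
  then have "AE t in restrict_space lborel {0..T}. P (t, p)"
    by (rule eventually_mono) (use p in \<open>auto simp: AE_count_space\<close>)
  then show ?thesis by (subst (asm) AE_restrict_space_iff) auto
qed

subsection \<open>Components of the data\<close>

lemma has_weak_deriv_component:
  assumes "has_weak_deriv w w1"
  shows "integrable lborel (\<lambda>x. indicat_real {0<..<1} x * w x $ j)" "integrable lborel (\<lambda>x. indicat_real {0<..<1} x * w1 x $ j)"
    "\<And>\<phi> \<phi>'. (\<And>x. (\<phi> has_real_derivative \<phi>' x) (at x)) \<Longrightarrow> continuous_on UNIV \<phi>' \<Longrightarrow>
        (\<exists>a b. 0 < a \<and> b < 1 \<and> (\<forall>x. x \<notin> {a..b} \<longrightarrow> \<phi> x = 0)) \<Longrightarrow>
        (\<integral>x. indicat_real {0<..<1} x * (\<phi>' x * w x $ j) \<partial>lborel) = - (\<integral>x. indicat_real {0<..<1} x * (\<phi> x * w1 x $ j) \<partial>lborel)"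
proof -
  have iw: "integrable Omega_meas w" and iw1: "integrable Omega_meas w1"
    using assms by (auto simp: has_weak_deriv_def)
  have comp: "integrable lborel (\<lambda>x. indicat_real {0<..<1} x * v x $ j)" if "integrable Omega_meas v" for v :: "real \<Rightarrow> real ^ 'a"
  proof -
    have "integrable Omega_meas (\<lambda>x. v x $ j)"
      using integrable_bounded_linear[OF bounded_linear_vec_nth that] .
    then show ?thesis unfolding Omega_meas_def by (subst (asm) integrable_restrict_space) auto
  qed
  show "integrable lborel (\<lambda>x. indicat_real {0<..<1} x * w x $ j)" "integrable lborel (\<lambda>x. indicat_real {0<..<1} x * w1 x $ j)"
    by (rule comp[OF iw] comp[OF iw1])+
  fix \<phi> \<phi>' :: "real \<Rightarrow> real"
  assume D: "\<And>x. (\<phi> has_real_derivative \<phi>' x) (at x)" and C: "continuous_on UNIV \<phi>'"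
    and S: "\<exists>a b. 0 < a \<and> b < 1 \<and> (\<forall>x. x \<notin> {a..b} \<longrightarrow> \<phi> x = 0)"
  have C0: "continuous_on UNIV \<phi>" using D by (meson DERIV_isCont continuous_at_imp_continuous_on)
  have eq: "(\<integral>x. \<phi>' x *\<^sub>R w x \<partial>Omega_meas) = - (\<integral>x. \<phi> x *\<^sub>R w1 x \<partial>Omega_meas)"
    using assms D C S by (auto simp: has_weak_deriv_def)
  have comp_int: "(\<integral>x. \<psi> x *\<^sub>R v x \<partial>Omega_meas) $ j = (\<integral>x. indicat_real {0<..<1} x * (\<psi> x * v x $ j) \<partial>lborel)"
    if v: "integrable Omega_meas v" and c: "continuous_on UNIV \<psi>" for v :: "real \<Rightarrow> real ^ 'a" and \<psi>
  proof -
    have [measurable]: "\<psi> \<in> borel_measurable Omega_meas"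
      unfolding Omega_meas_def by (intro measurable_restrict_space1) (simp add: borel_measurable_continuous_onI[OF c])
    have [measurable]: "v \<in> borel_measurable Omega_meas" using v by auto
    have "bounded (\<psi> ` {0..1})" by (rule compact_imp_bounded[OF compact_continuous_image]) (use c continuous_on_subset in auto)
    then obtain B where B: "\<And>x. x \<in> {0..1} \<Longrightarrow> \<bar>\<psi> x\<bar> \<le> B" unfolding bounded_iff by fastforce
    have "integrable Omega_meas (\<lambda>x. \<psi> x *\<^sub>R v x)"
    proof (rule Bochner_Integration.integrable_bound[where f = "\<lambda>x. B *\<^sub>R v x"])
      show "AE x in Omega_meas. norm (\<psi> x *\<^sub>R v x) \<le> norm (B *\<^sub>R v x)"
        by (intro AE_I2) (auto simp: Omega_meas_def space_restrict_space intro!: mult_right_mono order_trans[OF B abs_ge_self])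
    qed (use v in auto)
    from integral_bounded_linear[OF bounded_linear_vec_nth this, of j]
    have "(\<integral>x. \<psi> x *\<^sub>R v x \<partial>Omega_meas) $ j = (\<integral>x. (\<psi> x *\<^sub>R v x) $ j \<partial>Omega_meas)" by simp
    also have "\<dots> = (\<integral>x. indicat_real {0<..<1} x * (\<psi> x * v x $ j) \<partial>lborel)"
      unfolding Omega_meas_def by (subst integral_restrict_space) auto
    finally show ?thesis .
  qed
  show "(\<integral>x. indicat_real {0<..<1} x * (\<phi>' x * w x $ j) \<partial>lborel) = - (\<integral>x. indicat_real {0<..<1} x * (\<phi> x * w1 x $ j) \<partial>lborel)"
    using eq comp_int[OF iw C] comp_int[OF iw1 C0] by (metis vector_uminus_component)
qed

lemma has_weak_deriv_increment:
  assumes "has_weak_deriv w w1" "continuous_on {0..1} w" "a \<le> b"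
  shows "w (max 0 (min 1 b)) $ j - w (max 0 (min 1 a)) $ j = (LINT x:{a<..b}|lborel. indicat_real {0<..<1} x * w1 x $ j)"
proof (rule weak_deriv_increment[OF _ has_weak_deriv_component(2)[OF assms(1)] has_weak_deriv_component(3)[OF assms(1)] assms(3)])
  show "continuous_on {0..1} (\<lambda>x. w x $ j)"
    using assms(2) by (intro continuous_intros)
qed

lemma has_weak_deriv_unique:
  assumes w1: "has_weak_deriv w w1" and w2: "has_weak_deriv w w2" and c: "continuous_on {0..1} w"
  shows "AE x in Omega_meas. w1 x = w2 x"
proof -
  have "AE x in lborel. indicat_real {0<..<1} x * w1 x $ j - indicat_real {0<..<1} x * w2 x $ j = 0" for j
  proof (rule AE_eq_0_of_interval_integrals)
    note i = has_weak_deriv_component(2)[OF w1, of j] has_weak_deriv_component(2)[OF w2, of j]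
    show "integrable lborel (\<lambda>x. indicat_real {0<..<1} x * w1 x $ j - indicat_real {0<..<1} x * w2 x $ j)"
      using i by (intro Bochner_Integration.integrable_diff)
    show "(LINT x:{a<..b}|lborel. indicat_real {0<..<1} x * w1 x $ j - indicat_real {0<..<1} x * w2 x $ j) = 0" if "a \<le> b" for a b
      using has_weak_deriv_increment[OF w1 c that, of j] has_weak_deriv_increment[OF w2 c that, of j]
      by (subst set_integral_diff(2)) (auto intro!: set_integrable_lborel i)
  qed auto
  then have "AE x in lborel. \<forall>j. indicat_real {0<..<1} x * w1 x $ j - indicat_real {0<..<1} x * w2 x $ j = 0"
    by (rule eventually_all_finite)
  then have "AE x in lborel. x \<in> {0<..<1} \<longrightarrow> w1 x = w2 x"
    by (rule eventually_mono) (auto simp: vec_eq_iff)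
  then show ?thesis unfolding Omega_meas_def by (subst AE_restrict_space_iff) auto
qed

lemma W11_norm_ge:
  assumes w1: "has_weak_deriv w w1" and c: "continuous_on {0..1} w"
  shows "(\<integral>\<^sup>+x. ennreal (norm (w x)) \<partial>Omega_meas) + (\<integral>\<^sup>+x. ennreal (norm (w1 x)) \<partial>Omega_meas) \<le> W11_norm w"
  unfolding W11_norm_def
proof (rule INF_greatest)
  fix w2 assume "w2 \<in> {w'. has_weak_deriv w w'}"
  then have "AE x in Omega_meas. w1 x = w2 x" using has_weak_deriv_unique[OF w1 _ c] by simp
  then have "(\<integral>\<^sup>+x. ennreal (norm (w1 x)) \<partial>Omega_meas) = (\<integral>\<^sup>+x. ennreal (norm (w2 x)) \<partial>Omega_meas)"
    by (intro nn_integral_cong_AE) (auto elim: eventually_mono)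
  then show "(\<integral>\<^sup>+x. ennreal (norm (w x)) \<partial>Omega_meas) + (\<integral>\<^sup>+x. ennreal (norm (w1 x)) \<partial>Omega_meas)
      \<le> (\<integral>\<^sup>+x. ennreal (norm (w x)) \<partial>Omega_meas) + (\<integral>\<^sup>+x. ennreal (norm (w2 x)) \<partial>Omega_meas)" by simp
qed

text \<open>No measurability of N is assumed: the nonnegative integral is monotone without it. In
  later uses N is the W11 norm of a slice, an infimum over weak derivatives.\<close>

lemma integrable_pair_slice_bound:
  fixes H :: "real \<Rightarrow> real \<Rightarrow> real"
  assumes H[measurable]: "case_prod H \<in> borel_measurable (borel \<Otimes>\<^sub>M borel)"
    and b: "AE t in lborel. (\<integral>\<^sup>+x. ennreal \<bar>H t x\<bar> \<partial>lborel) \<le> N t" and N: "(\<integral>\<^sup>+t. N t \<partial>lborel) < \<infinity>"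
  shows "integrable (lborel \<Otimes>\<^sub>M lborel) (case_prod H)" "integrable lborel (\<lambda>t. \<integral>x. \<bar>H t x\<bar> \<partial>lborel)"
    "AE t in lborel. integrable lborel (H t)"
proof -
  have "(\<integral>\<^sup>+z. ennreal (norm (case_prod H z)) \<partial>(lborel \<Otimes>\<^sub>M lborel)) = (\<integral>\<^sup>+t. (\<integral>\<^sup>+x. ennreal \<bar>H t x\<bar> \<partial>lborel) \<partial>lborel)"
    by (subst lborel.nn_integral_fst[symmetric]) auto
  also have "\<dots> \<le> (\<integral>\<^sup>+t. N t \<partial>lborel)"
    by (rule nn_integral_mono_AE[OF b])
  also note N
  finally have fin: "(\<integral>\<^sup>+z. ennreal (norm (case_prod H z)) \<partial>(lborel \<Otimes>\<^sub>M lborel)) < \<infinity>" .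
  show i: "integrable (lborel \<Otimes>\<^sub>M lborel) (case_prod H)"
    by (rule integrableI_bounded[OF _ fin]) measurable
  have "(\<lambda>(t, x). \<bar>H t x\<bar>) = (\<lambda>z. \<bar>case_prod H z\<bar>)" by auto
  then have "integrable (lborel \<Otimes>\<^sub>M lborel) (\<lambda>(t, x). \<bar>H t x\<bar>)"
    using integrable_abs[OF i] by simp
  from lborel_pair.integrable_fst[OF this] show "integrable lborel (\<lambda>t. \<integral>x. \<bar>H t x\<bar> \<partial>lborel)" .
  show "AE t in lborel. integrable lborel (H t)"
    by (rule lborel_pair.AE_integrable_fst[OF i])
qed

lemma set_nn_integral_time:
  "(\<integral>\<^sup>+t. N t \<partial>time_meas T) = (\<integral>\<^sup>+t. N t * indicator {0<..<T} t \<partial>lborel)"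
  unfolding time_meas_def by (subst nn_integral_restrict_space) auto

lemma time_AE: "(AE t in time_meas T. P t) \<longleftrightarrow> (AE t in lborel. t \<in> {0<..<T} \<longrightarrow> P t)"
  unfolding time_meas_def by (subst AE_restrict_space_iff) auto

lemma Omega_AE: "(AE x in Omega_meas. P x) \<longleftrightarrow> (AE x in lborel. x \<in> {0<..<1} \<longrightarrow> P x)"
  unfolding Omega_meas_def by (subst AE_restrict_space_iff) auto

text \<open>The rate is the essential supremum of the zero extension of one component. It is
  measurable in time by \<open>measurable_esssup_slice\<close> and lies below the norm of the slice,
  whose time integral is finite.\<close>

lemma Bochner_Linf_rate:
  assumes g: "Bochner_L1 T Linf_norm g"
  obtains \<alpha> where "integrable lborel \<alpha>" "\<And>t. \<alpha> t \<ge> 0"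
    "AE t in lborel. AE x in lborel. t \<in> {0<..<T} \<longrightarrow> x \<in> {0<..<1} \<longrightarrow> \<bar>g (t, x) $ j\<bar> \<le> \<alpha> t"
proof -
  define h where "h t x = ennreal \<bar>(indicat_real ({0<..<T} \<times> {0<..<1}) (t, x) *\<^sub>R g (t, x)) $ j\<bar>" for t x
  have gm: "g \<in> borel_measurable (cyl_meas T)" using g by (simp add: Bochner_L1_def)
  have hm[measurable]: "case_prod h \<in> borel_measurable (borel \<Otimes>\<^sub>M borel)"
  proof -
    have "(\<lambda>z. (indicat_real ({0<..<T} \<times> {0<..<1}) z *\<^sub>R g z) $ j) \<in> borel_measurable (borel \<Otimes>\<^sub>M borel)"
      by (rule measurable_compose[OF cyl_ext_measurable[OF gm]])
        (auto intro!: borel_measurable_continuous_onI continuous_intros)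
    then show ?thesis unfolding h_def case_prod_beta prod.collapse by measurable
  qed
  define N where "N t = esssup Omega_meas (h t)" for t
  have Nm[measurable]: "N \<in> borel_measurable borel" unfolding N_def by (rule measurable_esssup_slice[OF hm])
  have hO: "h t \<in> borel_measurable Omega_meas" for t
    unfolding Omega_meas_def by (intro measurable_restrict_space1) measurable
  have Nle: "N t \<le> Linf_norm (\<lambda>x. g (t, x))" if t: "t \<in> {0<..<T}" for t
  proof -
    have "N t = esssup Omega_meas (\<lambda>x. ennreal \<bar>g (t, x) $ j\<bar>)"
      unfolding N_def
    proof (rule esssup_AE_cong)
      show "h t \<in> borel_measurable Omega_meas" by (rule hO)
      have eq: "h t x = ennreal \<bar>g (t, x) $ j\<bar>" if "x \<in> space Omega_meas" for x
        using that t by (simp add: h_def Omega_meas_def space_restrict_space)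
      show "(\<lambda>x. ennreal \<bar>g (t, x) $ j\<bar>) \<in> borel_measurable Omega_meas"
        using hO[of t] by (subst measurable_cong[symmetric, OF eq]) auto
      show "AE x in Omega_meas. h t x = ennreal \<bar>g (t, x) $ j\<bar>" by (intro AE_I2 eq)
    qed
    also have "\<dots> \<le> Linf_norm (\<lambda>x. g (t, x))"
      unfolding Linf_norm_def Linf_norm1_def by (intro Max_ge) auto
    finally show ?thesis .
  qed
  have fin: "(\<integral>\<^sup>+t. N t * indicator {0<..<T} t \<partial>lborel) < \<infinity>"
  proof -
    have "(\<integral>\<^sup>+t. N t * indicator {0<..<T} t \<partial>lborel) \<le> (\<integral>\<^sup>+t. Linf_norm (\<lambda>x. g (t, x)) * indicator {0<..<T} t \<partial>lborel)"
      using Nle by (intro nn_integral_mono) (auto simp: indicator_def)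
    also have "\<dots> < \<infinity>" using g by (simp add: Bochner_L1_def set_nn_integral_time)
    finally show ?thesis .
  qed
  define \<alpha> where "\<alpha> t = enn2real (N t * indicator {0<..<T} t)" for t
  have [measurable]: "\<alpha> \<in> borel_measurable borel" unfolding \<alpha>_def by measurable
  have AEfin: "AE t in lborel. N t * indicator {0<..<T} t \<noteq> \<infinity>"
    using fin by (intro nn_integral_PInf_AE) auto
  show ?thesis
  proof (rule that)
    show "\<alpha> t \<ge> 0" for t by (simp add: \<alpha>_def)
    show "integrable lborel \<alpha>"
    proof (rule integrableI_bounded)
      have "(\<integral>\<^sup>+t. ennreal (norm (\<alpha> t)) \<partial>lborel) \<le> (\<integral>\<^sup>+t. N t * indicator {0<..<T} t \<partial>lborel)"
        by (intro nn_integral_mono) (auto simp: \<alpha>_def ennreal_enn2real_if)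
      then show "(\<integral>\<^sup>+t. ennreal (norm (\<alpha> t)) \<partial>lborel) < \<infinity>" using fin by (rule le_less_trans)
    qed auto
    show "AE t in lborel. AE x in lborel. t \<in> {0<..<T} \<longrightarrow> x \<in> {0<..<1} \<longrightarrow> \<bar>g (t, x) $ j\<bar> \<le> \<alpha> t"
      using AEfin
    proof eventually_elim
      case (elim t)
      have "AE x in Omega_meas. h t x \<le> N t" unfolding N_def by (rule esssup_AE)
      then have "AE x in lborel. x \<in> {0<..<1} \<longrightarrow> h t x \<le> N t" by (simp add: Omega_AE)
      then show ?case
      proof eventually_elim
        case (elim x)
        show ?case
        proof (intro impI)
          assume tx: "t \<in> {0<..<T}" "x \<in> {0<..<1}"
          then have "ennreal \<bar>g (t, x) $ j\<bar> \<le> N t" using elim by (simp add: h_def)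
          also have "N t = ennreal (\<alpha> t)"
            using \<open>N t * indicator {0<..<T} t \<noteq> \<infinity>\<close> tx by (simp add: \<alpha>_def less_top)
          finally show "\<bar>g (t, x) $ j\<bar> \<le> \<alpha> t" by (simp add: \<alpha>_def)
        qed
      qed
    qed
  qed
qed

lemma Bochner_Linf_integrable:
  assumes g: "Bochner_L1 T Linf_norm g"
  shows "integrable (cyl_meas T) (\<lambda>z. g z $ j)"
proof -
  have gm: "g \<in> borel_measurable (cyl_meas T)" using g by (simp add: Bochner_L1_def)
  have gjm: "(\<lambda>z. g z $ j) \<in> borel_measurable (cyl_meas T)"
    by (rule measurable_compose[OF gm]) (auto intro!: borel_measurable_continuous_onI continuous_intros)
  obtain \<alpha> where \<alpha>: "integrable lborel \<alpha>" "\<And>t. \<alpha> t \<ge> 0"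
    "AE t in lborel. AE x in lborel. t \<in> {0<..<T} \<longrightarrow> x \<in> {0<..<1} \<longrightarrow> \<bar>g (t, x) $ j\<bar> \<le> \<alpha> t"
    using Bochner_Linf_rate[OF g] by blast
  define H where "H t x = indicat_real ({0<..<T} \<times> {0<..<1}) (t, x) *\<^sub>R g (t, x) $ j" for t x
  have Heq: "case_prod H = (\<lambda>z. indicat_real ({0<..<T} \<times> {0<..<1}) z *\<^sub>R g z $ j)"
    by (auto simp: H_def)
  have Hm: "case_prod H \<in> borel_measurable (borel \<Otimes>\<^sub>M borel)"
    unfolding Heq by (rule cyl_ext_measurable[OF gjm])
  have "integrable (lborel \<Otimes>\<^sub>M lborel) (case_prod H)"
  proof (rule integrable_pair_slice_bound(1)[OF Hm])
    show "AE t in lborel. (\<integral>\<^sup>+x. ennreal \<bar>H t x\<bar> \<partial>lborel) \<le> ennreal (\<alpha> t)"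
      using \<alpha>(3)
    proof eventually_elim
      case (elim t)
      have "(\<integral>\<^sup>+x. ennreal \<bar>H t x\<bar> \<partial>lborel) \<le> (\<integral>\<^sup>+x. ennreal (\<alpha> t) * indicator {0<..<1::real} x \<partial>lborel)"
        by (rule nn_integral_mono_AE) (use elim \<alpha>(2) in \<open>auto simp: H_def indicator_def elim!: eventually_mono intro: ennreal_leI\<close>)
      then show ?case by (simp add: nn_integral_cmult_indicator)
    qed
    have "(\<integral>\<^sup>+t. ennreal (\<alpha> t) \<partial>lborel) = ennreal (\<integral>t. \<alpha> t \<partial>lborel)"
      using \<alpha> by (intro nn_integral_eq_integral) auto
    then show "(\<integral>\<^sup>+t. ennreal (\<alpha> t) \<partial>lborel) < \<infinity>" by simp
  qed
  then show ?thesis unfolding cyl_integrable_iff Heq .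
qed

subsection \<open>Test functions of one component depending on space only\<close>

lemma dmat_mult_axis: "dmat v *v (a *\<^sub>R axis j 1) = (v $ j * a) *\<^sub>R axis j (1::real)"
  by (simp add: vec_eq_iff dmat_def matrix_vector_mult_def axis_def if_distrib[where f = "\<lambda>x. _ * x"] cong: if_cong)

lemma weak_integrand_axis:
  "weak_integrand u c f \<rho> (\<lambda>z. \<phi> (snd z) *\<^sub>R axis j 1) (\<lambda>_. 0) (\<lambda>z. \<phi>' (snd z) *\<^sub>R axis j 1) z
    = \<rho> z $ j * (u z $ j * \<phi>' (snd z) - c z $ j * \<phi> (snd z)) + f z $ j * \<phi> (snd z)"
  by (simp add: weak_integrand_def dmat_mult_axis[where a = 1, simplified] inner_diff_right inner_axis algebra_simps)

text \<open>Test functions constant in time are enough, since the trace identity holds between any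
  two times; the time dependence is carried by t0 and t1.\<close>

lemma test_fun_axis:
  fixes \<phi> \<phi>' :: "real \<Rightarrow> real"
  assumes D: "\<And>x. (\<phi> has_real_derivative \<phi>' x) (at x)" and C: "continuous_on UNIV \<phi>'"
  shows "test_fun T (\<lambda>z. \<phi> (snd z) *\<^sub>R axis j (1::real)) (\<lambda>_. 0) (\<lambda>z. \<phi>' (snd z) *\<^sub>R axis j 1)"
  unfolding test_fun_def
proof (intro conjI)
  have "bounded (\<phi>' ` {0..1})" by (rule compact_imp_bounded[OF compact_continuous_image]) (use C continuous_on_subset in auto)
  then obtain B where B: "\<And>x. x \<in> {0..1} \<Longrightarrow> \<bar>\<phi>' x\<bar> \<le> B" unfolding bounded_iff by fastforce
  have B0: "B \<ge> 0" using B[of 0] by simp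
  have lip: "\<bar>\<phi> x - \<phi> y\<bar> \<le> B * \<bar>x - y\<bar>" if "x \<in> {0..1}" "y \<in> {0..1}" for x y
  proof -
    have "norm (\<phi> x - \<phi> y) \<le> B * norm (x - y)"
      by (rule field_differentiable_bound[of "{0..1}" \<phi> \<phi>'])
        (use that B D in \<open>auto intro: has_field_derivative_at_within\<close>)
    then show ?thesis by simp
  qed
  show "\<exists>L. L-lipschitz_on ({0..T} \<times> {0..1}) (\<lambda>z. \<phi> (snd z) *\<^sub>R axis j (1::real))"
  proof (intro exI[of _ B] lipschitz_onI)
    fix z w :: "real \<times> real" assume zw: "z \<in> {0..T} \<times> {0..1}" "w \<in> {0..T} \<times> {0..1}"
    have "dist (\<phi> (snd z) *\<^sub>R axis j (1::real)) (\<phi> (snd w) *\<^sub>R axis j 1) = \<bar>\<phi> (snd z) - \<phi> (snd w)\<bar>"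
      by (simp add: dist_norm flip: scaleR_left_diff_distrib)
    also have "\<dots> \<le> B * \<bar>snd z - snd w\<bar>" using zw by (intro lip) auto
    also have "\<dots> \<le> B * dist z w"
      using B0 dist_snd_le[of z w] by (intro mult_left_mono) (auto simp: dist_real_def)
    finally show "dist (\<phi> (snd z) *\<^sub>R axis j (1::real)) (\<phi> (snd w) *\<^sub>R axis j 1) \<le> B * dist z w" .
  qed (rule B0)
  have "continuous_on UNIV (\<lambda>z::real \<times> real. \<phi>' (snd z) *\<^sub>R axis j (1::real))"
    by (intro continuous_intros continuous_on_compose2[OF C]) auto
  from borel_measurable_continuous_onI[OF this]
  show "(\<lambda>z::real \<times> real. \<phi>' (snd z) *\<^sub>R axis j (1::real)) \<in> borel_measurable (cyl_meas T)"
    unfolding cyl_meas_def by (intro measurable_restrict_space1) simp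
  have "((\<lambda>y. \<phi> y *\<^sub>R axis j (1::real)) has_vector_derivative \<phi>' x *\<^sub>R axis j 1) (at x)" for x
    using has_vector_derivative_scaleR[OF D[of x] has_vector_derivative_const[of "axis j (1::real)"]] by simp
  then show "AE (t, x) in cyl_meas T. ((\<lambda>s. \<phi> (snd (s, x)) *\<^sub>R axis j (1::real)) has_vector_derivative 0) (at t) \<and>
      ((\<lambda>y. \<phi> (snd (t, y)) *\<^sub>R axis j (1::real)) has_vector_derivative \<phi>' (snd (t, x)) *\<^sub>R axis j 1) (at x)"
    by (intro AE_I2) auto
qed auto

lemma measurable_vec_nth_comp [measurable (raw)]:
  "f \<in> borel_measurable M \<Longrightarrow> (\<lambda>x. (f x :: real ^ 'n) $ j) \<in> borel_measurable M"
  by (rule measurable_compose[of f M borel]) (auto intro!: borel_measurable_continuous_onI continuous_intros)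

text \<open>Point values are controlled by the one-dimensional Sobolev embedding with constant 1: |w
  p| is at most |w x| plus the total variation, and one averages over x in (0,1). This makes the
  boundary values of u integrable in time.\<close>

lemma W11_norm_component:
  assumes w1: "has_weak_deriv w w1" and c: "continuous_on {0..1} w"
  shows "(\<integral>\<^sup>+x. ennreal \<bar>indicat_real {0<..<1} x * w x $ j\<bar> \<partial>lborel) \<le> W11_norm w"
    "(\<integral>\<^sup>+x. ennreal \<bar>indicat_real {0<..<1} x * w1 x $ j\<bar> \<partial>lborel) \<le> W11_norm w"
    "p \<in> {0..1} \<Longrightarrow> ennreal \<bar>w p $ j\<bar> \<le> W11_norm w"
proof -
  have le: "(\<integral>\<^sup>+x. ennreal \<bar>indicat_real {0<..<1} x * v x $ j\<bar> \<partial>lborel) \<le> (\<integral>\<^sup>+x. ennreal (norm (v x)) \<partial>Omega_meas)" for v :: "real \<Rightarrow> real ^ 'a"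
    unfolding Omega_meas_def
    by (subst nn_integral_restrict_space)
      (auto intro!: nn_integral_mono ennreal_leI component_le_norm_cart simp: indicator_def)
  let ?A = "\<integral>\<^sup>+x. ennreal \<bar>indicat_real {0<..<1} x * w x $ j\<bar> \<partial>lborel"
  let ?B = "\<integral>\<^sup>+x. ennreal \<bar>indicat_real {0<..<1} x * w1 x $ j\<bar> \<partial>lborel"
  have AB: "?A + ?B \<le> W11_norm w"
    using add_mono[OF le[of w] le[of w1]] W11_norm_ge[OF w1 c] by (rule order_trans)
  show "?A \<le> W11_norm w" "?B \<le> W11_norm w"
    using AB by (auto intro: order_trans[OF _ AB])
  assume p: "p \<in> {0..1}"
  note i = has_weak_deriv_component(1,2)[OF w1, of j]
  let ?U = "\<integral>x. \<bar>indicat_real {0<..<1} x * w1 x $ j\<bar> \<partial>lborel"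
  have osc: "\<bar>w q $ j - w s $ j\<bar> \<le> ?U" if "s \<le> q" "s \<in> {0..1}" "q \<in> {0..1}" for s q
  proof -
    have "\<bar>w q $ j - w s $ j\<bar> = \<bar>LINT x:{s<..q}|lborel. indicat_real {0<..<1} x * w1 x $ j\<bar>"
      using has_weak_deriv_increment[OF w1 c that(1), of j] that by simp
    also have "\<dots> \<le> (LINT x:{s<..q}|lborel. \<bar>indicat_real {0<..<1} x * w1 x $ j\<bar>)"
      by (rule LINT_Ioc_abs_le[OF set_integrable_lborel[OF i(2)]]) simp
    also have "\<dots> \<le> ?U" by (rule LINT_subset_le[OF i(2)]) simp
    finally show ?thesis .
  qed
  have pw: "\<bar>w p $ j\<bar> \<le> \<bar>w x $ j\<bar> + ?U" if "x \<in> {0<..<1}" for x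
    using osc[of x p] osc[of p x] p that by (cases "x \<le> p") auto
  have i1: "integrable lborel (indicat_real {0<..<1::real})" by (rule integrable_real_indicator) auto
  have "\<bar>w p $ j\<bar> = (\<integral>x. indicat_real {0<..<1::real} x * \<bar>w p $ j\<bar> \<partial>lborel)" by simp
  also have "\<dots> \<le> (\<integral>x. \<bar>indicat_real {0<..<1} x * w x $ j\<bar> + indicat_real {0<..<1} x * ?U \<partial>lborel)"
    using pw by (intro integral_mono Bochner_Integration.integrable_add integrable_abs i integrable_mult_left i1)
      (auto simp: indicator_def)
  also have "\<dots> = (\<integral>x. \<bar>indicat_real {0<..<1} x * w x $ j\<bar> \<partial>lborel) + ?U"
    by (subst Bochner_Integration.integral_add[OF integrable_abs[OF i(1)] integrable_mult_left[OF i1]]) simp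
  finally have "ennreal \<bar>w p $ j\<bar> \<le> ennreal ((\<integral>x. \<bar>indicat_real {0<..<1} x * w x $ j\<bar> \<partial>lborel) + ?U)"
    by (rule ennreal_leI)
  also have "\<dots> = ennreal (\<integral>x. \<bar>indicat_real {0<..<1} x * w x $ j\<bar> \<partial>lborel) + ennreal ?U"
    by (intro ennreal_plus integral_nonneg_AE) auto
  also have "ennreal (\<integral>x. \<bar>indicat_real {0<..<1} x * w x $ j\<bar> \<partial>lborel) = ?A"
    by (rule nn_integral_eq_integral[symmetric]) (auto intro!: integrable_abs i simp del: abs_mult)
  also have "ennreal ?U = ?B"
    by (rule nn_integral_eq_integral[symmetric]) (auto intro!: integrable_abs i simp del: abs_mult)
  finally show "ennreal \<bar>w p $ j\<bar> \<le> W11_norm w" using AB by (rule order_trans)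
qed

subsection \<open>The difference of two solutions\<close>

locale ibvp_pair =
  fixes T :: real and u c f ux :: "real \<times> real \<Rightarrow> real ^ 'n"
    and \<rho>\<^sub>1 \<rho>\<^sub>2 g\<^sub>1 g\<^sub>2 :: "real \<times> real \<Rightarrow> real ^ 'n" and r\<^sub>1 r\<^sub>2 :: "real \<Rightarrow> real \<Rightarrow> real ^ 'n"
  assumes T: "T > 0"
    and u_W11: "Bochner_L1 T W11_norm u"
    and u_borel: "u \<in> borel_measurable (restrict_space borel ({0..T} \<times> {0..1}))"
    and u_cont: "AE t in time_meas T. continuous_on {0..1} (\<lambda>x. u (t, x))"
    and ux_meas: "ux \<in> borel_measurable (cyl_meas T)"
    and u_weak: "AE t in time_meas T. has_weak_deriv (\<lambda>x. u (t, x)) (\<lambda>x. ux (t, x))"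
    and c_int: "integrable (cyl_meas T) c"
    and f_int: "Bochner_L1 T Linf_norm f"
    and rho1: "Linf (\<lambda>_. cyl_meas T) \<rho>\<^sub>1" and rho2: "Linf (\<lambda>_. cyl_meas T) \<rho>\<^sub>2"
    and ver1: "time_continuous_version T \<rho>\<^sub>1 r\<^sub>1" and ver2: "time_continuous_version T \<rho>\<^sub>2 r\<^sub>2"
    and tr1: "is_trace T u c f \<rho>\<^sub>1 r\<^sub>1 g\<^sub>1" and tr2: "is_trace T u c f \<rho>\<^sub>2 r\<^sub>2 g\<^sub>2"
begin

lemma AE_good: "AE t in lborel. t \<in> {0<..<T} \<longrightarrow> continuous_on {0..1} (\<lambda>x. u (t, x)) \<and> has_weak_deriv (\<lambda>x. u (t, x)) (\<lambda>x. ux (t, x))"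
  using u_cont u_weak unfolding time_AE by eventually_elim auto

lemma W11_fin: "(\<integral>\<^sup>+t. W11_norm (\<lambda>x. u (t, x)) * indicator {0<..<T} t \<partial>lborel) < \<infinity>"
  using u_W11 by (simp add: Bochner_L1_def set_nn_integral_time)

lemma cyl_component_measurable:
  assumes "(\<lambda>z. g z $ j) \<in> borel_measurable (cyl_meas T)"
  shows "(\<lambda>(t, x). indicat_real {0<..<T} t * (indicat_real {0<..<1} x * g (t, x) $ j)) \<in> borel_measurable (borel \<Otimes>\<^sub>M borel)"
proof -
  have "(\<lambda>(t, x). indicat_real {0<..<T} t * (indicat_real {0<..<1} x * g (t, x) $ j)) =
      (\<lambda>z. indicat_real ({0<..<T} \<times> {0<..<1}) z *\<^sub>R g z $ j)"
    by (auto simp: indicator_def)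
  then show ?thesis using cyl_ext_measurable[OF assms] by simp
qed

lemma cyl_integrable_component_iff:
  "integrable (cyl_meas T) (\<lambda>z. g z) \<longleftrightarrow>
    integrable (lborel \<Otimes>\<^sub>M lborel) (\<lambda>(t, x). indicat_real {0<..<T} t * (indicat_real {0<..<1} x * g (t, x)))" for g :: "real \<times> real \<Rightarrow> real"
proof -
  have "(\<lambda>(t, x). indicat_real {0<..<T} t * (indicat_real {0<..<1} x * g (t, x))) =
      (\<lambda>z. indicat_real ({0<..<T} \<times> {0<..<1}) z *\<^sub>R g z)"
    by (auto simp: indicator_def)
  then show ?thesis by (simp add: cyl_integrable_iff)
qed

lemma u_cyl_meas: "u \<in> borel_measurable (cyl_meas T)"
  using u_W11 by (simp add: Bochner_L1_def)

lemma u_ux_slices: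
  "AE t in lborel. (\<integral>\<^sup>+x. ennreal \<bar>indicat_real {0<..<T} t * (indicat_real {0<..<1} x * u (t, x) $ j)\<bar> \<partial>lborel) \<le> W11_norm (\<lambda>x. u (t, x)) * indicator {0<..<T} t"
  "AE t in lborel. (\<integral>\<^sup>+x. ennreal \<bar>indicat_real {0<..<T} t * (indicat_real {0<..<1} x * ux (t, x) $ j)\<bar> \<partial>lborel) \<le> W11_norm (\<lambda>x. u (t, x)) * indicator {0<..<T} t"
  "p \<in> {0..1} \<Longrightarrow> AE t in lborel. ennreal \<bar>indicat_real {0<..<T} t * u (t, p) $ j\<bar> \<le> W11_norm (\<lambda>x. u (t, x)) * indicator {0<..<T} t"
proof -
  show "AE t in lborel. (\<integral>\<^sup>+x. ennreal \<bar>indicat_real {0<..<T} t * (indicat_real {0<..<1} x * u (t, x) $ j)\<bar> \<partial>lborel) \<le> W11_norm (\<lambda>x. u (t, x)) * indicator {0<..<T} t"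
    using AE_good
  proof eventually_elim
    case (elim t)
    then show ?case using W11_norm_component(1)[of "\<lambda>x. u (t, x)" "\<lambda>x. ux (t, x)" j] by (cases "t \<in> {0<..<T}") auto
  qed
  show "AE t in lborel. (\<integral>\<^sup>+x. ennreal \<bar>indicat_real {0<..<T} t * (indicat_real {0<..<1} x * ux (t, x) $ j)\<bar> \<partial>lborel) \<le> W11_norm (\<lambda>x. u (t, x)) * indicator {0<..<T} t"
    using AE_good
  proof eventually_elim
    case (elim t)
    then show ?case using W11_norm_component(2)[of "\<lambda>x. u (t, x)" "\<lambda>x. ux (t, x)" j] by (cases "t \<in> {0<..<T}") auto
  qed
  assume p: "p \<in> {0..1}"
  show "AE t in lborel. ennreal \<bar>indicat_real {0<..<T} t * u (t, p) $ j\<bar> \<le> W11_norm (\<lambda>x. u (t, x)) * indicator {0<..<T} t"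
    using AE_good
  proof eventually_elim
    case (elim t)
    then show ?case using W11_norm_component(3)[of "\<lambda>x. u (t, x)" "\<lambda>x. ux (t, x)" p j] p by (cases "t \<in> {0<..<T}") auto
  qed
qed

lemma u_cyl_int: "integrable (cyl_meas T) (\<lambda>z. u z $ j)"
  unfolding cyl_integrable_component_iff
  by (rule integrable_pair_slice_bound(1)[OF cyl_component_measurable u_ux_slices(1) W11_fin])
    (intro measurable_vec_nth_comp u_cyl_meas)

lemma ux_slice_int: "integrable lborel (\<lambda>t. \<integral>x. \<bar>indicat_real {0<..<T} t * (indicat_real {0<..<1} x * ux (t, x) $ j)\<bar> \<partial>lborel)"
  by (rule integrable_pair_slice_bound(2)[OF cyl_component_measurable u_ux_slices(2) W11_fin])
    (intro measurable_vec_nth_comp ux_meas)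

lemma u_ext_measurable: "(\<lambda>(t, x). indicat_real {0<..<T} t * u (t, max 0 (min 1 x)) $ j) \<in> borel_measurable (borel \<Otimes>\<^sub>M borel)"
proof -
  have "{0..T} \<times> {0..1::real} \<in> sets borel" by (intro borel_closed closed_Times) auto
  then have [measurable]: "(\<lambda>z. indicat_real ({0..T} \<times> {0..1}) z *\<^sub>R u z) \<in> borel_measurable borel"
    using u_borel by (subst (asm) borel_measurable_restrict_space_iff) auto
  have [measurable]: "(\<lambda>z::real \<times> real. (fst z, max 0 (min 1 (snd z)))) \<in> (borel \<Otimes>\<^sub>M borel) \<rightarrow>\<^sub>M borel"
    unfolding borel_prod[symmetric] by measurable
  have "(\<lambda>z. indicat_real {0<..<T} (fst z) * ((indicat_real ({0..T} \<times> {0..1}) (fst z, max 0 (min 1 (snd z)))) *\<^sub>R u (fst z, max 0 (min 1 (snd z)))) $ j)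
      \<in> borel_measurable (borel \<Otimes>\<^sub>M borel)"
    by measurable
  also have "(\<lambda>z. indicat_real {0<..<T} (fst z) * ((indicat_real ({0..T} \<times> {0..1}) (fst z, max 0 (min 1 (snd z)))) *\<^sub>R u (fst z, max 0 (min 1 (snd z)))) $ j)
      = (\<lambda>(t, x). indicat_real {0<..<T} t * u (t, max 0 (min 1 x)) $ j)"
    by (auto simp: indicator_def)
  finally show ?thesis .
qed

lemma u_bdry_measurable: "p \<in> {0..1} \<Longrightarrow> (\<lambda>t. indicat_real {0<..<T} t * u (t, p) $ j) \<in> borel_measurable borel"
proof -
  assume p: "p \<in> {0..1}"
  have "(\<lambda>t. (t, p)) \<in> borel \<rightarrow>\<^sub>M (borel \<Otimes>\<^sub>M borel)" by measurable
  from measurable_compose[OF this u_ext_measurable] show ?thesis using p by simp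
qed

lemma u_bdry_int:
  assumes p: "p \<in> {0..1}"
  shows "integrable lborel (\<lambda>t. indicat_real {0<..<T} t * u (t, p) $ j)"
proof (rule integrableI_bounded)
  show "(\<lambda>t. indicat_real {0<..<T} t * u (t, p) $ j) \<in> borel_measurable lborel" using u_bdry_measurable[OF p] by simp
  have "(\<integral>\<^sup>+t. ennreal (norm (indicat_real {0<..<T} t * u (t, p) $ j)) \<partial>lborel) \<le> (\<integral>\<^sup>+t. W11_norm (\<lambda>x. u (t, x)) * indicator {0<..<T} t \<partial>lborel)"
    using u_ux_slices(3)[OF p] by (intro nn_integral_mono_AE) simp
  then show "(\<integral>\<^sup>+t. ennreal (norm (indicat_real {0<..<T} t * u (t, p) $ j)) \<partial>lborel) < \<infinity>"
    using W11_fin by (rule le_less_trans)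
qed

text \<open>The flux in the direction of the x axis, without the sign of the outer normal; it plays
  the role of \<open>G0\<close> and \<open>G1\<close> in \<open>transport\<close>.\<close>

definition bflux :: "(real \<times> real \<Rightarrow> real ^ 'n) \<Rightarrow> 'n \<Rightarrow> real \<Rightarrow> real \<Rightarrow> real" where
  "bflux g j p t = indicat_real {0<..<T} t * (u (t, p) $ j * g (t, p) $ j)"

lemma u_Gamma_measurable: "(\<lambda>z. u z $ j) \<in> borel_measurable (Gamma_meas T)"
proof -
  have "{0..T} \<times> {0..1::real} \<in> sets borel" by (intro borel_closed closed_Times) auto
  then have m: "(\<lambda>z. indicat_real ({0..T} \<times> {0..1}) z *\<^sub>R u z) \<in> borel_measurable borel"
    using u_borel by (subst (asm) borel_measurable_restrict_space_iff) auto
  have "(\<lambda>z. (fst z, snd z)) \<in> Gamma_meas T \<rightarrow>\<^sub>M (borel \<Otimes>\<^sub>M borel)"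
    unfolding Gamma_meas_def
    by (intro measurable_Pair measurable_compose[OF measurable_fst] measurable_compose[OF measurable_snd] measurable_restrict_space1) auto
  then have "(\<lambda>z. z) \<in> Gamma_meas T \<rightarrow>\<^sub>M (borel :: (real \<times> real) measure)" by (simp add: borel_prod)
  from measurable_compose[OF this m]
  have "(\<lambda>z. (indicat_real ({0..T} \<times> {0..1}) z *\<^sub>R u z) $ j) \<in> borel_measurable (Gamma_meas T)"
    by (rule measurable_vec_nth_comp)
  then show ?thesis
    by (subst measurable_cong[where g = "\<lambda>z. (indicat_real ({0..T} \<times> {0..1}) z *\<^sub>R u z) $ j"])
      (auto simp: Gamma_meas_def space_pair_measure space_restrict_space)
qed

lemma nu_Gamma_measurable: "(\<lambda>z. nu (snd z)) \<in> borel_measurable (Gamma_meas T)"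
  unfolding Gamma_meas_def by (rule measurable_compose[OF measurable_snd]) simp

text \<open>The density |\<nu> u| vanishes only where u does. A trace is thus bounded only off the
  zeros of u, which suffices for the product with u.\<close>

lemma mu_abs_Linf:
  assumes g: "Linf (mu_abs T u) g"
  shows "(\<lambda>z. g z $ j) \<in> borel_measurable (Gamma_meas T)"
    "\<exists>B\<ge>0. AE z in Gamma_meas T. u z $ j \<noteq> 0 \<longrightarrow> \<bar>g z $ j\<bar> \<le> B"
proof -
  have m: "(\<lambda>(t, x). ennreal (vpos (nu x *\<^sub>R u (t, x)) $ j) + ennreal (vneg (nu x *\<^sub>R u (t, x)) $ j)) \<in> borel_measurable (Gamma_meas T)"
  proof -
    note [measurable] = u_Gamma_measurable nu_Gamma_measurable
    have "(\<lambda>z. ennreal (max (nu (snd z) * u z $ j) 0) + ennreal (max (- (nu (snd z) * u z $ j)) 0)) \<in> borel_measurable (Gamma_meas T)"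
      by measurable
    moreover have "(\<lambda>(t, x). ennreal (vpos (nu x *\<^sub>R u (t, x)) $ j) + ennreal (vneg (nu x *\<^sub>R u (t, x)) $ j))
        = (\<lambda>z. ennreal (max (nu (snd z) * u z $ j) 0) + ennreal (max (- (nu (snd z) * u z $ j)) 0))"
      by (auto simp: vpos_def vneg_def)
    ultimately show ?thesis by simp
  qed
  show "(\<lambda>z. g z $ j) \<in> borel_measurable (Gamma_meas T)"
    using g by (simp add: Linf_def mu_abs_def)
  obtain B where "AE z in mu_abs T u j. \<bar>g z $ j\<bar> \<le> B" using g by (auto simp: Linf_def)
  then have "AE z in Gamma_meas T. u z $ j \<noteq> 0 \<longrightarrow> \<bar>g z $ j\<bar> \<le> B"
    unfolding mu_abs_def AE_density[OF m]
  proof eventually_elim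
    case (elim z)
    show ?case
    proof
      assume "u z $ j \<noteq> 0"
      then have "0 < (case z of (t, x) \<Rightarrow> ennreal (vpos (nu x *\<^sub>R u (t, x)) $ j) + ennreal (vneg (nu x *\<^sub>R u (t, x)) $ j))"
        by (cases z) (auto simp: vpos_def vneg_def nu_def max_def add_pos_nonneg add_nonneg_pos)
      then show "\<bar>g z $ j\<bar> \<le> B" using elim by simp
    qed
  qed
  then have "AE z in Gamma_meas T. u z $ j \<noteq> 0 \<longrightarrow> \<bar>g z $ j\<bar> \<le> max B 0" by eventually_elim auto
  then show "\<exists>B\<ge>0. AE z in Gamma_meas T. u z $ j \<noteq> 0 \<longrightarrow> \<bar>g z $ j\<bar> \<le> B"
    by (intro exI[of _ "max B 0"]) auto
qed

lemma bflux_int: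
  assumes gm: "(\<lambda>z. g z $ j) \<in> borel_measurable (Gamma_meas T)"
    and gb: "AE z in Gamma_meas T. u z $ j \<noteq> 0 \<longrightarrow> \<bar>g z $ j\<bar> \<le> B" and p: "p \<in> {0, 1}"
  shows "integrable lborel (bflux g j p)"
proof (rule Bochner_Integration.integrable_bound[where f = "\<lambda>t. B * (indicat_real {0<..<T} t * u (t, p) $ j)"])
  have p': "p \<in> {0..1}" using p by auto
  show "integrable lborel (\<lambda>t. B * (indicat_real {0<..<T} t * u (t, p) $ j))"
    by (intro integrable_mult_right u_bdry_int p')
  have "(\<lambda>t. (indicat_real {0<..<T} t * u (t, p) $ j) * (indicat_real {0..T} t * g (t, p) $ j)) \<in> borel_measurable borel"
    by (intro borel_measurable_times u_bdry_measurable p' Gamma_slice_measurable[OF gm p])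
  also have "(\<lambda>t. (indicat_real {0<..<T} t * u (t, p) $ j) * (indicat_real {0..T} t * g (t, p) $ j)) = bflux g j p"
    by (auto simp: bflux_def indicator_def)
  finally show "bflux g j p \<in> borel_measurable lborel" by simp
  show "AE t in lborel. norm (bflux g j p t) \<le> norm (B * (indicat_real {0<..<T} t * u (t, p) $ j))"
    using Gamma_AE[OF gb p]
  proof eventually_elim
    case (elim t)
    show ?case
    proof (cases "t \<in> {0<..<T} \<and> u (t, p) $ j \<noteq> 0")
      case True
      then have "\<bar>g (t, p) $ j\<bar> \<le> \<bar>B\<bar>" using elim by auto
      then show ?thesis using True by (simp add: bflux_def abs_mult mult.commute mult_right_mono)
    qed (auto simp: bflux_def)
  qed
qed

lemma trace_boundary_term:
  assumes g: "Linf (mu_abs T u) g" and t: "0 \<le> t0" "t0 \<le> t1" "t1 \<le> T"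
  shows "(LINT z:{t0..t1} \<times> {0, 1}|Gamma_meas T. g z \<bullet> ((nu (snd z) *\<^sub>R dmat (u z)) *v (\<phi> (snd z) *\<^sub>R axis j 1)))
    = \<phi> 1 * (LINT t:{t0<..t1}|lborel. bflux g j 1 t) - \<phi> 0 * (LINT t:{t0<..t1}|lborel. bflux g j 0 t)"
proof -
  note gm = mu_abs_Linf(1)[OF g, of j]
  obtain B where gb: "AE z in Gamma_meas T. u z $ j \<noteq> 0 \<longrightarrow> \<bar>g z $ j\<bar> \<le> B" using mu_abs_Linf(2)[OF g] by blast
  note ib = bflux_int[OF gm gb]
  define F where "F z = indicat_real ({t0..t1} \<times> {0, 1}) z * (nu (snd z) * u z $ j * g z $ j * \<phi> (snd z))" for z
  have Fm: "F \<in> borel_measurable (Gamma_meas T)"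
  proof -
    note [measurable] = gm u_Gamma_measurable nu_Gamma_measurable
    have [measurable]: "(\<lambda>z. \<phi> (snd z)) \<in> borel_measurable (Gamma_meas T)"
      unfolding Gamma_meas_def by (rule measurable_compose[OF measurable_snd]) simp
    have [measurable]: "(\<lambda>z. indicat_real ({t0..t1} \<times> {0, 1}) z) \<in> borel_measurable (Gamma_meas T)"
    proof -
      have "{t0..t1} \<times> {0, 1::real} \<in> sets (Gamma_meas T)"
        unfolding Gamma_meas_def using t by (intro pair_measureI) (auto simp: sets_restrict_space_iff)
      then show ?thesis by simp
    qed
    show ?thesis unfolding F_def by measurable
  qed
  \<comment> \<open>Closed, half-open and open time intervals meet here; they differ only at t0, 0
    and T.\<close>
  have eqp: "AE t in lborel. indicat_real {0..T} t * F (t, p) = (nu p * \<phi> p) * (indicat_real {t0<..t1} t * bflux g j p t)" if p: "p \<in> {0, 1}" for p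
    using AE_lborel_singleton[of t0] AE_lborel_singleton[of T] AE_lborel_singleton[of 0]
  proof eventually_elim
    case (elim x)
    then show ?case using p t by (auto simp: F_def bflux_def indicator_def)
  qed
  have iset: "integrable lborel (\<lambda>t. (nu p * \<phi> p) * (indicat_real {t0<..t1} t * bflux g j p t))" if p: "p \<in> {0, 1}" for p
    using set_integrable_lborel[OF ib[OF p], of "{t0<..t1}"] by (intro integrable_mult_right) (simp add: set_integrable_def)
  have Fpm: "(\<lambda>t. indicat_real {0..T} t * F (t, p)) \<in> borel_measurable lborel" if p: "p \<in> {0, 1}" for p
    using Gamma_slice_measurable[OF Fm p] by simp
  have iF: "integrable lborel (\<lambda>t. indicat_real {0..T} t * F (t, p))" if p: "p \<in> {0, 1}" for p
    by (subst integrable_cong_AE[OF Fpm[OF p] _ eqp[OF p]]) (use iset[OF p] in auto)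
  have IF: "(\<integral>t. indicat_real {0..T} t * F (t, p) \<partial>lborel) = nu p * \<phi> p * (LINT t:{t0<..t1}|lborel. bflux g j p t)" if p: "p \<in> {0, 1}" for p
    unfolding set_lebesgue_integral_def
    by (subst integral_cong_AE[OF Fpm[OF p] _ eqp[OF p]]) (use iset[OF p] in auto)
  have "(LINT z:{t0..t1} \<times> {0, 1}|Gamma_meas T. g z \<bullet> ((nu (snd z) *\<^sub>R dmat (u z)) *v (\<phi> (snd z) *\<^sub>R axis j 1))) = (\<integral>z. F z \<partial>Gamma_meas T)"
    unfolding set_lebesgue_integral_def F_def
    by (intro Bochner_Integration.integral_cong refl)
      (simp add: scaleR_matrix_vector_assoc[symmetric] dmat_mult_axis inner_axis)
  also have "\<dots> = nu 0 * \<phi> 0 * (LINT t:{t0<..t1}|lborel. bflux g j 0 t) + nu 1 * \<phi> 1 * (LINT t:{t0<..t1}|lborel. bflux g j 1 t)"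
    using Gamma_integrable(2)[OF Fm iF] IF[of 0] IF[of 1] by simp
  finally show ?thesis by (simp add: nu_def)
qed

definition dif :: "'n \<Rightarrow> real \<Rightarrow> real \<Rightarrow> real" where
  "dif j t x = indicat_real {0<..<T} t * (indicat_real {0<..<1} x * (\<rho>\<^sub>1 (t, x) $ j - \<rho>\<^sub>2 (t, x) $ j))"

text \<open>Unlike \<open>dif\<close> this is not cut off in time, as it has to be meaningful at
  every single time, in particular at 0.\<close>

definition rdif :: "'n \<Rightarrow> real \<Rightarrow> real \<Rightarrow> real" where
  "rdif j t x = indicat_real {0<..<1} x * (r\<^sub>1 t x $ j - r\<^sub>2 t x $ j)"

lemma dif_measurable [measurable]: "case_prod (dif j) \<in> borel_measurable (borel \<Otimes>\<^sub>M borel)"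
proof -
  have "(\<lambda>z. (\<rho>\<^sub>1 z - \<rho>\<^sub>2 z) $ j) \<in> borel_measurable (cyl_meas T)"
    using rho1 rho2 unfolding Linf_def vector_minus_component by (intro borel_measurable_diff) auto
  from cyl_component_measurable[OF this] show ?thesis by (simp add: dif_def[abs_def])
qed

lemma dif_bounded: obtains M where "M \<ge> 0" "AE t in lborel. AE x in lborel. \<bar>dif j t x\<bar> \<le> M"
proof -
  obtain B1 where "AE z in cyl_meas T. \<bar>\<rho>\<^sub>1 z $ j\<bar> \<le> B1" using rho1 by (auto simp: Linf_def)
  moreover obtain B2 where "AE z in cyl_meas T. \<bar>\<rho>\<^sub>2 z $ j\<bar> \<le> B2" using rho2 by (auto simp: Linf_def)
  ultimately have "AE z in cyl_meas T. \<bar>\<rho>\<^sub>1 z $ j - \<rho>\<^sub>2 z $ j\<bar> \<le> \<bar>B1\<bar> + \<bar>B2\<bar>" by eventually_elim auto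
  from cyl_AE[OF this] have "AE t in lborel. AE x in lborel. \<bar>dif j t x\<bar> \<le> \<bar>B1\<bar> + \<bar>B2\<bar>"
  proof (rule eventually_mono)
    fix t assume "AE x in lborel. t \<in> {0<..<T} \<longrightarrow> x \<in> {0<..<1} \<longrightarrow> \<bar>\<rho>\<^sub>1 (t, x) $ j - \<rho>\<^sub>2 (t, x) $ j\<bar> \<le> \<bar>B1\<bar> + \<bar>B2\<bar>"
    then show "AE x in lborel. \<bar>dif j t x\<bar> \<le> \<bar>B1\<bar> + \<bar>B2\<bar>"
      by (rule eventually_mono) (auto simp: dif_def indicator_def)
  qed
  then show ?thesis by (intro that[of "\<bar>B1\<bar> + \<bar>B2\<bar>"]) auto
qed

lemma version_component_int:
  assumes v: "time_continuous_version T \<rho> r" and t: "0 \<le> t" "t \<le> T"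
    and c: "continuous_on UNIV \<psi>"
  shows "integrable lborel (\<lambda>x. indicat_real {0<..<1} x * (r t x $ j * \<psi> x))"
proof -
  have rm: "r t \<in> borel_measurable Omega_meas" and ri: "integrable Omega_meas (\<lambda>x. norm (r t x) powr 1)"
    using v t by (auto simp: time_continuous_version_def)
  have "integrable Omega_meas (r t)"
    using ri rm by (simp add: integrable_norm_iff)
  then have "integrable Omega_meas (\<lambda>x. r t x $ j)"
    using integrable_bounded_linear[OF bounded_linear_vec_nth] by blast
  then have i: "integrable lborel (\<lambda>x. indicat_real {0<..<1} x * r t x $ j)"
    unfolding Omega_meas_def by (subst (asm) integrable_restrict_space) auto
  have "bounded (\<psi> ` {0..1})" by (rule compact_imp_bounded[OF compact_continuous_image]) (use c continuous_on_subset in auto)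
  then obtain B where B: "\<And>x. x \<in> {0..1} \<Longrightarrow> \<bar>\<psi> x\<bar> \<le> B" unfolding bounded_iff by fastforce
  have pm: "(\<lambda>x. indicat_real {0..1} x * \<psi> x) \<in> borel_measurable borel"
    using borel_measurable_continuous_onI[OF c] by simp
  have "\<bar>indicat_real {0..1} x * \<psi> x\<bar> \<le> \<bar>B\<bar>" for x using B[of x] by (auto simp: indicator_def)
  from integrable_mult_bounded[OF i pm this]
  show ?thesis by (rule back_subst[of "integrable lborel"]) (auto simp: indicator_def)
qed

lemma weak_integrand_int:
  assumes rho: "Linf (\<lambda>_. cyl_meas T) \<rho>" and c0: "continuous_on UNIV \<phi>" and c1: "continuous_on UNIV \<phi>'"
  shows "integrable (cyl_meas T) (\<lambda>z. \<rho> z $ j * (u z $ j * \<phi>' (snd z) - c z $ j * \<phi> (snd z)) + f z $ j * \<phi> (snd z))"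
proof -
  have bdd: "\<exists>B. \<forall>x\<in>{0..1}. \<bar>\<psi> x\<bar> \<le> B" if "continuous_on UNIV \<psi>" for \<psi> :: "real \<Rightarrow> real"
  proof -
    have "bounded (\<psi> ` {0..1})" by (rule compact_imp_bounded[OF compact_continuous_image]) (use that continuous_on_subset in auto)
    then show ?thesis unfolding bounded_iff by fastforce
  qed
  have pm: "(\<lambda>z. \<psi> (snd z)) \<in> borel_measurable (cyl_meas T)" if "continuous_on UNIV \<psi>" for \<psi> :: "real \<Rightarrow> real"
  proof -
    have "continuous_on UNIV (\<lambda>z::real \<times> real. \<psi> (snd z))"
      by (intro continuous_on_compose2[OF that] continuous_intros) auto
    from borel_measurable_continuous_onI[OF this] show ?thesis
      unfolding cyl_meas_def by (intro measurable_restrict_space1) simp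
  qed
  obtain B where B: "AE z in cyl_meas T. \<bar>\<rho> z $ j\<bar> \<le> B" using rho by (auto simp: Linf_def)
  have rm: "(\<lambda>z. \<rho> z $ j) \<in> borel_measurable (cyl_meas T)" using rho by (auto simp: Linf_def)
  have spx: "snd z \<in> {0..1}" if "z \<in> space (cyl_meas T)" for z
    using that by (auto simp: cyl_meas_def space_restrict_space)
  have prod: "integrable (cyl_meas T) (\<lambda>z. h z * \<psi> (snd z))"
    if h: "integrable (cyl_meas T) h" and c: "continuous_on UNIV \<psi>" for h :: "real \<times> real \<Rightarrow> real" and \<psi>
  proof -
    obtain C where C: "\<And>x. x \<in> {0..1} \<Longrightarrow> \<bar>\<psi> x\<bar> \<le> C" using bdd[OF c] by blast
    show ?thesis
    proof (rule Bochner_Integration.integrable_bound[where f = "\<lambda>z. h z * C"])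
      show "AE z in cyl_meas T. norm (h z * \<psi> (snd z)) \<le> norm (h z * C)"
      proof (rule AE_I2)
        fix z assume "z \<in> space (cyl_meas T)"
        from C[OF spx[OF this]] have "\<bar>\<psi> (snd z)\<bar> \<le> \<bar>C\<bar>" by linarith
        then show "norm (h z * \<psi> (snd z)) \<le> norm (h z * C)" by (simp add: abs_mult mult_left_mono)
      qed
      show "(\<lambda>z. h z * \<psi> (snd z)) \<in> borel_measurable (cyl_meas T)"
        using h pm[OF c] by (intro borel_measurable_times) auto
    qed (use h in auto)
  qed
  have prho: "integrable (cyl_meas T) (\<lambda>z. \<rho> z $ j * h z)" if h: "integrable (cyl_meas T) h" for h
  proof (rule Bochner_Integration.integrable_bound[where f = "\<lambda>z. B * h z"])
    show "AE z in cyl_meas T. norm (\<rho> z $ j * h z) \<le> norm (B * h z)"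
      using B by eventually_elim (auto simp: abs_mult intro!: mult_right_mono)
    show "(\<lambda>z. \<rho> z $ j * h z) \<in> borel_measurable (cyl_meas T)" using h rm by (intro borel_measurable_times) auto
  qed (use h in auto)
  have cj: "integrable (cyl_meas T) (\<lambda>z. c z $ j)"
    using integrable_bounded_linear[OF bounded_linear_vec_nth c_int] .
  show ?thesis
    by (intro Bochner_Integration.integrable_add Bochner_Integration.integrable_diff prho prod u_cyl_int cj c0 c1 Bochner_Linf_integrable[OF f_int])
qed

lemma trace_identity:
  assumes rho: "Linf (\<lambda>_. cyl_meas T) \<rho>" and v: "time_continuous_version T \<rho> r" and tr: "is_trace T u c f \<rho> r g"
    and t: "0 \<le> t0" "t0 \<le> t1" "t1 \<le> T"
    and D: "\<And>x. (\<phi> has_real_derivative \<phi>' x) (at x)" and C: "continuous_on UNIV \<phi>'"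
  shows "(\<integral>x. indicat_real {0<..<1} x * (r t1 x $ j * \<phi> x) \<partial>lborel) - (\<integral>x. indicat_real {0<..<1} x * (r t0 x $ j * \<phi> x) \<partial>lborel)
    = (\<integral>z. indicat_real ({t0<..<t1} \<times> {0<..<1}) z * (\<rho> z $ j * (u z $ j * \<phi>' (snd z) - c z $ j * \<phi> (snd z)) + f z $ j * \<phi> (snd z)) \<partial>cyl_meas T)
      + \<phi> 0 * (LINT t:{t0<..t1}|lborel. bflux g j 0 t) - \<phi> 1 * (LINT t:{t0<..t1}|lborel. bflux g j 1 t)"
proof -
  have gL: "Linf (mu_abs T u) g" using tr by (simp add: is_trace_def)
  have O: "(\<integral>x. r t x \<bullet> (\<phi> (snd (t, x)) *\<^sub>R axis j 1) \<partial>Omega_meas) = (\<integral>x. indicat_real {0<..<1} x * (r t x $ j * \<phi> x) \<partial>lborel)" for t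
    unfolding Omega_meas_def by (subst integral_restrict_space) (auto simp: inner_axis mult_ac)
  have "0 = (LINT z:{t0<..<t1} \<times> {0<..<1}|cyl_meas T. weak_integrand u c f \<rho> (\<lambda>z. \<phi> (snd z) *\<^sub>R axis j 1) (\<lambda>_. 0) (\<lambda>z. \<phi>' (snd z) *\<^sub>R axis j 1) z)
          - (LINT z:{t0..t1} \<times> {0, 1}|Gamma_meas T. g z \<bullet> ((nu (snd z) *\<^sub>R dmat (u z)) *v (\<phi> (snd z) *\<^sub>R axis j 1)))
          + (\<integral>x. r t0 x \<bullet> (\<phi> (snd (t0, x)) *\<^sub>R axis j 1) \<partial>Omega_meas)
          - (\<integral>x. r t1 x \<bullet> (\<phi> (snd (t1, x)) *\<^sub>R axis j 1) \<partial>Omega_meas)"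
    using tr t test_fun_axis[OF D C] unfolding is_trace_def by blast
  then show ?thesis
    unfolding O trace_boundary_term[OF gL t, of \<phi> j] weak_integrand_axis
    by (simp add: set_lebesgue_integral_def)
qed

text \<open>
  After discarding a null set of times, the data of the \<open>j\<close>-th component are extended to the
  whole line; on the discarded times all of them are zero.
\<close>

lemma component_energy:
  assumes \<alpha>: "integrable lborel \<alpha>" "\<And>t. \<alpha> t \<ge> 0"
    and c_ge: "AE t in lborel. AE x in lborel. t \<in> {0<..<T} \<longrightarrow> x \<in> {0<..<1} \<longrightarrow> - c (t, x) $ j \<le> \<alpha> t"
  defines "g \<equiv> \<lambda>z. g\<^sub>1 z - g\<^sub>2 z" and "D \<equiv> \<lambda>t. \<integral>x. \<bar>dif j t x\<bar> \<partial>lborel"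
  shows "integrable lborel (\<lambda>t. \<alpha> t * D t)"
    and "0 \<le> t \<Longrightarrow> t \<le> T \<Longrightarrow> (\<integral>x. \<bar>rdif j t x\<bar> \<partial>lborel) - (\<integral>x. \<bar>rdif j 0 x\<bar> \<partial>lborel)
      \<le> (LINT s:{0<..t}|lborel. (indicat_real {0<..<T} s * (u (s, 0) $ j * \<bar>g (s, 0) $ j\<bar>)) - (indicat_real {0<..<T} s * (u (s, 1) $ j * \<bar>g (s, 1) $ j\<bar>)))
        + (LINT s:{0<..t}|lborel. \<alpha> s * D s)"
    and "AE t in lborel. t \<in> {0<..<T} \<longrightarrow> (\<integral>x. \<bar>rdif j t x\<bar> \<partial>lborel) = D t"
    and "integrable lborel (bflux g j 0)" and "integrable lborel (bflux g j 1)"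
proof -
  obtain M where M: "M \<ge> 0" "AE t in lborel. AE x in lborel. \<bar>dif j t x\<bar> \<le> M" by (rule dif_bounded)
  have cj: "(\<lambda>z. c z $ j) \<in> borel_measurable (cyl_meas T)" using c_int by (intro measurable_vec_nth_comp) auto
  have cji: "integrable (cyl_meas T) (\<lambda>z. c z $ j)"
    using integrable_bounded_linear[OF bounded_linear_vec_nth c_int] .
  define cx where "cx t x = indicat_real {0<..<T} t * (indicat_real {0<..<1} x * c (t, x) $ j)" for t x
  have cxm[measurable]: "case_prod cx \<in> borel_measurable (borel \<Otimes>\<^sub>M borel)"
    unfolding cx_def by (rule cyl_component_measurable[OF cj])
  have cxi: "integrable (lborel \<Otimes>\<^sub>M lborel) (case_prod cx)"
    using cji unfolding cyl_integrable_component_iff cx_def .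
  have "AE t in lborel. (t \<in> {0<..<T} \<longrightarrow> continuous_on {0..1} (\<lambda>x. u (t, x)) \<and> has_weak_deriv (\<lambda>x. u (t, x)) (\<lambda>x. ux (t, x)))
      \<and> integrable lborel (cx t) \<and> (AE x in lborel. \<bar>dif j t x\<bar> \<le> M) \<and> (AE x in lborel. t \<in> {0<..<T} \<longrightarrow> x \<in> {0<..<1} \<longrightarrow> - c (t, x) $ j \<le> \<alpha> t)"
    using AE_good lborel_pair.AE_integrable_fst[OF cxi] M(2) c_ge by eventually_elim auto
  then obtain N where N: "N \<in> null_sets lborel" and good: "\<And>t. t \<notin> N \<Longrightarrow>
      (t \<in> {0<..<T} \<longrightarrow> continuous_on {0..1} (\<lambda>x. u (t, x)) \<and> has_weak_deriv (\<lambda>x. u (t, x)) (\<lambda>x. ux (t, x)))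
      \<and> integrable lborel (cx t) \<and> (AE x in lborel. \<bar>dif j t x\<bar> \<le> M) \<and> (AE x in lborel. t \<in> {0<..<T} \<longrightarrow> x \<in> {0<..<1} \<longrightarrow> - c (t, x) $ j \<le> \<alpha> t)"
    by (rule AE_E3) auto
  define K where "K = {0<..<T} - N"
  have Kb[measurable]: "K \<in> sets borel" using N by (auto simp: K_def null_sets_def)
  have AE_K: "AE t in lborel. t \<in> {0<..<T} \<longrightarrow> t \<in> K"
    using AE_not_in[OF N] by eventually_elim (auto simp: K_def)
  have K_sub: "t \<in> K \<Longrightarrow> t \<in> {0<..<T}" for t by (auto simp: K_def)
  have K_good: "continuous_on {0..1} (\<lambda>x. u (t, x))" "has_weak_deriv (\<lambda>x. u (t, x)) (\<lambda>x. ux (t, x))"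
      "integrable lborel (cx t)" "AE x in lborel. \<bar>dif j t x\<bar> \<le> M" "AE x in lborel. x \<in> {0<..<1} \<longrightarrow> - c (t, x) $ j \<le> \<alpha> t" if "t \<in> K" for t
    using good[of t] that by (auto simp: K_def)
  \<comment> \<open>The difference is bounded by M only almost everywhere in x, while the locale
    demands the bound everywhere; offending values are set to 0.\<close>
  define \<sigma> where "\<sigma> t x = indicat_real K t * (if \<bar>dif j t x\<bar> \<le> M then dif j t x else 0)" for t x
  define u' where "u' t x = indicat_real K t * (indicat_real {0<..<T} t * u (t, max 0 (min 1 x)) $ j)" for t x
  define uxx where "uxx t x = indicat_real K t * (indicat_real {0<..<T} t * (indicat_real {0<..<1} x * ux (t, x) $ j))" for t x
  define c' where "c' t x = indicat_real K t * cx t x" for t x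
  have g_lin: "bflux g j p t = bflux g\<^sub>1 j p t - bflux g\<^sub>2 j p t" for p t
    by (simp add: g_def bflux_def algebra_simps)
  have gL: "Linf (mu_abs T u) g\<^sub>1" "Linf (mu_abs T u) g\<^sub>2" using tr1 tr2 by (auto simp: is_trace_def)
  have gi: "integrable lborel (bflux g\<^sub>1 j p)" "integrable lborel (bflux g\<^sub>2 j p)" if "p \<in> {0, 1}" for p
    using mu_abs_Linf[OF gL(1), of j] mu_abs_Linf[OF gL(2), of j] bflux_int that by blast+
  have gbi: "integrable lborel (bflux g j p)" if "p \<in> {0, 1}" for p
    unfolding g_lin[abs_def] using gi[OF that] by auto
  have sm[measurable]: "case_prod \<sigma> \<in> borel_measurable (borel \<Otimes>\<^sub>M borel)"
    unfolding \<sigma>_def by measurable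
  have um[measurable]: "case_prod u' \<in> borel_measurable (borel \<Otimes>\<^sub>M borel)"
  proof -
    have "case_prod u' = (\<lambda>z. indicat_real K (fst z) * (case z of (t, x) \<Rightarrow> indicat_real {0<..<T} t * u (t, max 0 (min 1 x)) $ j))"
      by (auto simp: u'_def)
    also have "\<dots> \<in> borel_measurable (borel \<Otimes>\<^sub>M borel)"
      by (rule borel_measurable_times[OF _ u_ext_measurable[of j]]) measurable
    finally show ?thesis .
  qed
  have uxm[measurable]: "case_prod uxx \<in> borel_measurable (borel \<Otimes>\<^sub>M borel)"
  proof -
    have "case_prod uxx = (\<lambda>z. indicat_real K (fst z) * (case z of (t, x) \<Rightarrow> indicat_real {0<..<T} t * (indicat_real {0<..<1} x * ux (t, x) $ j)))"
      by (auto simp: uxx_def)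
    also have "\<dots> \<in> borel_measurable (borel \<Otimes>\<^sub>M borel)"
      by (rule borel_measurable_times[OF _ cyl_component_measurable[OF measurable_vec_nth_comp[OF ux_meas], of j]]) measurable
    finally show ?thesis .
  qed
  have cm[measurable]: "case_prod c' \<in> borel_measurable (borel \<Otimes>\<^sub>M borel)"
    unfolding c'_def by measurable
  have slice: "transport_slice M (\<sigma> t) (u' t) (uxx t) (c' t)" for t
  proof
    show "\<sigma> t \<in> borel_measurable borel" "u' t \<in> borel_measurable borel" by measurable
    show "\<bar>\<sigma> t x\<bar> \<le> M" for x using M(1) by (auto simp: \<sigma>_def indicator_def)
    show "\<sigma> t x = 0" "uxx t x = 0" "c' t x = 0" if "x \<notin> {0<..<1}" for x
      using that by (auto simp: \<sigma>_def uxx_def c'_def cx_def dif_def)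
    show "integrable lborel (uxx t)" "integrable lborel (c' t)"
      using has_weak_deriv_component(2)[OF K_good(2), of t j] K_good(3)[of t]
      unfolding uxx_def c'_def by (cases "t \<in> K"; simp add: K_def)+
    show "u' t b - u' t a = (LINT z:{a<..b}|lborel. uxx t z)" if "a \<le> b" for a b
    proof (cases "t \<in> K")
      case True
      then show ?thesis
        using has_weak_deriv_increment[OF K_good(2)[OF True] K_good(1)[OF True] that, of j] K_sub[OF True]
        by (simp add: u'_def uxx_def)
    next
      case False
      then show ?thesis by (simp add: u'_def uxx_def set_lebesgue_integral_def)
    qed
  qed
  have L1K: "integrable lborel (\<lambda>t. indicat_real K t * h t)" if "integrable lborel h" for h :: "real \<Rightarrow> real"
    using integrable_mult_indicator[OF _ that, of K] Kb by simp
  have \<sigma>_dif: "AE x in lborel. \<sigma> t x = dif j t x" if "t \<in> K" for t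
    using K_good(4)[OF that] by eventually_elim (simp add: \<sigma>_def that)
  have r_dif: "AE t in lborel. t \<in> {0<..<T} \<longrightarrow> (AE x in lborel. rdif j t x = dif j t x)"
  proof -
    have "AE t in lborel. t \<in> {0<..<T} \<longrightarrow> (AE x in Omega_meas. r\<^sub>1 t x = \<rho>\<^sub>1 (t, x))"
      "AE t in lborel. t \<in> {0<..<T} \<longrightarrow> (AE x in Omega_meas. r\<^sub>2 t x = \<rho>\<^sub>2 (t, x))"
      using ver1 ver2 unfolding time_continuous_version_def time_AE by auto
    then show ?thesis
    proof eventually_elim
      case (elim t)
      show ?case
      proof
        assume t: "t \<in> {0<..<T}"
        then have "AE x in lborel. x \<in> {0<..<1} \<longrightarrow> r\<^sub>1 t x = \<rho>\<^sub>1 (t, x)" "AE x in lborel. x \<in> {0<..<1} \<longrightarrow> r\<^sub>2 t x = \<rho>\<^sub>2 (t, x)"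
          using elim unfolding Omega_AE by auto
        then show "AE x in lborel. rdif j t x = dif j t x"
          by eventually_elim (use t in \<open>auto simp: rdif_def dif_def indicator_def\<close>)
      qed
    qed
  qed
  have r_sigma: "AE t in lborel. 0 < t \<and> t \<le> T \<longrightarrow> (AE x in lborel. rdif j t x = \<sigma> t x)"
    using r_dif AE_K AE_lborel_singleton[of T]
  proof eventually_elim
    case (elim t)
    show ?case
    proof
      assume "0 < t \<and> t \<le> T"
      then have t: "t \<in> {0<..<T}" using elim(3) by auto
      have "AE x in lborel. rdif j t x = dif j t x" "AE x in lborel. \<sigma> t x = dif j t x"
        using elim t \<sigma>_dif by auto
      then show "AE x in lborel. rdif j t x = \<sigma> t x" by eventually_elim simp
    qed
  qed
  have r_int: "integrable lborel (rdif j t)" if "0 \<le> t" "t \<le> T" for t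
  proof -
    have "(\<lambda>x. indicat_real {0<..<1} x * (r\<^sub>1 t x $ j * 1) - indicat_real {0<..<1} x * (r\<^sub>2 t x $ j * 1)) = rdif j t"
      by (auto simp: rdif_def algebra_simps)
    then show ?thesis
      using Bochner_Integration.integrable_diff[OF version_component_int[OF ver1 that, of "\<lambda>_. 1" j] version_component_int[OF ver2 that, of "\<lambda>_. 1" j]] by simp
  qed
  interpret tr: transport T M \<sigma> u' uxx c' "rdif j" "\<lambda>t. bflux g j 0 t" "\<lambda>t. bflux g j 1 t"
  proof (rule transport.intro)
    show "transport_slice M (\<sigma> t) (u' t) (uxx t) (c' t)" for t by (rule slice)
    show "case_prod \<sigma> \<in> borel_measurable (borel \<Otimes>\<^sub>M borel)" "case_prod u' \<in> borel_measurable (borel \<Otimes>\<^sub>M borel)"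
      "case_prod uxx \<in> borel_measurable (borel \<Otimes>\<^sub>M borel)" "case_prod c' \<in> borel_measurable (borel \<Otimes>\<^sub>M borel)"
      by measurable
    show "integrable lborel (\<lambda>t. \<integral>x. \<bar>uxx t x\<bar> \<partial>lborel)"
      using L1K[OF ux_slice_int[of j]] by (simp add: uxx_def abs_mult)
    show "integrable lborel (\<lambda>t. \<integral>x. \<bar>c' t x\<bar> \<partial>lborel)"
    proof -
      have "(\<lambda>(t, x). \<bar>cx t x\<bar>) = (\<lambda>z. \<bar>case_prod cx z\<bar>)" by auto
      then have "integrable (lborel \<Otimes>\<^sub>M lborel) (\<lambda>(t, x). \<bar>cx t x\<bar>)" using integrable_abs[OF cxi] by simp
      from L1K[OF lborel_pair.integrable_fst[OF this]] show ?thesis by (simp add: c'_def abs_mult)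
    qed
    show "integrable lborel (\<lambda>t. u' t 0)"
      using L1K[OF u_bdry_int[of 0 j]] by (simp add: u'_def)
    show "integrable lborel (\<lambda>t. bflux g j 0 t)" "integrable lborel (\<lambda>t. bflux g j 1 t)" using gbi by auto
    show "integrable lborel (rdif j t)" if "0 \<le> t" "t \<le> T" for t by (rule r_int[OF that])
    show "rdif j t x = 0" if "x \<notin> {0<..<1}" for t x using that by (auto simp: rdif_def)
    show "AE t in lborel. 0 < t \<and> t \<le> T \<longrightarrow> (AE x in lborel. rdif j t x = \<sigma> t x)" by (rule r_sigma)
    fix \<phi> \<phi>' :: "real \<Rightarrow> real" and t0 t1 :: real
    assume t: "0 \<le> t0" "t0 \<le> t1" "t1 \<le> T" and D: "\<And>x. (\<phi> has_real_derivative \<phi>' x) (at x)" and C: "continuous_on UNIV \<phi>'"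
    have C0: "continuous_on UNIV \<phi>" using D by (meson DERIV_isCont continuous_at_imp_continuous_on)
    have [measurable]: "\<phi> \<in> borel_measurable borel" "\<phi>' \<in> borel_measurable borel"
      using C C0 by (auto intro: borel_measurable_continuous_onI)
    define H where "H \<rho> z = \<rho> z $ j * (u z $ j * \<phi>' (snd z) - c z $ j * \<phi> (snd z)) + f z $ j * \<phi> (snd z)" for \<rho> z
    define S where "S = {t0<..<t1} \<times> {0<..<1::real}"
    have iH: "integrable (cyl_meas T) (\<lambda>z. indicat_real S z * H \<rho> z)" if "Linf (\<lambda>_. cyl_meas T) \<rho>" for \<rho>
    proof -
      have "S \<in> sets (cyl_meas T)"
        unfolding S_def cyl_meas_def using t by (subst sets_restrict_space_iff) (auto simp: open_Times)
      from integrable_mult_indicator[OF this weak_integrand_int[OF that C0 C, of j]] show ?thesis by (simp add: H_def)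
    qed
    have rs: "(\<integral>x. rdif j t x * \<phi> x \<partial>lborel) = (\<integral>x. indicat_real {0<..<1} x * (r\<^sub>1 t x $ j * \<phi> x) \<partial>lborel) - (\<integral>x. indicat_real {0<..<1} x * (r\<^sub>2 t x $ j * \<phi> x) \<partial>lborel)"
      if "0 \<le> t" "t \<le> T" for t
      by (subst Bochner_Integration.integral_diff[OF version_component_int[OF ver1 that C0] version_component_int[OF ver2 that C0], symmetric])
        (simp add: rdif_def algebra_simps)
    \<comment> \<open>The difference of the two weak integrands, in which f cancels. Fubini turns
      its integral into the iterated one that the locale requires.\<close>
    define Z where "Z t x = indicat_real {0<..<T} t * (indicat_real {0<..<1} x * (indicat_real S (t, x) * H \<rho>\<^sub>1 (t, x) - indicat_real S (t, x) * H \<rho>\<^sub>2 (t, x)))" for t x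
    have iZ: "integrable (lborel \<Otimes>\<^sub>M lborel) (case_prod Z)"
      using Bochner_Integration.integrable_diff[OF iH[OF rho1] iH[OF rho2]] unfolding cyl_integrable_component_iff Z_def .
      have mZ: "(\<lambda>t. \<integral>x. Z t x \<partial>lborel) \<in> borel_measurable lborel"
        using lborel_pair.integrable_fst[OF iZ] by auto
      have mI: "(\<lambda>t. indicat_real {t0<..t1} t *\<^sub>R (\<integral>x. \<sigma> t x * (u' t x * \<phi>' x - c' t x * \<phi> x) \<partial>lborel)) \<in> borel_measurable lborel"
        by measurable
      have aeq: "AE t in lborel. (\<integral>x. Z t x \<partial>lborel) = indicat_real {t0<..t1} t *\<^sub>R (\<integral>x. \<sigma> t x * (u' t x * \<phi>' x - c' t x * \<phi> x) \<partial>lborel)"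
        using AE_K AE_lborel_singleton[of t1]
      proof eventually_elim
        case (elim s)
        show ?case
        proof (cases "s \<in> {t0<..<t1}")
          case True
          then have sT: "s \<in> {0<..<T}" and sK: "s \<in> K" using t elim by auto
          have "(\<integral>x. Z s x \<partial>lborel) = (\<integral>x. \<sigma> s x * (u' s x * \<phi>' x - c' s x * \<phi> x) \<partial>lborel)"
          proof (rule integral_cong_AE)
            have Zm: "case_prod Z \<in> borel_measurable (borel \<Otimes>\<^sub>M borel)"
              using borel_measurable_integrable[OF iZ] by simp
            from measurable_compose[OF measurable_Pair1'[of s borel borel] Zm]
            show "Z s \<in> borel_measurable lborel" by simp
            show "(\<lambda>x. \<sigma> s x * (u' s x * \<phi>' x - c' s x * \<phi> x)) \<in> borel_measurable lborel" by measurable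
            show "AE x in lborel. Z s x = \<sigma> s x * (u' s x * \<phi>' x - c' s x * \<phi> x)"
              using \<sigma>_dif[OF sK]
            proof eventually_elim
              case (elim x)
              show ?case
                using sT sK True unfolding elim
                by (cases "x \<in> {0<..<1}") (auto simp: Z_def dif_def S_def H_def u'_def c'_def cx_def algebra_simps)
            qed
          qed
          then show ?thesis using True by simp
        next
          case False
          then have "Z s x = 0" for x by (auto simp: Z_def S_def indicator_def)
          then show ?thesis using False elim by (auto simp: indicator_def)
        qed
      qed
    have iL: "set_integrable lborel {t0<..t1} (\<lambda>t. \<integral>x. \<sigma> t x * (u' t x * \<phi>' x - c' t x * \<phi> x) \<partial>lborel)"
      unfolding set_integrable_def
      by (rule integrable_cong_AE_imp[OF lborel_pair.integrable_fst[OF iZ] mI]) (use aeq in \<open>auto elim: eventually_mono\<close>)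
    have "(\<integral>z. indicat_real S z * H \<rho>\<^sub>1 z \<partial>cyl_meas T) - (\<integral>z. indicat_real S z * H \<rho>\<^sub>2 z \<partial>cyl_meas T)
        = (\<integral>z. indicat_real S z * H \<rho>\<^sub>1 z - indicat_real S z * H \<rho>\<^sub>2 z \<partial>cyl_meas T)"
      by (rule Bochner_Integration.integral_diff[OF iH[OF rho1] iH[OF rho2], symmetric])
    also have "\<dots> = (\<integral>z. case_prod Z z \<partial>(lborel \<Otimes>\<^sub>M lborel))"
      unfolding cyl_integral by (intro Bochner_Integration.integral_cong) (auto simp: Z_def indicator_def)
    also have "\<dots> = (\<integral>t. (\<integral>x. Z t x \<partial>lborel) \<partial>lborel)"
      by (rule lborel_pair.integral_fst[OF iZ, symmetric])
    also have "\<dots> = (LINT t:{t0<..t1}|lborel. (\<integral>x. \<sigma> t x * (u' t x * \<phi>' x - c' t x * \<phi> x) \<partial>lborel))"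
      unfolding set_lebesgue_integral_def by (rule integral_cong_AE[OF mZ mI aeq])
    finally have LL: "(\<integral>z. indicat_real S z * H \<rho>\<^sub>1 z \<partial>cyl_meas T) - (\<integral>z. indicat_real S z * H \<rho>\<^sub>2 z \<partial>cyl_meas T)
        = (LINT t:{t0<..t1}|lborel. (\<integral>x. \<sigma> t x * (u' t x * \<phi>' x - c' t x * \<phi> x) \<partial>lborel))" .
    have bl: "(LINT t:{t0<..t1}|lborel. bflux g j p t) = (LINT t:{t0<..t1}|lborel. bflux g\<^sub>1 j p t) - (LINT t:{t0<..t1}|lborel. bflux g\<^sub>2 j p t)" if "p \<in> {0, 1}" for p
      unfolding g_lin by (rule set_integral_diff(2)) (auto intro!: set_integrable_lborel gi[OF that])
    have "(\<integral>x. rdif j t1 x * \<phi> x \<partial>lborel) - (\<integral>x. rdif j t0 x * \<phi> x \<partial>lborel)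
        = (LINT t:{t0<..t1}|lborel. (\<integral>x. \<sigma> t x * (u' t x * \<phi>' x - c' t x * \<phi> x) \<partial>lborel))
          + \<phi> 0 * (LINT t:{t0<..t1}|lborel. bflux g j 0 t) - \<phi> 1 * (LINT t:{t0<..t1}|lborel. bflux g j 1 t)"
    proof -
      have arith: "R1 - R0 = L + f0 * B0 - f1 * B1"
        if "A1 - A0 = L1 + f0 * b10 - f1 * b11" "A1' - A0' = L2 + f0 * b20 - f1 * b21" "L1 - L2 = L"
          "B0 = b10 - b20" "B1 = b11 - b21" "R0 = A0 - A0'" "R1 = A1 - A1'"
        for R1 R0 L f0 B0 f1 B1 A1 A0 A1' A0' L1 L2 b10 b11 b20 b21 :: real
        using that by (simp add: right_diff_distrib)
      show ?thesis
        by (rule arith[OF trace_identity[OF rho1 ver1 tr1 t D C] trace_identity[OF rho2 ver2 tr2 t D C] LL[unfolded H_def S_def] bl bl rs rs])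
          (use t in auto)
    qed
    also have "\<dots> = (LINT t:{t0<..t1}|lborel. (\<integral>x. \<sigma> t x * (u' t x * \<phi>' x - c' t x * \<phi> x) \<partial>lborel) + bflux g j 0 t * \<phi> 0 - bflux g j 1 t * \<phi> 1)"
    proof -
      have i0: "set_integrable lborel {t0<..t1} (\<lambda>t. bflux g j 0 t * \<phi> 0)" and i1: "set_integrable lborel {t0<..t1} (\<lambda>t. bflux g j 1 t * \<phi> 1)"
        using gbi by (auto intro!: set_integrable_lborel)
      show ?thesis
        by (subst set_integral_diff(2)[OF set_integral_add(1)[OF iL i0] i1], subst set_integral_add(2)[OF iL i0])
          (simp add: mult.commute)
    qed
    finally show "(\<integral>x. rdif j t1 x * \<phi> x \<partial>lborel) - (\<integral>x. rdif j t0 x * \<phi> x \<partial>lborel)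
        = (LINT t:{t0<..t1}|lborel. (\<integral>x. \<sigma> t x * (u' t x * \<phi>' x - c' t x * \<phi> x) \<partial>lborel) + bflux g j 0 t * \<phi> 0 - bflux g j 1 t * \<phi> 1)" .
  qed
  show "integrable lborel (bflux g j 0)" "integrable lborel (bflux g j 1)" using gbi by auto
  show r_D: "AE t in lborel. t \<in> {0<..<T} \<longrightarrow> (\<integral>x. \<bar>rdif j t x\<bar> \<partial>lborel) = D t"
    using r_dif
  proof eventually_elim
    case (elim t)
    show ?case
    proof
      assume t: "t \<in> {0<..<T}"
      have [measurable]: "rdif j t \<in> borel_measurable borel" using r_int[of t] t by auto
      show "(\<integral>x. \<bar>rdif j t x\<bar> \<partial>lborel) = D t"
        unfolding D_def using elim t by (intro integral_cong_AE) (auto elim: eventually_mono)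
    qed
  qed
  have D_le: "AE t in lborel. \<bar>D t\<bar> \<le> M"
    using M(2)
  proof eventually_elim
    case (elim t)
    have "D t \<ge> 0" unfolding D_def by (intro integral_nonneg_AE) auto
    moreover have "D t \<le> (\<integral>x. M * indicat_real {0..1::real} x \<partial>lborel)"
      unfolding D_def
    proof (rule integral_mono_AE')
      show "integrable lborel (\<lambda>x. M * indicat_real {0..1::real} x)" by (intro integrable_mult_right integrable_indicator_Icc)
      show "AE x in lborel. \<bar>dif j t x\<bar> \<le> M * indicat_real {0..1} x"
        using elim by eventually_elim (auto simp: dif_def indicator_def split: if_splits)
    qed (use M(1) in auto)
    ultimately show ?case by simp
  qed
  show aD: "integrable lborel (\<lambda>t. \<alpha> t * D t)"
  proof (rule Bochner_Integration.integrable_bound[where f = "\<lambda>t. \<alpha> t * M"])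
    show "AE t in lborel. norm (\<alpha> t * D t) \<le> norm (\<alpha> t * M)"
      using D_le by eventually_elim (use M(1) in \<open>auto simp: abs_mult intro!: mult_left_mono\<close>)
    have [measurable]: "\<alpha> \<in> borel_measurable borel" using \<alpha> by auto
    show "(\<lambda>t. \<alpha> t * D t) \<in> borel_measurable lborel" unfolding D_def by measurable
  qed (use \<alpha> in auto)
  assume t: "0 \<le> t" "t \<le> T"
  define b where "b p s = indicat_real {0<..<T} s * (u (s, p) $ j * \<bar>g (s, p) $ j\<bar>)" for p s
  \<comment> \<open>sgn u |u g| = u |g|: this translates between the boundary terms of the energy
    inequality and those of the weighted norms, and it gives integrability.\<close>
  have b_eq: "b p s = sgn (indicat_real {0<..<T} s * u (s, p) $ j) * \<bar>bflux g j p s\<bar>" for p s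
    by (auto simp: b_def bflux_def abs_mult sgn_mult_abs indicator_def mult.assoc[symmetric])
  have ib: "integrable lborel (b p)" if p: "p \<in> {0, 1}" for p
  proof -
    have p': "p \<in> {0..1}" using p by auto
    have [measurable]: "(\<lambda>s. indicat_real {0<..<T} s * u (s, p) $ j) \<in> borel_measurable borel"
      by (rule u_bdry_measurable[OF p'])
    have "integrable lborel (\<lambda>s. \<bar>bflux g j p s\<bar> * sgn (indicat_real {0<..<T} s * u (s, p) $ j))"
      by (rule integrable_mult_bounded[OF integrable_abs[OF gbi[OF p]], where C = 1]) (auto simp: abs_sgn_eq)
    then show ?thesis unfolding b_eq[abs_def] by (simp add: mult.commute)
  qed
  \<comment> \<open>The lower bound on c is used only here, after all limits; until now c entered
    merely as an integrable function.\<close>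
  have absb: "- tr.absorption s \<le> \<alpha> s * D s" if s: "s \<in> K" for s
  proof -
    have i1: "integrable lborel (\<lambda>x. c' s x * \<bar>\<sigma> s x\<bar>)"
      by (rule integrable_mult_bounded[OF tr.c_int, where C = M]) (auto simp: tr.sigma_le)
    have i2: "integrable lborel (dif j s)"
      by (rule integrable_cong_AE_imp[OF tr.sigma_int[of s]]) (use \<sigma>_dif[OF s] in \<open>auto elim: eventually_mono\<close>)
    have "- tr.absorption s = (\<integral>x. - (c' s x * \<bar>\<sigma> s x\<bar>) \<partial>lborel)"
      unfolding tr.absorption_def by simp
    also have "\<dots> \<le> (\<integral>x. \<alpha> s * \<bar>dif j s x\<bar> \<partial>lborel)"
    proof (rule integral_mono_AE)
      show "integrable lborel (\<lambda>x. - (c' s x * \<bar>\<sigma> s x\<bar>))" using i1 by simp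
      show "integrable lborel (\<lambda>x. \<alpha> s * \<bar>dif j s x\<bar>)" using i2 by simp
      show "AE x in lborel. - (c' s x * \<bar>\<sigma> s x\<bar>) \<le> \<alpha> s * \<bar>dif j s x\<bar>"
        using \<sigma>_dif[OF s] K_good(5)[OF s]
      proof eventually_elim
        case (elim x)
        show ?case
        proof (cases "x \<in> {0<..<1}")
          case True
          then have "- c' s x \<le> \<alpha> s" using elim s K_sub[OF s] by (simp add: c'_def cx_def)
          then have "- c' s x * \<bar>\<sigma> s x\<bar> \<le> \<alpha> s * \<bar>\<sigma> s x\<bar>" by (rule mult_right_mono) simp
          then show ?thesis using elim by simp
        next
          case False
          then show ?thesis using \<alpha>(2)[of s] by (simp add: c'_def cx_def)
        qed
      qed
    qed
    finally show ?thesis by (simp add: D_def)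
  qed
  have "(\<integral>x. \<bar>rdif j t x\<bar> \<partial>lborel) - (\<integral>x. \<bar>rdif j 0 x\<bar> \<partial>lborel)
      \<le> (LINT s:{0<..t}|lborel. sgn (u' s 0) * \<bar>bflux g j 0 s\<bar> - sgn (u' s 1) * \<bar>bflux g j 1 s\<bar> - tr.absorption s)"
    using tr.energy_inequality[of 0 t] t unfolding tr.energy_def by simp
  also have "\<dots> \<le> (LINT s:{0<..t}|lborel. (b 0 s - b 1 s) + \<alpha> s * D s)"
  proof (rule set_integral_mono_AE)
    have sg: "integrable lborel (\<lambda>s. sgn (u' s p) * \<bar>bflux g j p s\<bar>)" if "p \<in> {0, 1}" for p
      using integrable_mult_bounded[OF integrable_abs[OF gbi[OF that]], of "\<lambda>s. sgn (u' s p)" 1]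
      by (simp add: mult.commute abs_sgn_eq)
    show "set_integrable lborel {0<..t} (\<lambda>s. sgn (u' s 0) * \<bar>bflux g j 0 s\<bar> - sgn (u' s 1) * \<bar>bflux g j 1 s\<bar> - tr.absorption s)"
      by (intro set_integrable_lborel Bochner_Integration.integrable_diff sg tr.absorption_int) auto
    show "set_integrable lborel {0<..t} (\<lambda>s. (b 0 s - b 1 s) + \<alpha> s * D s)"
      by (intro set_integrable_lborel Bochner_Integration.integrable_add Bochner_Integration.integrable_diff ib aD) auto
    show "AE s\<in>{0<..t} in lborel. sgn (u' s 0) * \<bar>bflux g j 0 s\<bar> - sgn (u' s 1) * \<bar>bflux g j 1 s\<bar> - tr.absorption s \<le> (b 0 s - b 1 s) + \<alpha> s * D s"
      using AE_K AE_lborel_singleton[of T]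
    proof eventually_elim
      case (elim s)
      show ?case
      proof
        assume "s \<in> {0<..t}"
        then have "s \<in> K" using elim t by auto
        then show "sgn (u' s 0) * \<bar>bflux g j 0 s\<bar> - sgn (u' s 1) * \<bar>bflux g j 1 s\<bar> - tr.absorption s \<le> (b 0 s - b 1 s) + \<alpha> s * D s"
          using absb[of s] by (simp add: b_eq u'_def)
      qed
    qed
  qed
  also have "\<dots> = (LINT s:{0<..t}|lborel. b 0 s - b 1 s) + (LINT s:{0<..t}|lborel. \<alpha> s * D s)"
    by (intro set_integral_add(2) set_integrable_lborel Bochner_Integration.integrable_diff ib aD) auto
  finally show "(\<integral>x. \<bar>rdif j t x\<bar> \<partial>lborel) - (\<integral>x. \<bar>rdif j 0 x\<bar> \<partial>lborel)
      \<le> (LINT s:{0<..t}|lborel. (indicat_real {0<..<T} s * (u (s, 0) $ j * \<bar>g (s, 0) $ j\<bar>)) - (indicat_real {0<..<T} s * (u (s, 1) $ j * \<bar>g (s, 1) $ j\<bar>)))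
        + (LINT s:{0<..t}|lborel. \<alpha> s * D s)"
    unfolding b_def .
qed

end

section \<open>The weighted boundary norms\<close>

lemma cutoff_component: "cutoff t g z $ j = indicat_real {0..t} (fst z) * g z $ j"
  by (cases z) (simp add: cutoff_def)

lemma wnorm_integrand:
  fixes W :: "real ^ 'n ^ 'n"
  assumes "\<And>i j. i \<noteq> j \<Longrightarrow> W $ i $ j = 0"
  shows "vabs a \<bullet> (W *v b) = (\<Sum>j\<in>UNIV. W $ j $ j * (\<bar>a $ j\<bar> * b $ j))"
proof -
  have "(W *v b) $ j = W $ j $ j * b $ j" for j
    unfolding matrix_vector_mult_def using assms
    by (simp add: sum.remove[of UNIV j] sum.neutral)
  then show ?thesis by (simp add: inner_vec_def vabs_def mult_ac)
qed

context ibvp_pair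
begin

lemma Gamma_weight_int:
  assumes hm: "(\<lambda>z. h z $ j) \<in> borel_measurable (Gamma_meas T)" and km: "k \<in> borel_measurable (Gamma_meas T)"
    and k: "\<And>z. \<bar>k z\<bar> \<le> \<bar>u z $ j\<bar>" and b: "AE z in Gamma_meas T. k z \<noteq> 0 \<longrightarrow> \<bar>h z $ j\<bar> \<le> B"
  shows "integrable (Gamma_meas T) (\<lambda>z. \<bar>h z $ j\<bar> * k z)"
proof (rule Gamma_integrable(1))
  show m: "(\<lambda>z. \<bar>h z $ j\<bar> * k z) \<in> borel_measurable (Gamma_meas T)"
    using hm km by (intro borel_measurable_times borel_measurable_abs)
  fix p :: real assume p: "p \<in> {0, 1}"
  then have p': "p \<in> {0..1}" by auto
  show "integrable lborel (\<lambda>t. indicat_real {0..T} t * (\<bar>h (t, p) $ j\<bar> * k (t, p)))"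
  proof (rule Bochner_Integration.integrable_bound[where f = "\<lambda>t. B * (indicat_real {0<..<T} t * u (t, p) $ j)"])
    show "integrable lborel (\<lambda>t. B * (indicat_real {0<..<T} t * u (t, p) $ j))"
      by (intro integrable_mult_right u_bdry_int p')
    show "(\<lambda>t. indicat_real {0..T} t * (\<bar>h (t, p) $ j\<bar> * k (t, p))) \<in> borel_measurable lborel"
      using Gamma_slice_measurable[OF m p] by simp
    show "AE t in lborel. norm (indicat_real {0..T} t * (\<bar>h (t, p) $ j\<bar> * k (t, p))) \<le> norm (B * (indicat_real {0<..<T} t * u (t, p) $ j))"
      using Gamma_AE[OF b p] AE_lborel_singleton[of 0] AE_lborel_singleton[of T]
    proof eventually_elim
      case (elim t)
      show ?case
      proof (cases "t \<in> {0..T} \<and> k (t, p) \<noteq> 0")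
        case True
        then have "\<bar>h (t, p) $ j\<bar> * \<bar>k (t, p)\<bar> \<le> \<bar>B\<bar> * \<bar>u (t, p) $ j\<bar>"
          using elim by (intro mult_mono k) auto
        then show ?thesis using True elim by (simp add: abs_mult)
      qed auto
    qed
  qed
qed

definition kpos :: "'n \<Rightarrow> real \<times> real \<Rightarrow> real" where "kpos j z = max (nu (snd z) * u z $ j) 0"

definition kneg :: "'n \<Rightarrow> real \<times> real \<Rightarrow> real" where "kneg j z = max (- (nu (snd z) * u z $ j)) 0"

lemma k_measurable: "kpos j \<in> borel_measurable (Gamma_meas T)" "kneg j \<in> borel_measurable (Gamma_meas T)"
proof -
  note [measurable] = u_Gamma_measurable nu_Gamma_measurable
  show "kpos j \<in> borel_measurable (Gamma_meas T)" "kneg j \<in> borel_measurable (Gamma_meas T)"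
    unfolding kpos_def kneg_def by measurable
qed

lemma k_le: "\<bar>kpos j z\<bar> \<le> \<bar>u z $ j\<bar>" "\<bar>kneg j z\<bar> \<le> \<bar>u z $ j\<bar>" "kpos j z \<ge> 0" "kneg j z \<ge> 0"
  "kneg j z - kpos j z = - (nu (snd z) * u z $ j)"
  by (auto simp: kpos_def kneg_def nu_def max_def)

lemma mu_plus_eq: "mu_plus T u j = density (Gamma_meas T) (\<lambda>z. ennreal (kpos j z))"
  and mu_minus_eq: "mu_minus T u j = density (Gamma_meas T) (\<lambda>z. ennreal (kneg j z))"
proof -
  have "(\<lambda>(t, x). ennreal (vpos (nu x *\<^sub>R u (t, x)) $ j)) = (\<lambda>z. ennreal (kpos j z))"
    "(\<lambda>(t, x). ennreal (vneg (nu x *\<^sub>R u (t, x)) $ j)) = (\<lambda>z. ennreal (kneg j z))"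
    by (auto simp: kpos_def kneg_def vpos_def vneg_def fun_eq_iff)
  then show "mu_plus T u j = density (Gamma_meas T) (\<lambda>z. ennreal (kpos j z))"
    "mu_minus T u j = density (Gamma_meas T) (\<lambda>z. ennreal (kneg j z))"
    by (simp_all add: mu_plus_def mu_minus_def)
qed

lemma mu_plus_AE: "(AE z in mu_plus T u j. P z) \<longleftrightarrow> (AE z in Gamma_meas T. kpos j z \<noteq> 0 \<longrightarrow> P z)"
  and mu_minus_AE: "(AE z in mu_minus T u j. P z) \<longleftrightarrow> (AE z in Gamma_meas T. kneg j z \<noteq> 0 \<longrightarrow> P z)"
proof -
  have e: "0 < ennreal (kpos j z) \<longleftrightarrow> kpos j z \<noteq> 0" "0 < ennreal (kneg j z) \<longleftrightarrow> kneg j z \<noteq> 0" for z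
    using k_le(3,4)[of j z] by auto
  note [measurable] = k_measurable
  show "(AE z in mu_plus T u j. P z) \<longleftrightarrow> (AE z in Gamma_meas T. kpos j z \<noteq> 0 \<longrightarrow> P z)"
    unfolding mu_plus_eq by (subst AE_density) (simp_all only: e, measurable)
  show "(AE z in mu_minus T u j. P z) \<longleftrightarrow> (AE z in Gamma_meas T. kneg j z \<noteq> 0 \<longrightarrow> P z)"
    unfolding mu_minus_eq by (subst AE_density) (simp_all only: e, measurable)
qed

lemma Linf_mu_plus: "Linf (mu_plus T u) h \<longleftrightarrow> (\<forall>j. (\<lambda>z. h z $ j) \<in> borel_measurable (Gamma_meas T) \<and>
    (\<exists>B. AE z in Gamma_meas T. kpos j z \<noteq> 0 \<longrightarrow> \<bar>h z $ j\<bar> \<le> B))"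
  and Linf_mu_minus: "Linf (mu_minus T u) h \<longleftrightarrow> (\<forall>j. (\<lambda>z. h z $ j) \<in> borel_measurable (Gamma_meas T) \<and>
    (\<exists>B. AE z in Gamma_meas T. kneg j z \<noteq> 0 \<longrightarrow> \<bar>h z $ j\<bar> \<le> B))"
  unfolding Linf_def mu_plus_AE mu_minus_AE by (simp_all add: mu_plus_eq mu_minus_eq)

lemma mu_abs_imp_Linf:
  assumes "Linf (mu_abs T u) h"
  shows "Linf (mu_plus T u) h" "Linf (mu_minus T u) h"
proof -
  have "\<exists>B. (AE z in Gamma_meas T. kpos j z \<noteq> 0 \<longrightarrow> \<bar>h z $ j\<bar> \<le> B) \<and> (AE z in Gamma_meas T. kneg j z \<noteq> 0 \<longrightarrow> \<bar>h z $ j\<bar> \<le> B)" for j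
  proof -
    obtain B where "AE z in Gamma_meas T. u z $ j \<noteq> 0 \<longrightarrow> \<bar>h z $ j\<bar> \<le> B" using mu_abs_Linf(2)[OF assms] by blast
    then show ?thesis by (intro exI[of _ B]) (auto elim!: eventually_mono simp: kpos_def kneg_def)
  qed
  then show "Linf (mu_plus T u) h" "Linf (mu_minus T u) h"
    unfolding Linf_mu_plus Linf_mu_minus using mu_abs_Linf(1)[OF assms] by blast+
qed

lemma cutoff_Gamma_measurable:
  assumes "(\<lambda>z. h z $ j) \<in> borel_measurable (Gamma_meas T)"
  shows "(\<lambda>z. cutoff t h z $ j) \<in> borel_measurable (Gamma_meas T)"
proof -
  have "(\<lambda>z. indicat_real {0..t} (fst z)) \<in> borel_measurable (Gamma_meas T)"
    unfolding Gamma_meas_def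
    by (rule measurable_compose[OF measurable_fst]) (intro measurable_restrict_space1, simp)
  then show ?thesis unfolding cutoff_component using assms by (intro borel_measurable_times)
qed

lemma Linf_cutoff:
  shows "Linf (mu_plus T u) h \<Longrightarrow> Linf (mu_plus T u) (cutoff t h)"
    and "Linf (mu_minus T u) h \<Longrightarrow> Linf (mu_minus T u) (cutoff t h)"
proof -
  have b: "\<exists>B. AE z in Gamma_meas T. k z \<noteq> 0 \<longrightarrow> \<bar>cutoff t h z $ j\<bar> \<le> B"
    if ex: "\<exists>B. AE z in Gamma_meas T. k z \<noteq> 0 \<longrightarrow> \<bar>h z $ j\<bar> \<le> B" for k :: "real \<times> real \<Rightarrow> real" and j
  proof -
    obtain B where "AE z in Gamma_meas T. k z \<noteq> 0 \<longrightarrow> \<bar>h z $ j\<bar> \<le> B" using ex by blast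
    then have "AE z in Gamma_meas T. k z \<noteq> 0 \<longrightarrow> \<bar>cutoff t h z $ j\<bar> \<le> \<bar>B\<bar>"
      by eventually_elim (auto simp: cutoff_component indicator_def)
    then show ?thesis by blast
  qed
  show "Linf (mu_plus T u) h \<Longrightarrow> Linf (mu_plus T u) (cutoff t h)"
    unfolding Linf_mu_plus using b cutoff_Gamma_measurable by blast
  show "Linf (mu_minus T u) h \<Longrightarrow> Linf (mu_minus T u) (cutoff t h)"
    unfolding Linf_mu_minus using b cutoff_Gamma_measurable by blast
qed

context
  fixes W :: "real ^ 'n ^ 'n"
  assumes W: "pos_def_diagonal W"
begin

lemma W_diag: "i \<noteq> j \<Longrightarrow> W $ i $ j = 0" and W_pos: "W $ j $ j > 0"
proof -
  show "i \<noteq> j \<Longrightarrow> W $ i $ j = 0" using W by (auto simp: pos_def_diagonal_def)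
  have "axis j (1::real) \<noteq> 0" by (simp add: axis_eq_0_iff)
  then have "0 < axis j (1::real) \<bullet> (W *v axis j 1)" using W by (auto simp: pos_def_diagonal_def)
  also have "axis j (1::real) \<bullet> (W *v axis j 1) = W $ j $ j"
    by (simp add: inner_commute[of "axis j 1"] inner_axis matrix_vector_mult_basis column_def)
  finally show "W $ j $ j > 0" .
qed

lemma wnorm_plus_eq: "wnorm_plus T u W h = (\<integral>z. (\<Sum>j\<in>UNIV. W $ j $ j * (\<bar>h z $ j\<bar> * kpos j z)) \<partial>Gamma_meas T)"
  and wnorm_minus_eq: "wnorm_minus T u W h = (\<integral>z. (\<Sum>j\<in>UNIV. W $ j $ j * (\<bar>h z $ j\<bar> * kneg j z)) \<partial>Gamma_meas T)"
proof -
  have "vabs a \<bullet> (W *v b) = (\<Sum>j\<in>UNIV. W $ j $ j * (\<bar>a $ j\<bar> * b $ j))" for a b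
    by (rule wnorm_integrand) (rule W_diag)
  then show "wnorm_plus T u W h = (\<integral>z. (\<Sum>j\<in>UNIV. W $ j $ j * (\<bar>h z $ j\<bar> * kpos j z)) \<partial>Gamma_meas T)"
    "wnorm_minus T u W h = (\<integral>z. (\<Sum>j\<in>UNIV. W $ j $ j * (\<bar>h z $ j\<bar> * kneg j z)) \<partial>Gamma_meas T)"
    by (auto simp: wnorm_plus_def wnorm_minus_def kpos_def kneg_def vpos_def vneg_def
        intro!: Bochner_Integration.integral_cong)
qed

lemma wnorm_plus_int: "Linf (mu_plus T u) h \<Longrightarrow> integrable (Gamma_meas T) (\<lambda>z. \<Sum>j\<in>UNIV. W $ j $ j * (\<bar>h z $ j\<bar> * kpos j z))"
  unfolding Linf_mu_plus
  by (intro Bochner_Integration.integrable_sum integrable_mult_right) (blast intro: Gamma_weight_int k_measurable k_le)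

lemma wnorm_minus_int: "Linf (mu_minus T u) h \<Longrightarrow> integrable (Gamma_meas T) (\<lambda>z. \<Sum>j\<in>UNIV. W $ j $ j * (\<bar>h z $ j\<bar> * kneg j z))"
  unfolding Linf_mu_minus
  by (intro Bochner_Integration.integrable_sum integrable_mult_right) (blast intro: Gamma_weight_int k_measurable k_le)

lemma wnorm_minus_cong:
  assumes "Linf (mu_minus T u) h" "Linf (mu_minus T u) h'" "AE_eq (mu_minus T u) h h'"
  shows "wnorm_minus T u W h = wnorm_minus T u W h'"
  unfolding wnorm_minus_eq
proof (rule integral_cong_AE)
  show "(\<lambda>z. \<Sum>j\<in>UNIV. W $ j $ j * (\<bar>h z $ j\<bar> * kneg j z)) \<in> borel_measurable (Gamma_meas T)"
    "(\<lambda>z. \<Sum>j\<in>UNIV. W $ j $ j * (\<bar>h' z $ j\<bar> * kneg j z)) \<in> borel_measurable (Gamma_meas T)"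
    using wnorm_minus_int[OF assms(1)] wnorm_minus_int[OF assms(2)] by auto
  have "AE z in Gamma_meas T. \<forall>j. kneg j z \<noteq> 0 \<longrightarrow> h z $ j = h' z $ j"
    using assms(3) unfolding AE_eq_def mu_minus_AE by (intro eventually_all_finite) auto
  then show "AE z in Gamma_meas T. (\<Sum>j\<in>UNIV. W $ j $ j * (\<bar>h z $ j\<bar> * kneg j z)) = (\<Sum>j\<in>UNIV. W $ j $ j * (\<bar>h' z $ j\<bar> * kneg j z))"
  proof eventually_elim
    case (elim z)
    show ?case
    proof (rule sum.cong[OF refl])
      fix j show "W $ j $ j * (\<bar>h z $ j\<bar> * kneg j z) = W $ j $ j * (\<bar>h' z $ j\<bar> * kneg j z)"
        using elim[rule_format, of j] by (cases "kneg j z = 0") auto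
    qed
  qed
qed

lemma wnorm_minus_cutoff_le:
  assumes "Linf (mu_minus T u) h"
  shows "wnorm_minus T u W (cutoff t h) \<le> wnorm_minus T u W h"
  unfolding wnorm_minus_eq
proof (rule integral_mono[OF wnorm_minus_int[OF Linf_cutoff(2)[OF assms]] wnorm_minus_int[OF assms]])
  fix z
  show "(\<Sum>j\<in>UNIV. W $ j $ j * (\<bar>cutoff t h z $ j\<bar> * kneg j z)) \<le> (\<Sum>j\<in>UNIV. W $ j $ j * (\<bar>h z $ j\<bar> * kneg j z))"
    using less_imp_le[OF W_pos] k_le(4)
    by (intro sum_mono mult_left_mono mult_right_mono) (auto simp: cutoff_component indicator_def)
qed

text \<open>The two densities differ by -\<nu> u, which is u at 0 and -u at 1. The difference of the
  norms is therefore the weighted sum of the boundary terms in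
  \<open>component_energy\<close>.\<close>

lemma wnorm_difference:
  assumes g: "Linf (mu_plus T u) g" "Linf (mu_minus T u) g" and ib: "\<And>j p. p \<in> {0, 1} \<Longrightarrow> integrable lborel (bflux g j p)"
    and t: "t < T"
  shows "wnorm_minus T u W (cutoff t g) - wnorm_plus T u W (cutoff t g) =
    (\<Sum>j\<in>UNIV. W $ j $ j * (LINT s:{0<..t}|lborel. (indicat_real {0<..<T} s * (u (s, 0) $ j * \<bar>g (s, 0) $ j\<bar>))
        - (indicat_real {0<..<T} s * (u (s, 1) $ j * \<bar>g (s, 1) $ j\<bar>))))"
proof -
  note gp = Linf_cutoff(1)[OF g(1), of t] and gm = Linf_cutoff(2)[OF g(2), of t]
  define F where "F j z = \<bar>cutoff t g z $ j\<bar> * kneg j z - \<bar>cutoff t g z $ j\<bar> * kpos j z" for j z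
  have iF: "integrable (Gamma_meas T) (F j)" for j
  proof -
    have "integrable (Gamma_meas T) (\<lambda>z. \<bar>cutoff t g z $ j\<bar> * kneg j z)" "integrable (Gamma_meas T) (\<lambda>z. \<bar>cutoff t g z $ j\<bar> * kpos j z)"
      using gp gm unfolding Linf_mu_plus Linf_mu_minus by (blast intro: Gamma_weight_int k_measurable k_le)+
    then show ?thesis unfolding F_def by (rule Bochner_Integration.integrable_diff)
  qed
  define b where "b j p s = indicat_real {0<..<T} s * (u (s, p) $ j * \<bar>g (s, p) $ j\<bar>)" for j p s
  have b_eq: "b j p s = sgn (indicat_real {0<..<T} s * u (s, p) $ j) * \<bar>bflux g j p s\<bar>" for j p s
    by (auto simp: b_def bflux_def abs_mult sgn_mult_abs indicator_def mult.assoc[symmetric])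
  have ibb: "integrable lborel (b j p)" if p: "p \<in> {0, 1}" for j p
  proof -
    have p': "p \<in> {0..1}" using p by auto
    have [measurable]: "(\<lambda>s. indicat_real {0<..<T} s * u (s, p) $ j) \<in> borel_measurable borel"
      by (rule u_bdry_measurable[OF p'])
    have "integrable lborel (\<lambda>s. \<bar>bflux g j p s\<bar> * sgn (indicat_real {0<..<T} s * u (s, p) $ j))"
      by (rule integrable_mult_bounded[OF integrable_abs[OF ib[OF p]], where C = 1]) (auto simp: abs_sgn_eq)
    then show ?thesis unfolding b_eq[abs_def] by (simp add: mult.commute)
  qed
  have slice: "AE s in lborel. indicat_real {0..T} s * F j (s, p) = (- nu p) * (indicat_real {0<..t} s * b j p s)" for j p
    using AE_lborel_singleton[of 0]
  proof eventually_elim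
    case (elim s)
    have F: "F j z = \<bar>cutoff t g z $ j\<bar> * (- (nu (snd z) * u z $ j))" for z
      unfolding F_def right_diff_distrib[symmetric] k_le(5) ..
    show ?case unfolding F using elim t by (auto simp: cutoff_component b_def indicator_def)
  qed
  have iset: "integrable lborel (\<lambda>s. (- nu p) * (indicat_real {0<..t} s * b j p s))" if p: "p \<in> {0, 1}" for j p
    using set_integrable_lborel[OF ibb[OF p], of "{0<..t}" j] by (intro integrable_mult_right) (simp add: set_integrable_def)
  have Fm: "F j \<in> borel_measurable (Gamma_meas T)" for j using iF by auto
  have Fpm: "(\<lambda>s. indicat_real {0..T} s * F j (s, p)) \<in> borel_measurable lborel" if p: "p \<in> {0, 1}" for j p
    using Gamma_slice_measurable[OF Fm p] by simp
  have iFp: "integrable lborel (\<lambda>s. indicat_real {0..T} s * F j (s, p))" if p: "p \<in> {0, 1}" for j p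
    by (subst integrable_cong_AE[OF Fpm[OF p] _ slice]) (use iset[OF p] borel_measurable_integrable[OF iset[OF p]] in auto)
  have IFp: "(\<integral>s. indicat_real {0..T} s * F j (s, p) \<partial>lborel) = (- nu p) * (LINT s:{0<..t}|lborel. b j p s)" if p: "p \<in> {0, 1}" for j p
    unfolding set_lebesgue_integral_def
    by (subst integral_cong_AE[OF Fpm[OF p] _ slice]) (use iset[OF p] borel_measurable_integrable[OF iset[OF p]] in auto)
  have "wnorm_minus T u W (cutoff t g) - wnorm_plus T u W (cutoff t g) = (\<integral>z. (\<Sum>j\<in>UNIV. W $ j $ j * F j z) \<partial>Gamma_meas T)"
    unfolding wnorm_plus_eq wnorm_minus_eq
    by (subst Bochner_Integration.integral_diff[OF wnorm_minus_int[OF gm] wnorm_plus_int[OF gp], symmetric])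
      (simp add: F_def right_diff_distrib sum_subtractf)
  also have "\<dots> = (\<Sum>j\<in>UNIV. W $ j $ j * (\<integral>z. F j z \<partial>Gamma_meas T))"
    by (subst Bochner_Integration.integral_sum) (auto intro!: integrable_mult_right iF)
  also have "\<dots> = (\<Sum>j\<in>UNIV. W $ j $ j * (LINT s:{0<..t}|lborel. b j 0 s - b j 1 s))"
  proof (rule sum.cong[OF refl])
    fix j
    have "(\<integral>z. F j z \<partial>Gamma_meas T) = (LINT s:{0<..t}|lborel. b j 0 s) - (LINT s:{0<..t}|lborel. b j 1 s)"
      using Gamma_integrable(2)[OF Fm iFp, of j] IFp[of 0 j] IFp[of 1 j] by (simp add: nu_def)
    also have "\<dots> = (LINT s:{0<..t}|lborel. b j 0 s - b j 1 s)"
      by (rule set_integral_diff(2)[symmetric]) (auto intro!: set_integrable_lborel ibb)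
    finally show "W $ j $ j * (\<integral>z. F j z \<partial>Gamma_meas T) = W $ j $ j * (LINT s:{0<..t}|lborel. b j 0 s - b j 1 s)" by simp
  qed
  finally show ?thesis by (simp add: b_def)
qed

end

end

section \<open>Uniqueness from the weighted sum of the component energies\<close>

theorem theorem5:
  fixes T :: real
    and u c f \<rho>\<^sub>i\<^sub>n :: "real \<times> real \<Rightarrow> real ^ 'n"
    and \<rho>\<^sub>0 :: "real \<Rightarrow> real ^ 'n"
    and G H :: "(real \<times> real \<Rightarrow> real ^ 'n) \<Rightarrow> (real \<times> real \<Rightarrow> real ^ 'n)"
    and \<rho>\<^sub>1 \<rho>\<^sub>2 :: "real \<times> real \<Rightarrow> real ^ 'n"
  assumes "T > 0"
    and "admissible T u c f \<rho>\<^sub>0 \<rho>\<^sub>i\<^sub>n G"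
    and "H = (\<lambda>g z. \<rho>\<^sub>i\<^sub>n z + G g z)"
    and "ibvp_solution T u c f \<rho>\<^sub>0 H \<rho>\<^sub>1"
    and "ibvp_solution T u c f \<rho>\<^sub>0 H \<rho>\<^sub>2"
  shows "AE_eq (\<lambda>_. cyl_meas T) \<rho>\<^sub>1 \<rho>\<^sub>2"
proof -
  from assms(2) obtain ux where u: "Bochner_L1 T W11_norm u"
        "u \<in> borel_measurable (restrict_space borel ({0..T} \<times> {0..1}))"
        "AE t in time_meas T. continuous_on {0..1} (\<lambda>x. u (t, x))"
    and ux: "ux \<in> borel_measurable (cyl_meas T)"
        "AE t in time_meas T. has_weak_deriv (\<lambda>x. u (t, x)) (\<lambda>x. ux (t, x))"
    and c: "integrable (cyl_meas T) c"
    and neg: "Bochner_L1 T Linf_norm (\<lambda>z. vneg (ux z + c z))"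
    and pos: "Bochner_L1 T Linf_norm (\<lambda>z. vpos (ux z))"
    and f: "Bochner_L1 T Linf_norm f"
    and G: "admissible_bdry_op T u G"
    unfolding admissible_def by blast
  from assms(4) obtain r1 g1 where s1: "weak_solution T u c f \<rho>\<^sub>1" "time_continuous_version T \<rho>\<^sub>1 r1" "is_trace T u c f \<rho>\<^sub>1 r1 g1"
    "AE x in Omega_meas. r1 0 x = \<rho>\<^sub>0 x" "AE_eq (mu_minus T u) g1 (H g1)"
    unfolding ibvp_solution_def by blast
  from assms(5) obtain r2 g2 where s2: "weak_solution T u c f \<rho>\<^sub>2" "time_continuous_version T \<rho>\<^sub>2 r2" "is_trace T u c f \<rho>\<^sub>2 r2 g2"
    "AE x in Omega_meas. r2 0 x = \<rho>\<^sub>0 x" "AE_eq (mu_minus T u) g2 (H g2)"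
    unfolding ibvp_solution_def by blast
  interpret P: ibvp_pair T u c f ux \<rho>\<^sub>1 \<rho>\<^sub>2 g1 g2 r1 r2
    by (rule ibvp_pair.intro) (use assms(1) u ux c f s1 s2 in \<open>auto simp: weak_solution_def\<close>)
  define g where "g = (\<lambda>z. g1 z - g2 z)"
  have gL: "Linf (mu_abs T u) g1" "Linf (mu_abs T u) g2" using s1(3) s2(3) by (auto simp: is_trace_def)
  obtain W where W: "pos_def_diagonal W" and GW: "\<And>h. Linf (mu_plus T u) h \<Longrightarrow> wnorm_minus T u W (G h) \<le> wnorm_plus T u W h"
    using G unfolding admissible_bdry_op_def by blast
  have G_Linf: "\<And>h. Linf (mu_plus T u) h \<Longrightarrow> Linf (mu_minus T u) (G h)"
    and G_causal: "\<And>h. Linf (mu_plus T u) h \<Longrightarrow> AE t in restrict_space lborel {0..T}. AE_eq (mu_minus T u) (cutoff t (G (cutoff t h))) (cutoff t (G h))"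
    and G_lin: "\<And>h k a b. Linf (mu_plus T u) h \<Longrightarrow> Linf (mu_plus T u) k \<Longrightarrow>
        AE_eq (mu_minus T u) (G (\<lambda>z. a *\<^sub>R h z + b *\<^sub>R k z)) (\<lambda>z. a *\<^sub>R G h z + b *\<^sub>R G k z)"
    using G unfolding admissible_bdry_op_def by blast+
  have Linf_diff: "Linf N (\<lambda>z. h z - k z)" if hk: "Linf N h" "Linf N k" for N :: "'n \<Rightarrow> (real \<times> real) measure" and h k
    unfolding Linf_def
  proof (intro allI conjI)
    fix j
    show "(\<lambda>z. (h z - k z) $ j) \<in> borel_measurable (N j)"
      unfolding vector_minus_component using hk unfolding Linf_def by (intro borel_measurable_diff) auto
    obtain B1 B2 where "AE z in N j. \<bar>h z $ j\<bar> \<le> B1" "AE z in N j. \<bar>k z $ j\<bar> \<le> B2" using hk unfolding Linf_def by blast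
    then have "AE z in N j. \<bar>(h z - k z) $ j\<bar> \<le> B1 + B2" by eventually_elim auto
    then show "\<exists>B. AE z in N j. \<bar>(h z - k z) $ j\<bar> \<le> B" by blast
  qed
  have g_plus: "Linf (mu_plus T u) g" and g_minus: "Linf (mu_minus T u) g"
    unfolding g_def by (intro Linf_diff P.mu_abs_imp_Linf gL)+
  \<comment> \<open>The inflow datum cancels in the difference, so linearity gives the homogeneous
    boundary condition.\<close>
  have gG: "AE_eq (mu_minus T u) g (G g)"
  proof -
    have "AE_eq (mu_minus T u) (G (\<lambda>z. 1 *\<^sub>R g1 z + (-1) *\<^sub>R g2 z)) (\<lambda>z. 1 *\<^sub>R G g1 z + (-1) *\<^sub>R G g2 z)"
      by (intro G_lin P.mu_abs_imp_Linf gL)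
    then have lin: "AE_eq (mu_minus T u) (G g) (\<lambda>z. G g1 z - G g2 z)" by (simp add: g_def)
    show ?thesis
      unfolding AE_eq_def
    proof
      fix j
      have "AE z in mu_minus T u j. g1 z $ j = \<rho>\<^sub>i\<^sub>n z $ j + G g1 z $ j" "AE z in mu_minus T u j. g2 z $ j = \<rho>\<^sub>i\<^sub>n z $ j + G g2 z $ j"
        "AE z in mu_minus T u j. G g z $ j = G g1 z $ j - G g2 z $ j"
        using s1(5) s2(5) lin unfolding AE_eq_def assms(3) by auto
      then show "AE z in mu_minus T u j. g z $ j = G g z $ j" by eventually_elim (simp add: g_def)
    qed
  qed
  have bdry: "AE t in lborel. t \<in> {0..T} \<longrightarrow> wnorm_minus T u W (cutoff t g) \<le> wnorm_plus T u W (cutoff t g)"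
  proof -
    have "AE t in lborel. t \<in> {0..T} \<longrightarrow> AE_eq (mu_minus T u) (cutoff t (G (cutoff t g))) (cutoff t (G g))"
      using G_causal[OF g_plus] by (subst (asm) AE_restrict_space_iff) auto
    then show ?thesis
    proof eventually_elim
      case (elim t)
      show ?case
      proof
        assume t: "t \<in> {0..T}"
        note cp = P.Linf_cutoff(1)[OF g_plus, of t]
        \<comment> \<open>The cutoff of the trace itself need not satisfy the boundary condition
          after t. By causality it does so up to t, and the outer cutoff that this leaves can only
          decrease the norm.\<close>
        have eq: "AE_eq (mu_minus T u) (cutoff t g) (cutoff t (G (cutoff t g)))"
          unfolding AE_eq_def
        proof
          fix j
          have "AE z in mu_minus T u j. cutoff t (G (cutoff t g)) z $ j = cutoff t (G g) z $ j" "AE z in mu_minus T u j. g z $ j = G g z $ j"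
            using elim t gG by (auto simp: AE_eq_def)
          then show "AE z in mu_minus T u j. cutoff t g z $ j = cutoff t (G (cutoff t g)) z $ j"
            by eventually_elim (auto simp: cutoff_component)
        qed
        have "wnorm_minus T u W (cutoff t g) = wnorm_minus T u W (cutoff t (G (cutoff t g)))"
          by (intro P.wnorm_minus_cong[OF W _ _ eq] P.Linf_cutoff g_minus G_Linf cp)
        also have "\<dots> \<le> wnorm_minus T u W (G (cutoff t g))"
          by (intro P.wnorm_minus_cutoff_le[OF W] G_Linf cp)
        also have "\<dots> \<le> wnorm_plus T u W (cutoff t g)" by (rule GW[OF cp])
        finally show "wnorm_minus T u W (cutoff t g) \<le> wnorm_plus T u W (cutoff t g)" .
      qed
    qed
  qed
  have "\<forall>j. \<exists>\<alpha>. integrable lborel \<alpha> \<and> (\<forall>t. \<alpha> t \<ge> 0) \<and>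
      (AE t in lborel. AE x in lborel. t \<in> {0<..<T} \<longrightarrow> x \<in> {0<..<1} \<longrightarrow> - c (t, x) $ j \<le> \<alpha> t)"
  proof
    fix j
    obtain \<alpha>1 where a1: "integrable lborel \<alpha>1" "\<And>t. \<alpha>1 t \<ge> 0"
      "AE t in lborel. AE x in lborel. t \<in> {0<..<T} \<longrightarrow> x \<in> {0<..<1} \<longrightarrow> \<bar>vneg (ux (t, x) + c (t, x)) $ j\<bar> \<le> \<alpha>1 t"
      using Bochner_Linf_rate[OF neg, of j] by auto
    obtain \<alpha>2 where a2: "integrable lborel \<alpha>2" "\<And>t. \<alpha>2 t \<ge> 0"
      "AE t in lborel. AE x in lborel. t \<in> {0<..<T} \<longrightarrow> x \<in> {0<..<1} \<longrightarrow> \<bar>vpos (ux (t, x)) $ j\<bar> \<le> \<alpha>2 t"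
      using Bochner_Linf_rate[OF pos, of j] by auto
    have "AE t in lborel. AE x in lborel. t \<in> {0<..<T} \<longrightarrow> x \<in> {0<..<1} \<longrightarrow> - c (t, x) $ j \<le> \<alpha>1 t + \<alpha>2 t"
      using a1(3) a2(3)
    proof eventually_elim
      case (elim t)
      then show ?case
      proof eventually_elim
        case (elim x)
        show ?case
        proof (intro impI)
          assume "t \<in> {0<..<T}" "x \<in> {0<..<1}"
          then have "max (- (ux (t, x) $ j + c (t, x) $ j)) 0 \<le> \<alpha>1 t" "max (ux (t, x) $ j) 0 \<le> \<alpha>2 t"
            using elim by (auto simp: vneg_def vpos_def)
          then show "- c (t, x) $ j \<le> \<alpha>1 t + \<alpha>2 t" by linarith
        qed
      qed
    qed
    then show "\<exists>\<alpha>. integrable lborel \<alpha> \<and> (\<forall>t. \<alpha> t \<ge> 0) \<and>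
      (AE t in lborel. AE x in lborel. t \<in> {0<..<T} \<longrightarrow> x \<in> {0<..<1} \<longrightarrow> - c (t, x) $ j \<le> \<alpha> t)"
      using a1(1,2) a2(1,2) by (intro exI[of _ "\<lambda>t. \<alpha>1 t + \<alpha>2 t"]) auto
  qed
  from choice[OF this] obtain \<beta> where \<beta>: "\<And>j. integrable lborel (\<beta> j)" "\<And>j t. \<beta> j t \<ge> 0"
      "\<And>j. AE t in lborel. AE x in lborel. t \<in> {0<..<T} \<longrightarrow> x \<in> {0<..<1} \<longrightarrow> - c (t, x) $ j \<le> \<beta> j t"
    by blast
  \<comment> \<open>Gronwall's inequality for the weighted sum needs one rate for all components;
    the sum of the nonnegative rates dominates each of them.\<close>
  define \<alpha> where "\<alpha> t = (\<Sum>j\<in>UNIV. \<beta> j t)" for t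
  have \<beta>_le: "\<beta> j t \<le> \<alpha> t" for j t
    unfolding \<alpha>_def by (rule member_le_sum) (auto simp: \<beta>)
  have \<alpha>: "integrable lborel \<alpha>" "\<And>t. \<alpha> t \<ge> 0"
    unfolding \<alpha>_def using \<beta> by (auto intro: sum_nonneg)
  have c_ge: "AE t in lborel. AE x in lborel. t \<in> {0<..<T} \<longrightarrow> x \<in> {0<..<1} \<longrightarrow> - c (t, x) $ j \<le> \<alpha> t" for j
    using \<beta>(3)[of j]
  proof eventually_elim
    case (elim t)
    then show ?case by eventually_elim (use \<beta>_le[of j t] in auto)
  qed
  note CE = P.component_energy[OF \<alpha> c_ge]
  define D where "D j t = (\<integral>x. \<bar>P.dif j t x\<bar> \<partial>lborel)" for j t
  have D0: "D j t \<ge> 0" for j t unfolding D_def by (intro integral_nonneg_AE) auto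
  define E where "E t = (\<Sum>j\<in>UNIV. W $ j $ j * D j t)" for t
  note Wp = P.W_pos[OF W]
  have E0: "E t \<ge> 0" for t unfolding E_def using less_imp_le[OF Wp] D0 by (intro sum_nonneg mult_nonneg_nonneg) auto
  have \<alpha>D: "integrable lborel (\<lambda>t. \<alpha> t * D j t)" for j unfolding D_def by (rule CE(1))
  have \<alpha>E_eq: "\<alpha> t * E t = (\<Sum>j\<in>UNIV. W $ j $ j * (\<alpha> t * D j t))" for t
    unfolding E_def sum_distrib_left by (simp add: mult_ac)
  have \<alpha>E: "integrable lborel (\<lambda>t. \<alpha> t * E t)"
    unfolding \<alpha>E_eq by (intro Bochner_Integration.integrable_sum integrable_mult_right \<alpha>D)
  \<comment> \<open>The energy inequality speaks of the continuous versions at single times,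
    Gronwall's inequality of functions measurable in time; both agree at almost every time.\<close>
  have rD: "AE t in lborel. \<forall>j. t \<in> {0<..<T} \<longrightarrow> (\<integral>x. \<bar>P.rdif j t x\<bar> \<partial>lborel) = D j t"
    unfolding D_def by (intro eventually_all_finite CE(3))
  have r0: "(\<integral>x. \<bar>P.rdif j 0 x\<bar> \<partial>lborel) = 0" for j
  proof -
    have "AE x in lborel. x \<in> {0<..<1} \<longrightarrow> r1 0 x = \<rho>\<^sub>0 x" "AE x in lborel. x \<in> {0<..<1} \<longrightarrow> r2 0 x = \<rho>\<^sub>0 x"
      using s1(4) s2(4) by (simp_all add: Omega_AE)
    then have "AE x in lborel. \<bar>P.rdif j 0 x\<bar> = 0"
      by eventually_elim (auto simp: P.rdif_def indicator_def)
    then show ?thesis by (rule integral_eq_zero_AE)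
  qed
  have "AE t in lborel. 0 < t \<and> t < T \<longrightarrow> E t = 0"
  proof (rule Gronwall_zero[OF \<alpha> E0 \<alpha>E assms(1)])
    show "AE t in lborel. 0 < t \<and> t < T \<longrightarrow> E t \<le> (LINT s:{0<..t}|lborel. \<alpha> s * E s)"
      using rD bdry
    proof eventually_elim
      case (elim t)
      show ?case
      proof
        assume t: "0 < t \<and> t < T"
        let ?b = "\<lambda>j. LINT s:{0<..t}|lborel. (indicat_real {0<..<T} s * (u (s, 0) $ j * \<bar>g (s, 0) $ j\<bar>)) - (indicat_real {0<..<T} s * (u (s, 1) $ j * \<bar>g (s, 1) $ j\<bar>))"
        have ibf: "integrable lborel (P.bflux g j p)" if "p \<in> {0, 1}" for j p
          using CE(4)[of j] CE(5)[of j] that by (auto simp: g_def)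
        have "D j t \<le> ?b j + (LINT s:{0<..t}|lborel. \<alpha> s * D j s)" for j
          using CE(2)[of t j] t elim(1) r0[of j] by (simp add: g_def D_def)
        then have "E t \<le> (\<Sum>j\<in>UNIV. W $ j $ j * (?b j + (LINT s:{0<..t}|lborel. \<alpha> s * D j s)))"
          unfolding E_def using less_imp_le[OF Wp] by (intro sum_mono mult_left_mono) auto
        also have "\<dots> = (\<Sum>j\<in>UNIV. W $ j $ j * ?b j) + (\<Sum>j\<in>UNIV. W $ j $ j * (LINT s:{0<..t}|lborel. \<alpha> s * D j s))"
          by (simp add: distrib_left sum.distrib)
        also have "(\<Sum>j\<in>UNIV. W $ j $ j * ?b j) = wnorm_minus T u W (cutoff t g) - wnorm_plus T u W (cutoff t g)"
          using P.wnorm_difference[OF W g_plus g_minus ibf, of t] t by simp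
        also have "\<dots> \<le> 0" using elim(2) t by auto
        also have "(\<Sum>j\<in>UNIV. W $ j $ j * (LINT s:{0<..t}|lborel. \<alpha> s * D j s)) = (LINT s:{0<..t}|lborel. \<alpha> s * E s)"
        proof -
          have "(LINT s:{0<..t}|lborel. \<alpha> s * E s) = (\<integral>s. (\<Sum>j\<in>UNIV. W $ j $ j * (indicat_real {0<..t} s * (\<alpha> s * D j s))) \<partial>lborel)"
            unfolding set_lebesgue_integral_def \<alpha>E_eq
            by (intro Bochner_Integration.integral_cong) (auto simp: sum_distrib_left mult_ac)
          also have "\<dots> = (\<Sum>j\<in>UNIV. W $ j $ j * (LINT s:{0<..t}|lborel. \<alpha> s * D j s))"
            unfolding set_lebesgue_integral_def
            using set_integrable_lborel[OF \<alpha>D, of "{0<..t}"]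
            by (subst Bochner_Integration.integral_sum) (auto simp: set_integrable_def)
          finally show ?thesis by simp
        qed
        finally show "E t \<le> (LINT s:{0<..t}|lborel. \<alpha> s * E s)" by simp
      qed
    qed
  qed
  then have D_zero: "AE t in lborel. 0 < t \<and> t < T \<longrightarrow> D j t = 0" for j
  proof eventually_elim
    case (elim t)
    have "W $ j $ j * D j t \<le> E t"
      unfolding E_def using less_imp_le[OF Wp] D0 by (intro member_le_sum) auto
    then show ?case using elim D0[of j t] Wp[of j] by (auto simp: mult_le_0_iff)
  qed
  show ?thesis
    unfolding AE_eq_def
  proof
    fix j
    obtain M where M: "M \<ge> 0" "AE t in lborel. AE x in lborel. \<bar>P.dif j t x\<bar> \<le> M" by (rule P.dif_bounded)
    have "AE t in lborel. (\<integral>\<^sup>+x. ennreal \<bar>P.dif j t x\<bar> \<partial>lborel) = 0"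
      using D_zero[of j] M(2)
    proof eventually_elim
      case (elim t)
      \<comment> \<open>D j t = 0 is a statement about a Bochner integral and says something only
        for an integrable function, which boundedness on (0,1) provides.\<close>
      have i: "integrable lborel (P.dif j t)"
      proof (rule integrableI_bounded_set[where A = "{0..1}" and B = M])
        show "AE x in lborel. x \<in> {0..1} \<longrightarrow> norm (P.dif j t x) \<le> M" using elim(2) by (auto elim: eventually_mono)
      qed (auto simp: P.dif_def)
      have "D j t = 0"
      proof (cases "0 < t \<and> t < T")
        case False
        then have "P.dif j t x = 0" for x by (auto simp: P.dif_def)
        then show ?thesis by (simp add: D_def)
      qed (use elim in simp)
      then show ?case using i by (subst nn_integral_eq_integral) (auto simp: D_def)
    qed
    then have "(\<integral>\<^sup>+t. (\<integral>\<^sup>+x. ennreal \<bar>P.dif j t x\<bar> \<partial>lborel) \<partial>lborel) = 0"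
      by (subst nn_integral_0_iff_AE) auto
    then have "(\<integral>\<^sup>+z. ennreal \<bar>case_prod (P.dif j) z\<bar> \<partial>(lborel \<Otimes>\<^sub>M lborel)) = 0"
      by (subst lborel.nn_integral_fst[symmetric]) auto
    then have "AE z in (lborel \<Otimes>\<^sub>M lborel). case_prod (P.dif j) z = 0"
      by (subst (asm) nn_integral_0_iff_AE) auto
    then have "AE z in lborel. z \<in> {0<..<T} \<times> {0<..<1} \<longrightarrow> \<rho>\<^sub>1 z $ j = \<rho>\<^sub>2 z $ j"
      unfolding lborel_prod by eventually_elim (auto simp: P.dif_def)
    then show "AE z in cyl_meas T. \<rho>\<^sub>1 z $ j = \<rho>\<^sub>2 z $ j"
      unfolding cyl_meas_def by (subst AE_restrict_space_iff) (auto simp: open_Times)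
  qed
qed

end
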